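(* The class of $H$-paracontact metric manifolds is invariant under $D$-homothetic deformations: if $(M,\varphi,\xi,\eta,g)$ is an $H$-paracontact metric manifold and $t\neq0$ is a real constant, then the $D$-homothetic deformation $(M,\varphi_t,\xi_t,\eta_t,g_t)$ is again $H$-paracontact.
   Context: All manifolds are smooth and connected. A $(2n+1)$-dimensional contact manifold is a manifold $M^{2n+1}$ with a global 1-form $\eta$ such that $\eta\wedge(d\eta)^n\neq 0$ everywhere; its Reeb vector field $\xi$ is the unique vector field with $\eta(\xi)=1$, $d\eta(\xi,\cdot)=0$. A paracontact metric structure $(\varphi,\xi,\eta,g)$ on $M$ consists of such $\eta,\xi$, a semi-Riemannian metric $g$ and a $(1,1)$-tensor $\varphi$ with $\eta=g(\xi,\cdot)$, $d\eta(\cdot,\cdot)=g(\cdot,\varphi\,\cdot)$, $\varphi^2=I-\eta\otimes\xi$ (here $2\,d\eta(X,Y)=X\eta(Y)-Y\eta(X)-\eta([X,Y])$). $D$-homothetic deformation: given a paracontact metric structure $(\varphi,\xi,\eta,g)$ and a real constant $t\neq 0$, it is the paracontact metric structure $\eta_t=t\eta$, $\xi_t=t^{-1}\xi$, $\varphi_t=\varphi$, $g_t=tg+t(t-1)\,\eta\otimes\eta$. A paracontact metric manifold is $H$-paracontact if its Reeb vector field $\xi$ is a harmonic vector field. Here the energy of a vector field $V$ on $(M,g)$ is the energy of the map $V:(M,g)\to(TM,g^s)$, $g^s$ the Sasaki metric (computed over relatively compact domains if $M$ is non-compact). A vector field $V$ of constant length $g(V,V)=r\neq 0$ is harmonic if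 it is a critical point of the energy restricted to vector fields of the same constant length $r$; equivalently, $\bar\Delta V$ is collinear to $V$, where $\bar\Delta V=-\mathrm{tr}\,\nabla^2V=\sum_i\varepsilon_i(\nabla_{\nabla_{E_i}E_i}V-\nabla_{E_i}\nabla_{E_i}V)$ for a local pseudo-orthonormal frame $\{E_i\}$, $\varepsilon_i=g(E_i,E_i)=\pm1$, and $\nabla$ is the Levi-Civita connection. *)

theory Defs
  imports "HOL-Analysis.Analysis"
begin

section \<open>Smooth manifolds\<close>

text \<open>For an open set S, the condition \<open>Ck_on k f S\<close> says that f has
  continuous derivatives up to order k on S (continuity of the derivatives of order less than k
  follows from their differentiability).\<close>

primrec Ck_on :: "nat \<Rightarrow> ('a::real_normed_vector \<Rightarrow> 'b::real_normed_vector) \<Rightarrow> 'a set \<Rightarrow> bool" where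
  "Ck_on 0 f S = continuous_on S f"
| "Ck_on (Suc k) f S =
    ((\<forall>x\<in>S. f differentiable (at x)) \<and>
     (\<forall>v. Ck_on k (\<lambda>x. frechet_derivative f (at x) v) S))"

definition smooth_on :: "'a set \<Rightarrow> ('a::real_normed_vector \<Rightarrow> 'b::real_normed_vector) \<Rightarrow> bool" where
  "smooth_on S f \<longleftrightarrow> (\<forall>k. Ck_on k f S)"

type_synonym ('m, 'n) chart = "'m set \<times> ('m \<Rightarrow> real ^ 'n)"

abbreviation chart_dom :: "('m, 'n::finite) chart \<Rightarrow> 'm set" where
  "chart_dom c \<equiv> fst c"

abbreviation coord :: "('m, 'n::finite) chart \<Rightarrow> 'm \<Rightarrow> real ^ 'n" where
  "coord c \<equiv> snd c"

definition chart_image :: "('m, 'n::finite) chart \<Rightarrow> (real ^ 'n) set" where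
  "chart_image c = coord c ` chart_dom c"

text \<open>The change of coordinates from c to d, meaningful on
  \<open>coord c ` (chart_dom c \<inter> chart_dom d)\<close>, and its differential.\<close>

definition transition :: "('m, 'n::finite) chart \<Rightarrow> ('m, 'n) chart \<Rightarrow> real ^ 'n \<Rightarrow> real ^ 'n" where
  "transition c d = coord d \<circ> inv_into (chart_dom c) (coord c)"

definition jacobian ::
  "('m, 'n::finite) chart \<Rightarrow> ('m, 'n) chart \<Rightarrow> 'm \<Rightarrow> real ^ 'n \<Rightarrow> real ^ 'n" where
  "jacobian c d p = frechet_derivative (transition c d) (at (coord c p))"

definition smooth_atlas :: "'m topology \<Rightarrow> ('m, 'n::finite) chart set \<Rightarrow> bool" where
  "smooth_atlas X A \<longleftrightarrow>
     (\<forall>c\<in>A. openin X (chart_dom c) \<and> open (chart_image c) \<and>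
        homeomorphic_map (subtopology X (chart_dom c)) (top_of_set (chart_image c)) (coord c)) \<and>
     (\<Union>c\<in>A. chart_dom c) = topspace X \<and>
     (\<forall>c\<in>A. \<forall>d\<in>A. smooth_on (coord c ` (chart_dom c \<inter> chart_dom d)) (transition c d))"

text \<open>Connected smooth manifolds of dimension \<open>CARD('n)\<close>; the smooth structure is the one
  generated by the (not necessarily maximal) atlas.\<close>

definition connected_smooth_manifold :: "'m topology \<Rightarrow> ('m, 'n::finite) chart set \<Rightarrow> bool" where
  "connected_smooth_manifold X A \<longleftrightarrow>
     Hausdorff_space X \<and> second_countable X \<and> connected_space X \<and> smooth_atlas X A"


section \<open>Tensor fields\<close>

text \<open>A tensor field T on a manifold is given by its local representatives: T c x is the
  tensor on \<open>real ^ 'n\<close> representing T in the chart c at the point with coordinates x. Only the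
  values at x in the image of c are meaningful. The representatives are smooth and are related by
  the usual transformation laws.\<close>

type_synonym ('m, 'n) vecfield = "('m, 'n) chart \<Rightarrow> real ^ 'n \<Rightarrow> real ^ 'n"
type_synonym ('m, 'n) form1 = "('m, 'n) chart \<Rightarrow> real ^ 'n \<Rightarrow> real ^ 'n \<Rightarrow> real"
type_synonym ('m, 'n) tensor02 = "('m, 'n) chart \<Rightarrow> real ^ 'n \<Rightarrow> real ^ 'n \<Rightarrow> real ^ 'n \<Rightarrow> real"
type_synonym ('m, 'n) tensor11 = "('m, 'n) chart \<Rightarrow> real ^ 'n \<Rightarrow> real ^ 'n \<Rightarrow> real ^ 'n"

definition vector_field :: "('m, 'n::finite) chart set \<Rightarrow> ('m, 'n) vecfield \<Rightarrow> bool" where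
  "vector_field A V \<longleftrightarrow>
     (\<forall>c\<in>A. smooth_on (chart_image c) (V c)) \<and>
     (\<forall>c\<in>A. \<forall>d\<in>A. \<forall>p\<in>chart_dom c \<inter> chart_dom d.
        V d (coord d p) = jacobian c d p (V c (coord c p)))"

definition one_form :: "('m, 'n::finite) chart set \<Rightarrow> ('m, 'n) form1 \<Rightarrow> bool" where
  "one_form A \<eta> \<longleftrightarrow>
     (\<forall>c\<in>A. (\<forall>x\<in>chart_image c. linear (\<eta> c x)) \<and>
        (\<forall>v. smooth_on (chart_image c) (\<lambda>x. \<eta> c x v))) \<and>
     (\<forall>c\<in>A. \<forall>d\<in>A. \<forall>p\<in>chart_dom c \<inter> chart_dom d. \<forall>v.
        \<eta> c (coord c p) v = \<eta> d (coord d p) (jacobian c d p v))"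

definition covariant_2_tensor :: "('m, 'n::finite) chart set \<Rightarrow> ('m, 'n) tensor02 \<Rightarrow> bool" where
  "covariant_2_tensor A g \<longleftrightarrow>
     (\<forall>c\<in>A. (\<forall>x\<in>chart_image c. bilinear (g c x)) \<and>
        (\<forall>v w. smooth_on (chart_image c) (\<lambda>x. g c x v w))) \<and>
     (\<forall>c\<in>A. \<forall>d\<in>A. \<forall>p\<in>chart_dom c \<inter> chart_dom d. \<forall>v w.
        g c (coord c p) v w = g d (coord d p) (jacobian c d p v) (jacobian c d p w))"

definition endomorphism_field :: "('m, 'n::finite) chart set \<Rightarrow> ('m, 'n) tensor11 \<Rightarrow> bool" where
  "endomorphism_field A \<phi> \<longleftrightarrow>
     (\<forall>c\<in>A. (\<forall>x\<in>chart_image c. linear (\<phi> c x)) \<and>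
        (\<forall>v. smooth_on (chart_image c) (\<lambda>x. \<phi> c x v))) \<and>
     (\<forall>c\<in>A. \<forall>d\<in>A. \<forall>p\<in>chart_dom c \<inter> chart_dom d. \<forall>v.
        jacobian c d p (\<phi> c (coord c p) v) = \<phi> d (coord d p) (jacobian c d p v))"

text \<open>The index of g is not prescribed; it is automatically constant on a connected manifold.\<close>

definition semi_riemannian_metric :: "('m, 'n::finite) chart set \<Rightarrow> ('m, 'n) tensor02 \<Rightarrow> bool" where
  "semi_riemannian_metric A g \<longleftrightarrow>
     covariant_2_tensor A g \<and>
     (\<forall>c\<in>A. \<forall>x\<in>chart_image c.
        (\<forall>v w. g c x v w = g c x w v) \<and>
        (\<forall>v. (\<forall>w. g c x v w = 0) \<longrightarrow> v = 0))"


section \<open>Contact and paracontact metric structures\<close>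

text \<open>The convention is \<open>2 d\<eta>(X,Y) = X \<eta>(Y) - Y \<eta>(X) - \<eta>([X,Y])\<close>. The formula is evaluated
  on vector fields with constant components v, w in the chart, whose bracket vanishes.\<close>

definition ext_deriv :: "('m, 'n::finite) form1 \<Rightarrow> ('m, 'n) tensor02" where
  "ext_deriv \<eta> c x v w =
     (frechet_derivative (\<lambda>y. \<eta> c y w) (at x) v - frechet_derivative (\<lambda>y. \<eta> c y v) (at x) w) / 2"

text \<open>An alternating p-form on a vector space is represented by a function of a sequence of
  vectors that depends only on the entries 0, ..., p - 1.\<close>

definition wedge ::
  "nat \<Rightarrow> nat \<Rightarrow> ((nat \<Rightarrow> 'v) \<Rightarrow> real) \<Rightarrow> ((nat \<Rightarrow> 'v) \<Rightarrow> real) \<Rightarrow> (nat \<Rightarrow> 'v) \<Rightarrow> real" where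
  "wedge p q \<alpha> \<beta> v =
     (\<Sum>\<sigma> | \<sigma> permutes {..<p + q}.
        of_int (sign \<sigma>) * \<alpha> (\<lambda>i. v (\<sigma> i)) * \<beta> (\<lambda>i. v (\<sigma> (p + i)))) / (fact p * fact q)"

primrec wedge_power2 :: "nat \<Rightarrow> ('v \<Rightarrow> 'v \<Rightarrow> real) \<Rightarrow> (nat \<Rightarrow> 'v) \<Rightarrow> real" where
  "wedge_power2 0 \<omega> = (\<lambda>v. 1)"
| "wedge_power2 (Suc n) \<omega> = wedge 2 (2 * n) (\<lambda>v. \<omega> (v 0) (v 1)) (wedge_power2 n \<omega>)"

definition contact_form :: "nat \<Rightarrow> ('m, 'n::finite) chart set \<Rightarrow> ('m, 'n) form1 \<Rightarrow> bool" where
  "contact_form n A \<eta> \<longleftrightarrow>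
     CARD('n) = 2 * n + 1 \<and> one_form A \<eta> \<and>
     (\<forall>c\<in>A. \<forall>x\<in>chart_image c.
        \<exists>v. wedge 1 (2 * n) (\<lambda>v. \<eta> c x (v 0)) (wedge_power2 n (ext_deriv \<eta> c x)) v \<noteq> 0)"

definition reeb_field ::
  "('m, 'n::finite) chart set \<Rightarrow> ('m, 'n) form1 \<Rightarrow> ('m, 'n) vecfield \<Rightarrow> bool" where
  "reeb_field A \<eta> \<xi> \<longleftrightarrow>
     vector_field A \<xi> \<and>
     (\<forall>c\<in>A. \<forall>x\<in>chart_image c. \<eta> c x (\<xi> c x) = 1 \<and> (\<forall>v. ext_deriv \<eta> c x (\<xi> c x) v = 0))"

definition paracontact_metric_manifold ::
  "nat \<Rightarrow> 'm topology \<Rightarrow> ('m, 'n::finite) chart set \<Rightarrow>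
   ('m, 'n) tensor11 \<Rightarrow> ('m, 'n) vecfield \<Rightarrow> ('m, 'n) form1 \<Rightarrow> ('m, 'n) tensor02 \<Rightarrow> bool" where
  "paracontact_metric_manifold n X A \<phi> \<xi> \<eta> g \<longleftrightarrow>
     connected_smooth_manifold X A \<and>
     contact_form n A \<eta> \<and> reeb_field A \<eta> \<xi> \<and>
     semi_riemannian_metric A g \<and> endomorphism_field A \<phi> \<and>
     (\<forall>c\<in>A. \<forall>x\<in>chart_image c. \<forall>v w.
        \<eta> c x v = g c x (\<xi> c x) v \<and>
        ext_deriv \<eta> c x v w = g c x v (\<phi> c x w) \<and>
        \<phi> c x (\<phi> c x v) = v - \<eta> c x v *\<^sub>R \<xi> c x)"


section \<open>Energy of vector fields\<close>

text \<open>Christoffel symbols of the Levi-Civita connection, from Koszul's formula on vector fields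
  with constant components: \<open>christoffel G x v w\<close> is the covariant derivative at x of the
  constant vector field w in the direction v.\<close>

definition christoffel ::
  "(real ^ 'n \<Rightarrow> real ^ 'n \<Rightarrow> real ^ 'n \<Rightarrow> real) \<Rightarrow>
   real ^ 'n \<Rightarrow> real ^ 'n \<Rightarrow> real ^ 'n \<Rightarrow> real ^ 'n::finite" where
  "christoffel G x v w = (THE u. \<forall>z.
     2 * G x u z = frechet_derivative (\<lambda>y. G y w z) (at x) v
                 + frechet_derivative (\<lambda>y. G y v z) (at x) w
                 - frechet_derivative (\<lambda>y. G y v w) (at x) z)"

text \<open>In the coordinates (x,u) of the tangent bundle induced by a chart, a tangent vector at (x,u)
  is a pair (a,b). Its image under the differential of the projection is a, and its image under the
  connection map is b + \<open>\<Gamma>\<close>(a,u). The Sasaki metric makes the horizontal and the vertical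
  subspaces orthogonal and restricts to g on each of them.\<close>

definition sasaki_metric ::
  "(real ^ 'n \<Rightarrow> real ^ 'n \<Rightarrow> real ^ 'n \<Rightarrow> real) \<Rightarrow> (real ^ 'n) \<times> (real ^ 'n) \<Rightarrow>
   (real ^ 'n) \<times> (real ^ 'n) \<Rightarrow> (real ^ 'n) \<times> (real ^ 'n::finite) \<Rightarrow> real" where
  "sasaki_metric G = (\<lambda>(x, u) (a, b) (a', b').
     G x a a' + G x (b + christoffel G x a u) (b' + christoffel G x a' u))"

definition gram_matrix :: "(real ^ 'n \<Rightarrow> real ^ 'n \<Rightarrow> real) \<Rightarrow> real ^ 'n ^ 'n::finite" where
  "gram_matrix B = (\<chi> i j. B (axis i 1) (axis j 1))"

text \<open>The trace of a bilinear form B with respect to a nondegenerate symmetric bilinear form G,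
  i.e. \<open>G\<^sup>i\<^sup>j B\<^sub>i\<^sub>j\<close>.\<close>

definition metric_trace ::
  "(real ^ 'n \<Rightarrow> real ^ 'n \<Rightarrow> real) \<Rightarrow> (real ^ 'n \<Rightarrow> real ^ 'n \<Rightarrow> real) \<Rightarrow> real" where
  "metric_trace G B =
     (\<Sum>i\<in>UNIV. \<Sum>j\<in>UNIV. matrix_inv (gram_matrix G) $ i $ j * B (axis i 1) (axis j 1))"

text \<open>In the chart c the map V from M to TM is y \<open>\<mapsto>\<close> (y, V c y). Its energy density is half the
  trace, with respect to g, of the pullback of the Sasaki metric.\<close>

definition local_energy_density ::
  "('m, 'n::finite) tensor02 \<Rightarrow> ('m, 'n) vecfield \<Rightarrow> ('m, 'n) chart \<Rightarrow> real ^ 'n \<Rightarrow> real" where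
  "local_energy_density g V c x =
     (let F = (\<lambda>y. (y, V c y)); dF = frechet_derivative F (at x) in
      metric_trace (g c x) (\<lambda>a b. sasaki_metric (g c) (F x) (dF a) (dF b)) / 2)"

text \<open>The energy density at p does not depend on the chart around p.\<close>

definition energy_density ::
  "('m, 'n::finite) chart set \<Rightarrow> ('m, 'n) tensor02 \<Rightarrow> ('m, 'n) vecfield \<Rightarrow> 'm \<Rightarrow> real" where
  "energy_density A g V p =
     (let c = (SOME c. c \<in> A \<and> p \<in> chart_dom c) in local_energy_density g V c (coord c p))"

text \<open>The canonical Borel measure of a semi-Riemannian manifold, with density
  \<open>sqrt \<bar>det (g\<^sub>i\<^sub>j)\<bar>\<close> in every chart.\<close>

definition is_volume_measure ::
  "'m topology \<Rightarrow> ('m, 'n::finite) chart set \<Rightarrow> ('m, 'n) tensor02 \<Rightarrow> 'm measure \<Rightarrow> bool" where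
  "is_volume_measure X A g \<mu> \<longleftrightarrow>
     space \<mu> = topspace X \<and> sets \<mu> = sigma_sets (topspace X) {U. openin X U} \<and>
     (\<forall>c\<in>A. \<forall>B\<in>sets \<mu>. B \<subseteq> chart_dom c \<longrightarrow>
        emeasure \<mu> B =
          (\<integral>\<^sup>+x\<in>coord c ` B. ennreal (sqrt \<bar>det (gram_matrix (g c x))\<bar>) \<partial>lborel))"

definition volume_measure ::
  "'m topology \<Rightarrow> ('m, 'n::finite) chart set \<Rightarrow> ('m, 'n) tensor02 \<Rightarrow> 'm measure" where
  "volume_measure X A g = (THE \<mu>. is_volume_measure X A g \<mu>)"

definition energy ::
  "'m topology \<Rightarrow> ('m, 'n::finite) chart set \<Rightarrow> ('m, 'n) tensor02 \<Rightarrow> 'm set \<Rightarrow>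
   ('m, 'n) vecfield \<Rightarrow> real" where
  "energy X A g D V = (LINT p:D|volume_measure X A g. energy_density A g V p)"


section \<open>Harmonic vector fields\<close>

definition constant_length ::
  "('m, 'n::finite) chart set \<Rightarrow> ('m, 'n) tensor02 \<Rightarrow> ('m, 'n) vecfield \<Rightarrow> real \<Rightarrow> bool" where
  "constant_length A g V r \<longleftrightarrow> (\<forall>c\<in>A. \<forall>x\<in>chart_image c. g c x (V c x) (V c x) = r)"

text \<open>The whole space is a relatively compact domain if it is compact.\<close>

definition relatively_compact_domain :: "'m topology \<Rightarrow> 'm set \<Rightarrow> bool" where
  "relatively_compact_domain X D \<longleftrightarrow>
     openin X D \<and> connectedin X D \<and> compactin X (X closure_of D)"

text \<open>Smooth one-parameter variations \<open>W s\<close>, \<open>\<bar>s\<bar> < \<epsilon>\<close>, of V through vector fields of constant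
  length r that are equal to V outside a compact subset of D.\<close>

definition length_preserving_variation ::
  "'m topology \<Rightarrow> ('m, 'n::finite) chart set \<Rightarrow> ('m, 'n) tensor02 \<Rightarrow> real \<Rightarrow> 'm set \<Rightarrow>
   ('m, 'n) vecfield \<Rightarrow> real \<Rightarrow> (real \<Rightarrow> ('m, 'n) vecfield) \<Rightarrow> bool" where
  "length_preserving_variation X A g r D V \<epsilon> W \<longleftrightarrow>
     \<epsilon> > 0 \<and>
     (\<forall>s\<in>{-\<epsilon><..<\<epsilon>}. vector_field A (W s) \<and> constant_length A g (W s) r) \<and>
     (\<forall>c\<in>A. smooth_on ({-\<epsilon><..<\<epsilon>} \<times> chart_image c) (\<lambda>(s, x). W s c x)) \<and>
     (\<forall>c\<in>A. \<forall>x\<in>chart_image c. W 0 c x = V c x) \<and>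
     (\<exists>K. compactin X K \<and> K \<subseteq> D \<and>
        (\<forall>s\<in>{-\<epsilon><..<\<epsilon>}. \<forall>c\<in>A. \<forall>p\<in>chart_dom c - K. W s c (coord c p) = V c (coord c p)))"

definition harmonic_vector_field ::
  "'m topology \<Rightarrow> ('m, 'n::finite) chart set \<Rightarrow> ('m, 'n) tensor02 \<Rightarrow> ('m, 'n) vecfield \<Rightarrow> bool" where
  "harmonic_vector_field X A g V \<longleftrightarrow>
     vector_field A V \<and>
     (\<exists>r. r \<noteq> 0 \<and> constant_length A g V r \<and>
        (\<forall>D \<epsilon> W. relatively_compact_domain X D \<longrightarrow>
           length_preserving_variation X A g r D V \<epsilon> W \<longrightarrow>
           ((\<lambda>s. energy X A g D (W s)) has_real_derivative 0) (at 0)))"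

definition H_paracontact ::
  "nat \<Rightarrow> 'm topology \<Rightarrow> ('m, 'n::finite) chart set \<Rightarrow>
   ('m, 'n) tensor11 \<Rightarrow> ('m, 'n) vecfield \<Rightarrow> ('m, 'n) form1 \<Rightarrow> ('m, 'n) tensor02 \<Rightarrow> bool" where
  "H_paracontact n X A \<phi> \<xi> \<eta> g \<longleftrightarrow>
     paracontact_metric_manifold n X A \<phi> \<xi> \<eta> g \<and> harmonic_vector_field X A g \<xi>"


section \<open>D-homothetic deformations\<close>

definition deform_phi :: "real \<Rightarrow> ('m, 'n::finite) tensor11 \<Rightarrow> ('m, 'n) tensor11" where
  "deform_phi t \<phi> = \<phi>"

definition deform_xi :: "real \<Rightarrow> ('m, 'n::finite) vecfield \<Rightarrow> ('m, 'n) vecfield" where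
  "deform_xi t \<xi> c x = inverse t *\<^sub>R \<xi> c x"

definition deform_eta :: "real \<Rightarrow> ('m, 'n::finite) form1 \<Rightarrow> ('m, 'n) form1" where
  "deform_eta t \<eta> c x v = t * \<eta> c x v"

definition deform_g ::
  "real \<Rightarrow> ('m, 'n::finite) form1 \<Rightarrow> ('m, 'n) tensor02 \<Rightarrow> ('m, 'n) tensor02" where
  "deform_g t \<eta> g c x v w = t * g c x v w + t * (t - 1) * (\<eta> c x v * \<eta> c x w)"

end

theory Submission
  imports Defs
begin

text \<open>The derivative of the energy at \<open>V\<close> in the direction \<open>B\<close> is the integral of
  \<open>tr\<^sub>g g(\<nabla>V, \<nabla>B)\<close>. A variation of the Reeb field through fields of constant length has a
  horizontal direction \<open>B\<close>, i.e. \<open>\<eta>(B) = 0\<close>, and conversely every compactly supported horizontal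
  \<open>B\<close> is the direction of such a variation; so \<open>\<xi>\<close> is harmonic iff
  \<open>\<integral> tr\<^sub>g g(\<nabla>\<xi>, \<nabla>B) = 0\<close> for all of these. The form \<open>\<theta>(a,b) = g(\<nabla>\<^sub>a\<xi>, b)\<close> becomes
  \<open>\<theta> + (t - 1) d\<eta>\<close> under the deformation and has \<open>\<xi>\<close> in both kernels, whence the integrand for
  the deformed structure is \<open>1/t\<close> times the old one plus \<open>(t - 1)/t\<close> times \<open>tr\<^sub>g d\<eta>(\<cdot>, \<nabla>B)\<close>, while
  the volume is multiplied by a constant. Finally \<open>tr\<^sub>g d\<eta>(\<cdot>, \<nabla>B)\<close> is the divergence of \<open>\<phi>B\<close>,
  because \<open>d\<eta>\<close> is closed, \<open>d\<eta>(\<phi>B, \<cdot>) = - g(B, \<cdot>)\<close> and \<open>d\<eta> + \<eta> \<otimes> \<eta>\<close> has the same determinant as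
  \<open>g\<close> up to sign; so its integral vanishes.\<close>

section \<open>Calculus of continuously differentiable maps\<close>

text \<open>Criticality is compared direction by direction, so no rough Laplacian is computed. Since
  \<eta> and its multiple by \<open>t\<close> have the same kernel, the direction \<open>B\<close>
  of a variation of the deformed Reeb field is horizontal for the original structure too; there it
  must be realized by a variation of its own, because harmonicity can only be used through one. The
  Levi-Civita connection changes as well, but on a horizontal \<open>B\<close> only by
  \<open>- (t - 1) \<eta>(b) \<phi>B\<close> and a multiple of \<xi>; in the trace both are paired
  with \<xi>, so the change drops out. The energy is an integral of densities read in an arbitrarily
  chosen chart, against a measure given by a definite description. Existence and uniqueness of that
  measure rest on the change of variables formula, and differentiation under the integral on the
  compact support of the variation. The divergence is integrated after cutting \<open>B\<close> into
  pieces that live in one chart. These pieces are only required to be continuously differentiable,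
  so that an elementary cutoff function does.\<close>

lemma frechet_derivative_eqI:
  "(f has_derivative f') (at x) \<Longrightarrow> frechet_derivative f (at x) = f'"
  by (metis frechet_derivative_at)

lemma frechet_derivative_cong_open:
  assumes "open S" "x \<in> S" "\<And>y. y \<in> S \<Longrightarrow> f y = g y" "f differentiable (at x)"
  shows "frechet_derivative g (at x) = frechet_derivative f (at x)" "g differentiable (at x)"
proof -
  have "(f has_derivative frechet_derivative f (at x)) (at x)"
    using assms(4) frechet_derivative_works by blast
  then have "(g has_derivative frechet_derivative f (at x)) (at x)"
    using has_derivative_transform_within_open assms by metis
  then show "frechet_derivative g (at x) = frechet_derivative f (at x)" "g differentiable (at x)"
    using frechet_derivative_eqI differentiable_def by blast+
qed

lemma Ck_on_cong:
  assumes "open S" "\<And>y. y \<in> S \<Longrightarrow> f y = g y" "Ck_on k f S"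
  shows "Ck_on k g S"
  using assms(2,3)
proof (induction k arbitrary: f g)
  case 0
  then show ?case by (simp cong: continuous_on_cong)
next
  case (Suc k)
  have d: "frechet_derivative g (at x) = frechet_derivative f (at x)" "g differentiable (at x)"
    if "x \<in> S" for x
    using frechet_derivative_cong_open[OF assms(1) that Suc.prems(1)] Suc.prems(2) that by auto
  show ?case
    using Suc.IH[of "\<lambda>x. frechet_derivative f (at x) _" "\<lambda>x. frechet_derivative g (at x) _"] d
      Suc.prems(2) by simp
qed

lemma Ck_on_subset: "Ck_on k f S \<Longrightarrow> T \<subseteq> S \<Longrightarrow> Ck_on k f T"
  by (induction k arbitrary: f) (auto intro: continuous_on_subset)

lemma Ck_on_Suc_imp: "Ck_on (Suc k) f S \<Longrightarrow> Ck_on k f S"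
proof (induction k arbitrary: f)
  case 0
  then have "\<forall>x\<in>S. isCont f x"
    using differentiable_imp_continuous_within by auto
  then show ?case
    by (simp add: continuous_at_imp_continuous_on)
next
  case (Suc k)
  then show ?case by (simp del: Ck_on.simps(1)) 
qed

lemma Ck_on_le: "Ck_on l f S \<Longrightarrow> k \<le> l \<Longrightarrow> Ck_on k f S"
  by (induction l) (use Ck_on_Suc_imp le_Suc_eq in blast)+

lemma Ck_on_imp_continuous: "Ck_on k f S \<Longrightarrow> continuous_on S f"
  using Ck_on_le[of k f S 0] by simp

lemma Ck_on_imp_has_derivative:
  "Ck_on (Suc k) f S \<Longrightarrow> x \<in> S \<Longrightarrow> (f has_derivative frechet_derivative f (at x)) (at x)"
  by (simp add: frechet_derivative_works)

lemma Ck_on_frechet_derivative: "Ck_on (Suc k) f S \<Longrightarrow> Ck_on k (\<lambda>x. frechet_derivative f (at x) v) S"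
  by simp

text \<open>An explicit derivative \<open>f'\<close> may take the place of
  \<open>frechet_derivative\<close>, since the two agree throughout the open set \<open>S\<close>.
  The inductive closure properties below go through this rule.\<close>

lemma Ck_on_SucI:
  assumes "open S" "\<And>x. x \<in> S \<Longrightarrow> (f has_derivative f' x) (at x)"
    "\<And>v. Ck_on k (\<lambda>x. f' x v) S"
  shows "Ck_on (Suc k) f S"
proof -
  have "Ck_on k (\<lambda>x. frechet_derivative f (at x) v) S" for v
    by (rule Ck_on_cong[OF assms(1) _ assms(3)[of v]])
      (use frechet_derivative_eqI[OF assms(2)] in auto)
  then show ?thesis
    using assms(2) by (auto simp: differentiable_def)
qed

lemma Ck_on_const: "Ck_on k (\<lambda>x. c) S"
  by (induction k arbitrary: c) auto

lemma Ck_on_bounded_linear_compose: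
  assumes "bounded_linear L" "open S" "Ck_on k f S"
  shows "Ck_on k (\<lambda>x. L (f x)) S"
  using assms(3)
proof (induction k arbitrary: f)
  case 0
  then show ?case
    using continuous_on_compose2[OF linear_continuous_on[OF assms(1)]] by auto
next
  case (Suc k)
  show ?case
    by (rule Ck_on_SucI[OF assms(2) bounded_linear.has_derivative[OF assms(1)
        Ck_on_imp_has_derivative[OF Suc.prems]] Suc.IH[OF Ck_on_frechet_derivative[OF Suc.prems]]])
qed

lemma Ck_on_id: "open S \<Longrightarrow> Ck_on k (\<lambda>x. x) S"
  by (cases k) (auto simp: Ck_on_const frechet_derivative_eqI[OF has_derivative_ident])

lemma Ck_on_bounded_linear: "bounded_linear L \<Longrightarrow> open S \<Longrightarrow> Ck_on k L S"
  using Ck_on_bounded_linear_compose[of L S k "\<lambda>x. x"] Ck_on_id by auto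

lemma Ck_on_add:
  assumes "open S" "Ck_on k f S" "Ck_on k g S"
  shows "Ck_on k (\<lambda>x. f x + g x) S"
  using assms(2,3)
proof (induction k arbitrary: f g)
  case 0
  then show ?case by (auto intro: continuous_on_add)
next
  case (Suc k)
  show ?case
    by (rule Ck_on_SucI[OF assms(1) has_derivative_add[OF Ck_on_imp_has_derivative[OF Suc.prems(1)]
        Ck_on_imp_has_derivative[OF Suc.prems(2)]]
        Suc.IH[OF Ck_on_frechet_derivative[OF Suc.prems(1)] Ck_on_frechet_derivative[OF Suc.prems(2)]]])
qed

text \<open>Each term of the product rule has one differentiated factor, of order \<open>k\<close>
  already, and one untouched factor, which is lowered to order \<open>k\<close>; the induction
  hypothesis then covers both.\<close>

lemma Ck_on_bilinear:
  assumes "bounded_bilinear h" "open S" "Ck_on k f S" "Ck_on k g S"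
  shows "Ck_on k (\<lambda>x. h (f x) (g x)) S"
  using assms(3,4)
proof (induction k arbitrary: f g)
  case 0
  then show ?case using bounded_bilinear.continuous_on[OF assms(1)] by auto
next
  case (Suc k)
  show ?case
    by (rule Ck_on_SucI[OF assms(2) bounded_bilinear.FDERIV[OF assms(1)
        Ck_on_imp_has_derivative[OF Suc.prems(1)] Ck_on_imp_has_derivative[OF Suc.prems(2)]]
        Ck_on_add[OF assms(2) Suc.IH[OF Ck_on_Suc_imp[OF Suc.prems(1)]
            Ck_on_frechet_derivative[OF Suc.prems(2)]]
          Suc.IH[OF Ck_on_frechet_derivative[OF Suc.prems(1)] Ck_on_Suc_imp[OF Suc.prems(2)]]]])
qed

lemmas Ck_on_mult = Ck_on_bilinear[OF bounded_bilinear_mult]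
lemmas Ck_on_scaleR = Ck_on_bilinear[OF bounded_bilinear_scaleR]
lemmas Ck_on_vec_nth = Ck_on_bounded_linear_compose[OF bounded_linear_vec_nth]
lemmas Ck_on_uminus = Ck_on_bounded_linear_compose[OF bounded_linear_minus[OF bounded_linear_ident]]

lemma Ck_on_diff:
  "open S \<Longrightarrow> Ck_on k f S \<Longrightarrow> Ck_on k g S \<Longrightarrow> Ck_on k (\<lambda>x. f x - g x) S"
  using Ck_on_add[of S k f "\<lambda>x. - g x"] Ck_on_uminus[of S k g] by simp

lemma Ck_on_sum:
  "open S \<Longrightarrow> (\<And>i. i \<in> I \<Longrightarrow> Ck_on k (f i) S) \<Longrightarrow> Ck_on k (\<lambda>x. \<Sum>i\<in>I. f i x) S"
  by (induction I rule: infinite_finite_induct) (auto simp: Ck_on_const intro: Ck_on_add)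

lemma Ck_on_inverse:
  fixes f :: "'a::real_normed_vector \<Rightarrow> real"
  assumes "open S" "Ck_on k f S" "\<And>x. x \<in> S \<Longrightarrow> f x \<noteq> 0"
  shows "Ck_on k (\<lambda>x. inverse (f x)) S"
  using assms(2)
proof (induction k)
  case 0
  then show ?case using assms(3) by (auto intro: continuous_on_inverse)
next
  case (Suc k)
  have inv: "Ck_on k (\<lambda>x. inverse (f x)) S" by (rule Suc.IH[OF Ck_on_Suc_imp[OF Suc.prems]])
  show ?case
  proof (rule Ck_on_SucI[OF assms(1)])
    show "((\<lambda>x. inverse (f x)) has_derivative
        (\<lambda>v. - (inverse (f x) * frechet_derivative f (at x) v * inverse (f x)))) (at x)"
      if "x \<in> S" for x
      using Deriv.has_derivative_inverse[OF assms(3)[OF that] Ck_on_imp_has_derivative[OF Suc.prems that]] .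
    show "Ck_on k (\<lambda>x. - (inverse (f x) * frechet_derivative f (at x) v * inverse (f x))) S" for v
      using Ck_on_uminus[OF assms(1) Ck_on_mult[OF assms(1) Ck_on_mult[OF assms(1) inv
          Ck_on_frechet_derivative[OF Suc.prems]] inv]] .
  qed
qed

text \<open>At arbitrary order only affine inner maps occur: the slices
  \<open>x \<mapsto> (s, x)\<close> of a variation and the projections from time and space. Their
  derivative is constant, so the chain rule does not leave the class of maps under
  induction.\<close>

lemma Ck_on_affine_compose:
  assumes "bounded_linear L" "open S" "open T" "\<And>x. x \<in> T \<Longrightarrow> a + L x \<in> S" "Ck_on k f S"
  shows "Ck_on k (\<lambda>x. f (a + L x)) T"
  using assms(5)
proof (induction k arbitrary: f)
  case 0
  have "continuous_on T (\<lambda>x. a + L x)"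
    by (intro continuous_intros linear_continuous_on assms(1))
  then show ?case
    using 0 assms(4) continuous_on_compose2[of S f T "\<lambda>x. a + L x"] by auto
next
  case (Suc k)
  have aff: "((\<lambda>x. a + L x) has_derivative L) (at x)" for x
    using bounded_linear.has_derivative[OF assms(1) has_derivative_ident] has_derivative_add_const
    by (auto intro!: derivative_eq_intros)
  show ?case
  proof (rule Ck_on_SucI[OF assms(3)])
    show "((\<lambda>x. f (a + L x)) has_derivative (\<lambda>v. frechet_derivative f (at (a + L x)) (L v))) (at x)"
      if "x \<in> T" for x
      using has_derivative_compose[OF aff Ck_on_imp_has_derivative[OF Suc.prems assms(4)[OF that]]] .
    show "Ck_on k (\<lambda>x. frechet_derivative f (at (a + L x)) (L v)) T" for v
      using Suc.IH[OF Ck_on_frechet_derivative[OF Suc.prems, of "L v"]] .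
  qed
qed

lemma vec_eq_sum_axis: "(v :: real ^ 'n) = (\<Sum>i\<in>UNIV. (v $ i) *\<^sub>R axis i 1)"
  using basis_expansion[of v] by (simp add: scalar_mult_eq_scaleR)

text \<open>The mean value theorem is applied twice: along \<open>v\<close> to the difference in the
  direction \<open>w\<close>, then along \<open>w\<close> to the derivative in the direction
  \<open>v\<close>. What makes this useful is that the second difference is symmetric in
  \<open>v\<close> and \<open>w\<close>.\<close>

lemma second_difference_mvt:
  fixes f :: "'a::real_normed_vector \<Rightarrow> real"
  assumes C2: "Ck_on 2 f (ball x r)" and h: "0 < h" "h * (norm v + norm w) < r"
  shows "\<exists>y. norm (y - x) \<le> h * (norm v + norm w) \<and>
    f (x + h *\<^sub>R v + h *\<^sub>R w) - f (x + h *\<^sub>R v) - f (x + h *\<^sub>R w) + f x =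
    h * h * frechet_derivative (\<lambda>y. frechet_derivative f (at y) v) (at y) w"
proof -
  let ?p = "\<lambda>s t. x + s *\<^sub>R v + t *\<^sub>R w"
  have C: "Ck_on (Suc (Suc 0)) f (ball x r)" using C2 by (simp only: numeral_2_eq_2)
  have bound: "norm (?p s t - x) \<le> h * (norm v + norm w)" if "s \<in> {0..h}" "t \<in> {0..h}" for s t
  proof -
    have "norm (?p s t - x) = norm (s *\<^sub>R v + t *\<^sub>R w)" by (simp add: algebra_simps)
    also have "\<dots> \<le> s * norm v + t * norm w"
      using that norm_triangle_ineq[of "s *\<^sub>R v" "t *\<^sub>R w"] by simp
    also have "\<dots> \<le> h * norm v + h * norm w"
      using that by (intro add_mono mult_right_mono) auto
    finally show ?thesis by (simp add: algebra_simps)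
  qed
  have ball: "?p s t \<in> ball x r" if "s \<in> {0..h}" "t \<in> {0..h}" for s t
  proof -
    have "dist (?p s t) x < r" using bound[OF that] h(2) unfolding dist_norm by linarith
    then show ?thesis by (simp only: mem_ball dist_commute)
  qed
  let ?Dv = "\<lambda>y. frechet_derivative f (at y) v"
  have dv: "((\<lambda>s. f (?p s t)) has_real_derivative ?Dv (?p s t)) (at s)"
    if "s \<in> {0..h}" "t \<in> {0..h}" for s t
  proof -
    have line: "((\<lambda>s. ?p s t) has_derivative (\<lambda>u. u *\<^sub>R v)) (at s)"
      by (auto intro!: derivative_eq_intros)
    have fd: "(f has_derivative frechet_derivative f (at (?p s t))) (at (?p s t))"
      using Ck_on_imp_has_derivative[OF C ball[OF that]] .
    have "((\<lambda>s. f (?p s t)) has_derivative (\<lambda>u. frechet_derivative f (at (?p s t)) (u *\<^sub>R v))) (at s)"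
      using has_derivative_compose[OF line fd] .
    moreover have "(\<lambda>u. frechet_derivative f (at (?p s t)) (u *\<^sub>R v)) = (*) (frechet_derivative f (at (?p s t)) v)"
      by (rule ext) (simp add: linear_cmul[OF has_derivative_linear[OF fd]] mult.commute)
    ultimately show ?thesis
      unfolding has_field_derivative_def by simp
  qed
  have dw: "((\<lambda>t. ?Dv (?p s t)) has_real_derivative
      frechet_derivative ?Dv (at (?p s t)) w) (at t)"
    if "s \<in> {0..h}" "t \<in> {0..h}" for s t
  proof -
    have line: "((\<lambda>t. ?p s t) has_derivative (\<lambda>u. u *\<^sub>R w)) (at t)"
      by (auto intro!: derivative_eq_intros)
    have fd: "(?Dv has_derivative frechet_derivative ?Dv (at (?p s t))) (at (?p s t))"
      using Ck_on_imp_has_derivative[OF Ck_on_frechet_derivative[OF C] ball[OF that]] .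
    have "((\<lambda>t. ?Dv (?p s t)) has_derivative (\<lambda>u. frechet_derivative ?Dv (at (?p s t)) (u *\<^sub>R w))) (at t)"
      using has_derivative_compose[OF line fd] .
    moreover have "(\<lambda>u. frechet_derivative ?Dv (at (?p s t)) (u *\<^sub>R w)) = (*) (frechet_derivative ?Dv (at (?p s t)) w)"
      by (rule ext) (simp add: linear_cmul[OF has_derivative_linear[OF fd]] mult.commute)
    ultimately show ?thesis
      unfolding has_field_derivative_def by simp
  qed
  have "\<exists>s>0. s < h \<and> (f (?p h h) - f (?p h 0)) - (f (?p 0 h) - f (?p 0 0)) =
      (h - 0) * (?Dv (?p s h) - ?Dv (?p s 0))"
    using h by (intro MVT2[of 0 h "\<lambda>s. f (?p s h) - f (?p s 0)"] DERIV_diff dv) auto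
  then obtain s where s: "0 < s" "s < h" and e1: "(f (?p h h) - f (?p h 0)) - (f (?p 0 h) - f (?p 0 0)) =
      h * (?Dv (?p s h) - ?Dv (?p s 0))" by auto
  have "\<exists>t>0. t < h \<and> ?Dv (?p s h) - ?Dv (?p s 0) = (h - 0) * frechet_derivative ?Dv (at (?p s t)) w"
    using h s by (intro MVT2[of 0 h "\<lambda>t. ?Dv (?p s t)"]) (auto intro!: dw)
  then obtain t where t: "0 < t" "t < h" "?Dv (?p s h) - ?Dv (?p s 0) = h * frechet_derivative ?Dv (at (?p s t)) w"
    by auto
  show ?thesis
    using e1 t s bound[of s t] by (intro exI[of _ "?p s t"]) (simp add: algebra_simps)
qed

text \<open>The same second difference is \<open>h * h\<close> times either mixed derivative, taken
  at two points within distance of order \<open>h\<close> from \<open>x\<close>. After cancelling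
  \<open>h * h\<close>, continuity of the second derivatives gives equality in the limit.\<close>

lemma second_derivative_symmetric_real:
  fixes f :: "'a::real_normed_vector \<Rightarrow> real"
  assumes C2: "Ck_on 2 f S" and S: "open S" "x \<in> S"
  shows "frechet_derivative (\<lambda>y. frechet_derivative f (at y) v) (at x) w =
         frechet_derivative (\<lambda>y. frechet_derivative f (at y) w) (at x) v"
proof -
  obtain r where r: "r > 0" "ball x r \<subseteq> S" using S openE by blast
  have C2': "Ck_on 2 f (ball x r)" using Ck_on_subset[OF C2 r(2)] .
  \<comment> \<open>The summand 1 keeps \<open>N\<close> positive when \<open>v\<close> and
    \<open>w\<close> vanish, and division by \<open>N\<close> in \<open>h\<close> keeps the whole
    parallelogram inside the ball.\<close>
  define N where "N = norm v + norm w + 1"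
  have N: "N > 0" unfolding N_def by (smt (verit) norm_ge_zero)
  define h where "h n = r / (N * real (n + 2))" for n :: nat
  have h: "0 < h n" "h n * (norm v + norm w) < r" for n
  proof -
    show h0: "0 < h n" unfolding h_def using r N by simp
    have "h n * (norm v + norm w) < h n * N" unfolding N_def using h0 by simp
    also have "\<dots> = r / real (n + 2)" unfolding h_def using N by simp
    also have "\<dots> \<le> r" using r by (simp add: divide_le_eq)
    finally show "h n * (norm v + norm w) < r" .
  qed
  let ?A = "\<lambda>v w y. frechet_derivative (\<lambda>y. frechet_derivative f (at y) v) (at y) w"
  have cont: "isCont (?A v w) x" for v w
    using C2' r continuous_on_interior[of "ball x r" "?A v w" x]
    by (simp add: numeral_2_eq_2 interior_open)
  have hlim: "h \<longlonglongrightarrow> 0"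
  proof -
    have "(\<lambda>n. (r / N) * inverse (real (Suc (n+1)))) \<longlonglongrightarrow> (r / N) * 0"
      by (intro tendsto_intros LIMSEQ_Suc[OF LIMSEQ_inverse_real_of_nat] LIMSEQ_ignore_initial_segment[OF LIMSEQ_inverse_real_of_nat])
    then show ?thesis by (simp add: h_def[abs_def] field_simps)
  qed
  have "\<exists>y z. norm (y - x) \<le> h n * (norm v + norm w) \<and> norm (z - x) \<le> h n * (norm v + norm w)
     \<and> ?A v w y = ?A w v z" for n
  proof -
    obtain y where y: "norm (y - x) \<le> h n * (norm v + norm w)"
      "f (x + h n *\<^sub>R v + h n *\<^sub>R w) - f (x + h n *\<^sub>R v) - f (x + h n *\<^sub>R w) + f x = h n * h n * ?A v w y"
      using second_difference_mvt[OF C2' h] by blast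
    obtain z where z: "norm (z - x) \<le> h n * (norm w + norm v)"
      "f (x + h n *\<^sub>R w + h n *\<^sub>R v) - f (x + h n *\<^sub>R w) - f (x + h n *\<^sub>R v) + f x = h n * h n * ?A w v z"
      using second_difference_mvt[OF C2', of "h n" w v] h by (metis add.commute)
    have "f (x + h n *\<^sub>R w + h n *\<^sub>R v) = f (x + h n *\<^sub>R v + h n *\<^sub>R w)" by (simp add: algebra_simps)
    then have "h n * h n * ?A v w y = h n * h n * ?A w v z" using y(2) z(2) by linarith
    then have "?A v w y = ?A w v z" using h(1)[of n] by simp
    then show ?thesis using y z by (auto simp: add.commute)
  qed
  then obtain y z where yz: "\<And>n. norm (y n - x) \<le> h n * (norm v + norm w)"
    "\<And>n. norm (z n - x) \<le> h n * (norm v + norm w)" "\<And>n. ?A v w (y n) = ?A w v (z n)"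
    by metis
  have "(\<lambda>n. h n * (norm v + norm w)) \<longlonglongrightarrow> 0 * (norm v + norm w)"
    by (intro tendsto_intros hlim)
  then have lim0: "(\<lambda>n. h n * (norm v + norm w)) \<longlonglongrightarrow> 0" by simp
  have ylim: "y \<longlonglongrightarrow> x" and zlim: "z \<longlonglongrightarrow> x"
    using yz(1,2) by (auto intro!: Lim_null[THEN iffD2] Lim_null_comparison[OF _ lim0])
  have "(\<lambda>n. ?A v w (y n)) \<longlonglongrightarrow> ?A v w x" "(\<lambda>n. ?A w v (z n)) \<longlonglongrightarrow> ?A w v x"
    using isCont_tendsto_compose[OF cont ylim] isCont_tendsto_compose[OF cont zlim] .
  then show ?thesis using yz(3) LIMSEQ_unique by (metis (no_types, lifting) ext)
qed

lemma second_derivative_symmetric: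
  fixes f :: "'a::real_normed_vector \<Rightarrow> real ^ 'n"
  assumes C2: "Ck_on 2 f S" and S: "open S" "x \<in> S"
  shows "frechet_derivative (\<lambda>y. frechet_derivative f (at y) v) (at x) w =
         frechet_derivative (\<lambda>y. frechet_derivative f (at y) w) (at x) v"
proof -
  have C: "Ck_on (Suc (Suc 0)) f S" using C2 by (simp only: numeral_2_eq_2)
  have comp1: "frechet_derivative (\<lambda>y. f y $ i) (at y) v = frechet_derivative f (at y) v $ i"
    if "y \<in> S" for y v i
    using frechet_derivative_eqI[OF bounded_linear.has_derivative[OF bounded_linear_vec_nth
          Ck_on_imp_has_derivative[OF C that]], of i] by simp
  have comp2: "frechet_derivative (\<lambda>y. frechet_derivative f (at y) v) (at x) w $ i =
      frechet_derivative (\<lambda>y. frechet_derivative (\<lambda>y. f y $ i) (at y) v) (at x) w" for v w i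
  proof -
    have d: "((\<lambda>y. frechet_derivative f (at y) v $ i) has_derivative
       (\<lambda>w. frechet_derivative (\<lambda>y. frechet_derivative f (at y) v) (at x) w $ i)) (at x)"
      by (rule bounded_linear.has_derivative[OF bounded_linear_vec_nth
          Ck_on_imp_has_derivative[OF Ck_on_frechet_derivative[OF C] S(2)]])
    show ?thesis
      using frechet_derivative_eqI[OF has_derivative_transform_within_open[OF d S]] comp1 by auto
  qed
  have "Ck_on 2 (\<lambda>y. f y $ i) S" for i using Ck_on_vec_nth[OF S(1) C2] .
  then show ?thesis
    using comp2 second_derivative_symmetric_real[OF _ S] by (simp add: vec_eq_iff)
qed

lemma smooth_on_imp_Ck: "smooth_on S f \<Longrightarrow> Ck_on k f S"
  by (simp add: smooth_on_def)

lemma smooth_on_frechet_derivative: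
  "smooth_on S f \<Longrightarrow> smooth_on S (\<lambda>x. frechet_derivative f (at x) v)"
  by (auto simp: smooth_on_def intro: Ck_on_frechet_derivative)

lemma smooth_on_has_derivative:
  "smooth_on S f \<Longrightarrow> x \<in> S \<Longrightarrow> (f has_derivative frechet_derivative f (at x)) (at x)"
  using Ck_on_imp_has_derivative[OF smooth_on_imp_Ck[of S f "Suc 0"]] .

section \<open>Traces and Christoffel symbols of nondegenerate forms\<close>

definition metric_form :: "(real ^ 'n \<Rightarrow> real ^ 'n \<Rightarrow> real) \<Rightarrow> bool" where
  "metric_form G \<longleftrightarrow> bilinear G \<and> (\<forall>v w. G v w = G w v) \<and> (\<forall>v. (\<forall>w. G v w = 0) \<longrightarrow> v = 0)"

lemma metric_formD:
  assumes "metric_form G"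
  shows "bilinear G" "G v w = G w v" "(\<And>w. G v w = 0) \<Longrightarrow> v = 0"
  using assms by (auto simp: metric_form_def)

lemma bilinear_eq_gram:
  fixes B :: "real ^ 'n \<Rightarrow> real ^ 'n \<Rightarrow> real"
  assumes "bilinear B"
  shows "B v w = v \<bullet> (gram_matrix B *v w)"
proof -
  have "B v w = B (\<Sum>i\<in>UNIV. (v $ i) *\<^sub>R axis i 1) (\<Sum>j\<in>UNIV. (w $ j) *\<^sub>R axis j 1)"
    by (simp only: vec_eq_sum_axis[symmetric])
  also have "\<dots> = (\<Sum>(i,j)\<in>UNIV\<times>UNIV. B ((v $ i) *\<^sub>R axis i 1) ((w $ j) *\<^sub>R axis j 1))"
    by (rule bilinear_sum[OF assms])
  also have "\<dots> = (\<Sum>i\<in>UNIV. \<Sum>j\<in>UNIV. v $ i * (w $ j * B (axis i 1) (axis j 1)))"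
    by (simp add: sum.cartesian_product bilinear_lmul[OF assms] bilinear_rmul[OF assms] mult.left_commute)
  also have "\<dots> = v \<bullet> (gram_matrix B *v w)"
    by (simp add: inner_vec_def gram_matrix_def matrix_vector_mult_def sum_distrib_left mult_ac)
  finally show ?thesis .
qed

lemma bilinear_eq_sum:
  fixes B :: "real ^ 'n \<Rightarrow> real ^ 'n \<Rightarrow> real"
  assumes "bilinear B"
  shows "B v w = (\<Sum>i\<in>UNIV. \<Sum>j\<in>UNIV. v $ i * w $ j * B (axis i 1) (axis j 1))"
  by (simp add: bilinear_eq_gram[OF assms, of v w] inner_vec_def gram_matrix_def
      matrix_vector_mult_def sum_distrib_left mult_ac)

lemma gram_matrix_eqI:
  assumes "\<And>v w. B v w = v \<bullet> (M *v w)"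
  shows "gram_matrix B = M"
  by (simp add: gram_matrix_def assms vec_eq_iff inner_axis' matrix_vector_mul_component)
     (simp add: inner_axis)

lemma matrix_mult_linear:
  fixes f :: "real ^ 'n \<Rightarrow> real ^ 'm"
  shows "linear f \<Longrightarrow> matrix f *v x = f x"
  using matrix_vector_mul(2) by metis

lemma gram_matrix_pullback:
  fixes B :: "real ^ 'n \<Rightarrow> real ^ 'n \<Rightarrow> real" and J :: "real ^ 'n \<Rightarrow> real ^ 'n"
  assumes "bilinear B" "linear J"
  shows "gram_matrix (\<lambda>v w. B (J v) (J w)) = transpose (matrix J) ** gram_matrix B ** matrix J"
proof (rule gram_matrix_eqI)
  fix v w
  have "B (J v) (J w) = (matrix J *v v) \<bullet> (gram_matrix B *v (matrix J *v w))"
    using bilinear_eq_gram[OF assms(1)] by (simp add: matrix_mult_linear[OF assms(2)])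
  also have "\<dots> = v \<bullet> (transpose (matrix J) *v (gram_matrix B *v (matrix J *v w)))"
    by (metis dot_lmul_matrix transpose_transpose vector_transpose_matrix)
  finally show "B (J v) (J w) = v \<bullet> ((transpose (matrix J) ** gram_matrix B ** matrix J) *v w)"
    by (simp add: matrix_vector_mul_assoc matrix_mul_assoc)
qed

lemma transpose_gram_matrix: "transpose (gram_matrix B) = gram_matrix (\<lambda>v w. B w v)"
  by (simp add: gram_matrix_def transpose_def)

lemma gram_matrix_symmetric: "metric_form G \<Longrightarrow> transpose (gram_matrix G) = gram_matrix G"
  unfolding transpose_gram_matrix by (rule arg_cong[where f = gram_matrix], intro ext, rule metric_formD(2))

lemma invertible_gram_matrix:
  assumes "metric_form G"
  shows "invertible (gram_matrix G)"
proof -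
  have "x = 0" if "gram_matrix G *v x = 0" for x
  proof -
    have "G x w = 0" for w
      using bilinear_eq_gram[OF metric_formD(1)[OF assms], of w x] that metric_formD(2)[OF assms]
      by (metis inner_zero_right)
    then show ?thesis using metric_formD(3)[OF assms] by blast
  qed
  then show ?thesis
    by (simp add: invertible_left_inverse matrix_left_invertible_ker)
qed

lemma matrix_inv_mult:
  fixes M :: "real ^ 'n ^ 'n"
  assumes "invertible M"
  shows "matrix_inv M ** M = mat 1" "M ** matrix_inv M = mat 1"
  using assms someI_ex[of "\<lambda>A'. M ** A' = mat 1 \<and> A' ** M = mat 1"]
  unfolding invertible_def matrix_inv_def by blast+

lemma matrix_inv_eqI:
  fixes M :: "real ^ 'n ^ 'n"
  assumes "N ** M = mat 1"
  shows "matrix_inv M = N"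
proof -
  have "invertible M" using assms invertible_left_inverse by blast
  then show ?thesis
    by (metis assms matrix_inv_mult(2) matrix_mul_assoc matrix_mul_lid matrix_mul_rid)
qed

text \<open>The contraction uses both indices in the same order, hence the transpose. In this form
  the facts about \<open>metric_trace\<close> become instances of the cyclicity of the matrix
  trace.\<close>

lemma metric_trace_eq_trace:
  "metric_trace G B = trace (matrix_inv (gram_matrix G) ** transpose (gram_matrix B))"
  by (simp add: metric_trace_def trace_def matrix_matrix_mult_def transpose_def gram_matrix_def)

lemma transpose_matrix_inv_symmetric:
  fixes M :: "real ^ 'n ^ 'n"
  assumes "invertible M" "transpose M = M"
  shows "transpose (matrix_inv M) = matrix_inv M"
proof -
  have "transpose (matrix_inv M) ** M = transpose (M ** matrix_inv M)"
    by (simp add: matrix_transpose_mul assms(2))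
  also have "\<dots> = mat 1" by (simp add: matrix_inv_mult(2)[OF assms(1)] transpose_mat)
  finally show ?thesis using matrix_inv_eqI by metis
qed

lemma trace_transpose: "trace (transpose M) = trace M"
  by (simp add: trace_def transpose_def)

text \<open>The inverse of a symmetric Gram matrix is symmetric, so the trace sees only the
  symmetric part of a form.\<close>

lemma metric_trace_flip:
  fixes G :: "real ^ 'n \<Rightarrow> real ^ 'n \<Rightarrow> real"
  assumes "metric_form G"
  shows "metric_trace G (\<lambda>a b. B b a) = metric_trace G B"
proof -
  note sym = transpose_matrix_inv_symmetric[OF invertible_gram_matrix gram_matrix_symmetric,
      OF assms assms]
  have "metric_trace G (\<lambda>a b. B b a) = trace (matrix_inv (gram_matrix G) ** gram_matrix B)"
    unfolding metric_trace_eq_trace transpose_gram_matrix ..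
  also have "\<dots> = trace (transpose (gram_matrix B) ** matrix_inv (gram_matrix G))"
    by (metis trace_transpose matrix_transpose_mul sym)
  also have "\<dots> = metric_trace G B"
    unfolding metric_trace_eq_trace by (rule trace_mul_sym)
  finally show ?thesis .
qed

lemma metric_trace_add:
  "metric_trace G (\<lambda>a b. B a b + C a b) = metric_trace G B + metric_trace G C"
  by (simp add: metric_trace_def distrib_left sum.distrib)

lemma metric_trace_cmult:
  "metric_trace G (\<lambda>a b. r * B a b) = r * metric_trace G B"
  by (simp add: metric_trace_def sum_distrib_left mult_ac)

text \<open>The source of all chart independence below: the inverse Gram matrix is multiplied by the
  inverse of \<open>J\<close> on one side and its transpose on the other, and these cancel against
  the factors of \<open>B\<close> under the trace.\<close>

lemma metric_trace_pullback:
  fixes G :: "real ^ 'n \<Rightarrow> real ^ 'n \<Rightarrow> real" and J :: "real ^ 'n \<Rightarrow> real ^ 'n"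
  assumes G: "metric_form G" and B: "bilinear B" and J: "linear J" "invertible (matrix J)"
  shows "metric_trace (\<lambda>v w. G (J v) (J w)) (\<lambda>v w. B (J v) (J w)) = metric_trace G B"
proof -
  let ?J = "matrix J" and ?J' = "matrix_inv (matrix J)"
  let ?G = "gram_matrix G" and ?B = "gram_matrix B"
  note JJ = matrix_inv_mult[OF J(2)]
  note GG = matrix_inv_mult[OF invertible_gram_matrix[OF G]]
  have TJ: "transpose ?J' ** transpose ?J = mat 1"
    by (metis JJ(2) matrix_transpose_mul transpose_mat)
  have "(?J' ** matrix_inv ?G ** transpose ?J') ** (transpose ?J ** ?G ** ?J) =
      ?J' ** matrix_inv ?G ** (transpose ?J' ** transpose ?J) ** ?G ** ?J"
    by (simp add: matrix_mul_assoc)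
  also have "\<dots> = ?J' ** (matrix_inv ?G ** ?G) ** ?J"
    by (simp add: matrix_mul_assoc TJ)
  also have "\<dots> = mat 1" by (simp add: GG JJ)
  finally have inv: "matrix_inv (transpose ?J ** ?G ** ?J) = ?J' ** matrix_inv ?G ** transpose ?J'"
    by (rule matrix_inv_eqI)
  have "metric_trace (\<lambda>v w. G (J v) (J w)) (\<lambda>v w. B (J v) (J w)) =
     trace ((?J' ** matrix_inv ?G ** transpose ?J') ** transpose (transpose ?J ** ?B ** ?J))"
    unfolding metric_trace_eq_trace gram_matrix_pullback[OF B J(1)]
      gram_matrix_pullback[OF metric_formD(1)[OF G] J(1)] inv ..
  also have "\<dots> = trace (?J' ** matrix_inv ?G ** (transpose ?J' ** transpose ?J) ** transpose ?B ** ?J)"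
    by (simp add: matrix_transpose_mul matrix_mul_assoc)
  also have "\<dots> = trace (?J' ** (matrix_inv ?G ** transpose ?B ** ?J))"
    by (simp add: TJ matrix_mul_assoc)
  also have "\<dots> = trace ((matrix_inv ?G ** transpose ?B ** ?J) ** ?J')"
    by (rule trace_mul_sym)
  also have "\<dots> = metric_trace G B"
    unfolding metric_trace_eq_trace by (metis JJ(2) matrix_mul_assoc matrix_mul_rid)
  finally show ?thesis .
qed

text \<open>Raising an index. The representing vector is given explicitly, because its dependence on
  a base point has to be continuous later.\<close>

lemma metric_form_represent:
  fixes G :: "real ^ 'n \<Rightarrow> real ^ 'n \<Rightarrow> real"
  assumes G: "metric_form G" and f: "linear f"
  shows "G (matrix_inv (gram_matrix G) *v (\<chi> i. f (axis i 1))) z = f z"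
proof -
  let ?b = "\<chi> i. f (axis i 1)"
  have "G (matrix_inv (gram_matrix G) *v ?b) z = z \<bullet> (gram_matrix G *v (matrix_inv (gram_matrix G) *v ?b))"
    using bilinear_eq_gram[OF metric_formD(1)[OF G]] metric_formD(2)[OF G] by metis
  also have "\<dots> = z \<bullet> ?b"
    by (simp add: matrix_vector_mul_assoc matrix_inv_mult[OF invertible_gram_matrix[OF G]])
  also have "\<dots> = f (\<Sum>i\<in>UNIV. (z $ i) *\<^sub>R axis i 1)"
    by (simp add: linear_sum[OF f] linear_cmul[OF f] inner_vec_def)
  finally show ?thesis by (simp only: vec_eq_sum_axis[symmetric])
qed

lemma metric_form_cancel:
  fixes G :: "real ^ 'n \<Rightarrow> real ^ 'n \<Rightarrow> real"
  assumes G: "metric_form G" and "\<And>z. G u z = G v z"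
  shows "u = v"
proof -
  have "G (u - v) z = 0" for z
    using assms(2) bilinear_lsub[OF metric_formD(1)[OF G], of u v z] by simp
  then show ?thesis using metric_formD(3)[OF G] by (metis eq_iff_diff_eq_0)
qed

section \<open>Smooth metrics in a chart: Koszul's formula, Christoffel symbols, covariant
  derivatives\<close>

definition metric_on :: "(real ^ 'n \<Rightarrow> real ^ 'n \<Rightarrow> real ^ 'n \<Rightarrow> real) \<Rightarrow> (real ^ 'n) set \<Rightarrow> bool" where
  "metric_on G S \<longleftrightarrow> open S \<and> (\<forall>x\<in>S. metric_form (G x)) \<and> (\<forall>v w. smooth_on S (\<lambda>x. G x v w))"

lemma metric_onD:
  assumes "metric_on G S"
  shows "open S" "x \<in> S \<Longrightarrow> metric_form (G x)" "smooth_on S (\<lambda>x. G x v w)"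
  using assms by (auto simp: metric_on_def)

lemma linear_frechet_derivative_family:
  assumes S: "open S" "x \<in> S" and lin: "\<And>y. y \<in> S \<Longrightarrow> linear (T y)"
    and d: "\<And>v. (\<lambda>y. T y v) differentiable (at x)"
  shows "linear (\<lambda>v. frechet_derivative (\<lambda>y. T y v) (at x) a)"
proof (rule linearI)
  have D: "((\<lambda>y. T y v) has_derivative frechet_derivative (\<lambda>y. T y v) (at x)) (at x)" for v
    using d frechet_derivative_works by blast
  fix v w and r :: real
  have "((\<lambda>y. T y (v + w)) has_derivative (\<lambda>a. frechet_derivative (\<lambda>y. T y v) (at x) a +
      frechet_derivative (\<lambda>y. T y w) (at x) a)) (at x)"
    by (rule has_derivative_transform_within_open[OF has_derivative_add[OF D D] S])
      (simp add: linear_add[OF lin])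
  then show "frechet_derivative (\<lambda>y. T y (v + w)) (at x) a =
      frechet_derivative (\<lambda>y. T y v) (at x) a + frechet_derivative (\<lambda>y. T y w) (at x) a"
    using frechet_derivative_eqI by metis
  have "((\<lambda>y. T y (r *\<^sub>R v)) has_derivative (\<lambda>a. r *\<^sub>R frechet_derivative (\<lambda>y. T y v) (at x) a)) (at x)"
    by (rule has_derivative_transform_within_open[OF has_derivative_scaleR_right[OF D] S])
      (simp add: linear_cmul[OF lin])
  then show "frechet_derivative (\<lambda>y. T y (r *\<^sub>R v)) (at x) a =
      r *\<^sub>R frechet_derivative (\<lambda>y. T y v) (at x) a"
    using frechet_derivative_eqI by metis
qed

abbreviation dform :: "(real ^ 'n \<Rightarrow> real ^ 'n \<Rightarrow> real ^ 'n \<Rightarrow> real) \<Rightarrow> real ^ 'n \<Rightarrow>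
    real ^ 'n \<Rightarrow> real ^ 'n \<Rightarrow> real ^ 'n \<Rightarrow> real" where
  "dform G x a v w \<equiv> frechet_derivative (\<lambda>y. G y v w) (at x) a"

definition bilinear_on :: "(real ^ 'n \<Rightarrow> real ^ 'n \<Rightarrow> real ^ 'n \<Rightarrow> real) \<Rightarrow> (real ^ 'n) set \<Rightarrow> bool" where
  "bilinear_on G S \<longleftrightarrow> open S \<and> (\<forall>x\<in>S. bilinear (G x)) \<and> (\<forall>v w. smooth_on S (\<lambda>x. G x v w))"

lemma metric_on_bilinear_on: "metric_on G S \<Longrightarrow> bilinear_on G S"
  by (auto simp: metric_on_def bilinear_on_def metric_form_def)

lemma bilinear_on_has_derivative:
  "bilinear_on G S \<Longrightarrow> x \<in> S \<Longrightarrow> ((\<lambda>y. G y v w) has_derivative (\<lambda>a. dform G x a v w)) (at x)"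
  using smooth_on_has_derivative[of S "\<lambda>y. G y v w" x] by (simp add: bilinear_on_def)

lemma dform_linear:
  assumes "bilinear_on G S" "x \<in> S"
  shows "linear (\<lambda>a. dform G x a v w)" "linear (\<lambda>v. dform G x a v w)" "linear (\<lambda>w. dform G x a v w)"
proof -
  have o: "open S" "\<And>y. y \<in> S \<Longrightarrow> bilinear (G y)" using assms by (auto simp: bilinear_on_def)
  note d = bilinear_on_has_derivative[OF assms]
  show "linear (\<lambda>a. dform G x a v w)" using d has_derivative_linear by blast
  show "linear (\<lambda>v. dform G x a v w)"
    using o(2) differentiableI[OF d]
    by (intro linear_frechet_derivative_family[OF o(1) assms(2)]) (auto simp: bilinear_def)
  show "linear (\<lambda>w. dform G x a v w)"
    using o(2) differentiableI[OF d]
    by (intro linear_frechet_derivative_family[OF o(1) assms(2)]) (auto simp: bilinear_def)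
qed

lemma dform_symmetric:
  assumes "metric_on G S" "x \<in> S"
  shows "dform G x a v w = dform G x a w v"
proof -
  note d = bilinear_on_has_derivative[OF metric_on_bilinear_on[OF assms(1)] assms(2)]
  have "((\<lambda>y. G y v w) has_derivative (\<lambda>a. dform G x a w v)) (at x)"
    using has_derivative_transform_within_open[OF d[of w v] metric_onD(1)[OF assms(1)] assms(2)]
      metric_formD(2)[OF metric_onD(2)[OF assms(1)]] by metis
  then show ?thesis using frechet_derivative_eqI by metis
qed

text \<open>The right-hand side of Koszul's formula is linear in \<open>z\<close>, so nondegeneracy
  yields existence and uniqueness. The definite description is thereby replaced by a formula from
  which continuity in \<open>x\<close> can be read off.\<close>

lemma christoffel_eq_matrix:
  assumes G: "metric_on G S" "x \<in> S"
  shows "christoffel G x v w = matrix_inv (gram_matrix (G x)) *v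
    (\<chi> k. (dform G x v w (axis k 1) + dform G x w v (axis k 1) - dform G x (axis k 1) v w) / 2)"
    (is "_ = ?u")
proof -
  note l = dform_linear[OF metric_on_bilinear_on[OF G(1)] G(2)]
  note m = metric_onD(2)[OF G]
  define f where "f z = (dform G x v w z + dform G x w v z - dform G x z v w) / 2" for z
  have lf: "linear f"
    unfolding f_def
    by (intro linearI; simp add: linear_add[OF l(1)] linear_add[OF l(3)] linear_cmul[OF l(1)]
        linear_cmul[OF l(3)]; simp add: field_simps)
  have r: "G x ?u z = f z" for z
    using metric_form_represent[OF m lf] by (simp add: f_def)
  show ?thesis
    unfolding christoffel_def
  proof (rule the_equality)
    show "\<forall>z. 2 * G x ?u z = dform G x v w z + dform G x w v z - dform G x z v w"
    proof
      show "2 * G x ?u z = dform G x v w z + dform G x w v z - dform G x z v w" for z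
        unfolding r[of z] by (simp add: f_def)
    qed
    fix u assume u: "\<forall>z. 2 * G x u z = dform G x v w z + dform G x w v z - dform G x z v w"
    have "2 * G x u z = 2 * f z" for z unfolding spec[OF u, of z] by (simp add: f_def)
    then have "G x u z = G x ?u z" for z unfolding r by simp
    then show "u = ?u" by (rule metric_form_cancel[OF m])
  qed
qed

lemma christoffel_koszul:
  assumes G: "metric_on G S" "x \<in> S"
  shows "2 * G x (christoffel G x v w) z = dform G x v w z + dform G x w v z - dform G x z v w"
proof -
  note l = dform_linear[OF metric_on_bilinear_on[OF G(1)] G(2)]
  define f where "f z = (dform G x v w z + dform G x w v z - dform G x z v w) / 2" for z
  have lf: "linear f"
    unfolding f_def
    by (intro linearI; simp add: linear_add[OF l(1)] linear_add[OF l(3)] linear_cmul[OF l(1)]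
        linear_cmul[OF l(3)]; simp add: field_simps)
  then show ?thesis
    using metric_form_represent[OF metric_onD(2)[OF G] lf, of z] unfolding christoffel_eq_matrix[OF G]
    by (simp add: f_def)
qed

text \<open>Tested against every \<open>z\<close>, Koszul's formula reduces both linearities to
  those of \<open>dform\<close>; nondegeneracy removes the test vector again.\<close>

lemma christoffel_linear:
  assumes G: "metric_on G S" "x \<in> S"
  shows "linear (\<lambda>v. christoffel G x v w)" "linear (\<lambda>w. christoffel G x v w)"
proof -
  note l = dform_linear[OF metric_on_bilinear_on[OF G(1)] G(2)]
  note m = metric_onD(2)[OF G]
  note b = metric_formD(1)[OF m]
  note k = christoffel_koszul[OF G]
  have *: "u = v" if "\<And>z. 2 * G x u z = 2 * G x v z" for u v
    using that metric_form_cancel[OF m] by simp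
  show "linear (\<lambda>v. christoffel G x v w)"
    by (intro linearI; rule *; simp only: k bilinear_ladd[OF b] bilinear_lmul[OF b] distrib_left
        mult.left_commute[of 2] linear_add[OF l(1)] linear_add[OF l(2)] linear_add[OF l(3)]
        linear_cmul[OF l(1)] linear_cmul[OF l(2)] linear_cmul[OF l(3)] real_scaleR_def;
        simp add: algebra_simps)
  show "linear (\<lambda>w. christoffel G x v w)"
    by (intro linearI; rule *; simp only: k bilinear_ladd[OF b] bilinear_lmul[OF b] distrib_left
        mult.left_commute[of 2] linear_add[OF l(1)] linear_add[OF l(2)] linear_add[OF l(3)]
        linear_cmul[OF l(1)] linear_cmul[OF l(2)] linear_cmul[OF l(3)] real_scaleR_def;
        simp add: algebra_simps)
qed

lemma continuous_on_det:
  fixes M :: "'a::topological_space \<Rightarrow> real ^ 'n ^ 'n"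
  assumes "\<And>i j. continuous_on S (\<lambda>x. M x $ i $ j)"
  shows "continuous_on S (\<lambda>x. det (M x))"
  unfolding det_def by (intro continuous_intros assms)

text \<open>Cramer's rule for the columns of the inverse. It exhibits the entries as quotients of
  polynomials in the entries of \<open>M\<close>, which gives their continuity.\<close>

lemma matrix_inv_entry:
  fixes M :: "real ^ 'n ^ 'n"
  assumes "invertible M"
  shows "matrix_inv M $ k $ j = det (\<chi> i l. if l = k then axis j 1 $ i else M $ i $ l) / det M"
proof -
  have "M *v (matrix_inv M *v axis j 1) = axis j 1"
    by (simp add: matrix_vector_mul_assoc matrix_inv_mult[OF assms])
  moreover have "det M \<noteq> 0" using assms invertible_det_nz by blast
  ultimately have "matrix_inv M *v axis j 1 =
    (\<chi> k. det (\<chi> i l. if l = k then axis j 1 $ i else M $ i $ l) / det M)"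
    using cramer by blast
  then have "(matrix_inv M *v axis j 1) $ k = det (\<chi> i l. if l = k then axis j 1 $ i else M $ i $ l) / det M"
    by simp
  then show ?thesis
    by (simp add: matrix_vector_mul_component inner_axis)
qed

lemma continuous_on_matrix_inv:
  fixes M :: "'a::topological_space \<Rightarrow> real ^ 'n ^ 'n"
  assumes "\<And>i j. continuous_on S (\<lambda>x. M x $ i $ j)" "\<And>x. x \<in> S \<Longrightarrow> invertible (M x)"
  shows "continuous_on S (\<lambda>x. matrix_inv (M x) $ k $ j)"
proof -
  have "continuous_on S (\<lambda>x. det (\<chi> i l. if l = k then axis j 1 $ i else M x $ i $ l) / det (M x))"
  proof (intro continuous_on_divide continuous_on_det)
    show "\<forall>x\<in>S. det (M x) \<noteq> 0" using assms(2) invertible_det_nz by blast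
    show "continuous_on S (\<lambda>x. (\<chi> i l. if l = k then axis j 1 $ i else M x $ i $ l) $ i $ l)" for i l
      by (cases "l = k") (simp_all add: assms(1))
  qed (rule assms(1))
  then show ?thesis
    using matrix_inv_entry[OF assms(2)] by (simp cong: continuous_on_cong)
qed

lemma metric_on_continuous:
  assumes "metric_on G S"
  shows "continuous_on S (\<lambda>x. G x v w)" "continuous_on S (\<lambda>x. dform G x a v w)"
  using smooth_on_imp_Ck[OF metric_onD(3)[OF assms], of 0] Ck_on_imp_continuous[OF
    smooth_on_imp_Ck[OF smooth_on_frechet_derivative[OF metric_onD(3)[OF assms]]]] by auto

lemma continuous_on_christoffel:
  assumes "metric_on G S"
  shows "continuous_on S (\<lambda>x. christoffel G x v w)"
proof -
  have "continuous_on S (\<lambda>x. matrix_inv (gram_matrix (G x)) *v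
    (\<chi> k. (dform G x v w (axis k 1) + dform G x w v (axis k 1) - dform G x (axis k 1) v w) / 2))"
    unfolding matrix_vector_mult_def
    by (intro continuous_on_vec_lambda continuous_on_sum continuous_on_mult continuous_on_matrix_inv)
      (auto simp: gram_matrix_def intro!: continuous_intros metric_on_continuous[OF assms]
        invertible_gram_matrix[unfolded gram_matrix_def] metric_onD(2)[OF assms])
  then show ?thesis
    using christoffel_eq_matrix[OF assms] by (simp cong: continuous_on_cong)
qed

definition covariant_deriv :: "(real ^ 'n \<Rightarrow> real ^ 'n \<Rightarrow> real ^ 'n \<Rightarrow> real) \<Rightarrow>
    (real ^ 'n \<Rightarrow> real ^ 'n) \<Rightarrow> real ^ 'n \<Rightarrow> real ^ 'n \<Rightarrow> real ^ 'n" where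
  "covariant_deriv G V x a = frechet_derivative V (at x) a + christoffel G x a (V x)"

lemma linear_covariant_deriv:
  assumes "metric_on G S" "x \<in> S" "V differentiable (at x)"
  shows "linear (covariant_deriv G V x)"
proof -
  have "linear (frechet_derivative V (at x))" using assms(3) by (rule linear_frechet_derivative)
  moreover note christoffel_linear(1)[OF assms(1,2)]
  ultimately show ?thesis
    unfolding covariant_deriv_def[abs_def] by (rule linear_compose_add)
qed

text \<open>Expanding the argument in the standard basis leaves a finite sum of products, so
  differentiability of \<open>F\<close> for each fixed vector suffices. Near \<open>x\<close> the
  base point \<open>z y\<close> stays in \<open>S\<close>, where the expansion is valid.\<close>

lemma has_derivative_linear_family:
  fixes F :: "real ^ 'n \<Rightarrow> real ^ 'm \<Rightarrow> 'b::real_normed_vector" and x :: "'c::real_normed_vector"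
  assumes S: "open S" "z x \<in> S" and lin: "\<And>y. y \<in> S \<Longrightarrow> linear (F y)"
    and d: "\<And>v. (\<lambda>y. F y v) differentiable (at (z x))"
    and z: "(z has_derivative z') (at x)" and u: "(u has_derivative u') (at x)"
  shows "((\<lambda>y. F (z y) (u y)) has_derivative
    (\<lambda>a. frechet_derivative (\<lambda>y. F y (u x)) (at (z x)) (z' a) + F (z x) (u' a))) (at x)"
proof -
  have ex: "F y v = (\<Sum>i\<in>UNIV. (v $ i) *\<^sub>R F y (axis i 1))" if "y \<in> S" for y v
  proof -
    have "F y v = F y (\<Sum>i\<in>UNIV. (v $ i) *\<^sub>R axis i 1)" by (simp only: vec_eq_sum_axis[symmetric])
    then show ?thesis by (simp add: linear_sum[OF lin[OF that]] linear_cmul[OF lin[OF that]])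
  qed
  have dF: "((\<lambda>y. F y v) has_derivative frechet_derivative (\<lambda>y. F y v) (at (z x))) (at (z x))" for v
    using d frechet_derivative_works by blast
  have D: "linear (\<lambda>v. frechet_derivative (\<lambda>y. F y v) (at (z x)) a)" for a
    by (rule linear_frechet_derivative_family[OF S lin d])
  have exD: "frechet_derivative (\<lambda>y. F y v) (at (z x)) a =
     (\<Sum>i\<in>UNIV. (v $ i) *\<^sub>R frechet_derivative (\<lambda>y. F y (axis i 1)) (at (z x)) a)" for v a
  proof -
    have "frechet_derivative (\<lambda>y. F y v) (at (z x)) a =
        frechet_derivative (\<lambda>y. F y (\<Sum>i\<in>UNIV. (v $ i) *\<^sub>R axis i 1)) (at (z x)) a"
      by (simp only: vec_eq_sum_axis[symmetric])
    then show ?thesis by (simp add: linear_sum[OF D] linear_cmul[OF D])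
  qed
  have "((\<lambda>y. \<Sum>i\<in>UNIV. (u y $ i) *\<^sub>R F (z y) (axis i 1)) has_derivative
     (\<lambda>a. \<Sum>i\<in>UNIV. (u x $ i) *\<^sub>R frechet_derivative (\<lambda>y. F y (axis i 1)) (at (z x)) (z' a) +
         (u' a $ i) *\<^sub>R F (z x) (axis i 1))) (at x)"
    by (intro has_derivative_sum has_derivative_scaleR has_derivative_compose[OF z dF]
        bounded_linear.has_derivative[OF bounded_linear_vec_nth u])
  then have "((\<lambda>y. \<Sum>i\<in>UNIV. (u y $ i) *\<^sub>R F (z y) (axis i 1)) has_derivative
     (\<lambda>a. frechet_derivative (\<lambda>y. F y (u x)) (at (z x)) (z' a) + F (z x) (u' a))) (at x)"
    by (simp add: sum.distrib ex[OF S(2), symmetric] exD[symmetric])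
  moreover have "\<forall>\<^sub>F y in at x. (\<Sum>i\<in>UNIV. (u y $ i) *\<^sub>R F (z y) (axis i 1)) = F (z y) (u y)"
  proof -
    have "(z \<longlongrightarrow> z x) (at x)"
      using has_derivative_continuous[OF z] by (simp add: continuous_within)
    then have "\<forall>\<^sub>F y in at x. z y \<in> S" using S topological_tendstoD by blast
    then show ?thesis by eventually_elim (simp add: ex[symmetric])
  qed
  ultimately show ?thesis
    by (rule has_derivative_transform_eventually) (simp_all add: ex[OF S(2), symmetric])
qed

text \<open>The previous rule treats the last argument while the middle one is held constant; the
  middle one is then expanded in the standard basis in the same manner.\<close>

lemma has_derivative_bilinear_on:
  fixes x :: "'c::real_normed_vector"
  assumes T: "bilinear_on T S" "z x \<in> S"
    and z: "(z has_derivative z') (at x)" and u: "(u has_derivative u') (at x)"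
    and w: "(w has_derivative w') (at x)"
  shows "((\<lambda>y. T (z y) (u y) (w y)) has_derivative
    (\<lambda>a. dform T (z x) (z' a) (u x) (w x) + T (z x) (u' a) (w x) + T (z x) (u x) (w' a))) (at x)"
proof -
  have o: "open S" and b: "\<And>y. y \<in> S \<Longrightarrow> bilinear (T y)" using T by (auto simp: bilinear_on_def)
  note bd = bilinear_on_has_derivative[OF T]
  have ex: "T y v v' = (\<Sum>i\<in>UNIV. (v $ i) * T y (axis i 1) v')" if "y \<in> S" for y v v'
  proof -
    have l: "linear (\<lambda>v. T y v v')" using b[OF that] by (simp add: bilinear_def)
    have "T y v v' = T y (\<Sum>i\<in>UNIV. (v $ i) *\<^sub>R axis i 1) v'" by (simp only: vec_eq_sum_axis[symmetric])
    then show ?thesis by (simp add: linear_sum[OF l] linear_cmul[OF l])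
  qed
  have exD: "dform T (z x) a v v' = (\<Sum>i\<in>UNIV. (v $ i) * dform T (z x) a (axis i 1) v')" for a v v'
  proof -
    note l = dform_linear(2)[OF T]
    have "dform T (z x) a v v' = dform T (z x) a (\<Sum>i\<in>UNIV. (v $ i) *\<^sub>R axis i 1) v'"
      by (simp only: vec_eq_sum_axis[symmetric])
    then show ?thesis by (simp add: linear_sum[OF l] linear_cmul[OF l])
  qed
  have inner: "((\<lambda>y. T (z y) v (w y)) has_derivative
    (\<lambda>a. dform T (z x) (z' a) v (w x) + T (z x) v (w' a))) (at x)" for v
    by (rule has_derivative_linear_family[OF o T(2) _ differentiableI[OF bd] z w])
      (use b in \<open>auto simp: bilinear_def\<close>)
  have "((\<lambda>y. \<Sum>i\<in>UNIV. (u y $ i) * T (z y) (axis i 1) (w y)) has_derivative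
     (\<lambda>a. \<Sum>i\<in>UNIV. (u x $ i) * (dform T (z x) (z' a) (axis i 1) (w x) + T (z x) (axis i 1) (w' a)) +
         (u' a $ i) * T (z x) (axis i 1) (w x))) (at x)"
    by (intro has_derivative_sum has_derivative_mult inner
        bounded_linear.has_derivative[OF bounded_linear_vec_nth u])
  then have "((\<lambda>y. \<Sum>i\<in>UNIV. (u y $ i) * T (z y) (axis i 1) (w y)) has_derivative
    (\<lambda>a. dform T (z x) (z' a) (u x) (w x) + T (z x) (u' a) (w x) + T (z x) (u x) (w' a))) (at x)"
    by (simp add: sum.distrib distrib_left ex[OF T(2), symmetric] exD[symmetric] add_ac)
  moreover have "\<forall>\<^sub>F y in at x. (\<Sum>i\<in>UNIV. (u y $ i) * T (z y) (axis i 1) (w y)) = T (z y) (u y) (w y)"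
  proof -
    have "(z \<longlongrightarrow> z x) (at x)"
      using has_derivative_continuous[OF z] by (simp add: continuous_within)
    then have "\<forall>\<^sub>F y in at x. z y \<in> S" using o T(2) topological_tendstoD by blast
    then show ?thesis by eventually_elim (simp add: ex[symmetric])
  qed
  ultimately show ?thesis
    by (rule has_derivative_transform_eventually) (simp_all add: ex[OF T(2), symmetric])
qed

section \<open>Charts\<close>

definition chart_point :: "('m, 'n::finite) chart \<Rightarrow> real ^ 'n \<Rightarrow> 'm" where
  "chart_point c = inv_into (chart_dom c) (coord c)"

locale smooth_charts =
  fixes X :: "'m topology" and A :: "('m, 'n::finite) chart set"
  assumes atlas: "smooth_atlas X A"
begin

lemma openin_chart_dom: "c \<in> A \<Longrightarrow> openin X (chart_dom c)"
  and open_chart_image: "c \<in> A \<Longrightarrow> open (chart_image c)"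
  and homeomorphic_coord: "c \<in> A \<Longrightarrow>
    homeomorphic_map (subtopology X (chart_dom c)) (top_of_set (chart_image c)) (coord c)"
  and Union_chart_dom: "(\<Union>c\<in>A. chart_dom c) = topspace X"
  using atlas by (auto simp: smooth_atlas_def)

lemma chart_dom_subset: "c \<in> A \<Longrightarrow> chart_dom c \<subseteq> topspace X"
  using openin_chart_dom openin_subset by blast

lemma inj_on_coord: "c \<in> A \<Longrightarrow> inj_on (coord c) (chart_dom c)"
  using homeomorphic_imp_injective_map[OF homeomorphic_coord] chart_dom_subset
  by (metis inf.absorb_iff2 topspace_subtopology)

lemma chart_point_coord: "c \<in> A \<Longrightarrow> p \<in> chart_dom c \<Longrightarrow> chart_point c (coord c p) = p"
  using inj_on_coord by (simp add: chart_point_def)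

lemma coord_in_image: "p \<in> chart_dom c \<Longrightarrow> coord c p \<in> chart_image c"
  by (simp add: chart_image_def)

lemma chart_point_in: "x \<in> chart_image c \<Longrightarrow> chart_point c x \<in> chart_dom c"
  and coord_chart_point: "x \<in> chart_image c \<Longrightarrow> coord c (chart_point c x) = x"
  by (auto simp: chart_image_def chart_point_def inv_into_into f_inv_into_f)

lemma open_coord_image:
  assumes "c \<in> A" "openin X U"
  shows "open (coord c ` (chart_dom c \<inter> U))"
proof -
  have "openin (subtopology X (chart_dom c)) (chart_dom c \<inter> U)"
    by (simp add: assms(2) openin_subtopology_Int2)
  then have "openin (top_of_set (chart_image c)) (coord c ` (chart_dom c \<inter> U))"
    using homeomorphic_coord[OF assms(1)] homeomorphic_imp_open_map open_map_def by blast
  then show ?thesis using open_chart_image[OF assms(1)] openin_open_trans by blast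
qed

lemma openin_coord_preimage:
  assumes "c \<in> A" "open S"
  shows "openin X {p \<in> chart_dom c. coord c p \<in> S}"
proof -
  have "continuous_map (subtopology X (chart_dom c)) (top_of_set (chart_image c)) (coord c)"
    using homeomorphic_coord[OF assms(1)] homeomorphic_imp_continuous_map by blast
  then have "continuous_map (subtopology X (chart_dom c)) euclidean (coord c)"
    by (rule continuous_map_into_fulltopology)
  then have "openin (subtopology X (chart_dom c))
     {p \<in> topspace (subtopology X (chart_dom c)). coord c p \<in> S}"
    using assms(2) openin_continuous_map_preimage by fastforce
  moreover have "topspace (subtopology X (chart_dom c)) = chart_dom c"
    using chart_dom_subset[OF assms(1)] by auto
  ultimately show ?thesis
    using openin_chart_dom[OF assms(1)] openin_trans_full by fastforce
qed

lemma transition_coord: "c \<in> A \<Longrightarrow> p \<in> chart_dom c \<Longrightarrow> transition c d (coord c p) = coord d p"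
  using chart_point_coord by (simp add: transition_def chart_point_def)

lemma transition_eq: "transition c d x = coord d (chart_point c x)"
  by (simp add: transition_def chart_point_def)

definition overlap :: "('m, 'n) chart \<Rightarrow> ('m, 'n) chart \<Rightarrow> (real ^ 'n) set" where
  "overlap c d = coord c ` (chart_dom c \<inter> chart_dom d)"

lemma open_overlap: "c \<in> A \<Longrightarrow> d \<in> A \<Longrightarrow> open (overlap c d)"
  unfolding overlap_def by (rule open_coord_image[OF _ openin_chart_dom])

lemma smooth_transition: "c \<in> A \<Longrightarrow> d \<in> A \<Longrightarrow> smooth_on (overlap c d) (transition c d)"
  using atlas by (auto simp: smooth_atlas_def overlap_def)

lemma transition_has_derivative:
  assumes "c \<in> A" "d \<in> A" "p \<in> chart_dom c \<inter> chart_dom d"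
  shows "(transition c d has_derivative jacobian c d p) (at (coord c p))"
  unfolding jacobian_def
  by (rule smooth_on_has_derivative[OF smooth_transition[OF assms(1,2)]])
    (use assms(3) in \<open>auto simp: overlap_def\<close>)

lemma linear_jacobian:
  "c \<in> A \<Longrightarrow> d \<in> A \<Longrightarrow> p \<in> chart_dom c \<inter> chart_dom d \<Longrightarrow> linear (jacobian c d p)"
  using transition_has_derivative has_derivative_linear by blast

text \<open>The two transition maps compose to the identity on the open overlap, and the chain rule
  differentiates this.\<close>

lemma jacobian_inverse:
  assumes "c \<in> A" "d \<in> A" "p \<in> chart_dom c \<inter> chart_dom d"
  shows "jacobian d c p (jacobian c d p v) = v"
proof -
  have x: "coord c p \<in> overlap c d" using assms(3) by (auto simp: overlap_def)
  have "(transition d c has_derivative jacobian d c p) (at (transition c d (coord c p)))"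
    using transition_has_derivative[of d c p] transition_coord[of c p d] assms by auto
  from has_derivative_compose[OF transition_has_derivative[OF assms] this]
  have "((\<lambda>x. transition d c (transition c d x)) has_derivative
      (\<lambda>v. jacobian d c p (jacobian c d p v))) (at (coord c p))" .
  moreover have "((\<lambda>x. transition d c (transition c d x)) has_derivative (\<lambda>v. v)) (at (coord c p))"
    by (rule has_derivative_transform_within_open[OF has_derivative_ident open_overlap[OF assms(1,2)] x])
      (use assms in \<open>auto simp: overlap_def transition_coord\<close>)
  ultimately show ?thesis using has_derivative_unique by metis
qed

lemma invertible_jacobian:
  assumes "c \<in> A" "d \<in> A" "p \<in> chart_dom c \<inter> chart_dom d"
  shows "invertible (matrix (jacobian c d p))"
proof -
  have "matrix (jacobian d c p) ** matrix (jacobian c d p) = mat 1"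
    using jacobian_inverse[OF assms] linear_jacobian assms
    by (auto simp: matrix_eq matrix_vector_mul_assoc[symmetric] matrix_mult_linear)
  then show ?thesis using invertible_left_inverse by blast
qed

text \<open>One continuous derivative instead of smoothness: multiplication by the cutoff functions
  used to localize the divergence leaves only that much regularity, and the traces below involve
  first derivatives only.\<close>

definition C1_field :: "('m, 'n) vecfield \<Rightarrow> bool" where
  "C1_field V \<longleftrightarrow> (\<forall>c\<in>A. Ck_on (Suc 0) (V c) (chart_image c)) \<and>
     (\<forall>c\<in>A. \<forall>d\<in>A. \<forall>p\<in>chart_dom c \<inter> chart_dom d.
        V d (coord d p) = jacobian c d p (V c (coord c p)))"

lemma vector_field_C1: "vector_field A V \<Longrightarrow> C1_field V"
  unfolding vector_field_def C1_field_def using smooth_on_imp_Ck by blast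

lemma C1_field_transform:
  "C1_field V \<Longrightarrow> c \<in> A \<Longrightarrow> d \<in> A \<Longrightarrow> p \<in> chart_dom c \<inter> chart_dom d \<Longrightarrow>
    V d (coord d p) = jacobian c d p (V c (coord c p))"
  unfolding C1_field_def by blast

lemma C1_field_has_derivative:
  "C1_field V \<Longrightarrow> c \<in> A \<Longrightarrow> x \<in> chart_image c \<Longrightarrow>
    (V c has_derivative frechet_derivative (V c) (at x)) (at x)"
  unfolding C1_field_def by (meson Ck_on_imp_has_derivative)

lemma semi_riemannian_metric_on:
  "semi_riemannian_metric A g \<Longrightarrow> c \<in> A \<Longrightarrow> metric_on (g c) (chart_image c)"
  unfolding semi_riemannian_metric_def covariant_2_tensor_def metric_on_def metric_form_def
  using open_chart_image by blast

lemma covariant_2_tensor_transform: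
  "covariant_2_tensor A T \<Longrightarrow> c \<in> A \<Longrightarrow> d \<in> A \<Longrightarrow> p \<in> chart_dom c \<inter> chart_dom d \<Longrightarrow>
    T c (coord c p) v w = T d (coord d p) (jacobian c d p v) (jacobian c d p w)"
  unfolding covariant_2_tensor_def by blast

lemma semi_riemannian_covariant: "semi_riemannian_metric A g \<Longrightarrow> covariant_2_tensor A g"
  by (simp add: semi_riemannian_metric_def)

lemma covariant_2_tensor_bilinear_on:
  "covariant_2_tensor A T \<Longrightarrow> c \<in> A \<Longrightarrow> bilinear_on (T c) (chart_image c)"
  unfolding covariant_2_tensor_def bilinear_on_def using open_chart_image by blast

text \<open>The second derivative \<open>H\<close> of the change of charts appears once in the
  derivative of the transformed field and once, with the opposite sign, in the transformation of the
  Christoffel symbols; the two cancel.\<close>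

theorem covariant_deriv_transform:
  assumes g: "semi_riemannian_metric A g" and V: "C1_field V"
    and c: "c \<in> A" and d: "d \<in> A" and p: "p \<in> chart_dom c \<inter> chart_dom d"
  shows "covariant_deriv (g d) (V d) (coord d p) (jacobian c d p a) =
    jacobian c d p (covariant_deriv (g c) (V c) (coord c p) a)"
proof -
  let ?\<tau> = "transition c d" and ?x = "coord c p" and ?U = "overlap c d"
  define J where "J y = frechet_derivative ?\<tau> (at y)" for y
  define H where "H a v = frechet_derivative (\<lambda>y. J y v) (at ?x) a" for a v
  have U: "open ?U" "?x \<in> ?U" using open_overlap[OF c d] p by (auto simp: overlap_def)
  have Jx: "J ?x = jacobian c d p" by (simp add: J_def jacobian_def)
  have \<tau>x: "?\<tau> ?x = coord d p" using transition_coord[OF c] p by auto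
  have xc: "?x \<in> chart_image c" and xd: "coord d p \<in> chart_image d"
    using p coord_in_image[of p c] coord_in_image[of p d] by blast+
  have pt: "\<exists>q. q \<in> chart_dom c \<inter> chart_dom d \<and> y = coord c q \<and> ?\<tau> y = coord d q \<and> J y = jacobian c d q"
    if "y \<in> ?U" for y
    using that transition_coord[OF c, of _ d] unfolding overlap_def J_def jacobian_def by blast
  note sm = smooth_transition[OF c d]
  have d\<tau>: "(?\<tau> has_derivative J ?x) (at ?x)"
    unfolding J_def by (rule smooth_on_has_derivative[OF sm U(2)])
  have dJ: "((\<lambda>y. J y v) has_derivative (\<lambda>a. H a v)) (at ?x)" for v
    unfolding J_def H_def by (rule smooth_on_has_derivative[OF smooth_on_frechet_derivative[OF sm] U(2)])
  have Hsym: "H a v = H v a" for a v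
    unfolding H_def J_def by (rule second_derivative_symmetric[OF smooth_on_imp_Ck[OF sm] U])
  have linJ: "linear (J y)" if "y \<in> ?U" for y
    using pt[OF that] linear_jacobian[OF c d] by metis
  note mc = semi_riemannian_metric_on[OF g c] and md = semi_riemannian_metric_on[OF g d]
  note sd = metric_formD(2)[OF metric_onD(2)[OF md xd]]
  have dg: "dform (g c) ?x a v w = dform (g d) (coord d p) (J ?x a) (J ?x v) (J ?x w) +
      g d (coord d p) (H a v) (J ?x w) + g d (coord d p) (J ?x v) (H a w)" for a v w
  proof -
    have "((\<lambda>y. g d (?\<tau> y) (J y v) (J y w)) has_derivative
      (\<lambda>a. dform (g d) (?\<tau> ?x) (J ?x a) (J ?x v) (J ?x w) + g d (?\<tau> ?x) (H a v) (J ?x w) +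
        g d (?\<tau> ?x) (J ?x v) (H a w))) (at ?x)"
      by (rule has_derivative_bilinear_on[OF metric_on_bilinear_on[OF md] _ d\<tau> dJ dJ]) (simp add: \<tau>x xd)
    moreover have "g d (?\<tau> y) (J y v) (J y w) = g c y v w" if "y \<in> ?U" for y
      using pt[OF that] covariant_2_tensor_transform[OF semi_riemannian_covariant[OF g] c d] by metis
    ultimately have "((\<lambda>y. g c y v w) has_derivative
      (\<lambda>a. dform (g d) (?\<tau> ?x) (J ?x a) (J ?x v) (J ?x w) + g d (?\<tau> ?x) (H a v) (J ?x w) +
        g d (?\<tau> ?x) (J ?x v) (H a w))) (at ?x)"
      by (rule has_derivative_transform_within_open[OF _ U])
    from fun_cong[OF frechet_derivative_eqI[OF this], of a] show ?thesis unfolding \<tau>x .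
  qed
  have dV: "frechet_derivative (V d) (at (coord d p)) (J ?x a) =
      H a (V c ?x) + J ?x (frechet_derivative (V c) (at ?x) a)" for a
  proof -
    note Vc = C1_field_has_derivative[OF V c xc] and Vd = C1_field_has_derivative[OF V d xd]
    have 1: "((\<lambda>y. J y (V c y)) has_derivative (\<lambda>a. H a (V c ?x) +
        J ?x (frechet_derivative (V c) (at ?x) a))) (at ?x)"
      using has_derivative_linear_family[OF U(1), of "\<lambda>y. y" ?x J, OF U(2) linJ differentiableI[OF dJ]
          has_derivative_ident Vc] frechet_derivative_eqI[OF dJ] by simp
    have e: "J y (V c y) = V d (?\<tau> y)" if "y \<in> ?U" for y
      using pt[OF that] C1_field_transform[OF V c d] by metis
    have "((\<lambda>y. V d (?\<tau> y)) has_derivative (\<lambda>a. H a (V c ?x) +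
        J ?x (frechet_derivative (V c) (at ?x) a))) (at ?x)"
      by (rule has_derivative_transform_within_open[OF 1 U e])
    moreover have "((\<lambda>y. V d (?\<tau> y)) has_derivative
        (\<lambda>a. frechet_derivative (V d) (at (coord d p)) (J ?x a))) (at ?x)"
      by (rule has_derivative_compose[OF d\<tau>]) (simp add: \<tau>x Vd)
    ultimately have "(\<lambda>a. H a (V c ?x) + J ?x (frechet_derivative (V c) (at ?x) a)) =
        (\<lambda>a. frechet_derivative (V d) (at (coord d p)) (J ?x a))"
      by (rule has_derivative_unique)
    from fun_cong[OF this, of a] show ?thesis by simp
  qed
  let ?gd = "g d (coord d p)"
  note b = metric_formD(1)[OF metric_onD(2)[OF md xd]]
  have \<Gamma>: "J ?x (christoffel (g c) ?x a v) = christoffel (g d) (coord d p) (J ?x a) (J ?x v) + H a v" for a v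
  proof (rule metric_form_cancel[OF metric_onD(2)[OF md xd]])
    fix z'
    \<comment> \<open>Every test vector has the form \<open>J z\<close>, because the Jacobian is
      invertible.\<close>
    define z where "z = jacobian d c p z'"
    have z: "z' = J ?x z" using jacobian_inverse[OF d c, of p z'] p by (simp add: Jx z_def)
    have "2 * ?gd (J ?x (christoffel (g c) ?x a v)) (J ?x z) = 2 * g c ?x (christoffel (g c) ?x a v) z"
      unfolding covariant_2_tensor_transform[OF semi_riemannian_covariant[OF g] c d p] Jx ..
    also have "\<dots> = dform (g c) ?x a v z + dform (g c) ?x v a z - dform (g c) ?x z a v"
      by (rule christoffel_koszul[OF mc xc])
    \<comment> \<open>Six terms contain \<open>H\<close>. By the symmetry of \<open>H\<close> and of
      the metric four of them cancel, and the other two both equal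
      \<open>g(H a v, J z)\<close>.\<close>
    also have "\<dots> = 2 * ?gd (christoffel (g d) (coord d p) (J ?x a) (J ?x v)) (J ?x z) + 2 * ?gd (H a v) (J ?x z)"
      unfolding christoffel_koszul[OF md xd] dg
      using sd[of "H z v" "J ?x a"] Hsym[of v a] Hsym[of z v] Hsym[of z a] by (simp add: sd)
    finally show "?gd (J ?x (christoffel (g c) ?x a v)) z' =
        ?gd (christoffel (g d) (coord d p) (J ?x a) (J ?x v) + H a v) z'"
      unfolding z bilinear_ladd[OF b] by simp
  qed
  have VJ: "V d (coord d p) = J ?x (V c ?x)" unfolding Jx by (rule C1_field_transform[OF V c d p])
  show ?thesis
    unfolding covariant_deriv_def linear_add[OF linear_jacobian[OF c d p]]
    unfolding Jx[symmetric] dV \<Gamma> VJ by simp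
qed

section \<open>Chart-independent traces\<close>

text \<open>This is \<open>tr\<^sub>g T(\<cdot>, \<nabla>V)\<close>. The first variation of the
  energy and the divergence of \<phi>\<open>B\<close> are both of this shape, for different
  \<open>T\<close>.\<close>

definition deriv_trace :: "('m, 'n) tensor02 \<Rightarrow> ('m, 'n) tensor02 \<Rightarrow> ('m, 'n) vecfield \<Rightarrow>
    ('m, 'n) chart \<Rightarrow> real ^ 'n \<Rightarrow> real" where
  "deriv_trace g T V c x = metric_trace (g c x) (\<lambda>a b. T c x a (covariant_deriv (g c) (V c) x b))"

text \<open>The tensor law without smoothness: a form built from the covariant derivative of a
  \<open>C1_field\<close> is in general only continuous.\<close>

definition pointwise_covariant :: "('m, 'n) tensor02 \<Rightarrow> bool" where
  "pointwise_covariant T \<longleftrightarrow> (\<forall>c\<in>A. \<forall>x\<in>chart_image c. bilinear (T c x)) \<and>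
     (\<forall>c\<in>A. \<forall>d\<in>A. \<forall>p\<in>chart_dom c \<inter> chart_dom d. \<forall>v w.
        T c (coord c p) v w = T d (coord d p) (jacobian c d p v) (jacobian c d p w))"

lemma pointwise_covariantD:
  assumes "pointwise_covariant T" "c \<in> A"
  shows "x \<in> chart_image c \<Longrightarrow> bilinear (T c x)"
    "d \<in> A \<Longrightarrow> p \<in> chart_dom c \<inter> chart_dom d \<Longrightarrow>
      T c (coord c p) v w = T d (coord d p) (jacobian c d p v) (jacobian c d p w)"
  using assms unfolding pointwise_covariant_def by blast+

lemma covariant_2_tensor_pointwise: "covariant_2_tensor A T \<Longrightarrow> pointwise_covariant T"
  unfolding covariant_2_tensor_def pointwise_covariant_def by blast

lemma metric_trace_transform:
  assumes g: "semi_riemannian_metric A g" and T: "pointwise_covariant T"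
    and c: "c \<in> A" and d: "d \<in> A" and p: "p \<in> chart_dom c \<inter> chart_dom d"
  shows "metric_trace (g c (coord c p)) (T c (coord c p)) = metric_trace (g d (coord d p)) (T d (coord d p))"
proof -
  have xd: "coord d p \<in> chart_image d" using p coord_in_image[of p d] by blast
  note md = metric_onD(2)[OF semi_riemannian_metric_on[OF g d] xd]
  have "g c (coord c p) = (\<lambda>v w. g d (coord d p) (jacobian c d p v) (jacobian c d p w))"
    by (intro ext covariant_2_tensor_transform[OF semi_riemannian_covariant[OF g] c d p])
  moreover have "T c (coord c p) = (\<lambda>v w. T d (coord d p) (jacobian c d p v) (jacobian c d p w))"
    by (intro ext pointwise_covariantD(2)[OF T c d p])
  moreover have "bilinear (T d (coord d p))" using pointwise_covariantD(1)[OF T d xd] .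
  ultimately show ?thesis
    using metric_trace_pullback[OF md _ linear_jacobian[OF c d p] invertible_jacobian[OF c d p]]
    by metis
qed

lemma C1_linear_covariant_deriv:
  assumes "semi_riemannian_metric A g" "C1_field V" "c \<in> A" "x \<in> chart_image c"
  shows "linear (covariant_deriv (g c) (V c) x)"
  by (rule linear_covariant_deriv[OF semi_riemannian_metric_on[OF assms(1,3)] assms(4)
    differentiableI[OF C1_field_has_derivative[OF assms(2-4)]]])

lemma pointwise_covariant_deriv:
  assumes g: "semi_riemannian_metric A g" and V: "C1_field V" and T: "pointwise_covariant T"
  shows "pointwise_covariant (\<lambda>c x a b. T c x a (covariant_deriv (g c) (V c) x b))"
  unfolding pointwise_covariant_def
proof (intro conjI ballI allI)
  fix c x assume c: "c \<in> A" "x \<in> chart_image c"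
  have b: "bilinear (T c x)" using pointwise_covariantD(1)[OF T c] .
  note l = C1_linear_covariant_deriv[OF g V c]
  show "bilinear (\<lambda>a b. T c x a (covariant_deriv (g c) (V c) x b))"
    unfolding bilinear_def
    by (intro conjI allI linearI)
      (simp_all add: bilinear_ladd[OF b] bilinear_lmul[OF b] bilinear_radd[OF b] bilinear_rmul[OF b]
        linear_add[OF l] linear_cmul[OF l])
next
  fix c d p v w assume a: "c \<in> A" "d \<in> A" "p \<in> chart_dom c \<inter> chart_dom d"
  show "T c (coord c p) v (covariant_deriv (g c) (V c) (coord c p) w) =
     T d (coord d p) (jacobian c d p v) (covariant_deriv (g d) (V d) (coord d p) (jacobian c d p w))"
    unfolding covariant_deriv_transform[OF g V a] by (rule pointwise_covariantD(2)[OF T a])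
qed

lemma pointwise_covariant_deriv2:
  assumes g: "semi_riemannian_metric A g" and V: "C1_field V" and T: "pointwise_covariant T"
  shows "pointwise_covariant (\<lambda>c x a b. T c x (covariant_deriv (g c) (V c) x a) b)"
proof -
  have "pointwise_covariant (\<lambda>c x a b. T c x b a)"
    using T unfolding pointwise_covariant_def bilinear_def by blast
  from pointwise_covariant_deriv[OF g V this]
  show ?thesis unfolding pointwise_covariant_def bilinear_def by blast
qed

lemma deriv_trace_transform:
  assumes "semi_riemannian_metric A g" "C1_field V" "pointwise_covariant T"
    "c \<in> A" "d \<in> A" "p \<in> chart_dom c \<inter> chart_dom d"
  shows "deriv_trace g T V c (coord c p) = deriv_trace g T V d (coord d p)"
  unfolding deriv_trace_def
  by (rule metric_trace_transform[OF assms(1) pointwise_covariant_deriv[OF assms(1-3)] assms(4-6)])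

text \<open>The differential of the section \<open>y \<mapsto> (y, V c y)\<close> has horizontal
  part \<open>a\<close> and vertical part the covariant derivative of \<open>V\<close> along
  \<open>a\<close>. Only the second summand depends on \<open>V\<close>.\<close>

lemma local_energy_density_eq:
  assumes "V c differentiable (at x)"
  shows "local_energy_density g V c x = metric_trace (g c x) (\<lambda>a b. g c x a b +
    g c x (covariant_deriv (g c) (V c) x a) (covariant_deriv (g c) (V c) x b)) / 2"
proof -
  have "(V c has_derivative frechet_derivative (V c) (at x)) (at x)"
    using assms frechet_derivative_works by blast
  then have "frechet_derivative (\<lambda>y. (y, V c y)) (at x) = (\<lambda>a. (a, frechet_derivative (V c) (at x) a))"
    by (intro frechet_derivative_eqI has_derivative_Pair has_derivative_ident)
  then show ?thesis
    by (simp add: local_energy_density_def sasaki_metric_def covariant_deriv_def metric_trace_def)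
qed

lemma local_energy_density_transform:
  assumes g: "semi_riemannian_metric A g" and V: "C1_field V"
    and cd: "c \<in> A" "d \<in> A" and p: "p \<in> chart_dom c \<inter> chart_dom d"
  shows "local_energy_density g V c (coord c p) = local_energy_density g V d (coord d p)"
proof -
  have d: "V c differentiable (at (coord c p))" "V d differentiable (at (coord d p))"
    using p differentiableI[OF C1_field_has_derivative[OF V cd(1) coord_in_image]]
      differentiableI[OF C1_field_has_derivative[OF V cd(2) coord_in_image]] by simp_all
  have g': "pointwise_covariant g"
    using covariant_2_tensor_pointwise[OF semi_riemannian_covariant[OF g]] .
  note 1 = pointwise_covariant_deriv2[OF g V pointwise_covariant_deriv[OF g V g']]
  show ?thesis
    unfolding local_energy_density_eq[where V = V, OF d(1)] local_energy_density_eq[where V = V, OF d(2)]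
      metric_trace_add
    using metric_trace_transform[OF g g' cd p] metric_trace_transform[OF g 1 cd p] by simp
qed

lemma energy_density_eq:
  assumes g: "semi_riemannian_metric A g" and V: "C1_field V" and c: "c \<in> A" "p \<in> chart_dom c"
  shows "energy_density A g V p = local_energy_density g V c (coord c p)"
proof -
  define d where "d = (SOME c. c \<in> A \<and> p \<in> chart_dom c)"
  have d: "d \<in> A \<and> p \<in> chart_dom d"
    unfolding d_def by (rule someI[of _ c]) (use c in auto)
  then show ?thesis
    using local_energy_density_transform[OF g V, of d c p] c by (auto simp: energy_density_def d_def[symmetric] Let_def)
qed

end

section \<open>Change of variables without an order on the index type\<close>

text \<open>The change of variables theorem of the library needs a well-ordered index type.\<close>

typedef (overloaded) 'n idx = "{..<CARD('n::finite)}"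
  using zero_less_card_finite by blast

instantiation idx :: (finite) linorder
begin

definition less_eq_idx :: "'a idx \<Rightarrow> 'a idx \<Rightarrow> bool" where "less_eq_idx i j \<longleftrightarrow> Rep_idx i \<le> Rep_idx j"
definition less_idx :: "'a idx \<Rightarrow> 'a idx \<Rightarrow> bool" where "less_idx i j \<longleftrightarrow> Rep_idx i < Rep_idx j"

instance
  by standard (auto simp: less_eq_idx_def less_idx_def Rep_idx_inject)

end

lemma bij_betw_Rep_idx: "bij_betw Rep_idx (UNIV :: 'n::finite idx set) {..<CARD('n)}"
  using type_definition.Rep_range[OF type_definition_idx] Rep_idx_inject
  by (auto simp: bij_betw_def inj_on_def)

instance idx :: (finite) finite
proof
  show "finite (UNIV :: 'a idx set)"
    using bij_betw_finite[OF bij_betw_Rep_idx] by simp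
qed

instance idx :: (finite) wellorder
proof
  fix P :: "'a idx \<Rightarrow> bool" and i
  assume step: "\<And>i. (\<And>j. j < i \<Longrightarrow> P j) \<Longrightarrow> P i"
  show "P i"
    by (induction i rule: measure_induct_rule[of Rep_idx]) (use step in \<open>auto simp: less_idx_def\<close>)
qed

definition enum_idx :: "'n::finite idx \<Rightarrow> 'n" where
  "enum_idx = (SOME e. bij e)"

lemma bij_enum_idx: "bij (enum_idx :: 'n::finite idx \<Rightarrow> 'n)"
proof -
  have "card (UNIV :: 'n idx set) = CARD('n)"
    using bij_betw_same_card[OF bij_betw_Rep_idx] by simp
  then have "\<exists>e :: 'n idx \<Rightarrow> 'n. bij e"
    using finite_same_card_bij[of "UNIV :: 'n idx set" "UNIV :: 'n set"] by auto
  then show ?thesis unfolding enum_idx_def by (rule someI_ex)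
qed

text \<open>Conjugation with \<open>e\<close> is a bijection between the permutations of the two
  index types that preserves signs and permutes the factors of each product.\<close>

lemma det_reindex:
  fixes M :: "real ^ 'n ^ 'n" and e :: "'k::finite \<Rightarrow> 'n"
  assumes "bij e"
  shows "det (\<chi> i j. M $ e i $ e j) = det M"
proof -
  have e: "inj e" "surj e" using assms by (auto simp: bij_def)
  let ?m = "map_permutation UNIV e" and ?m' = "map_permutation UNIV (inv e)"
  have m: "?m p = e \<circ> p \<circ> inv e" for p
    using e by (auto simp: map_permutation_def restrict_id_def fun_eq_iff)
  have m': "?m' q = inv e \<circ> q \<circ> e" for q
    using e inv_inv_eq[OF assms] by (auto simp: map_permutation_def restrict_id_def fun_eq_iff surj_imp_inj_inv
        inj_imp_surj_inv)
  have bij_inv: "bij (inv e)" using assms bij_imp_bij_inv by blast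
  have "(\<Sum>p | p permutes UNIV. of_int (sign p) * (\<Prod>i\<in>UNIV. (\<chi> i j. M $ e i $ e j) $ i $ p i)) =
      (\<Sum>q | q permutes UNIV. of_int (sign q) * (\<Prod>i\<in>UNIV. M $ i $ q i))"
  proof (rule sum.reindex_bij_witness[where i = ?m' and j = ?m])
    fix p :: "'k \<Rightarrow> 'k" assume p: "p \<in> {p. p permutes UNIV}"
    then have bp: "bij p" by (simp add: permutes_bij)
    show "?m' (?m p) = p" unfolding m m' using e by (auto simp: fun_eq_iff)
    show "?m p \<in> {q. q permutes UNIV}"
      unfolding m using bij_imp_permutes[OF bij_comp[OF bij_inv bij_comp[OF bp assms]]] by (simp add: o_assoc)
    have s: "sign (?m p) = sign p"
      by (rule sign_map_permutation) (use e p in auto)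
    have "(\<Prod>i\<in>UNIV. M $ i $ ?m p i) = (\<Prod>i\<in>UNIV. M $ e i $ ?m p (e i))"
      using prod.reindex_bij_betw[OF assms, of "\<lambda>i. M $ i $ ?m p i"] by simp
    then show "of_int (sign (?m p)) * (\<Prod>i\<in>UNIV. M $ i $ ?m p i) =
       of_int (sign p) * (\<Prod>i\<in>UNIV. (\<chi> i j. M $ e i $ e j) $ i $ p i)"
      using e(1) by (simp add: s[unfolded m] m)
  next
    fix q :: "'n \<Rightarrow> 'n" assume q: "q \<in> {q. q permutes UNIV}"
    then have bq: "bij q" by (simp add: permutes_bij)
    show "?m (?m' q) = q" unfolding m m' using e by (auto simp: fun_eq_iff surj_f_inv_f)
    show "?m' q \<in> {p. p permutes UNIV}"
      unfolding m' using bij_imp_permutes[OF bij_comp[OF assms bij_comp[OF bq bij_inv]]] by (simp add: o_assoc)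
  qed
  then show ?thesis by (simp add: det_def)
qed

definition reindex :: "real ^ 'n \<Rightarrow> real ^ ('n::finite idx)" where
  "reindex x = (\<chi> k. x $ enum_idx k)"

definition unreindex :: "real ^ ('n::finite idx) \<Rightarrow> real ^ 'n" where
  "unreindex y = (\<chi> i. y $ inv enum_idx i)"

lemma unreindex_reindex [simp]: "unreindex (reindex x) = (x :: real ^ 'n::finite)"
  using bij_is_surj[OF bij_enum_idx[where 'n = 'n]] by (simp add: reindex_def unreindex_def vec_eq_iff surj_f_inv_f)

lemma reindex_unreindex [simp]: "reindex (unreindex y) = (y :: real ^ 'n::finite idx)"
  using bij_is_inj[OF bij_enum_idx[where 'n = 'n]] by (simp add: reindex_def unreindex_def vec_eq_iff)

lemma linear_reindex: "linear reindex" and linear_unreindex: "linear unreindex"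
  by (auto intro!: linearI simp: reindex_def unreindex_def vec_eq_iff)

lemma det_reindex_conjugate:
  fixes f :: "real ^ 'n \<Rightarrow> real ^ 'n"
  shows "det (matrix (\<lambda>y. reindex (f (unreindex y)))) = det (matrix f)"
proof -
  have "unreindex (axis k 1) = axis (enum_idx k) 1" for k :: "'n idx"
  proof -
    have "inv enum_idx i = k \<longleftrightarrow> i = enum_idx k" for i :: 'n
      using bij_enum_idx by (metis bij_inv_eq_iff)
    then show ?thesis by (auto simp: unreindex_def axis_def vec_eq_iff)
  qed
  then have "matrix (\<lambda>y. reindex (f (unreindex y))) = (\<chi> i j. matrix f $ enum_idx i $ enum_idx j)"
    by (simp add: matrix_def reindex_def)
  then show ?thesis using det_reindex[OF bij_enum_idx] by metis
qed

lemma prod_Basis_vec_nth: "(\<Prod>b\<in>Basis. (v :: real ^ 'n) \<bullet> b) = (\<Prod>i\<in>UNIV. v $ i)"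
proof -
  have "bij_betw (\<lambda>i. axis i (1::real)) UNIV (Basis :: (real ^ 'n) set)"
    by (auto simp: bij_betw_def inj_on_def axis_eq_axis Basis_vec_def)
  from prod.reindex_bij_betw[OF this, of "\<lambda>b. v \<bullet> b"] show ?thesis by (simp add: inner_axis)
qed

text \<open>Lebesgue measure is determined by the volumes of boxes, and a renaming of the
  coordinates turns a box into one with the same side lengths.\<close>

lemma lborel_reindex: "lborel = distr lborel borel (reindex :: real ^ 'n \<Rightarrow> _)"
proof (rule lborel_eqI)
  have "continuous_on UNIV (reindex :: real ^ 'n \<Rightarrow> _)"
    using linear_continuous_on linear_conv_bounded_linear linear_reindex by blast
  then have meas: "(reindex :: real ^ 'n \<Rightarrow> _) \<in> borel_measurable borel"
    by (rule borel_measurable_continuous_onI)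
  fix l u :: "real ^ ('n idx)"
  assume le: "\<And>b. b \<in> Basis \<Longrightarrow> l \<bullet> b \<le> u \<bullet> b"
  then have le': "l $ k \<le> u $ k" for k
    using le[of "axis k 1"] by (auto simp: inner_axis Basis_vec_def)
  have "x \<in> reindex -` box l u \<longleftrightarrow> x \<in> box (unreindex l) (unreindex u)" for x :: "real ^ 'n"
  proof -
    have "x \<in> box (unreindex l) (unreindex u) \<longleftrightarrow> (\<forall>i. l $ inv enum_idx i < x $ i \<and> x $ i < u $ inv enum_idx i)"
      by (simp add: mem_box_cart unreindex_def)
    also have "\<dots> \<longleftrightarrow> (\<forall>k. l $ k < x $ enum_idx k \<and> x $ enum_idx k < u $ k)"
      using bij_enum_idx[where 'n = 'n] by (metis bij_inv_eq_iff)
    finally show ?thesis by (simp add: mem_box_cart reindex_def)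
  qed
  then have "reindex -` box l u = box (unreindex l) (unreindex u :: real ^ 'n)" by blast
  then have "emeasure (distr lborel borel (reindex :: real ^ 'n \<Rightarrow> _)) (box l u) =
     emeasure lborel (box (unreindex l) (unreindex u :: real ^ 'n))"
    using meas by (simp add: emeasure_distr)
  also have "\<dots> = (\<Prod>b\<in>Basis. (unreindex u - unreindex l :: real ^ 'n) \<bullet> b)"
    by (rule emeasure_lborel_box) (auto simp: Basis_vec_def inner_axis unreindex_def le')
  also have "(\<Prod>b\<in>Basis. (unreindex u - unreindex l :: real ^ 'n) \<bullet> b) =
     (\<Prod>i\<in>UNIV. (unreindex u - unreindex l :: real ^ 'n) $ i)"
    by (simp add: prod_Basis_vec_nth)
  also have "\<dots> = (\<Prod>i\<in>UNIV. (u - l) $ inv enum_idx (i :: 'n))"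
    by (simp add: unreindex_def)
  also have "\<dots> = (\<Prod>k\<in>UNIV. (u - l) $ k)"
    by (rule prod.reindex_bij_betw) (use bij_enum_idx bij_imp_bij_inv in blast)
  also have "\<dots> = (\<Prod>b\<in>Basis. (u - l) \<bullet> b)"
    by (simp add: prod_Basis_vec_nth)
  finally show "emeasure (distr lborel borel (reindex :: real ^ 'n \<Rightarrow> _)) (box l u) = (\<Prod>b\<in>Basis. (u - l) \<bullet> b)" .
qed simp

lemma nn_integral_reindex:
  fixes f :: "real ^ 'n \<Rightarrow> ennreal"
  assumes "f \<in> borel_measurable borel"
  shows "(\<integral>\<^sup>+x. f x \<partial>lborel) = (\<integral>\<^sup>+y. f (unreindex y) \<partial>lborel)"
proof -
  have "continuous_on UNIV (reindex :: real ^ 'n \<Rightarrow> _)" "continuous_on UNIV (unreindex :: _ \<Rightarrow> real ^ 'n)"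
    using linear_continuous_on linear_conv_bounded_linear linear_reindex linear_unreindex by blast+
  then have meas: "(reindex :: real ^ 'n \<Rightarrow> _) \<in> borel_measurable borel"
    "(unreindex :: _ \<Rightarrow> real ^ 'n) \<in> borel_measurable borel"
    by (auto intro: borel_measurable_continuous_onI)
  have "(\<integral>\<^sup>+y. f (unreindex y) \<partial>lborel) =
      (\<integral>\<^sup>+y. f (unreindex y) \<partial>distr lborel borel (reindex :: real ^ 'n \<Rightarrow> _))"
    by (subst lborel_reindex) (rule refl)
  also have "\<dots> = (\<integral>\<^sup>+x. f (unreindex (reindex x)) \<partial>lborel)"
    using meas assms by (intro nn_integral_distr) (auto intro: measurable_compose)
  finally show ?thesis by simp
qed

text \<open>The formula for absolutely integrable functions concerns finite integrals and vector
  values, hence the detour through \<open>real ^ 1\<close>. If one side is finite, its value is a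
  gauge integral that the formula carries to the other side; if neither is, both are
  infinite.\<close>

lemma nn_integral_change_of_variables_wellorder:
  fixes f :: "real ^ 'm::{finite,wellorder} \<Rightarrow> real" and \<tau> :: "real ^ 'm::{finite,wellorder} \<Rightarrow> real ^ 'm::_"
  assumes S: "S \<in> sets borel" "\<tau> ` S \<in> sets borel"
    and der: "\<And>x. x \<in> S \<Longrightarrow> (\<tau> has_derivative J x) (at x within S)"
    and inj: "inj_on \<tau> S"
    and f: "(\<lambda>y. indicator (\<tau> ` S) y * f y) \<in> borel_measurable borel" "\<And>y. y \<in> \<tau> ` S \<Longrightarrow> 0 \<le> f y"
    and F: "(\<lambda>x. indicator S x * (\<bar>det (matrix (J x))\<bar> * f (\<tau> x))) \<in> borel_measurable borel"
  shows "(\<integral>\<^sup>+y. ennreal (indicator (\<tau> ` S) y * f y) \<partial>lborel) =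
    (\<integral>\<^sup>+x. ennreal (indicator S x * (\<bar>det (matrix (J x))\<bar> * f (\<tau> x))) \<partial>lborel)"
    (is "(\<integral>\<^sup>+y. ennreal (?f y) \<partial>lborel) = (\<integral>\<^sup>+x. ennreal (?F x) \<partial>lborel)")
proof -
  have nn: "\<And>y. 0 \<le> ?f y" "\<And>x. 0 \<le> ?F x" using f(2) by (auto simp: indicator_def)
  have iff: "(?f has_integral r) UNIV \<longleftrightarrow> (?F has_integral r) UNIV" for r
  proof -
    \<comment> \<open>For nonnegative functions integrability and absolute integrability coincide;
      this links the gauge integral over the whole space to the hypotheses of the formula.\<close>
    have res: "((\<lambda>x. indicator T x * h x) has_integral r) UNIV \<longleftrightarrow>
        h absolutely_integrable_on T \<and> integral T h = r"
      if "\<And>x. x \<in> T \<Longrightarrow> 0 \<le> h x" for h :: "(real, 'm) vec \<Rightarrow> real" and T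
    proof -
      have "(\<lambda>x. indicator T x * h x) = (\<lambda>x. if x \<in> T then h x else 0)" by auto
      then have "((\<lambda>x. indicator T x * h x) has_integral r) UNIV \<longleftrightarrow> (h has_integral r) T"
        by (simp add: has_integral_restrict_UNIV)
      also have "\<dots> \<longleftrightarrow> h integrable_on T \<and> integral T h = r" by (simp add: has_integral_iff)
      also have "h integrable_on T \<longleftrightarrow> h absolutely_integrable_on T"
        using nonnegative_absolutely_integrable_1[of h T] that
          set_lebesgue_integral_eq_integral(1) by blast
      finally show ?thesis .
    qed
    have "((\<lambda>x. \<bar>det (matrix (J x))\<bar> *\<^sub>R (vec (f (\<tau> x)) :: real ^ 1)) absolutely_integrable_on S \<and>
        integral S (\<lambda>x. \<bar>det (matrix (J x))\<bar> *\<^sub>R (vec (f (\<tau> x)) :: real ^ 1)) = vec r) \<longleftrightarrow>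
      ((\<lambda>y. vec (f y) :: real ^ 1) absolutely_integrable_on \<tau> ` S \<and>
        integral (\<tau> ` S) (\<lambda>y. vec (f y) :: real ^ 1) = vec r)"
      by (rule has_absolute_integral_change_of_variables[OF _ der inj]) (use S in auto)
    then have "((\<lambda>x. \<bar>det (matrix (J x))\<bar> * f (\<tau> x)) absolutely_integrable_on S \<and>
        integral S (\<lambda>x. \<bar>det (matrix (J x))\<bar> * f (\<tau> x)) = r) \<longleftrightarrow>
      (f absolutely_integrable_on \<tau> ` S \<and> integral (\<tau> ` S) f = r)"
      by (simp add: absolutely_integrable_on_1_iff integral_on_1_eq)
    then show ?thesis
      using res[of "\<tau> ` S" f] res[of S "\<lambda>x. \<bar>det (matrix (J x))\<bar> * f (\<tau> x)"] f(2) by simp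
  qed
  have eq: "(\<integral>\<^sup>+y. ennreal (h y) \<partial>lborel) = ennreal r \<longleftrightarrow> (h has_integral r) UNIV"
    if "h \<in> borel_measurable borel" "\<And>y. 0 \<le> h y" "0 \<le> r" for h :: "(real, 'm) vec \<Rightarrow> real" and r
    using nn_integral_has_integral[OF that(1,2) _ that(3)] nn_integral_has_integral_lborel[OF that(1,2)]
    by blast
  show ?thesis
  proof (cases "(\<integral>\<^sup>+y. ennreal (?f y) \<partial>lborel) = \<infinity> \<and> (\<integral>\<^sup>+x. ennreal (?F x) \<partial>lborel) = \<infinity>")
    case True
    then show ?thesis by simp
  next
    case False
    have fin: "\<exists>r\<ge>0. z = ennreal r" if "z \<noteq> \<infinity>" for z
      using that by (cases z rule: ennreal_cases) auto
    obtain r where r: "0 \<le> r" "(\<integral>\<^sup>+y. ennreal (?f y) \<partial>lborel) = ennreal r \<or> (\<integral>\<^sup>+x. ennreal (?F x) \<partial>lborel) = ennreal r"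
      using False fin[of "\<integral>\<^sup>+y. ennreal (?f y) \<partial>lborel"] fin[of "\<integral>\<^sup>+x. ennreal (?F x) \<partial>lborel"] by blast
    then show ?thesis
      using eq[OF f(1) nn(1) r(1)] eq[OF F nn(2) r(1)] iff[of r] r(2) by argo
  qed
qed

text \<open>The measure-preserving linear map \<open>reindex\<close> conjugates \<tau> to a map over
  the well-ordered type, with the same Jacobian determinants.\<close>

lemma nn_integral_change_of_variables:
  fixes f :: "real ^ 'n \<Rightarrow> real" and \<tau> :: "real ^ 'n \<Rightarrow> real ^ 'n"
  assumes S: "S \<in> sets borel" "\<tau> ` S \<in> sets borel"
    and der: "\<And>x. x \<in> S \<Longrightarrow> (\<tau> has_derivative J x) (at x within S)"
    and inj: "inj_on \<tau> S"
    and f: "(\<lambda>y. indicator (\<tau> ` S) y * f y) \<in> borel_measurable borel" "\<And>y. y \<in> \<tau> ` S \<Longrightarrow> 0 \<le> f y"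
    and F: "(\<lambda>x. indicator S x * (\<bar>det (matrix (J x))\<bar> * f (\<tau> x))) \<in> borel_measurable borel"
  shows "(\<integral>\<^sup>+y. ennreal (indicator (\<tau> ` S) y * f y) \<partial>lborel) =
    (\<integral>\<^sup>+x. ennreal (indicator S x * (\<bar>det (matrix (J x))\<bar> * f (\<tau> x))) \<partial>lborel)"
proof -
  define S' where "S' = reindex ` S"
  define \<tau>' where "\<tau>' y = reindex (\<tau> (unreindex y))" for y
  define J' where "J' y v = reindex (J (unreindex y) (unreindex v))" for y v
  have "continuous_on UNIV (unreindex :: _ \<Rightarrow> real ^ 'n)"
    using linear_continuous_on linear_conv_bounded_linear linear_unreindex by blast
  then have meas: "(unreindex :: _ \<Rightarrow> real ^ 'n) \<in> borel_measurable borel"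
    by (auto intro: borel_measurable_continuous_onI)
  have im: "reindex ` T = unreindex -` T" for T :: "(real ^ 'n) set"
    using image_iff by fastforce
  have im_borel: "reindex ` T \<in> sets borel" if "T \<in> sets borel" for T :: "(real ^ 'n) set"
    unfolding im using measurable_sets[OF meas that] by simp
  have \<tau>S: "\<tau>' ` S' = reindex ` \<tau> ` S" by (simp add: \<tau>'_def S'_def image_image)
  have ind: "indicator S' y = (indicator S (unreindex y) :: real)"
    "indicator (\<tau>' ` S') y = (indicator (\<tau> ` S) (unreindex y) :: real)" for y
    unfolding \<tau>S unfolding S'_def im by (simp_all add: indicator_def)
  have det: "det (matrix (J' y)) = det (matrix (J (unreindex y)))" for y
    unfolding J'_def by (rule det_reindex_conjugate)
  have "(\<integral>\<^sup>+y. ennreal (indicator (\<tau> ` S) y * f y) \<partial>lborel) =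
     (\<integral>\<^sup>+y. ennreal (indicator (\<tau>' ` S') y * f (unreindex y)) \<partial>lborel)"
    using f(1) by (subst nn_integral_reindex) (simp_all add: ind)
  also have "\<dots> = (\<integral>\<^sup>+y. ennreal (indicator S' y * (\<bar>det (matrix (J' y))\<bar> * f (unreindex (\<tau>' y)))) \<partial>lborel)"
  proof (rule nn_integral_change_of_variables_wellorder)
    show "S' \<in> sets borel" "\<tau>' ` S' \<in> sets borel"
      unfolding \<tau>S unfolding S'_def by (intro im_borel S)+
    show "inj_on \<tau>' S'"
      using inj by (auto simp: inj_on_def S'_def \<tau>'_def) (metis unreindex_reindex)
    show "(\<tau>' has_derivative J' y) (at y within S')" if "y \<in> S'" for y
    proof -
      have 1: "(unreindex has_derivative unreindex) (at y within S')"
        using linear_imp_has_derivative[OF linear_unreindex] .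
      have "unreindex ` S' = S" by (auto simp: S'_def image_image)
      moreover have "unreindex y \<in> S" using that by (auto simp: S'_def)
      ultimately have "(\<tau> has_derivative J (unreindex y)) (at (unreindex y) within unreindex ` S')"
        using der by simp
      from has_derivative_in_compose[OF 1 this]
      have "((\<lambda>y. \<tau> (unreindex y)) has_derivative (\<lambda>v. J (unreindex y) (unreindex v))) (at y within S')" .
      from bounded_linear.has_derivative[OF _ this, of reindex] show ?thesis
        unfolding \<tau>'_def[abs_def] J'_def[abs_def] using linear_reindex linear_conv_bounded_linear by blast
    qed
    show "(\<lambda>y. indicator (\<tau>' ` S') y * f (unreindex y)) \<in> borel_measurable borel"
      unfolding ind by (rule measurable_compose[OF meas f(1)])
    show "0 \<le> f (unreindex y)" if "y \<in> \<tau>' ` S'" for y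
      using that f(2) unfolding \<tau>S by auto
    show "(\<lambda>y. indicator S' y * (\<bar>det (matrix (J' y))\<bar> * f (unreindex (\<tau>' y)))) \<in> borel_measurable borel"
      unfolding ind det \<tau>'_def using measurable_compose[OF meas F] by simp
  qed
  also have "\<dots> = (\<integral>\<^sup>+x. ennreal (indicator S x * (\<bar>det (matrix (J x))\<bar> * f (\<tau> x))) \<partial>lborel)"
    using F by (subst nn_integral_reindex) (simp_all add: ind det \<tau>'_def)
  finally show ?thesis .
qed

section \<open>The volume measure\<close>

definition volume_density :: "('m, 'n::finite) tensor02 \<Rightarrow> ('m, 'n) chart \<Rightarrow> real ^ 'n \<Rightarrow> real" where
  "volume_density g c x = sqrt \<bar>det (gram_matrix (g c x))\<bar>"

abbreviation borel_of_top :: "'m topology \<Rightarrow> 'm measure" where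
  "borel_of_top X \<equiv> sigma (topspace X) {U. openin X U}"

lemma opens_subset_Pow: "{U. openin X U} \<subseteq> Pow (topspace X)"
  by (auto dest: openin_subset)

lemma space_borel_of_top [simp]: "space (borel_of_top X) = topspace X"
  by (simp add: space_measure_of opens_subset_Pow)

lemma sets_borel_of_top: "sets (borel_of_top X) = sigma_sets (topspace X) {U. openin X U}"
  by (simp add: sets_measure_of opens_subset_Pow)

lemma openin_borel_of_top: "openin X U \<Longrightarrow> U \<in> sets (borel_of_top X)"
  by (simp add: sets_borel_of_top sigma_sets.Basic)

text \<open>Second countability provides countably many charts for the construction of the measure;
  the Hausdorff property makes compact sets closed, hence measurable, with open complements.\<close>

locale smooth_manifold = smooth_charts X A for X :: "'m topology" and A :: "('m, 'n::finite) chart set" +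
  assumes Hausdorff: "Hausdorff_space X" and second_countable: "second_countable X"
begin

lemma chart_dom_borel: "c \<in> A \<Longrightarrow> chart_dom c \<in> sets (borel_of_top X)"
  by (rule openin_borel_of_top[OF openin_chart_dom])

lemma chart_point_measurable:
  assumes c: "c \<in> A"
  shows "chart_point c \<in> measurable (restrict_space borel (chart_image c)) (borel_of_top X)"
proof (rule measurable_measure_of[OF opens_subset_Pow])
  have sp: "space (restrict_space borel (chart_image c)) = chart_image c"
    by (simp add: space_restrict_space)
  show "chart_point c \<in> space (restrict_space borel (chart_image c)) \<rightarrow> topspace X"
    unfolding sp using chart_point_in[of _ c] chart_dom_subset[OF c] by blast
  fix U assume "U \<in> {U. openin X U}"
  then have U: "openin X U" by simp
  have "chart_point c -` U \<inter> chart_image c = coord c ` (chart_dom c \<inter> U)"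
    using chart_point_in[of _ c] coord_chart_point[of _ c] chart_point_coord[OF c] coord_in_image[of _ c]
    by (auto intro!: image_eqI[of _ "coord c"])
  then show "chart_point c -` U \<inter> space (restrict_space borel (chart_image c)) \<in>
      sets (restrict_space borel (chart_image c))"
    unfolding sp using open_coord_image[OF c U] open_chart_image[OF c]
    by (auto simp: sets_restrict_space_iff)
qed

text \<open>The image under a chart is the preimage under its continuous inverse
  \<open>chart_point\<close>.\<close>

lemma coord_image_borel:
  assumes c: "c \<in> A" and B: "B \<in> sets (borel_of_top X)" "B \<subseteq> chart_dom c"
  shows "coord c ` B \<in> sets borel"
proof -
  have "coord c ` B = chart_point c -` B \<inter> space (restrict_space borel (chart_image c))"
    using B(2) chart_point_in[of _ c] coord_chart_point[of _ c] chart_point_coord[OF c] coord_in_image[of _ c]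
    by (auto simp: space_restrict_space intro!: image_eqI[of _ "coord c"])
  also have "\<dots> \<in> sets (restrict_space borel (chart_image c))"
    using measurable_sets[OF chart_point_measurable[OF c] B(1)] .
  finally show ?thesis
    using open_chart_image[OF c] by (auto simp: sets_restrict_space_iff)
qed

lemma coord_measurable:
  assumes c: "c \<in> A" and S: "S \<in> sets borel"
  shows "{p \<in> chart_dom c. coord c p \<in> S} \<in> sets (borel_of_top X)"
proof -
  have "coord c \<in> measurable (restrict_space (borel_of_top X) (chart_dom c)) borel"
  proof (rule borel_measurableI)
    fix T :: "(real ^ 'n) set" assume "open T"
    then have "{p \<in> chart_dom c. coord c p \<in> T} \<in> sets (borel_of_top X)"
      using openin_borel_of_top[OF openin_coord_preimage[OF c]] by blast
    moreover have "coord c -` T \<inter> space (restrict_space (borel_of_top X) (chart_dom c)) =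
        {p \<in> chart_dom c. coord c p \<in> T}"
      using chart_dom_subset[OF c] by (auto simp: space_restrict_space)
    ultimately show "coord c -` T \<inter> space (restrict_space (borel_of_top X) (chart_dom c)) \<in>
        sets (restrict_space (borel_of_top X) (chart_dom c))"
      using chart_dom_borel[OF c] chart_dom_subset[OF c]
      by (auto simp: sets_restrict_space_iff Int_absorb2)
  qed
  from measurable_sets[OF this S]
  have "coord c -` S \<inter> chart_dom c \<in> sets (borel_of_top X)"
    using chart_dom_borel[OF c] chart_dom_subset[OF c]
    by (auto simp: sets_restrict_space_iff space_restrict_space Int_absorb2)
  moreover have "coord c -` S \<inter> chart_dom c = {p \<in> chart_dom c. coord c p \<in> S}" by auto
  ultimately show ?thesis by simp
qed

lemma continuous_on_volume_density:
  assumes "covariant_2_tensor A g" "c \<in> A"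
  shows "continuous_on (chart_image c) (volume_density g c)"
proof -
  have "continuous_on (chart_image c) (\<lambda>x. g c x v w)" for v w
    using smooth_on_imp_Ck[of "chart_image c" "\<lambda>x. g c x v w" 0] assms
      covariant_2_tensor_bilinear_on[OF assms] by (auto simp: bilinear_on_def)
  then show ?thesis
    unfolding volume_density_def[abs_def]
    by (intro continuous_on_real_sqrt continuous_on_rabs continuous_on_det) (simp add: gram_matrix_def)
qed

text \<open>The Gram determinant picks up the square of the Jacobian determinant, so its square root
  picks up the absolute value: exactly the factor of the change of variables formula.\<close>

lemma volume_density_transform:
  assumes g: "covariant_2_tensor A g" and c: "c \<in> A" "d \<in> A" and p: "p \<in> chart_dom c \<inter> chart_dom d"
  shows "volume_density g c (coord c p) =
    \<bar>det (matrix (jacobian c d p))\<bar> * volume_density g d (coord d p)"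
proof -
  have "bilinear (g d (coord d p))"
    using covariant_2_tensor_bilinear_on[OF g c(2)] p coord_in_image[of p d] by (auto simp: bilinear_on_def)
  moreover have "g c (coord c p) = (\<lambda>v w. g d (coord d p) (jacobian c d p v) (jacobian c d p w))"
    by (intro ext covariant_2_tensor_transform[OF g c p])
  ultimately have "det (gram_matrix (g c (coord c p))) =
      det (matrix (jacobian c d p)) * det (matrix (jacobian c d p)) * det (gram_matrix (g d (coord d p)))"
    by (simp add: gram_matrix_pullback linear_jacobian[OF c p] det_mul)
  then show ?thesis by (simp add: volume_density_def abs_mult real_sqrt_mult)
qed

definition chart_volume :: "('m, 'n) tensor02 \<Rightarrow> ('m, 'n) chart \<Rightarrow> 'm set \<Rightarrow> ennreal" where
  "chart_volume g c B = (\<integral>\<^sup>+x\<in>coord c ` B. ennreal (volume_density g c x) \<partial>lborel)"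

text \<open>Change of variables along the transition map; its Jacobian factor is absorbed by the
  transformation of the density.\<close>

lemma chart_volume_independent:
  assumes g: "covariant_2_tensor A g" and c: "c \<in> A" "d \<in> A"
    and B: "B \<in> sets (borel_of_top X)" "B \<subseteq> chart_dom c" "B \<subseteq> chart_dom d"
  shows "chart_volume g c B = chart_volume g d B"
proof -
  let ?S = "coord c ` B" and ?\<tau> = "transition c d"
  have \<tau>S: "?\<tau> ` ?S = coord d ` B"
    using transition_coord[OF c(1), of _ d] B(2) by (force simp: image_image)
  have meas: "(\<lambda>x. indicator (coord c ` B) x * volume_density g c x) \<in> borel_measurable borel"
    if "c \<in> A" "B \<subseteq> chart_dom c" for c
  proof -
    have "continuous_on (coord c ` B) (volume_density g c)"
      by (rule continuous_on_subset[OF continuous_on_volume_density[OF g that(1)]])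
        (use that(2) in \<open>auto simp: chart_image_def\<close>)
    from borel_measurable_continuous_on_indicator[OF coord_image_borel[OF that(1) B(1) that(2)] this]
    show ?thesis by simp
  qed
  have J: "frechet_derivative ?\<tau> (at (coord c p)) = jacobian c d p" for p by (simp add: jacobian_def)
  have F: "indicator ?S x * (\<bar>det (matrix (frechet_derivative ?\<tau> (at x)))\<bar> * volume_density g d (?\<tau> x)) =
      indicator ?S x * volume_density g c x" for x
  proof (cases "x \<in> ?S")
    case True
    then obtain p where p: "p \<in> B" "x = coord c p" by blast
    then have "p \<in> chart_dom c \<inter> chart_dom d" using B by auto
    then show ?thesis
      using volume_density_transform[OF g c] transition_coord[OF c(1)] by (simp add: p(2) J)
  qed simp
  have "(\<integral>\<^sup>+y. ennreal (indicator (?\<tau> ` ?S) y * volume_density g d y) \<partial>lborel) =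
    (\<integral>\<^sup>+x. ennreal (indicator ?S x * (\<bar>det (matrix (frechet_derivative ?\<tau> (at x)))\<bar> *
      volume_density g d (?\<tau> x))) \<partial>lborel)"
  proof (rule nn_integral_change_of_variables)
    show "?S \<in> sets borel" "?\<tau> ` ?S \<in> sets borel"
      unfolding \<tau>S by (rule coord_image_borel, use c B in auto)+
    show "(?\<tau> has_derivative frechet_derivative ?\<tau> (at x)) (at x within ?S)" if x: "x \<in> ?S" for x
    proof -
      obtain p where p: "p \<in> B" "x = coord c p" using x by blast
      then have "p \<in> chart_dom c \<inter> chart_dom d" using B by auto
      from transition_has_derivative[OF c this] show ?thesis
        unfolding p(2) J by (rule has_derivative_at_withinI)
    qed
    show "inj_on ?\<tau> ?S"
    proof (rule inj_onI)
      fix x y assume "x \<in> ?S" "y \<in> ?S" and eq: "?\<tau> x = ?\<tau> y"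
      then obtain p q where pq: "p \<in> B" "q \<in> B" "x = coord c p" "y = coord c q" by blast
      then have "p \<in> chart_dom c" "q \<in> chart_dom c" using B(2) by auto
      then have "coord d p = coord d q"
        using eq pq(3,4) transition_coord[OF c(1), of p d] transition_coord[OF c(1), of q d] by simp
      moreover have "p \<in> chart_dom d" "q \<in> chart_dom d" using pq(1,2) B(3) by auto
      ultimately have "p = q" using inj_onD[OF inj_on_coord[OF c(2)]] by blast
      then show "x = y" using pq by simp
    qed
    show "(\<lambda>y. indicator (?\<tau> ` ?S) y * volume_density g d y) \<in> borel_measurable borel"
      unfolding \<tau>S by (rule meas[OF c(2) B(3)])
    show "(\<lambda>x. indicator ?S x * (\<bar>det (matrix (frechet_derivative ?\<tau> (at x)))\<bar> *
       volume_density g d (?\<tau> x))) \<in> borel_measurable borel"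
      unfolding F by (rule meas[OF c(1) B(2)])
  qed (simp add: volume_density_def)
  moreover have "ennreal (indicator T x * r) = ennreal r * indicator T x" for T :: "(real ^ 'n) set" and x r
    by (cases "x \<in> T") simp_all
  ultimately show ?thesis
    unfolding F \<tau>S chart_volume_def by (simp only:)
qed

lemma chart_volume_countably_additive:
  assumes g: "covariant_2_tensor A g" and c: "c \<in> A"
    and B: "range B \<subseteq> sets (borel_of_top X)" "\<And>k. B k \<subseteq> chart_dom c" "disjoint_family B"
  shows "chart_volume g c (\<Union>k. B k) = (\<Sum>k. chart_volume g c (B k))"
proof -
  have meas: "(\<lambda>x. ennreal (volume_density g c x) * indicator (coord c ` B k) x) \<in> borel_measurable lborel" for k
  proof -
    have "continuous_on (coord c ` B k) (volume_density g c)"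
      by (rule continuous_on_subset[OF continuous_on_volume_density[OF g c]])
        (unfold chart_image_def, rule image_mono[OF B(2)])
    moreover have "B k \<in> sets (borel_of_top X)" using B(1) by blast
    ultimately have "(\<lambda>x. indicator (coord c ` B k) x *\<^sub>R volume_density g c x) \<in> borel_measurable borel"
      by (intro borel_measurable_continuous_on_indicator coord_image_borel[OF c _ B(2)])
    from measurable_compose[OF this measurable_ennreal]
    have "(\<lambda>x. ennreal (indicator (coord c ` B k) x *\<^sub>R volume_density g c x)) \<in> borel_measurable borel" .
    moreover have "ennreal (indicator T x *\<^sub>R r) = ennreal r * indicator T x" for T :: "(real ^ 'n) set" and x r
      by (cases "x \<in> T") simp_all
    ultimately show ?thesis by simp
  qed
  have disj: "disjoint_family (\<lambda>k. coord c ` B k)"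
    unfolding disjoint_family_on_def
  proof (intro ballI impI)
    fix i j :: nat assume "i \<noteq> j"
    then have "B i \<inter> B j = {}" using B(3) by (auto simp: disjoint_family_on_def)
    then show "coord c ` B i \<inter> coord c ` B j = {}"
      using inj_onD[OF inj_on_coord[OF c]] B(2) by blast
  qed
  have ind: "indicator (coord c ` (\<Union>k. B k)) x = (\<Sum>k. indicator (coord c ` B k) x :: ennreal)" for x
    using suminf_indicator[OF disj, of x] by (simp add: image_UN)
  show ?thesis
    unfolding chart_volume_def ind ennreal_suminf_cmult[symmetric] by (rule nn_integral_suminf[OF meas])
qed

lemma chart_volume_empty [simp]: "chart_volume g c {} = 0"
  by (simp add: chart_volume_def)

text \<open>A second countable space is Lindelof, so countably many chart domains cover it.
  Subtracting the earlier ones makes them disjoint and keeps each piece Borel and inside a single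
  chart.\<close>

lemma countable_chart_partition:
  assumes "A \<noteq> {}"
  shows "\<exists>(c :: nat \<Rightarrow> ('m, 'n) chart) E. (\<forall>i. c i \<in> A \<and> E i \<in> sets (borel_of_top X) \<and> E i \<subseteq> chart_dom (c i)) \<and>
    disjoint_family E \<and> (\<Union>i. E i) = topspace X"
proof -
  have "Lindelof_space X" using second_countable second_countable_imp_Lindelof_space by blast
  then have "\<exists>\<V>. countable \<V> \<and> \<V> \<subseteq> chart_dom ` A \<and> \<Union>\<V> = topspace X"
  proof (rule Lindelof_spaceD)
    show "openin X U" if "U \<in> chart_dom ` A" for U using that openin_chart_dom by blast
    show "\<Union> (chart_dom ` A) = topspace X" by (rule Union_chart_dom)
  qed
  then obtain \<V> where V: "countable \<V> \<and> \<V> \<subseteq> chart_dom ` A \<and> \<Union>\<V> = topspace X" ..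
  then have "\<exists>C. countable C \<and> C \<subseteq> A \<and> \<V> = chart_dom ` C"
    using countable_subset_image[of \<V> chart_dom A] by simp
  then obtain C where C: "countable C" "C \<subseteq> A" "\<V> = chart_dom ` C"
    by (elim exE conjE)
  obtain c0 where c0: "c0 \<in> A" using assms by blast
  \<comment> \<open>The countable subcover is empty when the space is; adding \<open>c0\<close>
    makes it the range of a sequence in every case.\<close>
  define c where "c = from_nat_into (insert c0 C)"
  have rc: "range c = insert c0 C"
    unfolding c_def using C(1) by (intro range_from_nat_into) auto
  define E where "E = disjointed (\<lambda>i. chart_dom (c i))"
  have cA: "c i \<in> A" for i
  proof -
    have "c i \<in> insert c0 C" unfolding rc[symmetric] by (rule rangeI)
    then show ?thesis using C(2) c0 by auto
  qed
  have "(\<Union>i. E i) = (\<Union>i. chart_dom (c i))" unfolding E_def by (rule UN_disjointed_eq)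
  also have "\<dots> = topspace X"
  proof
    show "(\<Union>i. chart_dom (c i)) \<subseteq> topspace X" using cA chart_dom_subset by blast
    have "topspace X = \<Union>(chart_dom ` C)" using V unfolding C(3) by simp
    also have "\<dots> \<subseteq> \<Union>(chart_dom ` range c)" unfolding rc by blast
    finally show "topspace X \<subseteq> (\<Union>i. chart_dom (c i))" by (simp add: image_image)
  qed
  finally have UE: "(\<Union>i. E i) = topspace X" .
  have "range E \<subseteq> sets (borel_of_top X)"
    unfolding E_def by (rule sets.range_disjointed_sets) (use cA chart_dom_borel in blast)
  then have "E i \<in> sets (borel_of_top X)" for i by blast
  moreover have "E i \<subseteq> chart_dom (c i)" for i unfolding E_def by (rule disjointed_subset)
  moreover have "disjoint_family E" unfolding E_def by (rule disjoint_family_disjointed)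
  ultimately show ?thesis using cA UE by blast
qed

lemma is_volume_measure_chart_volume:
  "is_volume_measure X A g \<mu> \<longleftrightarrow> space \<mu> = topspace X \<and> sets \<mu> = sets (borel_of_top X) \<and>
     (\<forall>c\<in>A. \<forall>B\<in>sets \<mu>. B \<subseteq> chart_dom c \<longrightarrow> emeasure \<mu> B = chart_volume g c B)"
  by (simp add: is_volume_measure_def sets_borel_of_top chart_volume_def volume_density_def)

lemma is_volume_measureD:
  "is_volume_measure X A g \<mu> \<Longrightarrow> c \<in> A \<Longrightarrow> B \<in> sets \<mu> \<Longrightarrow> B \<subseteq> chart_dom c \<Longrightarrow>
    emeasure \<mu> B = chart_volume g c B"
  unfolding is_volume_measure_chart_volume by blast

text \<open>The defining condition fixes the measure on sets inside a chart, and countable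
  additivity over a partition into such pieces fixes it everywhere.\<close>

lemma volume_measure_unique:
  assumes "is_volume_measure X A g \<mu>" "is_volume_measure X A g \<nu>"
  shows "\<mu> = \<nu>"
proof (rule measure_eqI)
  show "sets \<mu> = sets \<nu>" using assms by (simp add: is_volume_measure_def)
  fix B assume B: "B \<in> sets \<mu>"
  then have BX: "B \<subseteq> topspace X" "B \<in> sets (borel_of_top X)"
    using assms sets.sets_into_space[OF B] by (auto simp: is_volume_measure_chart_volume)
  show "emeasure \<mu> B = emeasure \<nu> B"
  proof (cases "A = {}")
    case True
    then show ?thesis using Union_chart_dom BX by simp
  next
    case False
    obtain c :: "nat \<Rightarrow> ('m, 'n) chart" and E where E: "\<And>i. c i \<in> A" "\<And>i. E i \<in> sets (borel_of_top X)" "\<And>i. E i \<subseteq> chart_dom (c i)"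
      "disjoint_family E" "(\<Union>i. E i) = topspace X"
      using countable_chart_partition[OF False] by metis
    have BU: "B = (\<Union>i. B \<inter> E i)" using E(5) BX by auto
    have disj: "disjoint_family (\<lambda>i. B \<inter> E i)" using E(4) by (auto simp: disjoint_family_on_def)
    have em: "emeasure \<kappa> B = (\<Sum>i. chart_volume g (c i) (B \<inter> E i))" if "is_volume_measure X A g \<kappa>" for \<kappa>
    proof -
      have s: "B \<inter> E i \<in> sets \<kappa>" for i
        using that BX E(2) by (auto simp: is_volume_measure_chart_volume)
      have "emeasure \<kappa> B = emeasure \<kappa> (\<Union>i. B \<inter> E i)" using BU by simp
      also have "\<dots> = (\<Sum>i. emeasure \<kappa> (B \<inter> E i))"
        using s by (intro suminf_emeasure[symmetric] disj) auto
      also have "\<dots> = (\<Sum>i. chart_volume g (c i) (B \<inter> E i))"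
        by (intro suminf_cong is_volume_measureD[OF that E(1) s]) (use E(3) in blast)
      finally show ?thesis .
    qed
    show ?thesis using em[OF assms(1)] em[OF assms(2)] by simp
  qed
qed

text \<open>The measure is summed over the pieces of one partition, each measured in its own chart.
  That every other chart also computes it correctly is the independence of
  \<open>chart_volume\<close>.\<close>

lemma volume_measure_exists:
  assumes g: "covariant_2_tensor A g"
  shows "\<exists>\<mu>. is_volume_measure X A g \<mu>"
proof (cases "A = {}")
  case True
  then show ?thesis
    by (intro exI[of _ "borel_of_top X"]) (simp add: is_volume_measure_def sets_borel_of_top)
next
  case False
  obtain c :: "nat \<Rightarrow> ('m, 'n) chart" and E where E: "\<And>i. c i \<in> A" "\<And>i. E i \<in> sets (borel_of_top X)" "\<And>i. E i \<subseteq> chart_dom (c i)"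
    "disjoint_family E" "(\<Union>i. E i) = topspace X"
    using countable_chart_partition[OF False] by metis
  define m where "m B = (\<Sum>i. chart_volume g (c i) (B \<inter> E i))" for B
  define \<mu> where "\<mu> = measure_of (topspace X) {U. openin X U} m"
  have sp: "space \<mu> = topspace X" and st: "sets \<mu> = sets (borel_of_top X)"
    unfolding \<mu>_def by (simp_all add: space_measure_of sets_measure_of opens_subset_Pow)
  have em: "emeasure \<mu> B = m B" if "B \<in> sets \<mu>" for B
  proof (rule emeasure_measure_of[OF \<mu>_def opens_subset_Pow _ _ that])
    show "positive (sets \<mu>) m" by (simp add: positive_def m_def)
    show "countably_additive (sets \<mu>) m"
    proof (rule countably_additiveI)
      fix B :: "nat \<Rightarrow> 'm set"
      assume B: "range B \<subseteq> sets \<mu>" "disjoint_family B"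
      have "m (\<Union>k. B k) = (\<Sum>i. \<Sum>k. chart_volume g (c i) (B k \<inter> E i))"
        unfolding m_def
      proof (rule suminf_cong)
        fix i
        have "chart_volume g (c i) ((\<Union>k. B k) \<inter> E i) = chart_volume g (c i) (\<Union>k. B k \<inter> E i)"
          by (simp add: Int_UN_distrib2)
        also have "\<dots> = (\<Sum>k. chart_volume g (c i) (B k \<inter> E i))"
          by (rule chart_volume_countably_additive[OF g E(1)])
            (use B st E(2)[of i] E(3)[of i] in \<open>auto simp: disjoint_family_on_def\<close>)
        finally show "chart_volume g (c i) ((\<Union>k. B k) \<inter> E i) = (\<Sum>k. chart_volume g (c i) (B k \<inter> E i))" .
      qed
      \<comment> \<open>The double series is rearranged by reading the outer sum as an integral over
        counting measure.\<close>
      also have "\<dots> = (\<integral>\<^sup>+i. (\<Sum>k. chart_volume g (c i) (B k \<inter> E i)) \<partial>count_space UNIV)"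
        by (simp add: nn_integral_count_space_nat)
      also have "\<dots> = (\<Sum>k. \<integral>\<^sup>+i. chart_volume g (c i) (B k \<inter> E i) \<partial>count_space UNIV)"
        by (rule nn_integral_suminf) simp
      also have "\<dots> = (\<Sum>k. m (B k))"
        by (simp add: nn_integral_count_space_nat m_def)
      finally show "(\<Sum>k. m (B k)) = m (\<Union>k. B k)" ..
    qed
  qed
  have "emeasure \<mu> B = chart_volume g d B" if d: "d \<in> A" and B: "B \<in> sets \<mu>" "B \<subseteq> chart_dom d" for d B
  proof -
    have s: "B \<inter> E i \<in> sets (borel_of_top X)" for i using B E(2) st by auto
    have "emeasure \<mu> B = (\<Sum>i. chart_volume g (c i) (B \<inter> E i))"
      using em[OF B(1)] by (simp add: m_def)
    \<comment> \<open>Each piece lies in both charts, so all pieces can be transferred to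
      \<open>d\<close> before they are put together again.\<close>
    also have "\<dots> = (\<Sum>i. chart_volume g d (B \<inter> E i))"
      by (intro suminf_cong chart_volume_independent[OF g E(1) d s]) (use B E(3) in auto)
    also have "\<dots> = chart_volume g d (\<Union>i. B \<inter> E i)"
    proof (rule chart_volume_countably_additive[OF g d, symmetric])
      show "range (\<lambda>i. B \<inter> E i) \<subseteq> sets (borel_of_top X)" using s by blast
      show "B \<inter> E k \<subseteq> chart_dom d" for k using B(2) by blast
      show "disjoint_family (\<lambda>i. B \<inter> E i)"
        using E(4) unfolding disjoint_family_on_def by blast
    qed
    also have "(\<Union>i. B \<inter> E i) = B"
      using E(5) sets.sets_into_space[OF B(1)] sp by auto
    finally show ?thesis .
  qed
  then show ?thesis
    using sp st by (intro exI[of _ \<mu>]) (simp add: is_volume_measure_chart_volume)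
qed

theorem is_volume_measure_volume_measure:
  assumes "covariant_2_tensor A g"
  shows "is_volume_measure X A g (volume_measure X A g)"
  unfolding volume_measure_def
  using volume_measure_exists[OF assms] volume_measure_unique by (metis theI)

lemma volume_measure_eqI:
  "is_volume_measure X A g \<mu> \<Longrightarrow> volume_measure X A g = \<mu>"
  unfolding volume_measure_def using volume_measure_unique by blast

lemma
  assumes "covariant_2_tensor A g"
  shows space_volume_measure: "space (volume_measure X A g) = topspace X"
    and sets_volume_measure: "sets (volume_measure X A g) = sets (borel_of_top X)"
  using is_volume_measure_volume_measure[OF assms] by (auto simp: is_volume_measure_chart_volume)

text \<open>By uniqueness it is enough that the scaled measure has the density of \<open>h\<close>
  in every chart.\<close>

lemma volume_measure_scale:
  assumes g: "covariant_2_tensor A g" and h: "covariant_2_tensor A h" and k: "0 \<le> k"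
    and scale: "\<And>c x. c \<in> A \<Longrightarrow> x \<in> chart_image c \<Longrightarrow> volume_density h c x = k * volume_density g c x"
  shows "volume_measure X A h = scale_measure (ennreal k) (volume_measure X A g)"
proof (rule volume_measure_eqI)
  note V = is_volume_measure_volume_measure[OF g]
  have st: "sets (volume_measure X A g) = sets (borel_of_top X)"
    using V by (simp add: is_volume_measure_chart_volume)
  have "ennreal k * emeasure (volume_measure X A g) B = chart_volume h c B"
    if c: "c \<in> A" and B: "B \<in> sets (volume_measure X A g)" "B \<subseteq> chart_dom c" for c B
  proof -
    have im: "coord c ` B \<subseteq> chart_image c" using B(2) by (auto simp: chart_image_def)
    have bor: "coord c ` B \<in> sets borel" using coord_image_borel[OF c _ B(2)] B(1) st by simp
    have "continuous_on (coord c ` B) (volume_density g c)"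
      by (rule continuous_on_subset[OF continuous_on_volume_density[OF g c] im])
    from borel_measurable_continuous_on_indicator[OF bor this]
    have "(\<lambda>x. ennreal (indicator (coord c ` B) x *\<^sub>R volume_density g c x)) \<in> borel_measurable borel"
      by (rule measurable_compose[OF _ measurable_ennreal])
    moreover have "ennreal (indicator T x *\<^sub>R r) = ennreal r * indicator T x" for T :: "(real ^ 'n) set" and x r
      by (cases "x \<in> T") simp_all
    ultimately have meas: "(\<lambda>x. ennreal (volume_density g c x) * indicator (coord c ` B) x) \<in> borel_measurable lborel"
      by simp
    have "chart_volume h c B = (\<integral>\<^sup>+x. ennreal k * (ennreal (volume_density g c x) * indicator (coord c ` B) x) \<partial>lborel)"
      unfolding chart_volume_def
    proof (rule nn_integral_cong)
      fix x
      show "ennreal (volume_density h c x) * indicator (coord c ` B) x =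
        ennreal k * (ennreal (volume_density g c x) * indicator (coord c ` B) x)"
      proof (cases "x \<in> coord c ` B")
        case True
        then have "volume_density h c x = k * volume_density g c x" using scale[OF c] im by blast
        then show ?thesis using True k by (simp add: ennreal_mult')
      qed simp
    qed
    also have "\<dots> = ennreal k * chart_volume g c B"
      unfolding chart_volume_def by (rule nn_integral_cmult[OF meas])
    also have "chart_volume g c B = emeasure (volume_measure X A g) B"
      using is_volume_measureD[OF V c B] by simp
    finally show ?thesis by simp
  qed
  then show "is_volume_measure X A h (scale_measure (ennreal k) (volume_measure X A g))"
    using V by (simp add: is_volume_measure_chart_volume space_scale_measure)
qed

text \<open>Around each point a closed coordinate ball fits into a chart; the density is bounded
  there, so the open ball has finite measure. Finitely many such balls cover
  \<open>K\<close>.\<close>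

lemma emeasure_volume_compact_finite:
  assumes g: "covariant_2_tensor A g" and K: "compactin X K"
  shows "emeasure (volume_measure X A g) K < \<infinity>"
proof -
  let ?\<mu> = "volume_measure X A g"
  note V = is_volume_measure_volume_measure[OF g]
  have st: "sets ?\<mu> = sets (borel_of_top X)"
    using V by (simp add: is_volume_measure_chart_volume)
  have "\<exists>U. openin X U \<and> p \<in> U \<and> emeasure ?\<mu> U < \<infinity>" if p: "p \<in> K" for p
  proof -
    have "p \<in> topspace X" using K p compactin_subset_topspace by blast
    then obtain c where c: "c \<in> A" "p \<in> chart_dom c" using Union_chart_dom by blast
    obtain r where r: "r > 0" "cball (coord c p) r \<subseteq> chart_image c"
      using open_chart_image[OF c(1)] coord_in_image[OF c(2)] open_contains_cball by blast
    define U where "U = {q \<in> chart_dom c. coord c q \<in> ball (coord c p) r}"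
    have U: "openin X U" "p \<in> U" "U \<subseteq> chart_dom c"
      unfolding U_def using openin_coord_preimage[OF c(1), of "ball (coord c p) r"] c r by auto
    have "compact (volume_density g c ` cball (coord c p) r)"
      by (intro compact_continuous_image continuous_on_subset[OF continuous_on_volume_density[OF g c(1)] r(2)] compact_cball)
    then obtain b where b: "\<And>x. x \<in> cball (coord c p) r \<Longrightarrow> norm (volume_density g c x) \<le> b"
      using compact_imp_bounded bounded_iff by (metis imageI)
    have "emeasure ?\<mu> U = chart_volume g c U"
      using is_volume_measureD[OF V c(1) _ U(3)] openin_borel_of_top[OF U(1)] st by simp
    also have "\<dots> \<le> (\<integral>\<^sup>+x. ennreal b * indicator (ball (coord c p) r) x \<partial>lborel)"
      unfolding chart_volume_def
    proof (rule nn_integral_mono)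
      fix x
      have "coord c ` U \<subseteq> ball (coord c p) r" by (auto simp: U_def)
      then show "ennreal (volume_density g c x) * indicator (coord c ` U) x \<le>
        ennreal b * indicator (ball (coord c p) r) x"
        using b[of x] by (cases "x \<in> coord c ` U") (auto intro!: ennreal_leI simp: subset_eq)
    qed
    also have "\<dots> = ennreal b * emeasure lborel (ball (coord c p) r)"
      by (simp add: nn_integral_cmult_indicator)
    also have "\<dots> < \<infinity>"
      using emeasure_bounded_finite[OF bounded_ball, of "coord c p" r] by (simp add: ennreal_mult_less_top)
    finally show ?thesis using U by blast
  qed
  then obtain U where U: "\<And>p. p \<in> K \<Longrightarrow> openin X (U p) \<and> p \<in> U p \<and> emeasure ?\<mu> (U p) < \<infinity>"
    by metis
  obtain \<F> where F: "finite \<F>" "\<F> \<subseteq> U ` K" "K \<subseteq> \<Union>\<F>"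
    using compactinD[OF K, of "U ` K"] U by blast
  have fs: "W \<in> sets ?\<mu>" "emeasure ?\<mu> W < \<infinity>" if "W \<in> \<F>" for W
    using that F(2) U openin_borel_of_top st by blast+
  have "emeasure ?\<mu> K \<le> emeasure ?\<mu> (\<Union>W\<in>\<F>. W)"
    by (rule emeasure_mono) (use F fs in auto)
  also have "\<dots> \<le> (\<Sum>W\<in>\<F>. emeasure ?\<mu> W)"
    by (rule emeasure_subadditive_finite) (use F fs in auto)
  also have "\<dots> < \<infinity>" using fs by (simp add: F(1))
  finally show ?thesis .
qed

text \<open>The coordinate map carries the measure restricted to the chart domain to Lebesgue
  measure with density \<open>volume_density\<close>. This follows from the values on sets; the
  integral is then transported along the image measure.\<close>

lemma integral_volume_measure_chart:
  fixes f :: "'m \<Rightarrow> real"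
  assumes g: "covariant_2_tensor A g" and c: "c \<in> A" and f: "f \<in> borel_measurable (volume_measure X A g)"
  shows "(LINT p:chart_dom c|volume_measure X A g. f p) =
    (LINT x:chart_image c|lborel. volume_density g c x * f (chart_point c x))"
proof -
  let ?\<mu> = "volume_measure X A g"
  note V = is_volume_measure_volume_measure[OF g]
  have st: "sets ?\<mu> = sets (borel_of_top X)" and sp: "space ?\<mu> = topspace X"
    using V by (simp_all add: is_volume_measure_chart_volume)
  define M where "M = restrict_space ?\<mu> (chart_dom c)"
  define L where "L = restrict_space (lborel :: (real ^ 'n) measure) (chart_image c)"
  define D where "D = density L (\<lambda>x. ennreal (volume_density g c x))"
  have im: "chart_image c \<in> sets borel" using open_chart_image[OF c] by simp
  have dm: "chart_dom c \<in> sets ?\<mu>" using chart_dom_borel[OF c] st by simp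
  have spM: "space M = chart_dom c" using chart_dom_subset[OF c] by (auto simp: M_def space_restrict_space sp)
  have spL: "space L = chart_image c" by (simp add: L_def space_restrict_space)
  have setsL: "sets L = sets (restrict_space borel (chart_image c))"
    unfolding L_def by (rule sets_restrict_space_cong) simp
  have coordM: "coord c \<in> measurable M L"
  proof (rule measurableI)
    show "coord c p \<in> space L" if "p \<in> space M" for p
      using that by (simp add: spM spL coord_in_image)
    fix S assume "S \<in> sets L"
    then have S: "S \<in> sets borel" "S \<subseteq> chart_image c"
      using im by (auto simp: setsL sets_restrict_space_iff)
    have "coord c -` S \<inter> space M = {p \<in> chart_dom c. coord c p \<in> S}" by (auto simp: spM)
    then show "coord c -` S \<inter> space M \<in> sets M"
      using coord_measurable[OF c S(1)] dm by (auto simp: M_def sets_restrict_space_iff st)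
  qed
  have densL: "(\<lambda>x. volume_density g c x) \<in> borel_measurable L"
    using borel_measurable_continuous_on_restrict[OF continuous_on_volume_density[OF g c]]
      measurable_cong_sets[OF setsL refl] by blast
  have eq: "distr M L (coord c) = D"
  proof (rule measure_eqI)
    show "sets (distr M L (coord c)) = sets D" by (simp add: D_def)
    fix S assume "S \<in> sets (distr M L (coord c))"
    then have SL: "S \<in> sets L" by simp
    then have S: "S \<in> sets borel" "S \<subseteq> chart_image c"
      using im by (auto simp: setsL sets_restrict_space_iff)
    let ?B = "{p \<in> chart_dom c. coord c p \<in> S}"
    have B: "?B \<in> sets ?\<mu>" using coord_measurable[OF c S(1)] st by simp
    have cB: "coord c ` ?B = S" using S(2) by (auto simp: chart_image_def)
    have "emeasure (distr M L (coord c)) S = emeasure M (coord c -` S \<inter> space M)"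
      by (rule emeasure_distr[OF coordM SL])
    also have "coord c -` S \<inter> space M = ?B" by (auto simp: spM)
    also have "emeasure M ?B = emeasure ?\<mu> ?B"
      unfolding M_def by (rule emeasure_restrict_space) (use dm sets.sets_into_space[OF dm] in \<open>auto simp: Int_absorb2\<close>)
    also have "\<dots> = (\<integral>\<^sup>+x\<in>S. ennreal (volume_density g c x) \<partial>lborel)"
      using is_volume_measureD[OF V c B] cB by (simp add: chart_volume_def)
    also have "\<dots> = (\<integral>\<^sup>+x. ennreal (volume_density g c x) * indicator S x * indicator (chart_image c) x \<partial>lborel)"
      using S(2) by (intro nn_integral_cong) (auto simp: indicator_def)
    also have "\<dots> = (\<integral>\<^sup>+x\<in>S. ennreal (volume_density g c x) \<partial>L)"
      unfolding L_def by (rule nn_integral_restrict_space[symmetric]) (use im in simp)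
    also have "\<dots> = emeasure D S"
      unfolding D_def by (rule emeasure_density[symmetric]) (use densL SL in auto)
    finally show "emeasure (distr M L (coord c)) S = emeasure D S" .
  qed
  have fL: "(\<lambda>x. f (chart_point c x)) \<in> borel_measurable L"
  proof -
    have "f \<in> borel_measurable (borel_of_top X)"
      using f measurable_cong_sets[OF st refl] by blast
    from measurable_compose[OF chart_point_measurable[OF c] this]
    show ?thesis using measurable_cong_sets[OF setsL refl] by blast
  qed
  have "(LINT p:chart_dom c|?\<mu>. f p) = integral\<^sup>L M f"
    unfolding M_def set_lebesgue_integral_def
    by (rule integral_restrict_space[symmetric]) (use dm sets.sets_into_space[OF dm] in \<open>auto simp: Int_absorb2\<close>)
  also have "\<dots> = (LINT p|M. f (chart_point c (coord c p)))"
    by (rule Bochner_Integration.integral_cong) (simp_all add: spM chart_point_coord[OF c])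
  also have "\<dots> = (LINT x|distr M L (coord c). f (chart_point c x))"
    by (rule integral_distr[OF coordM fL, symmetric])
  also have "\<dots> = (LINT x|L. volume_density g c x *\<^sub>R f (chart_point c x))"
    unfolding eq D_def by (rule integral_density[OF fL densL]) (simp add: volume_density_def)
  also have "\<dots> = (LINT x:chart_image c|lborel. volume_density g c x * f (chart_point c x))"
    unfolding L_def set_lebesgue_integral_def
    by (subst integral_restrict_space) (use im in \<open>auto simp: Int_absorb2\<close>)
  finally show ?thesis .
qed

end

section \<open>First variation of the energy\<close>

lemma continuous_on_linear_family:
  fixes F :: "'a::topological_space \<Rightarrow> real ^ 'n \<Rightarrow> 'b::real_normed_vector"
  assumes "\<And>y. y \<in> S \<Longrightarrow> linear (F y)" "\<And>v. continuous_on S (\<lambda>y. F y v)"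
    and z: "continuous_on T z" "\<And>t. t \<in> T \<Longrightarrow> z t \<in> S" and u: "continuous_on T u"
  shows "continuous_on T (\<lambda>t. F (z t) (u t))"
proof -
  have "continuous_on T (\<lambda>t. \<Sum>i\<in>UNIV. (u t $ i) *\<^sub>R F (z t) (axis i 1))"
    by (intro continuous_intros u continuous_on_compose2[OF assms(2) z(1)]) (use z(2) in auto)
  moreover have "F (z t) (u t) = (\<Sum>i\<in>UNIV. (u t $ i) *\<^sub>R F (z t) (axis i 1))" if "t \<in> T" for t
  proof -
    note l = assms(1)[OF z(2)[OF that]]
    have "F (z t) (u t) = F (z t) (\<Sum>i\<in>UNIV. (u t $ i) *\<^sub>R axis i 1)"
      by (simp only: vec_eq_sum_axis[symmetric])
    then show ?thesis by (simp add: linear_sum[OF l] linear_cmul[OF l])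
  qed
  ultimately show ?thesis by (simp cong: continuous_on_cong)
qed

lemma continuous_on_bilinear_family:
  fixes F :: "'a::topological_space \<Rightarrow> real ^ 'n \<Rightarrow> real ^ 'n \<Rightarrow> real"
  assumes b: "\<And>y. y \<in> S \<Longrightarrow> bilinear (F y)" and c: "\<And>v w. continuous_on S (\<lambda>y. F y v w)"
    and z: "continuous_on T z" "\<And>t. t \<in> T \<Longrightarrow> z t \<in> S" and u: "continuous_on T u" "continuous_on T w"
  shows "continuous_on T (\<lambda>t. F (z t) (u t) (w t))"
proof -
  have "continuous_on T (\<lambda>t. F (z t) v (w t))" for v
    by (rule continuous_on_linear_family[where S = S, OF _ c z u(2)]) (use b in \<open>auto simp: bilinear_def\<close>)
  then show ?thesis
    by (intro continuous_on_linear_family[where S = T and F = "\<lambda>t u. F (z t) u (w t)", OF _ _ continuous_on_id _ u(1)])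
      (use b z in \<open>auto simp: bilinear_def\<close>)
qed

lemma continuous_on_metric_trace:
  assumes G: "metric_on G S" and T: "\<And>i j. continuous_on S (\<lambda>x. T x (axis i 1) (axis j 1))"
  shows "continuous_on S (\<lambda>x. metric_trace (G x) (T x))"
  unfolding metric_trace_def
  by (intro continuous_on_sum continuous_on_mult T continuous_on_matrix_inv)
    (auto simp: gram_matrix_def metric_on_continuous[OF G]
      intro!: invertible_gram_matrix[unfolded gram_matrix_def] metric_onD(2)[OF G])

lemma smooth_on_slice_time:
  fixes H :: "real \<times> 'a::real_normed_vector \<Rightarrow> 'b::real_normed_vector"
  assumes "smooth_on U H" "(s, x) \<in> U"
  shows "((\<lambda>s. H (s, x)) has_vector_derivative frechet_derivative H (at (s, x)) (1, 0)) (at s)"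
proof -
  have 1: "((\<lambda>s. (s, x)) has_vector_derivative (1, 0)) (at s)"
    by (intro has_vector_derivative_Pair has_vector_derivative_id has_vector_derivative_const)
  have "(H has_derivative frechet_derivative H (at (s, x))) (at (s, x))"
    by (rule smooth_on_has_derivative[OF assms])
  then have 2: "(H has_derivative frechet_derivative H (at (s, x))) (at (s, x) within range (\<lambda>s. (s, x)))"
    by (rule has_derivative_at_withinI)
  show ?thesis using vector_derivative_diff_chain_within[OF 1 2] by (simp add: o_def)
qed

lemma smooth_on_slice_space:
  fixes H :: "real \<times> 'a::real_normed_vector \<Rightarrow> 'b::real_normed_vector"
  assumes "smooth_on U H" "(s, x) \<in> U"
  shows "((\<lambda>x. H (s, x)) has_derivative (\<lambda>a. frechet_derivative H (at (s, x)) (0, a))) (at x)"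
proof -
  have 1: "((\<lambda>x. (s, x)) has_derivative (\<lambda>a. (0, a))) (at x)"
    by (intro has_derivative_Pair has_derivative_const has_derivative_ident)
  show ?thesis using has_derivative_compose[OF 1 smooth_on_has_derivative[OF assms]] .
qed

text \<open>Encoded as a partial derivative of the joint map of time and coordinates: its smoothness
  in \<open>x\<close> and the interchange of time and space derivatives are then properties of one
  smooth map.\<close>

definition variation_field :: "(real \<Rightarrow> ('m, 'n::finite) vecfield) \<Rightarrow> ('m, 'n) vecfield" where
  "variation_field W c x = frechet_derivative (\<lambda>(s, x). W s c x) (at (0, x)) (1, 0)"

text \<open>For the Reeb field this is the form \<theta> of the overview. Inserted into
  \<open>deriv_trace\<close> with a field \<open>B\<close>, it gives the derivative of the energy
  density in the direction \<open>B\<close>.\<close>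

definition energy_gradient :: "('m, 'n::finite) tensor02 \<Rightarrow> ('m, 'n) vecfield \<Rightarrow> ('m, 'n) tensor02" where
  "energy_gradient g V c x a b = g c x (covariant_deriv (g c) (V c) x a) b"

context smooth_charts
begin

text \<open>The derivative is provided for all small \<open>s\<close>, as a function continuous in
  \<open>(s, x)\<close> jointly, because bounds locally uniform in the point will be derived from
  it. Only at \<open>s = 0\<close> is it identified with a trace.\<close>

lemma local_energy_density_derivative:
  assumes g: "semi_riemannian_metric A g" and c: "c \<in> A" and \<epsilon>: "\<epsilon> > 0"
    and W: "smooth_on ({-\<epsilon><..<\<epsilon>} \<times> chart_image c) (\<lambda>(s, x). W s c x)"
  obtains E where "continuous_on ({-\<epsilon><..<\<epsilon>} \<times> chart_image c) E"
    "\<And>s x. s \<in> {-\<epsilon><..<\<epsilon>} \<Longrightarrow> x \<in> chart_image c \<Longrightarrow>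
      ((\<lambda>s. local_energy_density g (W s) c x) has_real_derivative E (s, x)) (at s)"
    "\<And>x. x \<in> chart_image c \<Longrightarrow>
      E (0, x) = deriv_trace g (energy_gradient g (W 0)) (variation_field W) c x"
proof -
  let ?I = "{-\<epsilon><..<\<epsilon>}" and ?S = "chart_image c" and ?G = "g c"
  let ?U = "?I \<times> ?S"
  define H where "H = (\<lambda>(s, x). W s c x)"
  define H' where "H' z = frechet_derivative H (at z) (1, 0)" for z
  \<comment> \<open>\<open>P i\<close> is the covariant derivative of \<open>W s\<close> along the
    axis \<open>i\<close> and \<open>P' i\<close> its time derivative. The Christoffel term is
    linear in the field, so there \<open>H\<close> is simply replaced by \<open>H'\<close>.\<close>
  define P where "P i z = frechet_derivative H (at z) (0, axis i 1) + christoffel ?G (snd z) (axis i 1) (H z)" for i z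
  define P' where "P' i z = frechet_derivative (\<lambda>z. frechet_derivative H (at z) (0, axis i 1)) (at z) (1, 0)
      + christoffel ?G (snd z) (axis i 1) (H' z)" for i z
  let ?h = "\<lambda>x i j. matrix_inv (gram_matrix (?G x)) $ i $ j"
  define E where "E z = (\<Sum>i\<in>UNIV. \<Sum>j\<in>UNIV. ?h (snd z) i j *
      (?G (snd z) (P i z) (P' j z) + ?G (snd z) (P' i z) (P j z))) / 2" for z
  note mG = semi_riemannian_metric_on[OF g c]
  have S: "open ?S" by (rule open_chart_image[OF c])
  have U: "open ?U" by (intro open_Times S) auto
  have sm: "smooth_on ?U H" using W by (simp add: H_def)
  note bG = metric_formD(1)[OF metric_onD(2)[OF mG]]
  have cH: "continuous_on ?U H" using Ck_on_imp_continuous[OF smooth_on_imp_Ck[OF sm, of 0]] .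
  have cD: "continuous_on ?U (\<lambda>z. frechet_derivative H (at z) v)" for v
    using Ck_on_imp_continuous[OF smooth_on_imp_Ck[OF smooth_on_frechet_derivative[OF sm], of 0]] .
  have cDD: "continuous_on ?U (\<lambda>z. frechet_derivative (\<lambda>z. frechet_derivative H (at z) v) (at z) w)" for v w
    using Ck_on_imp_continuous[OF smooth_on_imp_Ck[OF smooth_on_frechet_derivative[OF
      smooth_on_frechet_derivative[OF sm]], of 0]] .
  have csnd: "continuous_on ?U snd" by (intro continuous_intros)
  have cch: "continuous_on ?U (\<lambda>z. christoffel ?G (snd z) v (u z))" if "continuous_on ?U u" for v u
    by (rule continuous_on_linear_family[where S = ?S, OF christoffel_linear(2)[OF mG]
        continuous_on_christoffel[OF mG] csnd _ that]) auto
  have cP: "continuous_on ?U (P i)" and cP': "continuous_on ?U (P' i)" for i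
    unfolding P_def P'_def by (intro continuous_on_add cD cDD cch cH cD[of "(1,0)", folded H'_def])+
  have cG: "continuous_on ?U (\<lambda>z. ?G (snd z) (u z) (w z))" if "continuous_on ?U u" "continuous_on ?U w" for u w
    by (rule continuous_on_bilinear_family[where S = ?S, OF bG metric_on_continuous(1)[OF mG] csnd _ that]) auto
  have ch: "continuous_on ?U (\<lambda>z. ?h (snd z) i j)" for i j
  proof -
    have "continuous_on ?S (\<lambda>x. ?h x i j)"
      by (rule continuous_on_matrix_inv) (auto simp: gram_matrix_def metric_on_continuous[OF mG]
          intro!: invertible_gram_matrix[unfolded gram_matrix_def] metric_onD(2)[OF mG])
    then show ?thesis by (rule continuous_on_compose2[OF _ csnd]) auto
  qed
  have contE: "continuous_on ?U E"
    unfolding E_def[abs_def]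
    by (intro continuous_on_divide continuous_on_sum continuous_on_mult continuous_on_add
        continuous_on_const ch cG cP cP') simp_all
  have spc: "(W s c has_derivative (\<lambda>a. frechet_derivative H (at (s, x)) (0, a))) (at x)"
    if "s \<in> ?I" "x \<in> ?S" for s x
    using smooth_on_slice_space[OF sm, of s x] that by (simp add: H_def)
  have covP: "covariant_deriv ?G (W s c) x (axis i 1) = P i (s, x)" if "s \<in> ?I" "x \<in> ?S" for s x i
    using frechet_derivative_eqI[OF spc[OF that]] by (simp add: covariant_deriv_def P_def H_def)
  have led: "local_energy_density g (W s) c x = (metric_trace (?G x) (?G x) +
      (\<Sum>i\<in>UNIV. \<Sum>j\<in>UNIV. ?h x i j * ?G x (P i (s, x)) (P j (s, x)))) / 2" if "s \<in> ?I" "x \<in> ?S" for s x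
    by (subst local_energy_density_eq[where V = "W s", OF differentiableI[OF spc[OF that]]])
      (simp only: metric_trace_add, simp only: metric_trace_def covP[OF that])
  have dP: "((\<lambda>s. P i (s, x)) has_vector_derivative P' i (s, x)) (at s)" if "s \<in> ?I" "x \<in> ?S" for s x i
  proof -
    have z: "(s, x) \<in> ?U" using that by simp
    have "bounded_linear (christoffel ?G x (axis i 1))"
      using christoffel_linear(2)[OF mG that(2)] linear_conv_bounded_linear by blast
    from bounded_linear.has_vector_derivative[OF this smooth_on_slice_time[OF sm z]]
    have "((\<lambda>s. christoffel ?G x (axis i 1) (H (s, x))) has_vector_derivative
        christoffel ?G x (axis i 1) (H' (s, x))) (at s)" by (simp add: H'_def)
    then show ?thesis
      unfolding P_def P'_def snd_conv
      by (intro has_vector_derivative_add smooth_on_slice_time[OF smooth_on_frechet_derivative[OF sm] z])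
  qed
  have dE: "((\<lambda>s. local_energy_density g (W s) c x) has_real_derivative E (s, x)) (at s)"
    if s: "s \<in> ?I" and x: "x \<in> ?S" for s x
  proof -
    have bb: "bounded_bilinear (?G x)" using bG[OF x] bilinear_conv_bounded_bilinear by blast
    have "((\<lambda>s. ?G x (P i (s, x)) (P j (s, x))) has_real_derivative
        ?G x (P i (s, x)) (P' j (s, x)) + ?G x (P' i (s, x)) (P j (s, x))) (at s)" for i j
      unfolding has_real_derivative_iff_has_vector_derivative
      by (rule bounded_bilinear.has_vector_derivative[OF bb dP[OF s x] dP[OF s x]])
    then have "((\<lambda>s. (metric_trace (?G x) (?G x) +
      (\<Sum>i\<in>UNIV. \<Sum>j\<in>UNIV. ?h x i j * ?G x (P i (s, x)) (P j (s, x)))) / 2) has_real_derivative E (s, x)) (at s)"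
      unfolding E_def snd_conv
      by (auto intro!: derivative_eq_intros simp: sum_distrib_left mult.commute)
    then show ?thesis
      by (rule DERIV_cong_ev[THEN iffD1, OF refl _ refl, rotated])
        (use led[OF _ x] s in \<open>auto simp: eventually_nhds intro!: exI[of _ ?I]\<close>)
  qed
  have "E (0, x) = deriv_trace g (energy_gradient g (W 0)) (variation_field W) c x" if x: "x \<in> ?S" for x
  proof -
    have 0: "0 \<in> ?I" using \<epsilon> by simp
    have z: "(0, x) \<in> ?U" using 0 x by simp
    have B: "variation_field W c = (\<lambda>y. H' (0, y))"
      by (rule ext) (simp add: variation_field_def H'_def H_def)
    have "frechet_derivative (\<lambda>y. H' (0, y)) (at x) = (\<lambda>a. frechet_derivative H' (at (0, x)) (0, a))"
      unfolding H'_def[abs_def]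
      by (rule frechet_derivative_eqI[OF smooth_on_slice_space[OF smooth_on_frechet_derivative[OF sm] z]])
    \<comment> \<open>Time and space derivatives commute; hence at time 0 \<open>P'\<close> is the
      covariant derivative of the variation field.\<close>
    moreover have "frechet_derivative H' (at (0, x)) (0, a) =
        frechet_derivative (\<lambda>z. frechet_derivative H (at z) (0, a)) (at (0, x)) (1, 0)" for a
      unfolding H'_def[abs_def] by (rule second_derivative_symmetric[OF smooth_on_imp_Ck[OF sm] U z])
    ultimately have covB: "covariant_deriv ?G (variation_field W c) x (axis i 1) = P' i (0, x)" for i
      unfolding B covariant_deriv_def P'_def snd_conv by simp
    note sym = metric_formD(2)[OF metric_onD(2)[OF mG x]]
    have hsym: "?h x i j = ?h x j i" for i j
    proof -
      have "transpose (matrix_inv (gram_matrix (?G x))) = matrix_inv (gram_matrix (?G x))"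
        by (intro transpose_matrix_inv_symmetric invertible_gram_matrix gram_matrix_symmetric metric_onD(2)[OF mG x])
      from arg_cong[OF this, of "\<lambda>M. M $ j $ i"] show ?thesis by (simp add: transpose_def)
    qed
    have "(\<Sum>i\<in>UNIV. \<Sum>j\<in>UNIV. ?h x i j * ?G x (P' i (0, x)) (P j (0, x))) =
      (\<Sum>i\<in>UNIV. \<Sum>j\<in>UNIV. ?h x j i * ?G x (P' j (0, x)) (P i (0, x)))"
      by (rule sum.swap)
    also have "\<dots> = (\<Sum>i\<in>UNIV. \<Sum>j\<in>UNIV. ?h x i j * ?G x (P i (0, x)) (P' j (0, x)))"
    proof (intro sum.cong refl)
      show "?h x j i * ?G x (P' j (0, x)) (P i (0, x)) = ?h x i j * ?G x (P i (0, x)) (P' j (0, x))" for i j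
        by (simp only: hsym[of j i] sym[of "P' j (0, x)" "P i (0, x)"])
    qed
    finally have "E (0, x) = (\<Sum>i\<in>UNIV. \<Sum>j\<in>UNIV. ?h x i j * ?G x (P i (0, x)) (P' j (0, x)))"
      unfolding E_def snd_conv distrib_left sum.distrib by simp
    then show ?thesis
      by (simp add: deriv_trace_def metric_trace_def energy_gradient_def covB covP[OF 0 x])
  qed
  then show ?thesis using that contE dE by blast
qed

text \<open>The Jacobian does not depend on \<open>s\<close>, so the transformation law of
  \<open>W s\<close> can be differentiated at time 0.\<close>

lemma vector_field_variation_field:
  assumes \<epsilon>: "\<epsilon> > 0" and W: "\<And>s. s \<in> {-\<epsilon><..<\<epsilon>} \<Longrightarrow> vector_field A (W s)"
    and sm: "\<And>c. c \<in> A \<Longrightarrow> smooth_on ({-\<epsilon><..<\<epsilon>} \<times> chart_image c) (\<lambda>(s, x). W s c x)"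
  shows "vector_field A (variation_field W)"
  unfolding vector_field_def
proof (intro conjI ballI)
  have 0: "0 \<in> {-\<epsilon><..<\<epsilon>}" using \<epsilon> by simp
  fix c assume c: "c \<in> A"
  let ?U = "{-\<epsilon><..<\<epsilon>} \<times> chart_image c"
  have o: "open ?U" "open (chart_image c)" by (auto intro!: open_Times open_chart_image c)
  have lin: "bounded_linear (\<lambda>x :: real ^ 'n. (0 :: real, x))"
    by (intro bounded_linear_Pair bounded_linear_zero bounded_linear_ident)
  show "smooth_on (chart_image c) (variation_field W c)"
    unfolding smooth_on_def
  proof
    fix k
    have "Ck_on k (\<lambda>x. frechet_derivative (\<lambda>(s, x). W s c x) (at ((0, 0) + (0, x))) (1, 0)) (chart_image c)"
      by (rule Ck_on_affine_compose[OF lin o _ smooth_on_imp_Ck[OF smooth_on_frechet_derivative[OF sm[OF c]]]])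
        (use 0 in auto)
    then show "Ck_on k (variation_field W c) (chart_image c)"
      by (simp add: variation_field_def[abs_def])
  qed
  fix d p assume d: "d \<in> A" and p: "p \<in> chart_dom c \<inter> chart_dom d"
  have time: "((\<lambda>s. W s c (coord c p)) has_vector_derivative variation_field W c (coord c p)) (at 0)"
    if "c \<in> A" "p \<in> chart_dom c" for c p
    using smooth_on_slice_time[OF sm[OF that(1)], of 0 "coord c p"] 0 coord_in_image[OF that(2)]
    by (simp add: variation_field_def)
  have "bounded_linear (jacobian c d p)"
    using linear_jacobian[OF c d p] linear_conv_bounded_linear by blast
  from bounded_linear.has_vector_derivative[OF this time[OF c]] p
  have 1: "((\<lambda>s. jacobian c d p (W s c (coord c p))) has_vector_derivative
      jacobian c d p (variation_field W c (coord c p))) (at 0)" by auto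
  have 2: "((\<lambda>s. W s d (coord d p)) has_vector_derivative
      jacobian c d p (variation_field W c (coord c p))) (at 0)"
  proof (rule has_vector_derivative_transform_within_open[OF 1, of "{-\<epsilon><..<\<epsilon>}"])
    show "jacobian c d p (W s c (coord c p)) = W s d (coord d p)" if "s \<in> {-\<epsilon><..<\<epsilon>}" for s
      using C1_field_transform[OF vector_field_C1[OF W[OF that]] c d p] by simp
  qed (use \<epsilon> in auto)
  show "variation_field W d (coord d p) = jacobian c d p (variation_field W c (coord c p))"
    by (rule vector_derivative_unique_at[OF time[OF d] 2]) (use p in simp)
qed

lemma continuous_map_chartsI:
  fixes f :: "'m \<Rightarrow> real"
  assumes "\<And>c. c \<in> A \<Longrightarrow> continuous_on (chart_image c) (l c)"
    and "\<And>c p. c \<in> A \<Longrightarrow> p \<in> chart_dom c \<Longrightarrow> f p = l c (coord c p)"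
  shows "continuous_map X euclideanreal f"
  unfolding continuous_map_def
proof (intro conjI allI impI)
  fix V :: "real set" assume "openin euclideanreal V"
  then have V: "open V" by simp
  have "{x \<in> topspace X. f x \<in> V} = (\<Union>c\<in>A. {p \<in> chart_dom c. coord c p \<in> chart_image c \<inter> l c -` V})"
    (is "?L = ?R")
  proof (rule set_eqI)
    fix p
    have "p \<in> {p \<in> chart_dom c. coord c p \<in> chart_image c \<inter> l c -` V} \<longleftrightarrow> p \<in> chart_dom c \<and> f p \<in> V"
      if "c \<in> A" for c
      using assms(2)[OF that, of p] coord_in_image[of p c] by auto
    then have "p \<in> ?R \<longleftrightarrow> (\<exists>c\<in>A. p \<in> chart_dom c \<and> f p \<in> V)"
      unfolding UN_iff by (rule bex_cong[OF refl])
    also have "\<dots> \<longleftrightarrow> p \<in> ?L"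
      unfolding Union_chart_dom[symmetric] by blast
    finally show "p \<in> ?L \<longleftrightarrow> p \<in> ?R" by blast
  qed
  moreover have "openin X {p \<in> chart_dom c. coord c p \<in> chart_image c \<inter> l c -` V}" if "c \<in> A" for c
    using continuous_open_preimage[OF assms(1)[OF that] open_chart_image[OF that] V]
    by (rule openin_coord_preimage[OF that])
  ultimately show "openin X {x \<in> topspace X. f x \<in> V}" by auto
qed auto

lemma continuous_on_covariant_deriv:
  assumes g: "semi_riemannian_metric A g" and V: "C1_field V" and c: "c \<in> A"
  shows "continuous_on (chart_image c) (\<lambda>x. covariant_deriv (g c) (V c) x a)"
proof -
  note mG = semi_riemannian_metric_on[OF g c]
  have C: "Ck_on (Suc 0) (V c) (chart_image c)" using V c by (simp only: C1_field_def)
  have "continuous_on (chart_image c) (\<lambda>x. christoffel (g c) x a (V c x))"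
    by (rule continuous_on_linear_family[where S = "chart_image c", OF christoffel_linear(2)[OF mG]
        continuous_on_christoffel[OF mG] continuous_on_id _ Ck_on_imp_continuous[OF C]]) auto
  then show ?thesis
    unfolding covariant_deriv_def
    by (intro continuous_on_add Ck_on_imp_continuous[OF Ck_on_frechet_derivative[OF C]])
qed

lemma continuous_on_deriv_trace:
  assumes g: "semi_riemannian_metric A g" and V: "C1_field V" and c: "c \<in> A"
    and T: "\<And>x. x \<in> chart_image c \<Longrightarrow> bilinear (T c x)" "\<And>v w. continuous_on (chart_image c) (\<lambda>x. T c x v w)"
  shows "continuous_on (chart_image c) (deriv_trace g T V c)"
  unfolding deriv_trace_def[abs_def]
  by (intro continuous_on_metric_trace[OF semi_riemannian_metric_on[OF g c]]
      continuous_on_bilinear_family[where S = "chart_image c", OF T continuous_on_id]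
      continuous_on_covariant_deriv[OF g V c] continuous_on_const) auto

lemma energy_gradient_bilinear:
  assumes g: "semi_riemannian_metric A g" and V: "C1_field V" and c: "c \<in> A" "x \<in> chart_image c"
  shows "bilinear (energy_gradient g V c x)"
proof -
  note b = metric_formD(1)[OF metric_onD(2)[OF semi_riemannian_metric_on[OF g c(1)] c(2)]]
  note l = C1_linear_covariant_deriv[OF g V c]
  show ?thesis
    unfolding bilinear_def energy_gradient_def
    by (intro conjI allI linearI)
      (simp_all add: bilinear_ladd[OF b] bilinear_lmul[OF b] bilinear_radd[OF b] bilinear_rmul[OF b]
        linear_add[OF l] linear_cmul[OF l])
qed

lemma continuous_on_energy_gradient:
  assumes g: "semi_riemannian_metric A g" and V: "C1_field V" and c: "c \<in> A"
  shows "continuous_on (chart_image c) (\<lambda>x. energy_gradient g V c x v w)"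
  unfolding energy_gradient_def
  by (intro continuous_on_bilinear_family[where S = "chart_image c",
        OF metric_formD(1)[OF metric_onD(2)[OF semi_riemannian_metric_on[OF g c]]]
        metric_on_continuous(1)[OF semi_riemannian_metric_on[OF g c]] continuous_on_id]
      continuous_on_covariant_deriv[OF g V c] continuous_on_const) auto

lemma pointwise_covariant_energy_gradient:
  assumes g: "semi_riemannian_metric A g" and V: "C1_field V"
  shows "pointwise_covariant (energy_gradient g V)"
  unfolding energy_gradient_def[abs_def]
  by (rule pointwise_covariant_deriv2[OF g V covariant_2_tensor_pointwise[OF semi_riemannian_covariant[OF g]]])

lemma continuous_map_energy_density:
  assumes g: "semi_riemannian_metric A g" and V: "C1_field V"
  shows "continuous_map X euclideanreal (energy_density A g V)"
proof (rule continuous_map_chartsI[where l = "local_energy_density g V"])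
  fix c assume c: "c \<in> A"
  show "energy_density A g V p = local_energy_density g V c (coord c p)" if "p \<in> chart_dom c" for p
    by (rule energy_density_eq[OF g V c that])
  note mG = semi_riemannian_metric_on[OF g c]
  have "continuous_on (chart_image c) (\<lambda>x. (metric_trace (g c x) (g c x) +
      deriv_trace g (energy_gradient g V) V c x) / 2)"
    by (intro continuous_intros continuous_on_metric_trace[OF mG] metric_on_continuous(1)[OF mG]
        continuous_on_deriv_trace[where T = "energy_gradient g V", OF g V c]
        energy_gradient_bilinear[OF g V c] continuous_on_energy_gradient[OF g V c]) auto
  moreover have "(metric_trace (g c x) (g c x) + deriv_trace g (energy_gradient g V) V c x) / 2 =
      local_energy_density g V c x" if "x \<in> chart_image c" for x
    using local_energy_density_eq[where V = V, OF differentiableI[OF C1_field_has_derivative[OF V c that]]]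
    by (simp only: metric_trace_add deriv_trace_def energy_gradient_def)
  ultimately show "continuous_on (chart_image c) (local_energy_density g V c)"
    by (rule continuous_on_eq)
qed

text \<open>A function given by its chart representatives is read in an arbitrarily chosen chart, in
  the manner of \<open>energy_density\<close>; for the traces used below the choice is
  immaterial.\<close>

definition at_point :: "(('m, 'n) chart \<Rightarrow> real ^ 'n \<Rightarrow> real) \<Rightarrow> 'm \<Rightarrow> real" where
  "at_point l p = (let c = (SOME c. c \<in> A \<and> p \<in> chart_dom c) in l c (coord c p))"

lemma at_point_deriv_trace:
  assumes "semi_riemannian_metric A g" "C1_field V" "pointwise_covariant T" and c: "c \<in> A" "p \<in> chart_dom c"
  shows "at_point (deriv_trace g T V) p = deriv_trace g T V c (coord c p)"
proof -
  define d where "d = (SOME c. c \<in> A \<and> p \<in> chart_dom c)"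
  have "d \<in> A \<and> p \<in> chart_dom d"
    unfolding d_def by (rule someI[of _ c]) (use c in auto)
  then show ?thesis
    using deriv_trace_transform[OF assms(1-3), of d c p] c by (auto simp: at_point_def d_def[symmetric] Let_def)
qed

lemma continuous_map_deriv_trace:
  assumes g: "semi_riemannian_metric A g" and V: "C1_field V" and T: "pointwise_covariant T"
    and cont: "\<And>c v w. c \<in> A \<Longrightarrow> continuous_on (chart_image c) (\<lambda>x. T c x v w)"
  shows "continuous_map X euclideanreal (at_point (deriv_trace g T V))"
  by (rule continuous_map_chartsI[where l = "deriv_trace g T V"])
    (auto intro!: continuous_on_deriv_trace[OF g V] pointwise_covariantD(1)[OF T] cont at_point_deriv_trace[OF g V T])

end

section \<open>Differentiation of the energy under the integral sign\<close>

context smooth_manifold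
begin

lemma continuous_imp_measurable:
  fixes f :: "'m \<Rightarrow> real"
  assumes g: "covariant_2_tensor A g" and f: "continuous_map X euclideanreal f"
  shows "f \<in> borel_measurable (volume_measure X A g)"
proof (rule borel_measurableI)
  fix S :: "real set" assume "open S"
  then have "openin X {p \<in> topspace X. f p \<in> S}"
    using f by (auto simp: continuous_map_def)
  moreover have "f -` S \<inter> space (volume_measure X A g) = {p \<in> topspace X. f p \<in> S}"
    by (auto simp: space_volume_measure[OF g])
  ultimately show "f -` S \<inter> space (volume_measure X A g) \<in> sets (volume_measure X A g)"
    by (simp add: sets_volume_measure[OF g] openin_borel_of_top)
qed

text \<open>Both the measure of \<open>D\<close> and the values of \<open>f\<close> on it are
  controlled by the compact closure.\<close>

lemma continuous_imp_set_integrable: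
  fixes f :: "'m \<Rightarrow> real"
  assumes g: "covariant_2_tensor A g" and f: "continuous_map X euclideanreal f"
    and D: "openin X D" "compactin X (X closure_of D)"
  shows "set_integrable (volume_measure X A g) D f"
proof -
  let ?\<mu> = "volume_measure X A g"
  have sub: "D \<subseteq> X closure_of D" by (rule closure_of_subset[OF openin_subset[OF D(1)]])
  have Ds: "D \<in> sets ?\<mu>" using D(1) by (simp add: sets_volume_measure[OF g] openin_borel_of_top)
  have Cs: "X closure_of D \<in> sets ?\<mu>"
  proof -
    have o: "openin X (topspace X - X closure_of D)" by (rule openin_diff[OF openin_topspace closedin_closure_of])
    have "topspace X - (topspace X - X closure_of D) \<in> sets ?\<mu>"
      by (rule sets.Diff) (simp_all add: o sets_volume_measure[OF g] openin_borel_of_top)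
    moreover have "topspace X - (topspace X - X closure_of D) = X closure_of D"
      using closure_of_subset_topspace[of X D] by blast
    ultimately show ?thesis by simp
  qed
  have "emeasure ?\<mu> D \<le> emeasure ?\<mu> (X closure_of D)" by (rule emeasure_mono[OF sub Cs])
  then have fin: "emeasure ?\<mu> D < \<infinity>"
    using emeasure_volume_compact_finite[OF g D(2)] by (rule order_le_less_trans)
  have "compact (f ` (X closure_of D))"
    using image_compactin[OF D(2) f] by simp
  from compact_imp_bounded[OF this] obtain b where "\<forall>y\<in>f ` (X closure_of D). norm y \<le> b"
    unfolding bounded_iff ..
  then have b: "norm (f p) \<le> b" if "p \<in> X closure_of D" for p using that by blast
  show ?thesis
    unfolding set_integrable_def
    by (rule integrableI_bounded_set_indicator[OF Ds continuous_imp_measurable[OF g f] fin, of b])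
      (use b sub in auto)
qed

text \<open>Dominated convergence needs difference quotients bounded uniformly near each point. The
  derivative is continuous in time and position jointly, hence bounded near
  \<open>(0, coord c p)\<close>, and the mean value inequality converts this into a Lipschitz bound
  in \<open>s\<close>.\<close>

lemma energy_density_local_bound:
  assumes g: "semi_riemannian_metric A g" and \<epsilon>: "\<epsilon> > 0"
    and W: "\<And>s. s \<in> {-\<epsilon><..<\<epsilon>} \<Longrightarrow> vector_field A (W s)"
    and sm: "\<And>c. c \<in> A \<Longrightarrow> smooth_on ({-\<epsilon><..<\<epsilon>} \<times> chart_image c) (\<lambda>(s, x). W s c x)"
    and p: "p \<in> topspace X"
  shows "\<exists>U \<delta> C. openin X U \<and> p \<in> U \<and> 0 < \<delta> \<and> 0 \<le> C \<and>
      (\<forall>q\<in>U. \<forall>s\<in>{-\<delta><..<\<delta>}. \<bar>energy_density A g (W s) q - energy_density A g (W 0) q\<bar> \<le> C * \<bar>s\<bar>)"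
    and "((\<lambda>s. energy_density A g (W s) p) has_real_derivative
      at_point (deriv_trace g (energy_gradient g (W 0)) (variation_field W)) p) (at 0)"
proof -
  let ?I = "{-\<epsilon><..<\<epsilon>}"
  have 0: "0 \<in> ?I" using \<epsilon> by simp
  obtain c where c: "c \<in> A" "p \<in> chart_dom c" using p Union_chart_dom by blast
  note xS = coord_in_image[OF c(2)]
  obtain E where E: "continuous_on (?I \<times> chart_image c) E"
    "\<And>s x. s \<in> ?I \<Longrightarrow> x \<in> chart_image c \<Longrightarrow>
      ((\<lambda>s. local_energy_density g (W s) c x) has_real_derivative E (s, x)) (at s)"
    "\<And>x. x \<in> chart_image c \<Longrightarrow>
      E (0, x) = deriv_trace g (energy_gradient g (W 0)) (variation_field W) c x"
    using local_energy_density_derivative[where W = W, OF g c(1) \<epsilon> sm[OF c(1)]] by blast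
  have ed: "energy_density A g (W s) q = local_energy_density g (W s) c (coord c q)"
    if "s \<in> ?I" "q \<in> chart_dom c" for s q
    by (rule energy_density_eq[OF g vector_field_C1[OF W[OF that(1)]] c(1) that(2)])
  have der: "((\<lambda>s. energy_density A g (W s) q) has_real_derivative E (s, coord c q)) (at s)"
    if "s \<in> ?I" "q \<in> chart_dom c" for s q
    by (rule DERIV_cong_ev[THEN iffD2, OF refl _ refl E(2)[OF that(1) coord_in_image[OF that(2)]]])
      (use ed[OF _ that(2)] that(1) in \<open>auto simp: eventually_nhds intro!: exI[of _ ?I]\<close>)
  note vf = vector_field_variation_field[OF \<epsilon> W sm]
  have "at_point (deriv_trace g (energy_gradient g (W 0)) (variation_field W)) p = E (0, coord c p)"
    unfolding E(3)[OF xS]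
    by (rule at_point_deriv_trace[OF g vector_field_C1[OF vf]
        pointwise_covariant_energy_gradient[OF g vector_field_C1[OF W[OF 0]]] c])
  with der[OF 0 c(2)] show "((\<lambda>s. energy_density A g (W s) p) has_real_derivative
      at_point (deriv_trace g (energy_gradient g (W 0)) (variation_field W)) p) (at 0)" by simp
  \<comment> \<open>The added 1 makes the bound strict at \<open>(0, coord c p)\<close>, so that it
    persists on a product neighbourhood.\<close>
  let ?C = "\<bar>E (0, coord c p)\<bar> + 1"
  let ?O = "?I \<times> chart_image c \<inter> E -` {y. \<bar>y\<bar> < ?C}"
  have "open ?O"
    by (rule continuous_open_preimage[OF E(1)])
      (auto intro!: open_Times open_chart_image c open_Collect_less continuous_intros)
  moreover have "(0, coord c p) \<in> ?O" using 0 xS by simp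
  ultimately obtain S T where ST: "open S" "open T" "0 \<in> S" "coord c p \<in> T" "S \<times> T \<subseteq> ?O"
    by (rule open_prod_elim) auto
  obtain \<delta> where \<delta>: "\<delta> > 0" "ball 0 \<delta> \<subseteq> S" using ST(1,3) openE by blast
  have S: "s \<in> S" if "s \<in> {-\<delta><..<\<delta>}" for s using \<delta>(2) that by (auto simp: subset_eq dist_real_def)
  define U where "U = {q \<in> chart_dom c. coord c q \<in> T}"
  have U: "openin X U" "p \<in> U"
    unfolding U_def using openin_coord_preimage[OF c(1) ST(2)] c(2) ST(4) by auto
  have "\<bar>energy_density A g (W s) q - energy_density A g (W 0) q\<bar> \<le> ?C * \<bar>s\<bar>"
    if q: "q \<in> U" and s: "s \<in> {-\<delta><..<\<delta>}" for q s
  proof -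
    have q': "q \<in> chart_dom c" "coord c q \<in> T" using q by (auto simp: U_def)
    have in_O: "(r, coord c q) \<in> ?O" if "r \<in> {-\<delta><..<\<delta>}" for r using S[OF that] q'(2) ST(5) by blast
    have "norm (energy_density A g (W s) q - energy_density A g (W 0) q) \<le> ?C * norm (s - 0)"
    proof (rule field_differentiable_bound[where S = "{-\<delta><..<\<delta>}"])
      show "((\<lambda>s. energy_density A g (W s) q) has_real_derivative E (r, coord c q)) (at r within {-\<delta><..<\<delta>})"
        if "r \<in> {-\<delta><..<\<delta>}" for r
        using der[of r q] in_O[OF that] q'(1) has_field_derivative_at_within by blast
      show "norm (E (r, coord c q)) \<le> ?C" if "r \<in> {-\<delta><..<\<delta>}" for r
        using in_O[OF that] by simp
    qed (use s \<delta>(1) in auto)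
    then show ?thesis by simp
  qed
  then show "\<exists>U \<delta> C. openin X U \<and> p \<in> U \<and> 0 < \<delta> \<and> 0 \<le> C \<and>
      (\<forall>q\<in>U. \<forall>s\<in>{-\<delta><..<\<delta>}. \<bar>energy_density A g (W s) q - energy_density A g (W 0) q\<bar> \<le> C * \<bar>s\<bar>)"
    using U \<delta>(1) by (intro exI[of _ U] exI[of _ \<delta>] exI[of _ ?C]) auto
qed

lemma compact_complement_open:
  "compactin X K \<Longrightarrow> openin X (topspace X - K)"
  using Hausdorff compactin_imp_closedin by blast

text \<open>The density involves a derivative of the field, hence agreement on a whole
  neighbourhood. It will be applied on the open complement of the compact set outside of which a
  variation is constant.\<close>

lemma energy_density_cong:
  assumes g: "semi_riemannian_metric A g" and V: "C1_field V" "C1_field W" and U: "openin X U" "p \<in> U"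
    and eq: "\<And>c q. c \<in> A \<Longrightarrow> q \<in> chart_dom c \<inter> U \<Longrightarrow> V c (coord c q) = W c (coord c q)"
  shows "energy_density A g V p = energy_density A g W p"
proof -
  have "p \<in> topspace X" using U openin_subset by blast
  then obtain c where c: "c \<in> A" "p \<in> chart_dom c" using Union_chart_dom by blast
  note x = coord_in_image[OF c(2)]
  have o: "open (coord c ` (chart_dom c \<inter> U))" by (rule open_coord_image[OF c(1) U(1)])
  have xo: "coord c p \<in> coord c ` (chart_dom c \<inter> U)" using c(2) U(2) by blast
  have eq': "V c y = W c y" if "y \<in> coord c ` (chart_dom c \<inter> U)" for y using that eq[OF c(1)] by blast
  note dV = differentiableI[OF C1_field_has_derivative[OF V(1) c(1) x]]
  note dW = differentiableI[OF C1_field_has_derivative[OF V(2) c(1) x]]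
  have "frechet_derivative (W c) (at (coord c p)) = frechet_derivative (V c) (at (coord c p))"
    by (rule frechet_derivative_cong_open(1)[OF o xo eq' dV])
  then have "covariant_deriv (g c) (V c) (coord c p) = covariant_deriv (g c) (W c) (coord c p)"
    by (intro ext) (simp add: covariant_deriv_def eq'[OF xo])
  then show ?thesis
    unfolding energy_density_eq[OF g V(1) c] energy_density_eq[OF g V(2) c]
      local_energy_density_eq[where V = V, OF dV] local_energy_density_eq[where V = W, OF dW] by simp
qed

text \<open>Dominated convergence along sequences of times. Outside \<open>K\<close> the difference
  quotients vanish; on \<open>K\<close>, which has finite measure, finitely many of the local
  Lipschitz bounds combine into one constant.\<close>

theorem first_variation:
  assumes g: "semi_riemannian_metric A g" and D: "relatively_compact_domain X D" and \<epsilon>: "\<epsilon> > 0"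
    and W: "\<And>s. s \<in> {-\<epsilon><..<\<epsilon>} \<Longrightarrow> vector_field A (W s)"
    and sm: "\<And>c. c \<in> A \<Longrightarrow> smooth_on ({-\<epsilon><..<\<epsilon>} \<times> chart_image c) (\<lambda>(s, x). W s c x)"
    and K: "compactin X K" "K \<subseteq> D"
    and supp: "\<And>s c p. s \<in> {-\<epsilon><..<\<epsilon>} \<Longrightarrow> c \<in> A \<Longrightarrow> p \<in> chart_dom c - K \<Longrightarrow>
      W s c (coord c p) = W 0 c (coord c p)"
  shows "((\<lambda>s. energy X A g D (W s)) has_real_derivative
    (LINT p:D|volume_measure X A g.
      at_point (deriv_trace g (energy_gradient g (W 0)) (variation_field W)) p)) (at 0)"
proof -
  let ?I = "{-\<epsilon><..<\<epsilon>}" and ?\<mu> = "volume_measure X A g"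
  let ?e = "\<lambda>s. energy_density A g (W s)"
  let ?L = "at_point (deriv_trace g (energy_gradient g (W 0)) (variation_field W))"
  note gc = semi_riemannian_covariant[OF g]
  have 0: "0 \<in> ?I" using \<epsilon> by simp
  have DX: "D \<subseteq> topspace X" using D openin_subset by (auto simp: relatively_compact_domain_def)
  have KX: "K \<subseteq> topspace X" using K DX by blast
  note C1 = vector_field_C1[OF W]
  note C1B = vector_field_C1[OF vector_field_variation_field[OF \<epsilon> W sm]]
  have ce: "continuous_map X euclideanreal (?e s)" if "s \<in> ?I" for s
    by (rule continuous_map_energy_density[OF g C1[OF that]])
  have cL: "continuous_map X euclideanreal ?L"
    by (rule continuous_map_deriv_trace[OF g C1B pointwise_covariant_energy_gradient[OF g C1[OF 0]]
          continuous_on_energy_gradient[OF g C1[OF 0]]])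
  have int: "set_integrable ?\<mu> D f" if "continuous_map X euclideanreal f" for f
    using continuous_imp_set_integrable[OF gc that] D by (auto simp: relatively_compact_domain_def)
  have Ds: "D \<in> sets ?\<mu>"
    using D by (simp add: relatively_compact_domain_def sets_volume_measure[OF gc] openin_borel_of_top)
  have Ks: "K \<in> sets ?\<mu>"
  proof -
    have "topspace X - (topspace X - K) \<in> sets ?\<mu>"
      by (rule sets.Diff) (simp_all add: sets_volume_measure[OF gc] openin_borel_of_top compact_complement_open[OF K(1)])
    moreover have "topspace X - (topspace X - K) = K" using KX by blast
    ultimately show ?thesis by simp
  qed
  have out: "?e s p = ?e 0 p" if s: "s \<in> ?I" and p: "p \<in> topspace X - K" for s p
    by (rule energy_density_cong[OF g C1[OF s] C1[OF 0] compact_complement_open[OF K(1)] p])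
      (rule supp[OF s], auto)
  obtain \<delta> C where \<delta>: "0 < \<delta>" and C: "0 \<le> C"
    and bound: "\<And>q s. q \<in> K \<Longrightarrow> s \<in> {-\<delta><..<\<delta>} \<Longrightarrow> \<bar>?e s q - ?e 0 q\<bar> \<le> C * \<bar>s\<bar>"
  proof -
    have "\<forall>p\<in>K. \<exists>U \<delta> C. openin X U \<and> p \<in> U \<and> 0 < \<delta> \<and> 0 \<le> C \<and>
      (\<forall>q\<in>U. \<forall>s\<in>{-\<delta><..<\<delta>}. \<bar>?e s q - ?e 0 q\<bar> \<le> C * \<bar>s\<bar>)"
      using energy_density_local_bound(1)[OF g \<epsilon> W sm] KX by blast
    then obtain U d B where U: "\<And>p. p \<in> K \<Longrightarrow> openin X (U p) \<and> p \<in> U p \<and> 0 < d p \<and> 0 \<le> B p \<and>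
      (\<forall>q\<in>U p. \<forall>s\<in>{-d p<..<d p}. \<bar>?e s q - ?e 0 q\<bar> \<le> B p * \<bar>s\<bar>)"
      by metis
    have "\<exists>\<F>. finite \<F> \<and> \<F> \<subseteq> U ` K \<and> K \<subseteq> \<Union>\<F>"
      by (rule compactinD[OF K(1)]) (use U in blast)+
    then obtain F where F: "finite F" "F \<subseteq> K" "K \<subseteq> \<Union>(U ` F)"
      by (metis finite_subset_image)
    \<comment> \<open>The inserted 1 gives the minimum a meaning when \<open>K\<close>, and with it
      \<open>F\<close>, is empty. The sum of the nonnegative local constants dominates each of
      them.\<close>
    define \<delta> where "\<delta> = Min (insert 1 (d ` F))"
    define C where "C = (\<Sum>p\<in>F. B p)"
    have nn: "0 \<le> B p" if "p \<in> F" for p using U F(2) that by blast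
    have dpos: "0 < d p" if "p \<in> F" for p using U F(2) that by blast
    show thesis
    proof (rule that[of \<delta> C])
      show "0 < \<delta>" unfolding \<delta>_def using F(1) dpos by simp
      show "0 \<le> C" unfolding C_def using nn by (rule sum_nonneg)
      fix q s assume q: "q \<in> K" and s: "s \<in> {-\<delta><..<\<delta>}"
      obtain p where p: "p \<in> F" "q \<in> U p" using q F(3) by blast
      have "\<delta> \<le> d p" unfolding \<delta>_def using F(1) p(1) by simp
      then have "s \<in> {-d p<..<d p}" using s by auto
      then have "\<bar>?e s q - ?e 0 q\<bar> \<le> B p * \<bar>s\<bar>" using U[of p] p F(2) by blast
      also have "\<dots> \<le> C * \<bar>s\<bar>"
        unfolding C_def using member_le_sum[of p F B] p(1) nn F(1) by (intro mult_right_mono) auto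
      finally show "\<bar>?e s q - ?e 0 q\<bar> \<le> C * \<bar>s\<bar>" .
    qed
  qed
  have "((\<lambda>s. (energy X A g D (W s) - energy X A g D (W 0)) / (s - 0)) \<longlongrightarrow> (LINT p:D|?\<mu>. ?L p)) (at 0)"
    unfolding tendsto_at_iff_sequentially
  proof (intro allI impI)
    fix Y :: "nat \<Rightarrow> real"
    assume Y: "\<forall>i. Y i \<in> UNIV - {0}" "Y \<longlonglongrightarrow> 0"
    have "\<forall>\<^sub>F i in sequentially. \<bar>Y i\<bar> < min \<delta> \<epsilon>"
      using tendstoD[OF Y(2), of "min \<delta> \<epsilon>"] \<delta> \<epsilon> by (simp add: dist_real_def)
    then obtain N where N: "\<And>i. i \<ge> N \<Longrightarrow> \<bar>Y i\<bar> < min \<delta> \<epsilon>"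
      by (auto simp: eventually_sequentially)
    \<comment> \<open>Dropping the first \<open>N\<close> terms brings all times into the intervals
      on which the bounds and the variation are available; the limit is unchanged.\<close>
    define Z where "Z i = Y (i + N)" for i
    have Z: "Z i \<in> ?I" "Z i \<in> {-\<delta><..<\<delta>}" "Z i \<noteq> 0" for i
      using N[of "i + N"] Y(1) by (auto simp: Z_def)
    have Zlim: "Z \<longlonglongrightarrow> 0" unfolding Z_def[abs_def] by (rule LIMSEQ_ignore_initial_segment[OF Y(2)])
    have "(\<lambda>i. LINT p|?\<mu>. indicator D p * ((?e (Z i) p - ?e 0 p) / Z i)) \<longlonglongrightarrow>
        (LINT p|?\<mu>. indicator D p * ?L p)"
    proof (rule integral_dominated_convergence[where w = "\<lambda>p. C * indicator K p"])
      show "(\<lambda>p. indicator D p * ?L p) \<in> borel_measurable ?\<mu>"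
        using continuous_imp_measurable[OF gc cL] Ds by measurable
      show "(\<lambda>p. indicator D p * ((?e (Z i) p - ?e 0 p) / Z i)) \<in> borel_measurable ?\<mu>" for i
        using continuous_imp_measurable[OF gc ce[OF Z(1)]] continuous_imp_measurable[OF gc ce[OF 0]] Ds
        by measurable
      show "integrable ?\<mu> (\<lambda>p. C * indicator K p)"
        using Ks emeasure_volume_compact_finite[OF gc K(1)]
        by (intro integrable_mult_right integrable_real_indicator) auto
      show "AE p in ?\<mu>. (\<lambda>i. indicator D p * ((?e (Z i) p - ?e 0 p) / Z i)) \<longlonglongrightarrow> indicator D p * ?L p"
      proof (rule AE_I2)
        fix p assume "p \<in> space ?\<mu>"
        then have p: "p \<in> topspace X" by (simp add: space_volume_measure[OF gc])
        have "((\<lambda>s. (?e s p - ?e 0 p) / (s - 0)) \<longlongrightarrow> ?L p) (at 0)"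
          using energy_density_local_bound(2)[OF g \<epsilon> W sm p] by (simp add: has_field_derivative_iff)
        then have "(\<lambda>i. (?e (Z i) p - ?e 0 p) / (Z i - 0)) \<longlonglongrightarrow> ?L p"
          using Zlim Z(3) unfolding tendsto_at_iff_sequentially by (auto simp: o_def)
        then show "(\<lambda>i. indicator D p * ((?e (Z i) p - ?e 0 p) / Z i)) \<longlonglongrightarrow> indicator D p * ?L p"
          by (intro tendsto_mult_left) simp
      qed
      show "AE p in ?\<mu>. norm (indicator D p * ((?e (Z i) p - ?e 0 p) / Z i)) \<le> C * indicator K p" for i
      proof (rule AE_I2)
        fix p assume "p \<in> space ?\<mu>"
        then have p: "p \<in> topspace X" by (simp add: space_volume_measure[OF gc])
        show "norm (indicator D p * ((?e (Z i) p - ?e 0 p) / Z i)) \<le> C * indicator K p"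
        proof (cases "p \<in> K")
          case True
          have "\<bar>?e (Z i) p - ?e 0 p\<bar> / \<bar>Z i\<bar> \<le> C"
            using bound[OF True Z(2)] Z(3)[of i] by (simp add: divide_le_eq)
          then show ?thesis using True K(2) by (auto simp: abs_mult)
        next
          case False
          then show ?thesis using out[OF Z(1)] p by simp
        qed
      qed
    qed
    moreover have "(LINT p|?\<mu>. indicator D p * ((?e (Z i) p - ?e 0 p) / Z i)) =
        (energy X A g D (W (Z i)) - energy X A g D (W 0)) / (Z i - 0)" for i
    proof -
      have "energy X A g D (W (Z i)) - energy X A g D (W 0) = (LINT p:D|?\<mu>. ?e (Z i) p - ?e 0 p)"
        unfolding energy_def by (rule set_integral_diff(2)[OF int[OF ce[OF Z(1)]] int[OF ce[OF 0]], symmetric])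
      moreover have "indicator D p * ((?e (Z i) p - ?e 0 p) / Z i) =
          (indicator D p *\<^sub>R (?e (Z i) p - ?e 0 p)) / Z i" for p by simp
      ultimately show ?thesis by (simp add: set_lebesgue_integral_def)
    qed
    ultimately have "(\<lambda>i. (energy X A g D (W (Z i)) - energy X A g D (W 0)) / (Z i - 0)) \<longlonglongrightarrow> (LINT p:D|?\<mu>. ?L p)"
      unfolding set_lebesgue_integral_def real_scaleR_def by (simp only:)
    then show "((\<lambda>s. (energy X A g D (W s) - energy X A g D (W 0)) / (s - 0)) \<circ> Y) \<longlonglongrightarrow> (LINT p:D|?\<mu>. ?L p)"
      unfolding Z_def o_def by (rule LIMSEQ_offset)
  qed
  then show ?thesis by (simp add: has_field_derivative_iff)
qed

end

section \<open>The divergence identity of a paracontact structure\<close>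

lemma gram_matrix_right:
  fixes T :: "real ^ 'n \<Rightarrow> real ^ 'n \<Rightarrow> real"
  assumes "bilinear T" "linear f"
  shows "gram_matrix (\<lambda>a b. T a (f b)) = gram_matrix T ** matrix f"
  by (rule gram_matrix_eqI)
    (simp add: bilinear_eq_gram[OF assms(1)] matrix_vector_mul_assoc[symmetric] matrix_mult_linear[OF assms(2)])

lemma gram_matrix_left:
  fixes T :: "real ^ 'n \<Rightarrow> real ^ 'n \<Rightarrow> real"
  assumes "bilinear T" "linear f"
  shows "gram_matrix (\<lambda>a b. T (f a) b) = transpose (matrix f) ** gram_matrix T"
proof -
  have "bilinear (\<lambda>a b. T b a)" using assms(1) by (auto simp: bilinear_def)
  have "gram_matrix (\<lambda>a b. T (f a) b) = transpose (gram_matrix (\<lambda>a b. T (f b) a))"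
    by (rule transpose_gram_matrix[symmetric])
  also have "\<dots> = transpose (gram_matrix (\<lambda>a b. T b a) ** matrix f)"
    unfolding gram_matrix_right[OF \<open>bilinear (\<lambda>a b. T b a)\<close> assms(2)] ..
  finally show ?thesis by (simp only: matrix_transpose_mul transpose_gram_matrix)
qed

text \<open>In matrices adjointness says that the inverse Gram matrix intertwines the transpose of
  \<open>f\<close> with \<open>f'\<close>; cyclicity of the trace then brings the map to the other
  argument.\<close>

lemma metric_trace_adjoint:
  fixes G T :: "real ^ 'n \<Rightarrow> real ^ 'n \<Rightarrow> real"
  assumes G: "metric_form G" and T: "bilinear T" and f: "linear f" "linear f'"
    and adj: "\<And>v w. G (f v) w = G v (f' w)"
  shows "metric_trace G (\<lambda>a b. T a (f b)) = metric_trace G (\<lambda>a b. T (f' a) b)"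
proof -
  let ?G = "gram_matrix G" and ?T = "gram_matrix T" and ?f = "matrix f" and ?f' = "matrix f'"
  note GG = matrix_inv_mult[OF invertible_gram_matrix[OF G]]
  note b = metric_formD(1)[OF G]
  have "transpose ?f ** ?G = ?G ** ?f'"
    using gram_matrix_left[OF b f(1)] gram_matrix_right[OF b f(2)] adj by simp
  then have "matrix_inv ?G ** (transpose ?f ** ?G) ** matrix_inv ?G = matrix_inv ?G ** (?G ** ?f') ** matrix_inv ?G"
    by simp
  then have sw: "matrix_inv ?G ** transpose ?f = ?f' ** matrix_inv ?G"
    by (metis GG matrix_mul_assoc matrix_mul_lid matrix_mul_rid)
  have "metric_trace G (\<lambda>a b. T a (f b)) = trace (matrix_inv ?G ** transpose ?f ** transpose ?T)"
    by (simp add: metric_trace_eq_trace gram_matrix_right[OF T f(1)] matrix_transpose_mul matrix_mul_assoc)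
  also have "\<dots> = trace (?f' ** (matrix_inv ?G ** transpose ?T))"
    by (simp add: sw matrix_mul_assoc)
  also have "\<dots> = trace (matrix_inv ?G ** transpose ?T ** ?f')"
    by (rule trace_mul_sym)
  also have "\<dots> = metric_trace G (\<lambda>a b. T (f' a) b)"
    by (simp add: metric_trace_eq_trace gram_matrix_left[OF T f(2)] matrix_transpose_mul matrix_mul_assoc)
  finally show ?thesis .
qed

text \<open>Lowering and raising an index cancel. Applied to the derivative of a vector field, this
  turns a metric trace into the coordinate divergence.\<close>

lemma metric_trace_endomorphism:
  fixes G :: "real ^ 'n \<Rightarrow> real ^ 'n \<Rightarrow> real"
  assumes G: "metric_form G" and f: "linear f"
  shows "metric_trace G (\<lambda>a b. G a (f b)) = (\<Sum>i\<in>UNIV. f (axis i 1) $ i)"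
proof -
  let ?G = "gram_matrix G" and ?f = "matrix f"
  note GG = matrix_inv_mult[OF invertible_gram_matrix[OF G]]
  have "metric_trace G (\<lambda>a b. G a (f b)) = trace (matrix_inv ?G ** (transpose ?f ** ?G))"
    by (simp add: metric_trace_eq_trace gram_matrix_right[OF metric_formD(1)[OF G] f]
        matrix_transpose_mul gram_matrix_symmetric[OF G])
  also have "\<dots> = trace (transpose ?f ** ?G ** matrix_inv ?G)" by (rule trace_mul_sym)
  also have "\<dots> = trace ?f" by (simp add: matrix_mul_assoc[symmetric] GG trace_transpose)
  finally show ?thesis by (simp add: trace_def matrix_def)
qed

text \<open>Raising the index of the form \<open>G u\<close> returns \<open>u\<close>, into which
  \<alpha> is then evaluated.\<close>

lemma metric_trace_rank_one:
  fixes G :: "real ^ 'n \<Rightarrow> real ^ 'n \<Rightarrow> real"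
  assumes G: "metric_form G" and \<alpha>: "linear \<alpha>"
  shows "metric_trace G (\<lambda>a b. \<alpha> a * G u b) = \<alpha> u"
proof -
  note GG = matrix_inv_mult[OF invertible_gram_matrix[OF G]]
  have Gu: "G u (axis j 1) = (gram_matrix G *v u) $ j" for j
    using bilinear_eq_gram[OF metric_formD(1)[OF G], of "axis j 1" u] metric_formD(2)[OF G, of u "axis j 1"]
    by (simp add: inner_axis')
  have "metric_trace G (\<lambda>a b. \<alpha> a * G u b) =
      (\<Sum>i\<in>UNIV. \<alpha> (axis i 1) * (matrix_inv (gram_matrix G) *v (gram_matrix G *v u)) $ i)"
    unfolding metric_trace_def matrix_vector_mult_def[of "matrix_inv (gram_matrix G)"]
    by (simp add: Gu sum_distrib_left mult_ac)
  also have "\<dots> = (\<Sum>i\<in>UNIV. u $ i * \<alpha> (axis i 1))"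
    by (simp add: matrix_vector_mul_assoc GG mult.commute)
  also have "\<dots> = \<alpha> (\<Sum>i\<in>UNIV. (u $ i) *\<^sub>R axis i 1)"
    by (simp add: linear_sum[OF \<alpha>] linear_cmul[OF \<alpha>])
  finally show ?thesis by (simp only: vec_eq_sum_axis[symmetric])
qed

text \<open>Moving the skew map to the other argument changes the sign, while exchanging the
  arguments changes nothing, neither in the trace nor in the symmetric \<open>T\<close>.\<close>

lemma metric_trace_skew_symmetric:
  fixes G T :: "real ^ 'n \<Rightarrow> real ^ 'n \<Rightarrow> real"
  assumes G: "metric_form G" and T: "bilinear T" "\<And>v w. T v w = T w v"
    and f: "linear f" "\<And>v w. G (f v) w = - G v (f w)"
  shows "metric_trace G (\<lambda>a b. T a (f b)) = 0"
proof -
  have nf: "linear (\<lambda>v. - f v)" by (rule linear_compose_neg[OF f(1)])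
  have adj: "G (f v) w = G v (- f w)" for v w
    using f(2) bilinear_rneg[OF metric_formD(1)[OF G]] by simp
  have "metric_trace G (\<lambda>a b. T a (f b)) = metric_trace G (\<lambda>a b. T (- f a) b)"
    by (rule metric_trace_adjoint[OF G T(1) f(1) nf adj])
  also have "\<dots> = metric_trace G (\<lambda>a b. (-1) * T b (f a))"
  proof (rule arg_cong[where f = "metric_trace G"], intro ext)
    show "T (- f a) b = (-1) * T b (f a)" for a b
      using T(2)[of "f a" b] by (simp add: bilinear_lneg[OF T(1)])
  qed
  also have "\<dots> = - metric_trace G (\<lambda>a b. T b (f a))"
    unfolding metric_trace_cmult by simp
  also have "\<dots> = - metric_trace G (\<lambda>a b. T a (f b))"
    by (simp only: metric_trace_flip[OF G, of "\<lambda>a b. T a (f b)"])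
  finally show ?thesis by simp
qed

text \<open>A permutation other than the identity moves at least two indices. After one factor of
  its product has been differentiated, another off-diagonal entry of the identity matrix remains and
  is 0.\<close>

lemma has_derivative_det_identity:
  fixes M :: "'a::real_normed_vector \<Rightarrow> real ^ 'n ^ 'n"
  assumes d: "\<And>i j. ((\<lambda>y. M y $ i $ j) has_derivative M' i j) (at x)" and id: "M x = mat 1"
  shows "((\<lambda>y. det (M y)) has_derivative (\<lambda>a. \<Sum>i\<in>UNIV. M' i i a)) (at x)"
proof -
  have "((\<lambda>y. \<Sum>p | p permutes UNIV. of_int (sign p) * (\<Prod>i\<in>UNIV. M y $ i $ p i)) has_derivative
     (\<lambda>a. \<Sum>p | p permutes UNIV. of_int (sign p) *
        (\<Sum>i\<in>UNIV. M' i (p i) a * (\<Prod>j\<in>UNIV - {i}. M x $ j $ p j)))) (at x)"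
    by (intro has_derivative_sum has_derivative_mult_right has_derivative_prod d)
  moreover have "(\<Sum>p | p permutes UNIV. of_int (sign p) *
        (\<Sum>i\<in>UNIV. M' i (p i) a * (\<Prod>j\<in>UNIV - {i}. M x $ j $ p j))) = (\<Sum>i\<in>UNIV. M' i i a)" for a
  proof -
    have z: "of_int (sign p) * (\<Sum>i\<in>UNIV. M' i (p i) a * (\<Prod>j\<in>UNIV - {i}. M x $ j $ p j)) = 0"
      if p: "p \<in> {p. p permutes UNIV} - {id}" for p
    proof -
      have "(\<Prod>j\<in>UNIV - {i}. M x $ j $ p j) = 0" for i
      proof -
        have inj: "inj p" using p permutes_inj by blast
        have "\<exists>j. j \<noteq> i \<and> p j \<noteq> j"
        proof (rule ccontr)
          assume "\<not> ?thesis"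
          then have fix_j: "p j = j" if "j \<noteq> i" for j using that by blast
          have "p i = i"
          proof (rule ccontr)
            assume "p i \<noteq> i"
            then have "p (p i) = p i" using fix_j by blast
            then show False using inj \<open>p i \<noteq> i\<close> by (meson injD)
          qed
          then have "p = id" using fix_j by (intro ext) (metis id_apply)
          then show False using p by simp
        qed
        then obtain j where "j \<noteq> i" "p j \<noteq> j" by blast
        then have "M x $ j $ p j = 0" by (simp add: id mat_def)
        then show ?thesis using \<open>j \<noteq> i\<close> by (intro prod_zero) auto
      qed
      then show ?thesis by (simp only: mult_zero_right sum.neutral_const)
    qed
    have "(\<Sum>p | p permutes UNIV. of_int (sign p) *
        (\<Sum>i\<in>UNIV. M' i (p i) a * (\<Prod>j\<in>UNIV - {i}. M x $ j $ p j))) =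
      (\<Sum>p\<in>{id}. of_int (sign p) * (\<Sum>i\<in>UNIV. M' i (p i) a * (\<Prod>j\<in>UNIV - {i}. M x $ j $ p j)))"
      by (rule sum.mono_neutral_right) (use z permutes_id in auto)
    also have "\<dots> = (\<Sum>i\<in>UNIV. M' i i a)"
      by (simp add: id mat_def sign_id)
    finally show ?thesis .
  qed
  ultimately show ?thesis by (simp add: det_def)
qed

text \<open>Jacobi's formula, reduced to the identity by multiplying with the fixed matrix
  \<open>matrix_inv (M x)\<close>.\<close>

lemma has_derivative_det:
  fixes M :: "'a::real_normed_vector \<Rightarrow> real ^ 'n ^ 'n"
  assumes d: "\<And>i j. ((\<lambda>y. M y $ i $ j) has_derivative (\<lambda>a. M' a $ i $ j)) (at x)"
    and inv: "invertible (M x)"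
  shows "((\<lambda>y. det (M y)) has_derivative (\<lambda>a. det (M x) * trace (matrix_inv (M x) ** M' a))) (at x)"
proof -
  note MM = matrix_inv_mult[OF inv]
  have "((\<lambda>y. (matrix_inv (M x) ** M y) $ i $ j) has_derivative (\<lambda>a. (matrix_inv (M x) ** M' a) $ i $ j)) (at x)" for i j
    unfolding matrix_matrix_mult_def by (auto intro!: derivative_eq_intros d)
  from has_derivative_det_identity[OF this MM(1)]
  have "((\<lambda>y. det (M x) * det (matrix_inv (M x) ** M y)) has_derivative
      (\<lambda>a. det (M x) * trace (matrix_inv (M x) ** M' a))) (at x)"
    unfolding trace_def by (rule has_derivative_mult_right)
  moreover have "det (M x) * det (matrix_inv (M x) ** M y) = det (M y)" for y
    by (simp add: det_mul[symmetric] matrix_mul_assoc MM)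
  ultimately show ?thesis by simp
qed

text \<open>The sign of \<open>f\<close> is constant near \<open>x\<close>, where the absolute value
  is multiplication by \<open>sgn (f x)\<close>. The result is arranged as half a logarithmic
  derivative.\<close>

lemma has_derivative_sqrt_abs:
  fixes f :: "'a::real_normed_vector \<Rightarrow> real"
  assumes d: "(f has_derivative f') (at x)" and nz: "f x \<noteq> 0"
  shows "((\<lambda>y. sqrt \<bar>f y\<bar>) has_derivative (\<lambda>a. sqrt \<bar>f x\<bar> * (f' a / (2 * f x)))) (at x)"
proof -
  have c: "(f \<longlongrightarrow> f x) (at x)" using has_derivative_continuous[OF d] by (simp add: continuous_within)
  have pos: "0 < sgn (f x) * f x" using nz by (auto simp: sgn_if)
  have ev: "\<forall>\<^sub>F y in at x. sqrt (sgn (f x) * f y) = sqrt \<bar>f y\<bar>"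
  proof (cases "f x > 0")
    case True
    then have "\<forall>\<^sub>F y in at x. f y > 0" using c order_tendstoD(1) by blast
    then show ?thesis by eventually_elim (use True in simp)
  next
    case False
    then have "f x < 0" using nz by simp
    then have "\<forall>\<^sub>F y in at x. f y < 0" using c order_tendstoD(2) by blast
    then show ?thesis by eventually_elim (use \<open>f x < 0\<close> in simp)
  qed
  have abs: "sgn (f x) * f x = \<bar>f x\<bar>" by (simp add: abs_sgn mult.commute)
  have "((\<lambda>y. sqrt (sgn (f x) * f y)) has_derivative
      (\<lambda>a. sgn (f x) * f' a * (inverse (sqrt (sgn (f x) * f x)) / 2))) (at x)"
    using pos by (auto intro!: derivative_eq_intros d)
  moreover have "sgn (f x) * f' a * (inverse (sqrt (sgn (f x) * f x)) / 2) = sqrt \<bar>f x\<bar> * (f' a / (2 * f x))" for a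
  proof -
    have quot: "sgn (f x) / sqrt \<bar>f x\<bar> = sqrt \<bar>f x\<bar> / f x"
    proof (cases "f x > 0")
      case True
      then show ?thesis using sqrt_divide_self_eq[of "f x"] by (simp add: inverse_eq_divide)
    next
      case False
      then show ?thesis using sqrt_divide_self_eq[of "- f x"] nz by (simp add: inverse_eq_divide)
    qed
    have "p * q * (inverse r / 2) = q / 2 * (p / r)" for p q r :: real
      by (simp add: inverse_eq_divide mult.commute)
    then have "sgn (f x) * f' a * (inverse (sqrt (sgn (f x) * f x)) / 2) = f' a / 2 * (sgn (f x) / sqrt \<bar>f x\<bar>)"
      unfolding abs .
    also have "\<dots> = sqrt \<bar>f x\<bar> * (f' a / (2 * f x))"
      unfolding quot by simp
    finally show ?thesis .
  qed
  ultimately have "((\<lambda>y. sqrt (sgn (f x) * f y)) has_derivative (\<lambda>a. sqrt \<bar>f x\<bar> * (f' a / (2 * f x)))) (at x)"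
    by (simp only:)
  then show ?thesis by (rule has_derivative_transform_eventually[OF _ ev]) (simp_all add: abs)
qed

section \<open>Paracontact structures in a single chart and the divergence of
  \<phi>\<open>B\<close>\<close>

locale local_paracontact =
  fixes G :: "real ^ 'n \<Rightarrow> real ^ 'n \<Rightarrow> real ^ 'n \<Rightarrow> real" and S :: "(real ^ 'n) set"
    and \<phi> :: "real ^ 'n \<Rightarrow> real ^ 'n \<Rightarrow> real ^ 'n" and \<xi> :: "real ^ 'n \<Rightarrow> real ^ 'n"
    and \<eta> :: "real ^ 'n \<Rightarrow> real ^ 'n \<Rightarrow> real"
  assumes mG: "metric_on G S"
    and smooth_xi: "smooth_on S \<xi>"
    and smooth_eta: "smooth_on S (\<lambda>x. \<eta> x v)"
    and linear_phi: "x \<in> S \<Longrightarrow> linear (\<phi> x)" and smooth_phi: "smooth_on S (\<lambda>x. \<phi> x v)"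
    and eta_eq: "x \<in> S \<Longrightarrow> \<eta> x v = G x (\<xi> x) v"
    and deta_eq: "x \<in> S \<Longrightarrow> (frechet_derivative (\<lambda>y. \<eta> y w) (at x) v - frechet_derivative (\<lambda>y. \<eta> y v) (at x) w) / 2 =
      G x v (\<phi> x w)"
    and phi_phi: "x \<in> S \<Longrightarrow> \<phi> x (\<phi> x v) = v - \<eta> x v *\<^sub>R \<xi> x"
    and eta_xi: "x \<in> S \<Longrightarrow> \<eta> x (\<xi> x) = 1"
    and omega_xi: "x \<in> S \<Longrightarrow> G x (\<xi> x) (\<phi> x v) = 0"
begin

abbreviation "deta x a v \<equiv> frechet_derivative (\<lambda>y. \<eta> y v) (at x) a"

definition "\<omega> x v w = G x v (\<phi> x w)"

lemmas oS = metric_onD(1)[OF mG]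
lemmas mf = metric_onD(2)[OF mG]
lemmas bG = metric_formD(1)[OF mf]
lemmas symG = metric_formD(2)[OF mf]

lemma omega_eq: "x \<in> S \<Longrightarrow> \<omega> x v w = (deta x v w - deta x w v) / 2"
  unfolding \<omega>_def by (rule deta_eq[symmetric])

lemma omega_skew: "x \<in> S \<Longrightarrow> \<omega> x v w = - \<omega> x w v"
  by (simp only: omega_eq minus_divide_left minus_diff_eq)

lemma phi_skew: "x \<in> S \<Longrightarrow> G x (\<phi> x v) w = - G x v (\<phi> x w)"
  using omega_skew[of x w v] symG[of x "\<phi> x v" w] by (simp add: \<omega>_def)

lemma phi_xi: "x \<in> S \<Longrightarrow> \<phi> x (\<xi> x) = 0"
proof (rule metric_form_cancel[OF mf])
  show "G x (\<phi> x (\<xi> x)) z = G x 0 z" if "x \<in> S" for z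
    by (simp only: phi_skew[OF that] omega_xi[OF that] bilinear_lzero[OF bG[OF that]] minus_zero)
qed

lemma eta_phi: "x \<in> S \<Longrightarrow> \<eta> x (\<phi> x v) = 0"
  by (simp add: eta_eq omega_xi)

lemma linear_eta: "x \<in> S \<Longrightarrow> linear (\<eta> x)"
  by (intro linearI) (simp_all add: eta_eq bilinear_radd[OF bG] bilinear_rmul[OF bG])

lemma bilinear_omega: "x \<in> S \<Longrightarrow> bilinear (\<omega> x)"
  unfolding bilinear_def \<omega>_def
  by (intro conjI allI linearI)
    (simp_all add: bilinear_ladd[OF bG] bilinear_lmul[OF bG] bilinear_radd[OF bG] bilinear_rmul[OF bG]
      linear_add[OF linear_phi] linear_cmul[OF linear_phi])

lemma Ck_on_omega: "Ck_on k (\<lambda>x. \<omega> x v w) S"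
proof -
  have "Ck_on k (\<lambda>x. (1 / 2) * (deta x v w - deta x w v)) S"
    by (intro Ck_on_mult[OF oS] Ck_on_const Ck_on_diff[OF oS]
        smooth_on_imp_Ck[OF smooth_on_frechet_derivative[OF smooth_eta]])
  then show ?thesis by (rule Ck_on_cong[OF oS, rotated]) (simp add: omega_eq)
qed

lemma bilinear_on_omega: "bilinear_on \<omega> S"
  unfolding bilinear_on_def using oS bilinear_omega Ck_on_omega by (simp add: smooth_on_def)

lemma domega_eq:
  assumes "x \<in> S"
  shows "dform \<omega> x a v w = (frechet_derivative (\<lambda>y. deta y v w) (at x) a -
    frechet_derivative (\<lambda>y. deta y w v) (at x) a) / 2"
proof -
  have d: "((\<lambda>y. deta y v w) has_derivative frechet_derivative (\<lambda>y. deta y v w) (at x)) (at x)" for v w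
    by (rule smooth_on_has_derivative[OF smooth_on_frechet_derivative[OF smooth_eta] assms])
  have "((\<lambda>y. (deta y v w - deta y w v) / 2) has_derivative (\<lambda>a. (frechet_derivative (\<lambda>y. deta y v w) (at x) a -
    frechet_derivative (\<lambda>y. deta y w v) (at x) a) / 2)) (at x)"
    by (rule bounded_linear.has_derivative[OF bounded_linear_divide has_derivative_diff[OF d d]])
  then have "((\<lambda>y. \<omega> y v w) has_derivative (\<lambda>a. (frechet_derivative (\<lambda>y. deta y v w) (at x) a -
    frechet_derivative (\<lambda>y. deta y w v) (at x) a) / 2)) (at x)"
    by (rule has_derivative_transform_within_open[OF _ oS assms]) (simp add: omega_eq)
  from frechet_derivative_eqI[OF this] show ?thesis by simp
qed

text \<open>This is \<open>d(d\<eta>) = 0\<close> on constant vectors: the six second derivatives of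
  \<eta> cancel in pairs by their symmetry.\<close>

lemma domega_closed:
  assumes "x \<in> S"
  shows "dform \<omega> x a v w + dform \<omega> x v w a + dform \<omega> x w a v = 0"
proof -
  have s: "frechet_derivative (\<lambda>y. deta y v w) (at x) a = frechet_derivative (\<lambda>y. deta y a w) (at x) v" for a v w
    by (rule second_derivative_symmetric_real[OF smooth_on_imp_Ck[OF smooth_eta] oS assms])
  have cyc: "(p - q) / 2 + (r - p') / 2 + (q' - r') / 2 = 0" if "p = p'" "q = q'" "r = r'"
    for p q r p' q' r' :: real
    using that by (simp add: diff_divide_distrib)
  show ?thesis
    unfolding domega_eq[OF assms] by (rule cyc[OF s s s])
qed

lemma domega_skew:
  assumes "x \<in> S"
  shows "dform \<omega> x a v w = - dform \<omega> x a w v"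
  unfolding domega_eq[OF assms] minus_divide_left minus_diff_eq ..

text \<open>The metric trace on the left is twice the logarithmic derivative of the volume density
  along \<phi>\<open>B\<close>, so the left-hand side is a divergence. Closedness trades the
  derivative of \<omega> along \<phi>\<open>B\<close> for derivatives of the form
  \<open>\<omega>(\<phi>B, \<cdot>) = - G(B, \<cdot>)\<close>, whose trace against \<phi> contains
  the wanted trace and minus the coordinate divergence.\<close>

lemma horizontal_divergence:
  assumes x: "x \<in> S" and B: "(B has_derivative B') (at x)" and hor: "\<And>y. y \<in> S \<Longrightarrow> \<eta> y (B y) = 0"
    and Z: "((\<lambda>y. \<phi> y (B y)) has_derivative Z') (at x)"
  shows "(\<Sum>i\<in>UNIV. Z' (axis i 1) $ i) + metric_trace (G x) (\<lambda>a b.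
      dform \<omega> x (\<phi> x (B x)) a (\<phi> x b + \<eta> x b *\<^sub>R \<xi> x) +
      (deta x (\<phi> x (B x)) a * \<eta> x (\<phi> x b + \<eta> x b *\<^sub>R \<xi> x) +
       \<eta> x a * deta x (\<phi> x (B x)) (\<phi> x b + \<eta> x b *\<^sub>R \<xi> x))) / 2 =
    metric_trace (G x) (\<lambda>a b. \<omega> x a (covariant_deriv G B x b))"
proof -
  let ?tr = "metric_trace (G x)" and ?\<phi> = "\<phi> x" and ?\<xi> = "\<xi> x" and ?\<eta> = "\<eta> x" and ?B = "B x"
  let ?Z = "?\<phi> ?B" and ?n = "covariant_deriv G B x"
  note m = mf[OF x] and b = bG[OF x] and sG = symG[OF x]
  note lp = linear_phi[OF x] and le = linear_eta[OF x]
  have lB: "linear B'" and lZ: "linear Z'" using B Z has_derivative_linear by blast+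
  have ln: "linear ?n" by (rule linear_covariant_deriv[OF mG x differentiableI[OF B]])
  note bo = bilinear_omega[OF x]
  note dG = dform_linear[OF metric_on_bilinear_on[OF mG] x]
  note dO = dform_linear[OF bilinear_on_omega x]
  have de: "linear (\<lambda>v. deta x a v)" for a
    by (rule linear_frechet_derivative_family[OF oS x linear_eta])
      (use differentiableI[OF smooth_on_has_derivative[OF smooth_eta x]] in auto)
  have adj: "?tr (\<lambda>a b. T a (?\<phi> b)) = - ?tr (\<lambda>a b. T (?\<phi> a) b)" if T: "bilinear T" for T
  proof -
    have "?tr (\<lambda>a b. T a (?\<phi> b)) = ?tr (\<lambda>a b. T (- ?\<phi> a) b)"
      by (rule metric_trace_adjoint[OF m T lp linear_compose_neg[OF lp]])
        (simp add: phi_skew[OF x] bilinear_rneg[OF b])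
    also have "\<dots> = ?tr (\<lambda>a b. (-1) * T (?\<phi> a) b)" by (simp add: bilinear_lneg[OF T])
    finally show ?thesis unfolding metric_trace_cmult by simp
  qed
  have rank: "?tr (\<lambda>a b. \<alpha> a * ?\<eta> b) = \<alpha> ?\<xi>" "?tr (\<lambda>a b. ?\<eta> a * \<alpha> b) = \<alpha> ?\<xi>" if "linear \<alpha>" for \<alpha>
  proof -
    show 1: "?tr (\<lambda>a b. \<alpha> a * ?\<eta> b) = \<alpha> ?\<xi>"
      unfolding eta_eq[OF x] by (rule metric_trace_rank_one[OF m that])
    have "?tr (\<lambda>a b. ?\<eta> a * \<alpha> b) = ?tr (\<lambda>a b. \<alpha> b * ?\<eta> a)" by (simp only: mult.commute)
    also have "\<dots> = ?tr (\<lambda>a b. \<alpha> a * ?\<eta> b)" by (rule metric_trace_flip[OF m])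
    finally show "?tr (\<lambda>a b. ?\<eta> a * \<alpha> b) = \<alpha> ?\<xi>" using 1 by simp
  qed
  \<comment> \<open>\<beta> is the derivative of the one-form \<open>G(B, \<cdot>)\<close>. By
    Koszul's formula the covariant derivative of \<open>B\<close>, paired with \<open>a\<close>, is
    \<beta> minus the symmetric form \<open>Sy\<close>; a trace against the skew \<phi> does not see
    \<open>Sy\<close>.\<close>
  define \<beta> where "\<beta> u a = dform G x u ?B a + G x (B' u) a" for u a
  define Sy where "Sy u a = (dform G x u ?B a - dform G x ?B u a + dform G x a ?B u) / 2" for u a
  define N where "N = ?tr (\<lambda>a b. \<omega> x a (?n b))"
  have bbeta: "bilinear \<beta>"
    unfolding bilinear_def \<beta>_def
    by (intro conjI allI linearI)
      (simp_all add: linear_add[OF dG(1)] linear_cmul[OF dG(1)] linear_add[OF dG(3)] linear_cmul[OF dG(3)]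
        linear_add[OF lB] linear_cmul[OF lB] bilinear_ladd[OF b] bilinear_lmul[OF b] bilinear_radd[OF b]
        bilinear_rmul[OF b] distrib_left)
  have dGs: "dform G x u v w = dform G x u w v" for u v w by (rule dform_symmetric[OF mG x])
  have bSy: "bilinear Sy"
    unfolding bilinear_def Sy_def
    by (intro conjI allI linearI)
      (simp_all add: linear_add[OF dG(1)] linear_cmul[OF dG(1)] linear_add[OF dG(2)] linear_cmul[OF dG(2)]
        linear_add[OF dG(3)] linear_cmul[OF dG(3)] field_simps)
  have sSy: "Sy u a = Sy a u" for u a
    unfolding Sy_def dGs[where u = ?B and v = u and w = a] by simp
  have cov: "G x (?n u) a = \<beta> u a - Sy u a" for u a
  proof -
    have 1: "frechet_derivative B (at x) = B'" by (rule frechet_derivative_eqI[OF B])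
    have "2 * G x (?n u) a = 2 * G x (B' u) a + (dform G x u ?B a + dform G x ?B u a - dform G x a u ?B)"
      unfolding covariant_deriv_def bilinear_ladd[OF b] distrib_left christoffel_koszul[OF mG x] 1 ..
    then show ?thesis
      unfolding \<beta>_def Sy_def using dGs[where u = a and v = u and w = ?B] by (simp add: field_simps)
  qed
  have btn: "bilinear (\<lambda>a c. G x a (?n c))"
    unfolding bilinear_def
    by (intro conjI allI linearI)
      (simp_all add: linear_add[OF ln] linear_cmul[OF ln] bilinear_ladd[OF b] bilinear_lmul[OF b]
        bilinear_radd[OF b] bilinear_rmul[OF b])
  have N\<beta>: "N = ?tr (\<lambda>a b. \<beta> (?\<phi> b) a)"
  proof -
    have "N = ?tr (\<lambda>a b. (-1) * G x (?\<phi> a) (?n b))"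
      unfolding N_def \<omega>_def by (simp add: phi_skew[OF x])
    also have "\<dots> = - ?tr (\<lambda>a b. G x (?\<phi> a) (?n b))" unfolding metric_trace_cmult by simp
    also have "\<dots> = ?tr (\<lambda>a b. G x a (?n (?\<phi> b)))" using adj[OF btn] by simp
    also have "\<dots> = ?tr (\<lambda>a b. \<beta> (?\<phi> b) a + (-1) * Sy a (?\<phi> b))"
    proof (rule arg_cong[where f = ?tr], intro ext)
      show "G x a (?n (?\<phi> c)) = \<beta> (?\<phi> c) a + (-1) * Sy a (?\<phi> c)" for a c
        using cov[of "?\<phi> c" a] sG[of a "?n (?\<phi> c)"] sSy[of a "?\<phi> c"] by simp
    qed
    also have "\<dots> = ?tr (\<lambda>a b. \<beta> (?\<phi> b) a)"
      unfolding metric_trace_add metric_trace_cmult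
        metric_trace_skew_symmetric[OF m bSy sSy lp phi_skew[OF x]] by simp
    finally show ?thesis .
  qed
  \<comment> \<open>Since \<open>B\<close> is horizontal,
    \<open>\<omega>(\<phi>B, a) = - G(B, a)\<close>. Differentiating both sides along
    \<open>u\<close> shows that \<open>- Q u a\<close> is the part in which only \<omega> is
    differentiated.\<close>
  define Q where "Q u a = \<beta> u a + \<omega> x (Z' u) a" for u a
  have bQ: "bilinear Q"
    using bbeta lZ bo unfolding bilinear_def Q_def
    by (intro conjI allI linearI)
      (simp_all add: bilinear_ladd[OF bbeta] bilinear_lmul[OF bbeta] bilinear_radd[OF bbeta] bilinear_rmul[OF bbeta]
        linear_add[OF lZ] linear_cmul[OF lZ] bilinear_ladd[OF bo] bilinear_lmul[OF bo]
        bilinear_radd[OF bo] bilinear_rmul[OF bo] distrib_left)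
  have dQ: "dform \<omega> x u ?Z a = - Q u a" for u a
  proof -
    have c: "((\<lambda>y. a) has_derivative (\<lambda>u. 0)) (at x)" by (rule has_derivative_const)
    have 1: "((\<lambda>y. \<omega> y (\<phi> y (B y)) a) has_derivative
        (\<lambda>u. dform \<omega> x u ?Z a + \<omega> x (Z' u) a + \<omega> x ?Z 0)) (at x)"
      by (rule has_derivative_bilinear_on[OF bilinear_on_omega x has_derivative_ident Z c])
    have "((\<lambda>y. G y (B y) a) has_derivative (\<lambda>u. dform G x u ?B a + G x (B' u) a + G x ?B 0)) (at x)"
      by (rule has_derivative_bilinear_on[OF metric_on_bilinear_on[OF mG] x has_derivative_ident B c])
    then have 2: "((\<lambda>y. - G y (B y) a) has_derivative (\<lambda>u. - (dform G x u ?B a + G x (B' u) a + G x ?B 0))) (at x)"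
      by (rule has_derivative_minus)
    have eq: "- G y (B y) a = \<omega> y (\<phi> y (B y)) a" if y: "y \<in> S" for y
      unfolding \<omega>_def phi_skew[OF y] phi_phi[OF y] bilinear_rsub[OF bG[OF y]] bilinear_rmul[OF bG[OF y]]
      using hor[OF y] eta_eq[OF y, of "B y"] symG[OF y, of "B y" "\<xi> y"] by simp
    have "(\<lambda>u. dform \<omega> x u ?Z a + \<omega> x (Z' u) a + \<omega> x ?Z 0) =
        (\<lambda>u. - (dform G x u ?B a + G x (B' u) a + G x ?B 0))"
      by (rule has_derivative_unique[OF 1 has_derivative_transform_within_open[OF 2 oS x eq]])
    from fun_cong[OF this, of u] show ?thesis
      by (simp add: Q_def \<beta>_def bilinear_rzero[OF b] bilinear_rzero[OF bo])
  qed
  \<comment> \<open>Of the three cyclic terms of closedness, the two that are not derivatives along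
    \<open>?Z\<close> have \<open>?Z\<close> as an argument and are expressed by
    \<open>Q\<close>.\<close>
  have d\<omega>: "dform \<omega> x ?Z a c = Q c a - Q a c" for a c
    using domega_closed[OF x, where a = ?Z and v = a and w = c] domega_skew[OF x, where a = a and v = c and w = ?Z] dQ[of a c] dQ[of c a] by simp
  \<comment> \<open>In the \<omega>-part of \<open>Q\<close> the second \<phi> is moved over to the
    first; \<open>\<phi>\<^sup>2 = I - \<eta> \<otimes> \<xi>\<close> then yields minus the
    coordinate divergence and a correction along \<xi>.\<close>
  have trQ: "?tr (\<lambda>a b. Q (?\<phi> b) a) = N - (\<Sum>i\<in>UNIV. Z' (axis i 1) $ i) + ?\<eta> (Z' ?\<xi>)"
  proof -
    have bT: "bilinear (\<lambda>a c. G x (?\<phi> a) (Z' c))"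
      unfolding bilinear_def
      by (intro conjI allI linearI)
        (simp_all add: linear_add[OF lZ] linear_cmul[OF lZ] linear_add[OF lp] linear_cmul[OF lp]
          bilinear_ladd[OF b] bilinear_lmul[OF b] bilinear_radd[OF b] bilinear_rmul[OF b])
    have "?tr (\<lambda>a b. \<omega> x (Z' (?\<phi> b)) a) = ?tr (\<lambda>a b. G x (?\<phi> a) (Z' (?\<phi> b)))"
    proof (rule arg_cong[where f = ?tr], intro ext)
      show "\<omega> x (Z' (?\<phi> c)) a = G x (?\<phi> a) (Z' (?\<phi> c))" for a c
        using sG[of "Z' (?\<phi> c)" "?\<phi> a"] by (simp add: \<omega>_def)
    qed
    also have "\<dots> = - ?tr (\<lambda>a b. G x (?\<phi> (?\<phi> a)) (Z' b))" by (rule adj[OF bT])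
    also have "\<dots> = - ?tr (\<lambda>a b. G x a (Z' b) + (-1) * (?\<eta> a * ?\<eta> (Z' b)))"
      by (simp add: phi_phi[OF x] bilinear_lsub[OF b] bilinear_lmul[OF b] eta_eq[OF x])
    also have "\<dots> = - (\<Sum>i\<in>UNIV. Z' (axis i 1) $ i) + ?\<eta> (Z' ?\<xi>)"
      unfolding metric_trace_add metric_trace_cmult metric_trace_endomorphism[OF m lZ]
      using rank(2)[of "\<lambda>v. ?\<eta> (Z' v)"] linear_compose[OF lZ le] by (simp add: o_def)
    finally show ?thesis unfolding Q_def metric_trace_add N\<beta> by simp
  qed
  have tr\<omega>: "?tr (\<lambda>a b. dform \<omega> x ?Z a (?\<phi> b)) = 2 * ?tr (\<lambda>a b. Q (?\<phi> b) a)"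
  proof -
    have "?tr (\<lambda>a b. dform \<omega> x ?Z a (?\<phi> b)) = ?tr (\<lambda>a b. Q (?\<phi> b) a + (-1) * Q a (?\<phi> b))"
      by (simp add: d\<omega>)
    also have "\<dots> = ?tr (\<lambda>a b. Q (?\<phi> b) a) + ?tr (\<lambda>a b. Q (?\<phi> a) b)"
      unfolding metric_trace_add metric_trace_cmult adj[OF bQ] by simp
    also have "?tr (\<lambda>a b. Q (?\<phi> a) b) = ?tr (\<lambda>a b. Q (?\<phi> b) a)"
      using metric_trace_flip[OF m, of "\<lambda>a b. Q (?\<phi> b) a"] by simp
    finally show ?thesis by simp
  qed
  \<comment> \<open>The correction along \<xi> is removed by differentiating
    \<open>\<eta>(\<phi>B) = 0\<close> along \<xi>, together with
    \<open>d\<eta>(\<xi>, \<cdot>) = 0\<close>, which exchanges the two arguments in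
    \<open>deta_Z\<close>.\<close>
  have eta_Z: "?\<eta> (Z' ?\<xi>) + deta x ?\<xi> ?Z = 0"
  proof -
    have 1: "((\<lambda>y. \<eta> y (\<phi> y (B y))) has_derivative (\<lambda>u. deta x u ?Z + ?\<eta> (Z' u))) (at x)"
      by (rule has_derivative_linear_family[OF oS x linear_eta _ has_derivative_ident Z])
        (use differentiableI[OF smooth_on_has_derivative[OF smooth_eta x]] in auto)
    have 2: "((\<lambda>y. \<eta> y (\<phi> y (B y))) has_derivative (\<lambda>u. 0)) (at x)"
      by (rule has_derivative_transform_within_open[OF has_derivative_const[of 0] oS x]) (simp add: eta_phi)
    from fun_cong[OF has_derivative_unique[OF 1 2], of ?\<xi>] show ?thesis by simp
  qed
  have deta_Z: "deta x ?Z ?\<xi> = deta x ?\<xi> ?Z"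
    using omega_eq[OF x, of ?\<xi> ?Z] omega_xi[OF x, of ?Z] by (simp add: \<omega>_def)
  have "?tr (\<lambda>a b. dform \<omega> x ?Z a (?\<phi> b + ?\<eta> b *\<^sub>R ?\<xi>) +
      (deta x ?Z a * ?\<eta> (?\<phi> b + ?\<eta> b *\<^sub>R ?\<xi>) + ?\<eta> a * deta x ?Z (?\<phi> b + ?\<eta> b *\<^sub>R ?\<xi>))) =
    ?tr (\<lambda>a b. (dform \<omega> x ?Z a (?\<phi> b) + dform \<omega> x ?Z a ?\<xi> * ?\<eta> b) +
      (deta x ?Z a * ?\<eta> b + (?\<eta> a * deta x ?Z (?\<phi> b) + deta x ?Z ?\<xi> * (?\<eta> a * ?\<eta> b))))"
    by (simp add: linear_add[OF dO(3)] linear_cmul[OF dO(3)] linear_add[OF le] linear_cmul[OF le]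
        linear_add[OF de] linear_cmul[OF de] eta_phi[OF x] eta_xi[OF x] algebra_simps)
  also have "\<dots> = 2 * (N - (\<Sum>i\<in>UNIV. Z' (axis i 1) $ i) + ?\<eta> (Z' ?\<xi>)) + 2 * deta x ?Z ?\<xi>"
  proof -
    have "linear (\<lambda>v. deta x ?Z (?\<phi> v))" using linear_compose[OF lp de] by (simp add: o_def)
    moreover have "dform \<omega> x ?Z ?\<xi> ?\<xi> = 0" using domega_skew[OF x, where a = ?Z and v = ?\<xi> and w = ?\<xi>] by simp
    ultimately show ?thesis
      unfolding metric_trace_add metric_trace_cmult rank(1)[OF dO(2)] rank(1)[OF de] rank(2)[OF le]
      by (simp add: rank(2) tr\<omega> trQ phi_xi[OF x] linear_0[OF de] eta_xi[OF x])
  qed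
  moreover have "t + (2 * (r - t + e) + 2 * d) / 2 = r" if "e + d' = 0" "d = d'" for t r e d d' :: real
    using that by (simp add: field_simps)
  ultimately show ?thesis
    unfolding N_def[symmetric] using eta_Z deta_Z by (simp only:)
qed

text \<open>The volume density is computed from \<open>d\<eta> + \<eta> \<otimes> \<eta> = g(\<cdot>, F \<cdot>)\<close>, where \<open>F = \<phi> + \<eta> \<otimes> \<xi>\<close> is an
  involution.\<close>

lemma has_derivative_volume_density:
  assumes x: "x \<in> S"
  shows "((\<lambda>y. sqrt \<bar>det (gram_matrix (G y))\<bar>) has_derivative
    (\<lambda>u. sqrt \<bar>det (gram_matrix (G x))\<bar> * (metric_trace (G x) (\<lambda>a b.
      dform \<omega> x u a (\<phi> x b + \<eta> x b *\<^sub>R \<xi> x) +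
      (deta x u a * \<eta> x (\<phi> x b + \<eta> x b *\<^sub>R \<xi> x) +
       \<eta> x a * deta x u (\<phi> x b + \<eta> x b *\<^sub>R \<xi> x))) / 2))) (at x)"
proof -
  define F where "F y v = \<phi> y v + \<eta> y v *\<^sub>R \<xi> y" for y v
  \<comment> \<open>Differentiating \<open>M\<close> instead of the Gram matrix produces derivatives
    of \<omega> and \<eta>, to which closedness applies, and none of the metric.\<close>
  define M where "M y = gram_matrix (\<lambda>a b. \<omega> y a b + \<eta> y a * \<eta> y b)" for y
  define T where "T u a b = dform \<omega> x u a b + (deta x u a * \<eta> x b + \<eta> x a * deta x u b)" for u a b
  have lF: "linear (F y)" if "y \<in> S" for y
    unfolding F_def
    by (intro linearI) (simp_all add: linear_add[OF linear_phi[OF that]] linear_cmul[OF linear_phi[OF that]]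
        linear_add[OF linear_eta[OF that]] linear_cmul[OF linear_eta[OF that]] algebra_simps)
  have FF: "F y (F y v) = v" if y: "y \<in> S" for y v
    unfolding F_def linear_add[OF linear_phi[OF y]] linear_cmul[OF linear_phi[OF y]]
      linear_add[OF linear_eta[OF y]] linear_cmul[OF linear_eta[OF y]]
    by (simp add: phi_phi[OF y] phi_xi[OF y] eta_phi[OF y] eta_xi[OF y])
  have MF: "M y = gram_matrix (G y) ** matrix (F y)" if y: "y \<in> S" for y
  proof -
    have "M y = gram_matrix (\<lambda>a b. G y a (F y b))"
      unfolding M_def
    proof (rule arg_cong[where f = gram_matrix], intro ext)
      show "\<omega> y a c + \<eta> y a * \<eta> y c = G y a (F y c)" for a c
        using symG[OF y, of a "\<xi> y"] eta_eq[OF y, of a]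
        by (simp add: F_def \<omega>_def bilinear_radd[OF bG[OF y]] bilinear_rmul[OF bG[OF y]])
    qed
    then show ?thesis by (simp add: gram_matrix_right[OF bG[OF y] lF[OF y]])
  qed
  have mFF: "matrix (F y) ** matrix (F y) = mat 1" if "y \<in> S" for y
    using FF[OF that] by (simp add: matrix_eq matrix_vector_mul_assoc[symmetric] matrix_mult_linear[OF lF[OF that]])
  have det1: "\<bar>det (matrix (F y))\<bar> = 1" if "y \<in> S" for y
  proof -
    have "det (matrix (F y)) * det (matrix (F y)) = 1"
      using mFF[OF that] by (metis det_I det_mul)
    then show ?thesis by (metis abs_mult_self_eq abs_1 abs_square_eq_1 power2_eq_square)
  qed
  have detM: "\<bar>det (M y)\<bar> = \<bar>det (gram_matrix (G y))\<bar>" if "y \<in> S" for y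
    using det1[OF that] by (simp add: MF[OF that] det_mul abs_mult)
  note GG = matrix_inv_mult[OF invertible_gram_matrix[OF mf[OF x]]]
  have "matrix (F x) ** matrix_inv (gram_matrix (G x)) ** (gram_matrix (G x) ** matrix (F x)) =
      matrix (F x) ** (matrix_inv (gram_matrix (G x)) ** gram_matrix (G x)) ** matrix (F x)"
    by (simp add: matrix_mul_assoc)
  also have "\<dots> = mat 1" by (simp add: GG mFF[OF x])
  finally have left: "(matrix (F x) ** matrix_inv (gram_matrix (G x))) ** M x = mat 1"
    unfolding MF[OF x] .
  have invM: "invertible (M x)" using left invertible_left_inverse by blast
  have inv: "matrix_inv (M x) = matrix (F x) ** matrix_inv (gram_matrix (G x))"
    by (rule matrix_inv_eqI[OF left])
  have nz: "det (M x) \<noteq> 0" using invM invertible_det_nz by blast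
  have entries: "((\<lambda>y. M y $ i $ j) has_derivative (\<lambda>u. gram_matrix (T u) $ i $ j)) (at x)" for i j
    unfolding M_def gram_matrix_def T_def
    by (auto intro!: derivative_eq_intros bilinear_on_has_derivative[OF bilinear_on_omega x]
        smooth_on_has_derivative[OF smooth_eta x] simp: algebra_simps)
  have bT: "bilinear (T u)" for u
  proof -
    have de: "linear (\<lambda>v. deta x u v)"
      by (rule linear_frechet_derivative_family[OF oS x linear_eta])
        (use differentiableI[OF smooth_on_has_derivative[OF smooth_eta x]] in auto)
    note dO = dform_linear[OF bilinear_on_omega x] and le = linear_eta[OF x]
    show ?thesis
      unfolding bilinear_def T_def
      by (intro conjI allI linearI)
        (simp_all add: linear_add[OF dO(2)] linear_cmul[OF dO(2)] linear_add[OF dO(3)] linear_cmul[OF dO(3)]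
          linear_add[OF de] linear_cmul[OF de] linear_add[OF le] linear_cmul[OF le] algebra_simps)
  qed
  have tr: "trace (matrix_inv (M x) ** gram_matrix (T u)) = metric_trace (G x) (\<lambda>a b. T u a (F x b))" for u
  proof -
    have "trace (matrix_inv (M x) ** gram_matrix (T u)) =
        trace (matrix (F x) ** (matrix_inv (gram_matrix (G x)) ** gram_matrix (T u)))"
      unfolding inv by (simp add: matrix_mul_assoc)
    also have "\<dots> = trace (matrix_inv (gram_matrix (G x)) ** (gram_matrix (T u) ** matrix (F x)))"
      by (subst trace_mul_sym) (simp add: matrix_mul_assoc)
    also have "\<dots> = metric_trace (G x) (\<lambda>a b. T u b (F x a))"
      unfolding metric_trace_eq_trace transpose_gram_matrix gram_matrix_right[OF bT lF[OF x]] ..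
    also have "\<dots> = metric_trace (G x) (\<lambda>a b. T u a (F x b))"
      by (rule metric_trace_flip[OF mf[OF x]])
    finally show ?thesis .
  qed
  have "((\<lambda>y. sqrt \<bar>det (M y)\<bar>) has_derivative (\<lambda>u. sqrt \<bar>det (M x)\<bar> *
      (det (M x) * trace (matrix_inv (M x) ** gram_matrix (T u)) / (2 * det (M x))))) (at x)"
    by (rule has_derivative_sqrt_abs[OF has_derivative_det[OF entries invM] nz])
  then have "((\<lambda>y. sqrt \<bar>det (M y)\<bar>) has_derivative (\<lambda>u. sqrt \<bar>det (gram_matrix (G x))\<bar> *
      (metric_trace (G x) (\<lambda>a b. T u a (F x b)) / 2))) (at x)"
    using nz by (simp add: tr detM[OF x])
  then have "((\<lambda>y. sqrt \<bar>det (gram_matrix (G y))\<bar>) has_derivative (\<lambda>u. sqrt \<bar>det (gram_matrix (G x))\<bar> *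
      (metric_trace (G x) (\<lambda>a b. T u a (F x b)) / 2))) (at x)"
    by (rule has_derivative_transform_within_open[OF _ oS x]) (simp add: detM)
  then show ?thesis by (simp only: T_def F_def)
qed

text \<open>The identity in the form that can be integrated over a chart: the density is moved
  inside, and the left-hand side becomes a sum of partial derivatives. The product rule supplies the
  logarithmic derivative that \<open>horizontal_divergence\<close> expects.\<close>

theorem weighted_divergence:
  assumes x: "x \<in> S" and B: "Ck_on (Suc 0) B S" and hor: "\<And>y. y \<in> S \<Longrightarrow> \<eta> y (B y) = 0"
  shows "(\<Sum>i\<in>UNIV. frechet_derivative (\<lambda>y. (sqrt \<bar>det (gram_matrix (G y))\<bar> *\<^sub>R \<phi> y (B y)) $ i) (at x) (axis i 1)) =
    sqrt \<bar>det (gram_matrix (G x))\<bar> * metric_trace (G x) (\<lambda>a b. \<omega> x a (covariant_deriv G B x b))"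
proof -
  let ?\<rho> = "\<lambda>y. sqrt \<bar>det (gram_matrix (G y))\<bar>"
  obtain \<rho>' where \<rho>': "(?\<rho> has_derivative \<rho>') (at x)" and
    \<rho>'_eq: "\<rho>' u = ?\<rho> x * (metric_trace (G x) (\<lambda>a b.
      dform \<omega> x u a (\<phi> x b + \<eta> x b *\<^sub>R \<xi> x) +
      (deta x u a * \<eta> x (\<phi> x b + \<eta> x b *\<^sub>R \<xi> x) +
       \<eta> x a * deta x u (\<phi> x b + \<eta> x b *\<^sub>R \<xi> x))) / 2)" for u
    using has_derivative_volume_density[OF x] by blast
  note Bd = Ck_on_imp_has_derivative[OF B x]
  obtain Z' where Z: "((\<lambda>y. \<phi> y (B y)) has_derivative Z') (at x)"
    using has_derivative_linear_family[OF oS x linear_phi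
        differentiableI[OF smooth_on_has_derivative[OF smooth_phi x]] has_derivative_ident Bd] by blast
  have l: "linear \<rho>'" using \<rho>' has_derivative_linear by blast
  have "frechet_derivative (\<lambda>y. (?\<rho> y *\<^sub>R \<phi> y (B y)) $ i) (at x) (axis i 1) =
      ?\<rho> x * Z' (axis i 1) $ i + \<phi> x (B x) $ i * \<rho>' (axis i 1)" for i
  proof -
    have "((\<lambda>y. (?\<rho> y *\<^sub>R \<phi> y (B y)) $ i) has_derivative
        (\<lambda>u. (?\<rho> x *\<^sub>R Z' u + \<rho>' u *\<^sub>R \<phi> x (B x)) $ i)) (at x)"
      by (rule bounded_linear.has_derivative[OF bounded_linear_vec_nth has_derivative_scaleR[OF \<rho>' Z]])
    from frechet_derivative_eqI[OF this] show ?thesis by (simp add: mult.commute)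
  qed
  then have "(\<Sum>i\<in>UNIV. frechet_derivative (\<lambda>y. (?\<rho> y *\<^sub>R \<phi> y (B y)) $ i) (at x) (axis i 1)) =
      ?\<rho> x * (\<Sum>i\<in>UNIV. Z' (axis i 1) $ i) + (\<Sum>i\<in>UNIV. \<phi> x (B x) $ i * \<rho>' (axis i 1))"
    by (simp add: sum.distrib sum_distrib_left)
  also have "(\<Sum>i\<in>UNIV. \<phi> x (B x) $ i * \<rho>' (axis i 1)) = \<rho>' (\<Sum>i\<in>UNIV. (\<phi> x (B x) $ i) *\<^sub>R axis i 1)"
    by (simp add: linear_sum[OF l] linear_cmul[OF l])
  also have "\<dots> = \<rho>' (\<phi> x (B x))" by (simp only: vec_eq_sum_axis[symmetric])
  finally show ?thesis
    unfolding \<rho>'_eq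
    using arg_cong[OF horizontal_divergence[OF x Bd hor Z], of "\<lambda>z. ?\<rho> x * z"] by (simp only: distrib_left)
qed

end

section \<open>The integral of a divergence\<close>

text \<open>Translation invariance of Lebesgue measure makes the integral of every difference
  quotient vanish; dominated convergence passes to the derivative.\<close>

lemma integral_directional_derivative:
  fixes u :: "'a::euclidean_space \<Rightarrow> real"
  assumes d: "\<And>x. (u has_derivative u' x) (at x)" and c: "continuous_on UNIV (\<lambda>x. u' x e)"
    and K: "compact K" "\<And>x. x \<notin> K \<Longrightarrow> u x = 0"
  shows "(LINT x|lborel. u' x e) = 0"
proof -
  from compact_imp_bounded[OF K(1)] obtain R where "R > 0" "\<forall>x\<in>K. norm x \<le> R"
    unfolding bounded_pos by (elim exE conjE)
  then have R: "R > 0" "K \<subseteq> cball 0 R" by auto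
  \<comment> \<open>With steps of length at most \<open>norm e\<close>, every difference quotient
    vanishes outside \<open>?C\<close>, and the segments that start in \<open>?C\<close> stay in
    \<open>?C'\<close>, where the derivative is bounded.\<close>
  let ?C = "cball (0::'a) (R + norm e)" and ?C' = "cball (0::'a) (R + 2 * norm e)"
  have cu: "continuous_on UNIV u"
    using d has_derivative_continuous by (metis continuous_at_imp_continuous_on)
  have iu: "integrable lborel u"
  proof -
    have "integrable lborel (\<lambda>x. indicator (cball 0 R) x *\<^sub>R u x)"
      by (rule borel_integrable_compact) (use cu continuous_on_subset in auto)
    moreover have "(\<lambda>x. indicator (cball 0 R) x *\<^sub>R u x) = u"
    proof
      fix x
      show "indicator (cball 0 R) x *\<^sub>R u x = u x"
        using K(2)[of x] subsetD[OF R(2), of x] by (cases "x \<in> K") (simp_all add: indicator_def)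
    qed
    ultimately show ?thesis by simp
  qed
  have "compact ((\<lambda>x. u' x e) ` ?C')"
    by (intro compact_continuous_image continuous_on_subset[OF c]) auto
  from compact_imp_bounded[OF this] obtain b where "\<forall>y\<in>(\<lambda>x. u' x e) ` ?C'. norm y \<le> b"
    unfolding bounded_iff ..
  then have b: "\<bar>u' x e\<bar> \<le> b" if "x \<in> ?C'" for x using that by auto
  define h where "h n = inverse (real (Suc n))" for n
  have h: "0 < h n" "h n \<le> 1" for n by (auto simp: h_def field_simps)
  have hlim: "h \<longlonglongrightarrow> 0" unfolding h_def[abs_def] by (rule LIMSEQ_inverse_real_of_nat)
  define f where "f n x = (u (x + h n *\<^sub>R e) - u x) / h n" for n x
  have trans: "(LINT x|lborel. u (x + a)) = (LINT x|lborel. u x)" "integrable lborel (\<lambda>x. u (x + a))" for a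
  proof -
    have meas: "(\<lambda>x. a + x) \<in> measurable lborel borel" "u \<in> borel_measurable borel"
      using cu by (auto intro: borel_measurable_continuous_onI)
    have "(LINT x|lborel. u x) = (LINT x|distr lborel borel ((+) a). u x)" by (simp add: lborel_distr_plus)
    also have "\<dots> = (LINT x|lborel. u (a + x))" by (rule integral_distr[OF meas])
    finally show "(LINT x|lborel. u (x + a)) = (LINT x|lborel. u x)" by (simp add: add.commute)
    have "integrable (distr lborel borel ((+) a)) u" using iu by (simp add: lborel_distr_plus)
    then show "integrable lborel (\<lambda>x. u (x + a))"
      by (subst (asm) integrable_distr_eq[OF meas]) (simp add: add.commute)
  qed
  have "(LINT x|lborel. f n x) = 0" for n
    unfolding f_def using trans[of "h n *\<^sub>R e"] iu by simp
  moreover have "(\<lambda>n. LINT x|lborel. f n x) \<longlonglongrightarrow> (LINT x|lborel. u' x e)"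
  proof (rule integral_dominated_convergence[where w = "\<lambda>x. indicator ?C x *\<^sub>R b"])
    show "(\<lambda>x. u' x e) \<in> borel_measurable lborel"
      using c by (auto intro: borel_measurable_continuous_onI)
    show "f n \<in> borel_measurable lborel" for n
      unfolding f_def using trans(2)[of "h n *\<^sub>R e"] iu by (intro borel_measurable_divide borel_measurable_diff) auto
    show "integrable lborel (\<lambda>x. indicator ?C x *\<^sub>R b)"
      by (rule borel_integrable_compact) auto
    show "AE x in lborel. (\<lambda>n. f n x) \<longlonglongrightarrow> u' x e"
    proof (rule AE_I2)
      fix x
      have "((\<lambda>s. x + s *\<^sub>R e) has_derivative (\<lambda>s. s *\<^sub>R e)) (at 0)" by (auto intro!: derivative_eq_intros)
      from has_derivative_compose[OF this, of u "u' (x + 0 *\<^sub>R e)"]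
      have "((\<lambda>s. u (x + s *\<^sub>R e)) has_derivative (\<lambda>s. u' x (s *\<^sub>R e))) (at 0)" using d by simp
      moreover have "u' x (s *\<^sub>R e) = u' x e * s" for s
        using linear_cmul[OF has_derivative_linear[OF d]] by simp
      ultimately have "((\<lambda>s. u (x + s *\<^sub>R e)) has_real_derivative u' x e) (at 0)"
        by (simp add: has_field_derivative_def)
      then have "((\<lambda>s. (u (x + s *\<^sub>R e) - u x) / s) \<longlongrightarrow> u' x e) (at 0)"
        by (simp add: has_field_derivative_iff)
      then show "(\<lambda>n. f n x) \<longlonglongrightarrow> u' x e"
        using hlim h(1) unfolding tendsto_at_iff_sequentially f_def by (auto simp: o_def less_le)
    qed
    show "AE x in lborel. norm (f n x) \<le> indicator ?C x *\<^sub>R b" for n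
    proof (rule AE_I2)
      fix x
      show "norm (f n x) \<le> indicator ?C x *\<^sub>R b"
      proof (cases "x \<in> ?C")
        case True
        have in_C: "x + s *\<^sub>R e \<in> ?C'" if "0 \<le> s" "s \<le> h n" for s
        proof -
          have "norm (x + s *\<^sub>R e) \<le> norm x + \<bar>s\<bar> * norm e" by (metis norm_scaleR norm_triangle_ineq)
          also have "\<bar>s\<bar> * norm e \<le> 1 * norm e" using that h(2)[of n] by (intro mult_right_mono) auto
          finally show ?thesis using True by simp
        qed
        have der: "((\<lambda>s. u (x + s *\<^sub>R e)) has_real_derivative u' (x + s *\<^sub>R e) e) (at s within {0..h n})" for s
        proof -
          have "((\<lambda>s. x + s *\<^sub>R e) has_derivative (\<lambda>s. s *\<^sub>R e)) (at s)" by (auto intro!: derivative_eq_intros)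
          from has_derivative_compose[OF this d]
          have "((\<lambda>s. u (x + s *\<^sub>R e)) has_derivative (\<lambda>r. u' (x + s *\<^sub>R e) (r *\<^sub>R e))) (at s)" .
          moreover have "u' (x + s *\<^sub>R e) (r *\<^sub>R e) = u' (x + s *\<^sub>R e) e * r" for r
            using linear_cmul[OF has_derivative_linear[OF d]] by simp
          ultimately show ?thesis
            by (simp add: has_field_derivative_def has_derivative_at_withinI)
        qed
        have "norm (u (x + h n *\<^sub>R e) - u (x + 0 *\<^sub>R e)) \<le> b * norm (h n - 0)"
        proof (rule field_differentiable_bound[of "{0..h n}" "\<lambda>s. u (x + s *\<^sub>R e)"])
          show "norm (u' (x + s *\<^sub>R e) e) \<le> b" if "s \<in> {0..h n}" for s
            using b[OF in_C] that by simp
        qed (use der h(1)[of n] in auto)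
        then show ?thesis
          using True h(1)[of n] by (simp add: f_def divide_le_eq)
      next
        case False
        have "x \<notin> K"
          using False R by (auto simp: subset_iff)
             (smt (verit) norm_ge_zero)
        moreover have "x + h n *\<^sub>R e \<notin> K"
        proof
          assume "x + h n *\<^sub>R e \<in> K"
          then have "norm (x + h n *\<^sub>R e) \<le> R" using R by auto
          moreover have "norm x \<le> norm (x + h n *\<^sub>R e) + norm (h n *\<^sub>R e)"
            using norm_triangle_ineq4[of "x + h n *\<^sub>R e" "h n *\<^sub>R e"] by simp
          moreover have "norm (h n *\<^sub>R e) \<le> 1 * norm e"
            unfolding norm_scaleR using h[of n] by (intro mult_right_mono) auto
          ultimately show False using False by simp
        qed
        ultimately show ?thesis using False K(2) by (simp add: f_def)
      qed
    qed
  qed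
  ultimately show ?thesis by (simp add: LIMSEQ_const_iff)
qed

lemma Ck_on_open_Un:
  assumes "open S" "open T" "Ck_on k f S" "Ck_on k f T"
  shows "Ck_on k f (S \<union> T)"
  using assms(3,4)
proof (induction k arbitrary: f)
  case 0
  then show ?case using continuous_on_open_Un assms(1,2) by simp
next
  case (Suc k)
  then show ?case by auto
qed

text \<open>Extended by 0, \<open>w\<close> is continuously differentiable on \<open>S\<close> and
  on the complement of \<open>K\<close>. These are open and cover the whole space.\<close>

lemma integral_derivative_compact_support:
  fixes w :: "real ^ 'n \<Rightarrow> real"
  assumes S: "open S" and w: "Ck_on (Suc 0) w S" and K: "compact K" "K \<subseteq> S" "\<And>x. x \<in> S - K \<Longrightarrow> w x = 0"
  shows "(LINT x:S|lborel. frechet_derivative w (at x) e) = 0"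
    and "set_integrable lborel S (\<lambda>x. frechet_derivative w (at x) e)"
proof -
  define u where "u x = (if x \<in> S then w x else 0)" for x
  have uS: "Ck_on (Suc 0) u S" by (rule Ck_on_cong[OF S _ w]) (simp add: u_def)
  have oK: "open (- K)" using K(1) compact_imp_closed by blast
  have uK: "Ck_on (Suc 0) u (- K)"
    by (rule Ck_on_cong[OF oK _ Ck_on_const[of _ 0]]) (use K(3) in \<open>auto simp: u_def\<close>)
  have "S \<union> - K = UNIV" using K(2) by auto
  then have u: "Ck_on (Suc 0) u UNIV" using Ck_on_open_Un[OF S oK uS uK] by simp
  have d0: "frechet_derivative u (at x) = (\<lambda>v. 0)" if "x \<notin> K" for x
  proof (rule frechet_derivative_eqI)
    show "(u has_derivative (\<lambda>v. 0)) (at x)"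
      by (rule has_derivative_transform_within_open[OF has_derivative_const[of 0] oK])
        (use that K(3) in \<open>auto simp: u_def\<close>)
  qed
  have dS: "frechet_derivative u (at x) = frechet_derivative w (at x)" if "x \<in> S" for x
    by (rule frechet_derivative_cong_open(1)[OF S that, of w u])
      (use w that in \<open>auto simp: u_def\<close>)
  have eq: "indicator S x *\<^sub>R frechet_derivative w (at x) e = frechet_derivative u (at x) e" for x
  proof (cases "x \<in> S")
    case False
    then have "x \<notin> K" using K(2) by blast
    with False show ?thesis by (simp add: d0)
  qed (simp add: dS)
  have "(LINT x|lborel. frechet_derivative u (at x) e) = 0"
  proof (rule integral_directional_derivative[OF _ _ K(1)])
    show "(u has_derivative frechet_derivative u (at x)) (at x)" for x
      by (rule Ck_on_imp_has_derivative[OF u]) simp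
    show "continuous_on UNIV (\<lambda>x. frechet_derivative u (at x) e)"
      using Ck_on_imp_continuous[OF Ck_on_frechet_derivative[OF u]] .
    show "u x = 0" if "x \<notin> K" for x using that K(3) by (simp add: u_def)
  qed
  then show "(LINT x:S|lborel. frechet_derivative w (at x) e) = 0"
    unfolding set_lebesgue_integral_def eq .
  have "integrable lborel (\<lambda>x. indicator K x *\<^sub>R frechet_derivative u (at x) e)"
    by (rule borel_integrable_compact[OF K(1)])
      (rule continuous_on_subset[OF Ck_on_imp_continuous[OF Ck_on_frechet_derivative[OF u]]], simp)
  moreover have "indicator K x *\<^sub>R frechet_derivative u (at x) e = indicator S x *\<^sub>R frechet_derivative w (at x) e" for x
    unfolding eq using d0[of x] by (cases "x \<in> K") auto
  ultimately show "set_integrable lborel S (\<lambda>x. frechet_derivative w (at x) e)"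
    by (simp add: set_integrable_def)
qed

section \<open>Continuously differentiable cutoff functions\<close>

lemma Ck1_on_compose_real:
  fixes f :: "'a::real_normed_vector \<Rightarrow> real" and F :: "real \<Rightarrow> real"
  assumes S: "open S" and f: "Ck_on (Suc 0) f S"
    and F: "\<And>t. (F has_real_derivative F' t) (at t)" "continuous_on UNIV F'"
  shows "Ck_on (Suc 0) (\<lambda>x. F (f x)) S"
proof (rule Ck_on_SucI[OF S])
  fix x assume x: "x \<in> S"
  have "(F has_derivative (*) (F' (f x))) (at (f x))" using F(1) by (simp add: has_field_derivative_def)
  from has_derivative_compose[OF Ck_on_imp_has_derivative[OF f x] this]
  show "((\<lambda>x. F (f x)) has_derivative (\<lambda>v. F' (f x) * frechet_derivative f (at x) v)) (at x)" .
next
  fix v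
  have "continuous_on S (\<lambda>x. F' (f x))"
    by (rule continuous_on_compose2[OF F(2) Ck_on_imp_continuous[OF f]]) simp
  then show "Ck_on 0 (\<lambda>x. F' (f x) * frechet_derivative f (at x) v) S"
    using Ck_on_imp_continuous[OF Ck_on_frechet_derivative[OF f]] by (simp add: continuous_on_mult)
qed

lemma Ck1_on_compose:
  fixes \<tau> :: "'a::real_normed_vector \<Rightarrow> real ^ 'n" and f :: "real ^ 'n \<Rightarrow> 'b::real_normed_vector"
  assumes S: "open S" and \<tau>: "Ck_on (Suc 0) \<tau> S" and f: "Ck_on (Suc 0) f T" and im: "\<And>x. x \<in> S \<Longrightarrow> \<tau> x \<in> T"
  shows "Ck_on (Suc 0) (\<lambda>x. f (\<tau> x)) S"
proof (rule Ck_on_SucI[OF S])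
  fix x assume x: "x \<in> S"
  from has_derivative_compose[OF Ck_on_imp_has_derivative[OF \<tau> x] Ck_on_imp_has_derivative[OF f im[OF x]]]
  show "((\<lambda>x. f (\<tau> x)) has_derivative (\<lambda>v. frechet_derivative f (at (\<tau> x)) (frechet_derivative \<tau> (at x) v))) (at x)" .
next
  fix v
  have "continuous_on S (\<lambda>x. frechet_derivative f (at (\<tau> x)) (frechet_derivative \<tau> (at x) v))"
  proof (rule continuous_on_linear_family[where S = T])
    show "linear (frechet_derivative f (at y))" if "y \<in> T" for y
      using has_derivative_linear[OF Ck_on_imp_has_derivative[OF f that]] .
    show "continuous_on T (\<lambda>y. frechet_derivative f (at y) v)" for v
      by (rule Ck_on_imp_continuous[OF Ck_on_frechet_derivative[OF f]])
    show "continuous_on S \<tau>" by (rule Ck_on_imp_continuous[OF \<tau>])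
    show "continuous_on S (\<lambda>x. frechet_derivative \<tau> (at x) v)"
      by (rule Ck_on_imp_continuous[OF Ck_on_frechet_derivative[OF \<tau>]])
  qed (rule im)
  then show "Ck_on 0 (\<lambda>x. frechet_derivative f (at (\<tau> x)) (frechet_derivative \<tau> (at x) v)) S" by simp
qed

text \<open>Squaring removes the corner of the positive part at 0, since the difference quotient
  there is the positive part itself. The cutoff function is assembled from this function and
  polynomials.\<close>

lemma has_real_derivative_positive_part_square:
  "((\<lambda>t::real. (max 0 t)\<^sup>2) has_real_derivative 2 * max 0 t) (at t)"
proof -
  consider "t > 0" | "t < 0" | "t = 0" by linarith
  then show ?thesis
  proof cases
    case 1
    have "((\<lambda>t. t\<^sup>2) has_real_derivative 2 * t) (at t)" by (auto intro!: derivative_eq_intros)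
    then have "((\<lambda>t. (max 0 t)\<^sup>2) has_real_derivative 2 * t) (at t)"
      by (rule DERIV_cong_ev[THEN iffD1, OF refl _ refl, rotated])
        (use 1 in \<open>auto simp: eventually_nhds intro!: exI[of _ "{0<..}"]\<close>)
    then show ?thesis using 1 by simp
  next
    case 2
    have "((\<lambda>t. 0) has_real_derivative 0) (at t)" by simp
    then have "((\<lambda>t. (max 0 t)\<^sup>2) has_real_derivative 0) (at t)"
      by (rule DERIV_cong_ev[THEN iffD1, OF refl _ refl, rotated])
        (use 2 in \<open>auto simp: eventually_nhds intro!: exI[of _ "{..<0}"]\<close>)
    then show ?thesis using 2 by simp
  next
    case 3
    have "((\<lambda>s::real. max 0 s) \<longlongrightarrow> max 0 0) (at 0)" by (intro tendsto_intros)
    moreover have "max 0 s = ((max 0 s)\<^sup>2 - 0) / (s - 0)" if "s \<noteq> 0" for s :: real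
      using that by (auto simp: max_def power2_eq_square)
    ultimately have "((\<lambda>s::real. ((max 0 s)\<^sup>2 - 0) / (s - 0)) \<longlongrightarrow> 0) (at 0)"
      by (metis (mono_tags, lifting) Lim_cong_within max.idem UNIV_I)
    then show ?thesis unfolding 3 by (simp add: has_field_derivative_iff)
  qed
qed

lemma C1_cutoff_exists:
  fixes x :: "real ^ 'n"
  assumes r: "r > 0"
  obtains h where "Ck_on (Suc 0) h (UNIV :: (real ^ 'n) set)" "\<And>y. y \<in> ball x (r / 2) \<Longrightarrow> h y = (1::real)"
    "\<And>y. y \<notin> ball x r \<Longrightarrow> h y = 0"
proof -
  let ?p = "\<lambda>t::real. (max 0 t)\<^sup>2"
  define q where "q y = r\<^sup>2 - (y - x) \<bullet> (y - x)" for y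
  \<comment> \<open>On the half ball \<open>q \<ge> 3/4 r\<^sup>2\<close>, so the inner square is at
    least \<open>9/16 r\<^sup>4\<close>; the factor \<open>4 / r\<^sup>4\<close> lifts it to
    \<open>9/4\<close>, beyond 1, and the outer square vanishes. Outside the ball
    \<open>q \<le> 0\<close>, and \<open>h\<close> is \<open>1 - 1\<close>.\<close>
  define h where "h y = 1 - ?p (1 - 4 / r ^ 4 * ?p (q y))" for y
  have p: "Ck_on (Suc 0) (\<lambda>y. ?p (f y)) UNIV" if "Ck_on (Suc 0) f (UNIV :: (real ^ 'n) set)" for f
    by (rule Ck1_on_compose_real[OF open_UNIV that has_real_derivative_positive_part_square])
      (intro continuous_intros)
  have "Ck_on (Suc 0) h UNIV"
    unfolding h_def q_def
    by (intro Ck_on_diff Ck_on_const p Ck_on_mult Ck_on_bilinear[OF bounded_bilinear_inner] Ck_on_id open_UNIV)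
  moreover have "h y = 1" if "y \<in> ball x (r / 2)" for y
  proof -
    have "norm (y - x) \<le> r / 2" using that by (simp add: dist_norm norm_minus_commute)
    then have "(norm (y - x))\<^sup>2 \<le> (r / 2)\<^sup>2" by (intro power_mono) auto
    then have "q y \<ge> 3 / 4 * r\<^sup>2" by (simp add: q_def power2_norm_eq_inner[symmetric] power_divide)
    then have "(3 / 4 * r\<^sup>2)\<^sup>2 \<le> ?p (q y)" using r by (intro power_mono) auto
    then have "4 / r ^ 4 * (3 / 4 * r\<^sup>2)\<^sup>2 \<le> 4 / r ^ 4 * ?p (q y)" using r by (intro mult_left_mono) auto
    moreover have "4 / r ^ 4 * (3 / 4 * r\<^sup>2)\<^sup>2 = 9 / 4" using r by (simp add: field_simps power2_eq_square power4_eq_xxxx)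
    ultimately show ?thesis by (simp add: h_def)
  qed
  moreover have "h y = 0" if "y \<notin> ball x r" for y
  proof -
    have "r \<le> norm (y - x)" using that by (simp add: dist_norm norm_minus_commute)
    then have "r\<^sup>2 \<le> (norm (y - x))\<^sup>2" using r by (intro power_mono) auto
    then have "q y \<le> 0" by (simp add: q_def power2_norm_eq_inner[symmetric])
    then show ?thesis by (simp add: h_def)
  qed
  ultimately show ?thesis by (rule that)
qed

section \<open>The integral of the divergence over a paracontact manifold\<close>

locale paracontact_manifold = smooth_manifold X A
  for X :: "'m topology" and A :: "('m, 'n::finite) chart set" +
  fixes n :: nat and \<phi> :: "('m, 'n) tensor11" and \<xi> :: "('m, 'n) vecfield"
    and \<eta> :: "('m, 'n) form1" and g :: "('m, 'n) tensor02"
  assumes paracontact: "paracontact_metric_manifold n X A \<phi> \<xi> \<eta> g"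
begin

lemma metric: "semi_riemannian_metric A g"
  and reeb: "reeb_field A \<eta> \<xi>"
  and eta_form: "one_form A \<eta>"
  and phi_field: "endomorphism_field A \<phi>"
  using paracontact by (auto simp: paracontact_metric_manifold_def contact_form_def)

lemmas metric_covariant = semi_riemannian_covariant[OF metric]

lemma compatible:
  assumes "c \<in> A" "x \<in> chart_image c"
  shows "\<eta> c x v = g c x (\<xi> c x) v" "ext_deriv \<eta> c x v w = g c x v (\<phi> c x w)"
    "\<phi> c x (\<phi> c x v) = v - \<eta> c x v *\<^sub>R \<xi> c x"
  using paracontact assms unfolding paracontact_metric_manifold_def by blast+

lemma local_paracontact:
  assumes c: "c \<in> A"
  shows "local_paracontact (g c) (chart_image c) (\<phi> c) (\<xi> c) (\<eta> c)"
proof (rule local_paracontact.intro)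
  show "metric_on (g c) (chart_image c)" by (rule semi_riemannian_metric_on[OF metric c])
  show "smooth_on (chart_image c) (\<xi> c)" using reeb c unfolding reeb_field_def vector_field_def by blast
  show "smooth_on (chart_image c) (\<lambda>x. \<eta> c x v)" for v using eta_form c unfolding one_form_def by blast
  show "smooth_on (chart_image c) (\<lambda>x. \<phi> c x v)" for v
    using phi_field c unfolding endomorphism_field_def by blast
  fix x assume x: "x \<in> chart_image c"
  show "linear (\<phi> c x)" using phi_field c x unfolding endomorphism_field_def by blast
  show "\<eta> c x v = g c x (\<xi> c x) v" for v by (rule compatible(1)[OF c x])
  show "(frechet_derivative (\<lambda>y. \<eta> c y w) (at x) v - frechet_derivative (\<lambda>y. \<eta> c y v) (at x) w) / 2 =
    g c x v (\<phi> c x w)" for v w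
    using compatible(2)[OF c x] by (simp add: ext_deriv_def)
  show "\<phi> c x (\<phi> c x v) = v - \<eta> c x v *\<^sub>R \<xi> c x" for v by (rule compatible(3)[OF c x])
  have r: "\<eta> c x (\<xi> c x) = 1 \<and> (\<forall>v. ext_deriv \<eta> c x (\<xi> c x) v = 0)"
    using reeb c x unfolding reeb_field_def by blast
  then show "\<eta> c x (\<xi> c x) = 1" by blast
  show "g c x (\<xi> c x) (\<phi> c x v) = 0" for v using r compatible(2)[OF c x] by metis
qed

text \<open>By compatibility this is \<open>d\<eta>\<close>. Written with \<open>g\<close> and
  \<phi>, it obeys the tensor law for algebraic reasons, without derivatives of the changes of
  charts.\<close>

definition fundamental_form :: "('m, 'n) tensor02" where
  "fundamental_form c x v w = g c x v (\<phi> c x w)"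

lemma phi_transform:
  "c \<in> A \<Longrightarrow> d \<in> A \<Longrightarrow> p \<in> chart_dom c \<inter> chart_dom d \<Longrightarrow>
    \<phi> d (coord d p) (jacobian c d p v) = jacobian c d p (\<phi> c (coord c p) v)"
  using phi_field unfolding endomorphism_field_def by metis

lemma fundamental_form_bilinear:
  "c \<in> A \<Longrightarrow> x \<in> chart_image c \<Longrightarrow> bilinear (fundamental_form c x)"
proof -
  assume c: "c \<in> A" and x: "x \<in> chart_image c"
  interpret lp: local_paracontact "g c" "chart_image c" "\<phi> c" "\<xi> c" "\<eta> c" by (rule local_paracontact[OF c])
  have "fundamental_form c x = lp.\<omega> x" by (intro ext) (simp add: fundamental_form_def lp.\<omega>_def)
  then show ?thesis using lp.bilinear_omega[OF x] by simp
qed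

lemma pointwise_covariant_fundamental_form: "pointwise_covariant fundamental_form"
  unfolding pointwise_covariant_def
proof (intro conjI ballI allI)
  show "bilinear (fundamental_form c x)" if "c \<in> A" "x \<in> chart_image c" for c x
    by (rule fundamental_form_bilinear[OF that])
  show "fundamental_form c (coord c p) v w = fundamental_form d (coord d p) (jacobian c d p v) (jacobian c d p w)"
    if "c \<in> A" "d \<in> A" "p \<in> chart_dom c \<inter> chart_dom d" for c d p v w
    unfolding fundamental_form_def phi_transform[OF that]
    by (rule covariant_2_tensor_transform[OF metric_covariant that])
qed

lemma continuous_on_fundamental_form:
  assumes "c \<in> A"
  shows "continuous_on (chart_image c) (\<lambda>x. fundamental_form c x v w)"
proof -
  interpret lp: local_paracontact "g c" "chart_image c" "\<phi> c" "\<xi> c" "\<eta> c" by (rule local_paracontact[OF assms])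
  show ?thesis
    using Ck_on_imp_continuous[OF lp.Ck_on_omega, of v w] by (simp add: lp.\<omega>_def fundamental_form_def)
qed

text \<open>The trace \<open>tr\<^sub>g d\<eta>(\<cdot>, \<nabla>B)\<close>, by which the first variations of the two energies differ.\<close>

definition fundamental_trace :: "('m, 'n) vecfield \<Rightarrow> 'm \<Rightarrow> real" where
  "fundamental_trace B = at_point (deriv_trace g fundamental_form B)"

lemma fundamental_trace_eq:
  "C1_field B \<Longrightarrow> c \<in> A \<Longrightarrow> p \<in> chart_dom c \<Longrightarrow>
    fundamental_trace B p = deriv_trace g fundamental_form B c (coord c p)"
  unfolding fundamental_trace_def by (rule at_point_deriv_trace[OF metric _ pointwise_covariant_fundamental_form])

lemma continuous_map_fundamental_trace:
  "C1_field B \<Longrightarrow> continuous_map X euclideanreal (fundamental_trace B)"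
  unfolding fundamental_trace_def
  by (rule continuous_map_deriv_trace[OF metric _ pointwise_covariant_fundamental_form continuous_on_fundamental_form])

text \<open>\<open>K\<close> may be any compact set containing the support. It is carried as a
  parameter because the localization argument shrinks it step by step.\<close>

definition horizontal_supported :: "('m, 'n) vecfield \<Rightarrow> 'm set \<Rightarrow> bool" where
  "horizontal_supported B K \<longleftrightarrow> C1_field B \<and> compactin X K \<and>
     (\<forall>c\<in>A. \<forall>x\<in>chart_image c. \<eta> c x (B c x) = 0) \<and>
     (\<forall>c\<in>A. \<forall>p\<in>chart_dom c - K. B c (coord c p) = 0)"

lemma horizontal_supportedD:
  assumes "horizontal_supported B K"
  shows "C1_field B" "compactin X K" "c \<in> A \<Longrightarrow> x \<in> chart_image c \<Longrightarrow> \<eta> c x (B c x) = 0"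
    "c \<in> A \<Longrightarrow> p \<in> chart_dom c - K \<Longrightarrow> B c (coord c p) = 0"
  using assms unfolding horizontal_supported_def by blast+

lemma covariant_deriv_outside:
  assumes B: "C1_field B" and U: "openin X U" "p \<in> U" and c: "c \<in> A" "p \<in> chart_dom c"
    and zero: "\<And>q. q \<in> chart_dom c \<inter> U \<Longrightarrow> B c (coord c q) = 0"
  shows "covariant_deriv (g c) (B c) (coord c p) a = 0"
proof -
  let ?O = "coord c ` (chart_dom c \<inter> U)"
  have o: "open ?O" "coord c p \<in> ?O" using open_coord_image[OF c(1) U(1)] c(2) U(2) by auto
  have "(B c has_derivative (\<lambda>v. 0)) (at (coord c p))"
    by (rule has_derivative_transform_within_open[OF has_derivative_const[of 0] o]) (use zero in auto)
  moreover have "B c (coord c p) = 0" using zero c(2) U(2) by blast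
  ultimately show ?thesis
    using linear_0[OF christoffel_linear(2)[OF semi_riemannian_metric_on[OF metric c(1)] coord_in_image[OF c(2)]]]
    by (simp add: covariant_deriv_def frechet_derivative_eqI)
qed

lemma fundamental_trace_outside:
  assumes B: "horizontal_supported B K" and p: "p \<in> topspace X - K"
  shows "fundamental_trace B p = 0"
proof -
  note B' = horizontal_supportedD[OF B]
  obtain c where c: "c \<in> A" "p \<in> chart_dom c" using p Union_chart_dom by blast
  have cov: "covariant_deriv (g c) (B c) (coord c p) a = 0" for a
    by (rule covariant_deriv_outside[OF B'(1) compact_complement_open[OF B'(2)] p c])
      (rule B'(4)[OF c(1)], blast)
  show ?thesis
    using bilinear_rzero[OF fundamental_form_bilinear[OF c(1) coord_in_image[OF c(2)]]]
    by (simp add: fundamental_trace_eq[OF B'(1) c] deriv_trace_def metric_trace_def cov)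
qed

lemma compact_in_sets:
  assumes "compactin X K"
  shows "K \<in> sets (volume_measure X A g)"
proof -
  have "topspace X - (topspace X - K) \<in> sets (volume_measure X A g)"
    by (rule sets.Diff) (simp_all add: sets_volume_measure[OF metric_covariant] openin_borel_of_top
        compact_complement_open[OF assms])
  moreover have "topspace X - (topspace X - K) = K" using compactin_subset_topspace[OF assms] by blast
  ultimately show ?thesis by simp
qed

lemma integrable_fundamental_trace:
  assumes B: "horizontal_supported B K"
  shows "integrable (volume_measure X A g) (fundamental_trace B)"
proof -
  let ?\<mu> = "volume_measure X A g"
  note B' = horizontal_supportedD[OF B]
  note cont = continuous_map_fundamental_trace[OF B'(1)]
  have "compact (fundamental_trace B ` K)"
    using image_compactin[OF B'(2) cont] by simp
  from compact_imp_bounded[OF this] obtain b where "\<forall>y\<in>fundamental_trace B ` K. norm y \<le> b"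
    unfolding bounded_iff ..
  then have b: "norm (fundamental_trace B p) \<le> b" if "p \<in> K" for p using that by blast
  have "integrable ?\<mu> (\<lambda>p. indicator K p *\<^sub>R fundamental_trace B p)"
    by (rule integrableI_bounded_set_indicator[OF compact_in_sets[OF B'(2)]
        continuous_imp_measurable[OF metric_covariant cont] emeasure_volume_compact_finite[OF metric_covariant B'(2)], of b])
      (use b in auto)
  moreover have "indicator K p *\<^sub>R fundamental_trace B p = fundamental_trace B p" if "p \<in> space ?\<mu>" for p
    using fundamental_trace_outside[OF B] that by (cases "p \<in> K") (auto simp: space_volume_measure[OF metric_covariant])
  ultimately show ?thesis
    using Bochner_Integration.integrable_cong[OF refl, of ?\<mu> "\<lambda>p. indicator K p *\<^sub>R fundamental_trace B p" "fundamental_trace B"]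
    by simp
qed

text \<open>In coordinates the integrand times the density is a sum of partial derivatives of
  functions with compact support in the chart image, by \<open>weighted_divergence\<close>; each of
  them integrates to 0.\<close>

lemma integral_fundamental_trace_chart:
  assumes B: "horizontal_supported B K" and c: "c \<in> A" "K \<subseteq> chart_dom c"
  shows "(LINT p|volume_measure X A g. fundamental_trace B p) = 0"
proof -
  let ?\<mu> = "volume_measure X A g" and ?S = "chart_image c"
  note B' = horizontal_supportedD[OF B]
  note sp = space_volume_measure[OF metric_covariant]
  interpret lp: local_paracontact "g c" ?S "\<phi> c" "\<xi> c" "\<eta> c" by (rule local_paracontact[OF c(1)])
  define w where "w i y = (sqrt \<bar>det (gram_matrix (g c y))\<bar> *\<^sub>R \<phi> c y (B c y)) $ i" for i y
  let ?K = "coord c ` K"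
  have CB: "Ck_on (Suc 0) (B c) ?S" using B'(1) c(1) unfolding C1_field_def by blast
  have oS: "open ?S" by (rule open_chart_image[OF c(1)])
  have cK: "compact ?K"
  proof -
    have "compactin (subtopology X (chart_dom c)) K" using B'(2) c(2) by (simp add: compactin_subtopology)
    moreover have "continuous_map (subtopology X (chart_dom c)) euclidean (coord c)"
      using continuous_map_into_fulltopology[OF homeomorphic_imp_continuous_map[OF homeomorphic_coord[OF c(1)]]] .
    ultimately have "compactin euclidean ?K" by (rule image_compactin)
    then show ?thesis by simp
  qed
  have KS: "?K \<subseteq> ?S" using c(2) by (auto simp: chart_image_def)
  have Cphi: "Ck_on (Suc 0) (\<lambda>y. \<phi> c y (B c y)) ?S"
  proof -
    have "Ck_on (Suc 0) (\<lambda>y. \<Sum>i\<in>UNIV. (B c y $ i) *\<^sub>R \<phi> c y (axis i 1)) ?S"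
      by (intro Ck_on_sum Ck_on_scaleR oS Ck_on_vec_nth[OF oS CB] smooth_on_imp_Ck[OF lp.smooth_phi])
    moreover have "(\<Sum>i\<in>UNIV. (B c y $ i) *\<^sub>R \<phi> c y (axis i 1)) = \<phi> c y (B c y)" if "y \<in> ?S" for y
    proof -
      note l = lp.linear_phi[OF that]
      have "\<phi> c y (B c y) = \<phi> c y (\<Sum>i\<in>UNIV. (B c y $ i) *\<^sub>R axis i 1)"
        by (simp only: vec_eq_sum_axis[symmetric])
      then show ?thesis by (simp add: linear_sum[OF l] linear_cmul[OF l])
    qed
    ultimately show ?thesis using Ck_on_cong[OF oS] by (metis (no_types, lifting))
  qed
  have Crho: "Ck_on (Suc 0) (\<lambda>y. sqrt \<bar>det (gram_matrix (g c y))\<bar>) ?S"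
  proof -
    have Cdet: "Ck_on (Suc 0) (\<lambda>y. det (gram_matrix (g c y))) ?S"
    proof -
      have prod: "Ck_on (Suc 0) (\<lambda>y. \<Prod>i\<in>I. f i y) ?S"
        if "\<And>i. Ck_on (Suc 0) (f i) ?S" for I :: "'n set" and f :: "'n \<Rightarrow> real ^ 'n \<Rightarrow> real"
        by (induction I rule: infinite_finite_induct) (auto simp del: Ck_on.simps simp: Ck_on_const intro!: Ck_on_mult oS that)
      show ?thesis
        unfolding det_def
        by (intro Ck_on_sum Ck_on_mult oS Ck_on_const prod)
          (simp del: Ck_on.simps add: gram_matrix_def smooth_on_imp_Ck[OF metric_onD(3)[OF lp.mG]])
    qed
    have nz: "det (gram_matrix (g c y)) \<noteq> 0" if "y \<in> ?S" for y
      using invertible_gram_matrix[OF lp.mf[OF that]] invertible_det_nz by blast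
    have crho: "continuous_on ?S (\<lambda>y. sqrt \<bar>det (gram_matrix (g c y))\<bar>)"
      by (intro continuous_on_real_sqrt continuous_on_rabs Ck_on_imp_continuous[OF Cdet])
    show ?thesis
    proof (rule Ck_on_SucI[OF oS has_derivative_sqrt_abs[OF Ck_on_imp_has_derivative[OF Cdet] nz]])
      fix v
      show "Ck_on 0 (\<lambda>x. sqrt \<bar>det (gram_matrix (g c x))\<bar> *
          (frechet_derivative (\<lambda>y. det (gram_matrix (g c y))) (at x) v / (2 * det (gram_matrix (g c x))))) ?S"
        unfolding Ck_on.simps
        by (intro continuous_on_mult continuous_on_divide crho continuous_on_const
            Ck_on_imp_continuous[OF Ck_on_frechet_derivative[OF Cdet]] Ck_on_imp_continuous[OF Cdet])
          (use nz in simp)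
    qed
  qed
  have Cw: "Ck_on (Suc 0) (w i) ?S" for i
    unfolding w_def[abs_def] by (intro Ck_on_vec_nth Ck_on_scaleR oS Crho Cphi)
  have w0: "w i y = 0" if y: "y \<in> ?S - ?K" for i y
  proof -
    obtain p where p: "p \<in> chart_dom c" "y = coord c p" "p \<notin> K" using y unfolding chart_image_def by blast
    then have "B c y = 0" using B'(4)[OF c(1), of p] by simp
    then show ?thesis using linear_0[OF lp.linear_phi] y by (simp add: w_def)
  qed
  note int = integral_derivative_compact_support[OF oS Cw cK KS w0]
  have eq: "volume_density g c x * fundamental_trace B (chart_point c x) =
      (\<Sum>i\<in>UNIV. frechet_derivative (w i) (at x) (axis i 1))" if x: "x \<in> ?S" for x
  proof -
    have "fundamental_trace B (chart_point c x) = deriv_trace g fundamental_form B c x"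
      using fundamental_trace_eq[OF B'(1) c(1) chart_point_in[OF x]] coord_chart_point[OF x] by simp
    moreover have "w i = (\<lambda>y. (sqrt \<bar>det (gram_matrix (g c y))\<bar> *\<^sub>R \<phi> c y (B c y)) $ i)" for i
      by (rule ext) (rule w_def)
    ultimately show ?thesis
      using lp.weighted_divergence[OF x CB B'(3)[OF c(1)]]
      by (simp only: volume_density_def deriv_trace_def lp.\<omega>_def fundamental_form_def)
  qed
  have "(LINT p|?\<mu>. fundamental_trace B p) = (LINT p:chart_dom c|?\<mu>. fundamental_trace B p)"
    unfolding set_lebesgue_integral_def
  proof (rule Bochner_Integration.integral_cong[OF refl])
    fix p assume "p \<in> space ?\<mu>"
    then show "fundamental_trace B p = indicator (chart_dom c) p *\<^sub>R fundamental_trace B p"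
      using fundamental_trace_outside[OF B, of p] c(2) by (cases "p \<in> chart_dom c") (auto simp: sp)
  qed
  also have "\<dots> = (LINT x:?S|lborel. volume_density g c x * fundamental_trace B (chart_point c x))"
    by (rule integral_volume_measure_chart[OF metric_covariant c(1)
        continuous_imp_measurable[OF metric_covariant continuous_map_fundamental_trace[OF B'(1)]]])
  also have "\<dots> = (LINT x:?S|lborel. (\<Sum>i\<in>UNIV. frechet_derivative (w i) (at x) (axis i 1)))"
    unfolding set_lebesgue_integral_def
    by (rule Bochner_Integration.integral_cong[OF refl]) (use eq in \<open>auto simp: indicator_def\<close>)
  also have "\<dots> = (\<Sum>i\<in>UNIV. (LINT x:?S|lborel. frechet_derivative (w i) (at x) (axis i 1)))"
    using int(2) unfolding set_lebesgue_integral_def set_integrable_def scaleR_sum_right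
    by (intro Bochner_Integration.integral_sum) blast
  also have "\<dots> = 0" by (intro sum.neutral ballI int(1))
  finally show ?thesis .
qed

text \<open>One cutoff function is split off at a time: this avoids dividing by the sum of a partition of
  unity.\<close>

lemma horizontal_supported_cutoff:
  assumes p: "p \<in> topspace X"
  shows "\<exists>U. openin X U \<and> p \<in> U \<and> (\<forall>B K. horizontal_supported B K \<longrightarrow>
    (\<exists>c K' B' B''. c \<in> A \<and> K' \<subseteq> chart_dom c \<and> horizontal_supported B' K' \<and> horizontal_supported B'' (K - U) \<and>
      (\<forall>d\<in>A. \<forall>y\<in>chart_image d. B d y = B' d y + B'' d y)))"
proof -
  obtain c where c: "c \<in> A" "p \<in> chart_dom c" using p Union_chart_dom by blast
  let ?x = "coord c p"
  obtain r where r: "r > 0" "cball ?x r \<subseteq> chart_image c"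
    using open_chart_image[OF c(1)] coord_in_image[OF c(2)] open_contains_cball by blast
  obtain h where h: "Ck_on (Suc 0) h (UNIV :: (real ^ 'n) set)" "\<And>y. y \<in> ball ?x (r / 2) \<Longrightarrow> h y = (1::real)"
    "\<And>y. y \<notin> ball ?x r \<Longrightarrow> h y = 0"
    using C1_cutoff_exists[OF r(1)] by blast
  \<comment> \<open>The cutoff \<kappa> is 1 on the open half ball \<open>U\<close> and vanishes
    outside the compact set \<open>Kc\<close>, which lies in the chart domain.\<close>
  define U where "U = {q \<in> chart_dom c. coord c q \<in> ball ?x (r / 2)}"
  define Kc where "Kc = chart_point c ` cball ?x r"
  define \<kappa> where "\<kappa> q = (if q \<in> chart_dom c then h (coord c q) else 0)" for q
  have U: "openin X U" "p \<in> U"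
    unfolding U_def using openin_coord_preimage[OF c(1) open_ball, of ?x "r / 2"] c(2) r(1) by auto
  have Kc_dom: "Kc \<subseteq> chart_dom c" unfolding Kc_def using chart_point_in[of _ c] r(2) by blast
  have Kc: "compactin X Kc"
  proof -
    have "compactin (subtopology X (chart_dom c)) Kc"
      unfolding Kc_def
    proof (rule image_compactin)
      show "compactin (top_of_set (chart_image c)) (cball ?x r)" using r(2) by (simp add: compactin_subtopology)
      have "continuous_map (top_of_set (chart_image c)) X (chart_point c)"
        unfolding continuous_map_def
      proof (intro conjI allI impI)
        show "chart_point c \<in> topspace (top_of_set (chart_image c)) \<rightarrow> topspace X"
          using chart_point_in[of _ c] chart_dom_subset[OF c(1)] by auto
        fix V assume V: "openin X V"
        have "{y \<in> topspace (top_of_set (chart_image c)). chart_point c y \<in> V} = coord c ` (chart_dom c \<inter> V)"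
          using chart_point_in[of _ c] coord_chart_point[of _ c] chart_point_coord[OF c(1)] coord_in_image[of _ c]
          by (auto intro!: image_eqI[of _ "coord c"])
        moreover have "coord c ` (chart_dom c \<inter> V) \<subseteq> chart_image c" by (auto simp: chart_image_def)
        ultimately show "openin (top_of_set (chart_image c)) {y \<in> topspace (top_of_set (chart_image c)). chart_point c y \<in> V}"
          using open_coord_image[OF c(1) V] open_chart_image[OF c(1)] by (simp add: openin_open_eq)
      qed
      then show "continuous_map (top_of_set (chart_image c)) (subtopology X (chart_dom c)) (chart_point c)"
        using chart_point_in[of _ c] by (auto simp: continuous_map_in_subtopology)
    qed
    then show ?thesis by (simp add: compactin_subtopology)
  qed
  have out_Kc: "\<kappa> q = 0" if "q \<notin> Kc" for q
  proof (cases "q \<in> chart_dom c")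
    case True
    have "coord c q \<notin> ball ?x r"
    proof
      assume "coord c q \<in> ball ?x r"
      then have "chart_point c (coord c q) \<in> Kc" unfolding Kc_def by (intro imageI) simp
      then show False using that chart_point_coord[OF c(1) True] by simp
    qed
    then show ?thesis using h(3) by (simp add: \<kappa>_def)
  qed (simp add: \<kappa>_def)
  have \<kappa>_U: "\<kappa> q = 1" if "q \<in> U" for q using that h(2) by (simp add: U_def \<kappa>_def)
  have C\<kappa>: "Ck_on (Suc 0) (\<lambda>y. \<kappa> (chart_point d y)) (chart_image d)" if d: "d \<in> A" for d
  proof -
    \<comment> \<open>In another chart \<kappa> is a composition with the transition map on the
      overlap and is 0 off \<open>Kc\<close>. Both sets are open since \<open>Kc\<close> is compact,
      hence closed, and together they fill the chart.\<close>
    let ?O1 = "overlap d c" and ?O2 = "coord d ` (chart_dom d \<inter> (topspace X - Kc))"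
    have o: "open ?O1" "open ?O2"
      using open_overlap[OF d c(1)] open_coord_image[OF d compact_complement_open[OF Kc]] by auto
    have un: "?O1 \<union> ?O2 = chart_image d"
      using Kc_dom chart_dom_subset[OF d] unfolding overlap_def chart_image_def by blast
    have "Ck_on (Suc 0) (\<lambda>y. h (transition d c y)) ?O1"
      by (rule Ck1_on_compose[OF o(1) smooth_on_imp_Ck[OF smooth_transition[OF d c(1)]] h(1)]) simp
    then have 1: "Ck_on (Suc 0) (\<lambda>y. \<kappa> (chart_point d y)) ?O1"
      by (rule Ck_on_cong[OF o(1), rotated])
        (auto simp: overlap_def transition_eq \<kappa>_def chart_point_coord[OF d])
    have 2: "Ck_on (Suc 0) (\<lambda>y. \<kappa> (chart_point d y)) ?O2"
      by (rule Ck_on_cong[OF o(2) _ Ck_on_const[of _ 0]]) (auto simp: chart_point_coord[OF d] out_Kc)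
    show ?thesis using Ck_on_open_Un[OF o 1 2] by (simp only: un)
  qed
  have split: "\<exists>c K' B' B''. c \<in> A \<and> K' \<subseteq> chart_dom c \<and> horizontal_supported B' K' \<and>
      horizontal_supported B'' (K - U) \<and> (\<forall>d\<in>A. \<forall>y\<in>chart_image d. B d y = B' d y + B'' d y)"
    if B: "horizontal_supported B K" for B K
  proof -
    note H = horizontal_supportedD[OF B]
    have scaled: "C1_field (\<lambda>d y. f (\<kappa> (chart_point d y)) *\<^sub>R B d y)" if f: "\<And>d. d \<in> A \<Longrightarrow> Ck_on (Suc 0) (\<lambda>y. f (\<kappa> (chart_point d y))) (chart_image d)"
      for f :: "real \<Rightarrow> real"
      unfolding C1_field_def
    proof (intro conjI ballI)
      fix d assume d: "d \<in> A"
      have "Ck_on (Suc 0) (B d) (chart_image d)" using H(1) d unfolding C1_field_def by blast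
      then show "Ck_on (Suc 0) (\<lambda>y. f (\<kappa> (chart_point d y)) *\<^sub>R B d y) (chart_image d)"
        by (rule Ck_on_scaleR[OF open_chart_image[OF d] f[OF d]])
    next
      fix d d' q assume a: "d \<in> A" "d' \<in> A" "q \<in> chart_dom d \<inter> chart_dom d'"
      then show "f (\<kappa> (chart_point d' (coord d' q))) *\<^sub>R B d' (coord d' q) =
          jacobian d d' q (f (\<kappa> (chart_point d (coord d q))) *\<^sub>R B d (coord d q))"
        using C1_field_transform[OF H(1) a] by (simp add: chart_point_coord linear_cmul[OF linear_jacobian[OF a]])
    qed
    \<comment> \<open>The first summand is supported in \<open>Kc \<inter> K\<close>, inside the
      chart of \<open>p\<close>; the second vanishes on \<open>U\<close>, so \<open>K - U\<close>
      supports it.\<close>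
    define B' where "B' d y = \<kappa> (chart_point d y) *\<^sub>R B d y" for d y
    define B'' where "B'' d y = (1 - \<kappa> (chart_point d y)) *\<^sub>R B d y" for d y
    have "C1_field B'"
      unfolding B'_def[abs_def] by (rule scaled[of "\<lambda>t. t", OF C\<kappa>])
    moreover have "C1_field B''"
      unfolding B''_def[abs_def]
      by (rule scaled[of "\<lambda>t. 1 - t", OF Ck_on_diff[OF open_chart_image Ck_on_const C\<kappa>]])
    moreover have "\<eta> d y (B' d y) = 0" "\<eta> d y (B'' d y) = 0" if d: "d \<in> A" "y \<in> chart_image d" for d y
    proof -
      interpret lp: local_paracontact "g d" "chart_image d" "\<phi> d" "\<xi> d" "\<eta> d" by (rule local_paracontact[OF d(1)])
      show "\<eta> d y (B' d y) = 0" "\<eta> d y (B'' d y) = 0"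
        by (simp_all add: B'_def B''_def linear_cmul[OF lp.linear_eta[OF d(2)]] H(3)[OF d])
    qed
    moreover have "compactin X (K - U)"
    proof -
      have "K - U = (topspace X - U) \<inter> K" using compactin_subset_topspace[OF H(2)] by blast
      moreover have "closedin X (topspace X - U)" using U(1) by (rule closedin_diff[OF closedin_topspace])
      ultimately show ?thesis using closed_Int_compactin[OF _ H(2)] by metis
    qed
    moreover have "compactin X (Kc \<inter> K)"
      by (rule closed_Int_compactin[OF compactin_imp_closedin[OF Hausdorff Kc] H(2)])
    moreover have "B' d (coord d q) = 0" if q: "d \<in> A" "q \<in> chart_dom d - Kc \<inter> K" for d q
      using q H(4)[OF q(1), of q] out_Kc[of q] by (auto simp: B'_def chart_point_coord)
    moreover have "B'' d (coord d q) = 0" if q: "d \<in> A" "q \<in> chart_dom d - (K - U)" for d q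
      using q H(4)[OF q(1), of q] \<kappa>_U[of q] by (auto simp: B''_def chart_point_coord)
    ultimately have "horizontal_supported B' (Kc \<inter> K)" "horizontal_supported B'' (K - U)"
      unfolding horizontal_supported_def by blast+
    moreover have "B d y = B' d y + B'' d y" for d y by (simp add: B'_def B''_def algebra_simps)
    ultimately show ?thesis using c(1) Kc_dom by blast
  qed
  show ?thesis using U split by blast
qed

lemma fundamental_trace_add:
  assumes B: "C1_field B" "C1_field B'" "C1_field B''"
    and eq: "\<And>d y. d \<in> A \<Longrightarrow> y \<in> chart_image d \<Longrightarrow> B d y = B' d y + B'' d y" and p: "p \<in> topspace X"
  shows "fundamental_trace B p = fundamental_trace B' p + fundamental_trace B'' p"
proof -
  obtain c where c: "c \<in> A" "p \<in> chart_dom c" using p Union_chart_dom by blast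
  note x = coord_in_image[OF c(2)]
  have "(B c has_derivative (\<lambda>a. frechet_derivative (B' c) (at (coord c p)) a +
      frechet_derivative (B'' c) (at (coord c p)) a)) (at (coord c p))"
    by (rule has_derivative_transform_within_open[OF has_derivative_add[OF
        C1_field_has_derivative[OF B(2) c(1) x] C1_field_has_derivative[OF B(3) c(1) x]]
        open_chart_image[OF c(1)] x]) (simp add: eq[OF c(1)])
  note d = frechet_derivative_eqI[OF this]
  note chr = linear_add[OF christoffel_linear(2)[OF semi_riemannian_metric_on[OF metric c(1)] x]]
  have "covariant_deriv (g c) (B c) (coord c p) a = covariant_deriv (g c) (B' c) (coord c p) a +
      covariant_deriv (g c) (B'' c) (coord c p) a" for a
    unfolding covariant_deriv_def d eq[OF c(1) x] chr by simp
  then show ?thesis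
    unfolding fundamental_trace_eq[OF B(1) c] fundamental_trace_eq[OF B(2) c] fundamental_trace_eq[OF B(3) c] deriv_trace_def
    by (simp add: bilinear_radd[OF fundamental_form_bilinear[OF c(1) x]] metric_trace_add)
qed

text \<open>Induction on a finite cover of \<open>K\<close>: each set splits off a field that lives
  in one chart and contributes 0, and leaves a field supported in what the remaining sets cover.
  Without sets, nothing is left of the field.\<close>

theorem integral_fundamental_trace:
  assumes B: "horizontal_supported B K"
  shows "(LINT p|volume_measure X A g. fundamental_trace B p) = 0"
proof -
  let ?\<mu> = "volume_measure X A g"
  have KX: "K \<subseteq> topspace X" using compactin_subset_topspace[OF horizontal_supportedD(2)[OF B]] .
  \<comment> \<open>The splitting property is demanded for all \<open>B\<close> and
    \<open>K\<close>, since both change from step to step of the induction.\<close>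
  define good where "good U \<longleftrightarrow> openin X U \<and> (\<forall>B K. horizontal_supported B K \<longrightarrow>
    (\<exists>c K' B' B''. c \<in> A \<and> K' \<subseteq> chart_dom c \<and> horizontal_supported B' K' \<and> horizontal_supported B'' (K - U) \<and>
      (\<forall>d\<in>A. \<forall>y\<in>chart_image d. B d y = B' d y + B'' d y)))" for U
  have cover: "\<exists>U. good U \<and> p \<in> U" if "p \<in> K" for p
    using horizontal_supported_cutoff[of p] that KX unfolding good_def by blast
  have "\<exists>\<F>. finite \<F> \<and> \<F> \<subseteq> Collect good \<and> K \<subseteq> \<Union>\<F>"
    by (rule compactinD[OF horizontal_supportedD(2)[OF B]]) (use cover in \<open>auto simp: good_def\<close>)
  then obtain \<F> where F: "finite \<F>" "\<F> \<subseteq> Collect good" "K \<subseteq> \<Union>\<F>" by (elim exE conjE)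
  have "(LINT p|?\<mu>. fundamental_trace B p) = 0" if "finite \<F>" "\<F> \<subseteq> Collect good" "K \<subseteq> \<Union>\<F>" "horizontal_supported B K"
    for \<F> B K
    using that
  proof (induction \<F> arbitrary: B K rule: finite_induct)
    case empty
    then have "fundamental_trace B p = 0" if "p \<in> space ?\<mu>" for p
      using fundamental_trace_outside[OF empty(3)] that by (simp add: space_volume_measure[OF metric_covariant])
    then show ?case by (simp cong: Bochner_Integration.integral_cong)
  next
    case (insert U \<F>)
    have "good U" using insert.prems(1) by blast
    then obtain c K' B' B'' where s: "c \<in> A" "K' \<subseteq> chart_dom c" "horizontal_supported B' K'"
      "horizontal_supported B'' (K - U)" "\<And>d y. d \<in> A \<Longrightarrow> y \<in> chart_image d \<Longrightarrow> B d y = B' d y + B'' d y"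
      using insert.prems(3) unfolding good_def by metis
    have "(LINT p|?\<mu>. fundamental_trace B p) = (LINT p|?\<mu>. fundamental_trace B' p + fundamental_trace B'' p)"
      by (rule Bochner_Integration.integral_cong[OF refl], rule fundamental_trace_add)
        (use s(5) horizontal_supportedD(1) insert.prems(3) s(3,4) in \<open>auto simp: space_volume_measure[OF metric_covariant]\<close>)
    also have "\<dots> = (LINT p|?\<mu>. fundamental_trace B' p) + (LINT p|?\<mu>. fundamental_trace B'' p)"
      by (rule Bochner_Integration.integral_add[OF integrable_fundamental_trace[OF s(3)] integrable_fundamental_trace[OF s(4)]])
    also have "(LINT p|?\<mu>. fundamental_trace B' p) = 0"
      by (rule integral_fundamental_trace_chart[OF s(3,1,2)])
    also have "(LINT p|?\<mu>. fundamental_trace B'' p) = 0"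
      by (rule insert.IH[OF _ _ s(4)]) (use insert.prems in auto)
    finally show ?case by simp
  qed
  then show ?thesis using F B by blast
qed

end

section \<open>D-homothetic deformations\<close>

text \<open>As a function of \<open>s\<close> the determinant solves \<open>f' = f / (1 + s)\<close>.\<close>

lemma det_identity_plus_projection_pos:
  fixes P :: "real ^ 'n ^ 'n"
  assumes P: "\<And>v. P *v (P *v v) = P *v v" "trace P = 1" and s: "s > -1"
  shows "det (mat 1 + s *\<^sub>R P) = 1 + s"
proof -
  let ?f = "\<lambda>s. det (mat 1 + s *\<^sub>R P)"
  have "((\<lambda>s. ?f s / (1 + s)) has_real_derivative 0) (at r)" if r: "r > -1" for r
  proof -
    \<comment> \<open>As \<open>P\<close> is idempotent, the inverse of
      \<open>mat 1 + r *\<^sub>R P\<close> is again the identity plus a multiple of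
      \<open>P\<close>; the multiple comes from solving a scalar equation.\<close>
    let ?M = "mat 1 + r *\<^sub>R P" and ?N = "mat 1 - (r / (1 + r)) *\<^sub>R P"
    have "?N *v (?M *v v) = v + (r - r / (1 + r) - r / (1 + r) * r) *\<^sub>R (P *v v)" for v
      by (simp add: matrix_vector_mult_add_rdistrib matrix_vector_mult_diff_rdistrib matrix_vector_right_distrib
          scaleR_matrix_vector_assoc[symmetric] matrix_vector_mult_scaleR P(1) algebra_simps)
    moreover have "r - r / (1 + r) - r / (1 + r) * r = 0" using r by (simp add: field_simps)
    ultimately have "?N *v (?M *v v) = v" for v by simp
    then have NM: "?N ** ?M = mat 1" by (simp add: matrix_eq matrix_vector_mul_assoc[symmetric])
    have inv: "invertible ?M" using NM invertible_left_inverse by blast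
    have "((\<lambda>s. det (mat 1 + s *\<^sub>R P)) has_derivative (\<lambda>a. ?f r * trace (matrix_inv ?M ** (a *\<^sub>R P)))) (at r)"
      by (rule has_derivative_det[where M = "\<lambda>s. mat 1 + s *\<^sub>R P" and M' = "\<lambda>a. a *\<^sub>R P", OF _ inv]) (auto intro!: derivative_eq_intros)
    moreover have "trace (matrix_inv ?M ** (a *\<^sub>R P)) = a / (1 + r)" for a
    proof -
      have "(?N ** (a *\<^sub>R P)) *v v = ((a - r / (1 + r) * a) *\<^sub>R P) *v v" for v
        by (simp add: matrix_vector_mul_assoc[symmetric] matrix_vector_mult_diff_rdistrib
          scaleR_matrix_vector_assoc[symmetric] matrix_vector_mult_scaleR P(1) algebra_simps)
      then have "matrix_inv ?M ** (a *\<^sub>R P) = (a - r / (1 + r) * a) *\<^sub>R P"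
        unfolding matrix_inv_eqI[OF NM] by (simp add: matrix_eq)
      then have "trace (matrix_inv ?M ** (a *\<^sub>R P)) = (a - r / (1 + r) * a) * trace P"
        by (simp add: trace_def sum_distrib_left)
      then show ?thesis using r by (simp add: P(2) field_simps)
    qed
    ultimately have "((\<lambda>s. ?f s) has_derivative (\<lambda>a. ?f r * (a / (1 + r)))) (at r)"
      by (simp only:)
    moreover have "(\<lambda>a. ?f r * (a / (1 + r))) = (*) (?f r / (1 + r))" by (rule ext) simp
    ultimately have "(?f has_real_derivative ?f r / (1 + r)) (at r)"
      by (simp only: has_field_derivative_def)
    moreover have "((\<lambda>s. 1 + s) has_real_derivative 1) (at r)" by (auto intro!: derivative_eq_intros)
    ultimately have "((\<lambda>s. ?f s / (1 + s)) has_real_derivative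
        (?f r / (1 + r) * (1 + r) - ?f r * 1) / ((1 + r) * (1 + r))) (at r)"
      by (rule DERIV_divide) (use r in simp)
    then show ?thesis using r by simp
  qed
  then have "\<exists>k. \<forall>r\<in>{-1<..}. ?f r / (1 + r) = k"
    by (intro has_field_derivative_zero_constant) (auto intro: has_field_derivative_at_within)
  then obtain k where k: "\<forall>r\<in>{-1<..}. ?f r / (1 + r) = k" ..
  have "?f s / (1 + s) = ?f 0 / (1 + 0)" using bspec[OF k, of s] bspec[OF k, of 0] s by simp
  then show ?thesis using s by (simp add: field_simps)
qed

text \<open>At \<open>s = -1\<close> the determinant vanishes and the differential equation stops.
  The reflection \<open>mat 1 - 2 *\<^sub>R P\<close>, of determinant 1 or -1, carries
  \<open>s\<close> to \<open>- s - 2\<close>, the mirror image about -1; negative \<open>t\<close>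
  require this.\<close>

lemma abs_det_identity_plus_projection:
  fixes P :: "real ^ 'n ^ 'n"
  assumes P: "\<And>v. P *v (P *v v) = P *v v" "trace P = 1" and s: "s \<noteq> -1"
  shows "\<bar>det (mat 1 + s *\<^sub>R P)\<bar> = \<bar>1 + s\<bar>"
proof (cases "s > -1")
  case True
  then show ?thesis using det_identity_plus_projection_pos[OF P True] by simp
next
  case False
  have r: "(mat 1 - c *\<^sub>R P) *v ((mat 1 + s *\<^sub>R P) *v v) = (mat 1 + (s - c - c * s) *\<^sub>R P) *v v" for c s v
    by (simp add: matrix_vector_mult_add_rdistrib matrix_vector_mult_diff_rdistrib matrix_vector_right_distrib
        scaleR_matrix_vector_assoc[symmetric] matrix_vector_mult_scaleR P(1) algebra_simps)
  have m: "(mat 1 - 2 *\<^sub>R P) ** (mat 1 + s *\<^sub>R P) = mat 1 + (s - 2 - 2 * s) *\<^sub>R P" for s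
    using r[of 2] by (simp add: matrix_eq matrix_vector_mul_assoc[symmetric])
  have "(mat 1 - 2 *\<^sub>R P) ** (mat 1 + s *\<^sub>R P) = mat 1 + (- s - 2) *\<^sub>R P"
    using m[of s] by (simp add: algebra_simps)
  moreover have "(mat 1 - 2 *\<^sub>R P) ** (mat 1 - 2 *\<^sub>R P) = mat 1"
    using m[of "- 2"] by simp
  ultimately have d: "det (mat 1 - 2 *\<^sub>R P) * det (mat 1 + s *\<^sub>R P) = det (mat 1 + (- s - 2) *\<^sub>R P)"
    "det (mat 1 - 2 *\<^sub>R P) * det (mat 1 - 2 *\<^sub>R P) = 1"
    by (metis det_mul, metis det_mul det_I)
  have "\<bar>det (mat 1 - 2 *\<^sub>R P)\<bar> = 1"
    using d(2) by (metis abs_mult_self_eq abs_1 abs_square_eq_1 power2_eq_square)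
  then have "\<bar>det (mat 1 + s *\<^sub>R P)\<bar> = \<bar>det (mat 1 + (- s - 2) *\<^sub>R P)\<bar>"
    using d(1) by (metis abs_mult mult_1)
  also have "\<dots> = \<bar>1 + (- s - 2)\<bar>"
    using det_identity_plus_projection_pos[OF P, of "- s - 2"] False s by simp
  finally show ?thesis by simp
qed

text \<open>The two summands are the Lie derivative of the metric along \<open>V\<close> and the exterior derivative
  of the dual form \<open>\<alpha>\<close>.\<close>

lemma covariant_deriv_decomposition:
  assumes G: "metric_on G S" "x \<in> S" and V: "(V has_derivative V') (at x)"
    and \<alpha>: "\<And>y v. y \<in> S \<Longrightarrow> \<alpha> y v = G y (V y) v"
  shows "2 * G x (covariant_deriv G V x a) b =
    (dform G x (V x) a b + G x (V' a) b + G x a (V' b)) +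
    (frechet_derivative (\<lambda>y. \<alpha> y b) (at x) a - frechet_derivative (\<lambda>y. \<alpha> y a) (at x) b)"
proof -
  note bG = metric_formD(1)[OF metric_onD(2)[OF G]] and sG = metric_formD(2)[OF metric_onD(2)[OF G]]
  have d\<alpha>: "frechet_derivative (\<lambda>y. \<alpha> y v) (at x) u = dform G x u (V x) v + G x (V' u) v" for u v
  proof -
    have "((\<lambda>y. G y (V y) v) has_derivative (\<lambda>u. dform G x u (V x) v + G x (V' u) v + G x (V x) 0)) (at x)"
      by (rule has_derivative_bilinear_on[OF metric_on_bilinear_on[OF G(1)] G(2) has_derivative_ident V has_derivative_const])
    then have "((\<lambda>y. \<alpha> y v) has_derivative (\<lambda>u. dform G x u (V x) v + G x (V' u) v + G x (V x) 0)) (at x)"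
      by (rule has_derivative_transform_within_open[OF _ metric_onD(1)[OF G(1)] G(2)]) (simp add: \<alpha>)
    from fun_cong[OF frechet_derivative_eqI[OF this], of u] show ?thesis by (simp add: bilinear_rzero[OF bG])
  qed
  have "2 * G x (covariant_deriv G V x a) b = 2 * G x (V' a) b +
      (dform G x a (V x) b + dform G x (V x) a b - dform G x b a (V x))"
    unfolding covariant_deriv_def frechet_derivative_eqI[OF V] bilinear_ladd[OF bG] distrib_left
      christoffel_koszul[OF G] ..
  then show ?thesis
    unfolding d\<alpha> using sG[of a "V' b"] dform_symmetric[OF G, where a = b and v = a and w = "V x"] by simp
qed

section \<open>The deformed metric, its volume, trace and connection in a chart\<close>

context local_paracontact
begin

definition "Gt t x v w = t * G x v w + t * (t - 1) * (\<eta> x v * \<eta> x w)"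

lemma metric_form_Gt:
  assumes t: "t \<noteq> 0" and x: "x \<in> S"
  shows "metric_form (Gt t x)"
  unfolding metric_form_def
proof (intro conjI allI impI)
  note le = linear_eta[OF x]
  show b: "bilinear (Gt t x)"
    unfolding bilinear_def Gt_def
    by (intro conjI allI linearI)
      (simp_all add: linear_add[OF le] linear_cmul[OF le] bilinear_ladd[OF bG[OF x]] bilinear_lmul[OF bG[OF x]]
        bilinear_radd[OF bG[OF x]] bilinear_rmul[OF bG[OF x]] algebra_simps)
  show "Gt t x v w = Gt t x w v" for v w
    unfolding Gt_def using symG[OF x, of v w] by simp
  fix v assume v: "\<forall>w. Gt t x v w = 0"
  \<comment> \<open>Pairing with \<xi> isolates \<open>\<eta> x v\<close>; once that is 0, the
    deformed metric is just \<open>t\<close> times the old one.\<close>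
  have "Gt t x v (\<xi> x) = t * t * \<eta> x v"
    unfolding Gt_def symG[OF x, of v "\<xi> x"] eta_eq[OF x, symmetric] eta_xi[OF x] by (simp add: algebra_simps)
  then have "\<eta> x v = 0" using v t by simp
  then have "G x v w = 0" for w using v t by (simp add: Gt_def)
  then show "v = 0" by (rule metric_formD(3)[OF mf[OF x]])
qed

lemma metric_on_Gt: "t \<noteq> 0 \<Longrightarrow> metric_on (Gt t) S"
  unfolding metric_on_def smooth_on_def Gt_def[abs_def]
  using oS metric_form_Gt[of t, unfolded Gt_def[abs_def]]
  by (auto intro!: Ck_on_add Ck_on_mult Ck_on_const oS smooth_on_imp_Ck[OF smooth_eta]
      smooth_on_imp_Ck[OF metric_onD(3)[OF mG]] simp del: Ck_on.simps)

lemma gram_matrix_Gt: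
  assumes "x \<in> S"
  shows "gram_matrix (Gt t x) = gram_matrix (G x) ** matrix (\<lambda>v. t *\<^sub>R v + (t * (t - 1) * \<eta> x v) *\<^sub>R \<xi> x)"
proof -
  note le = linear_eta[OF assms]
  have l: "linear (\<lambda>v. t *\<^sub>R v + (t * (t - 1) * \<eta> x v) *\<^sub>R \<xi> x)"
    by (intro linearI) (simp_all add: linear_add[OF le] linear_cmul[OF le] algebra_simps)
  have "Gt t x = (\<lambda>a b. G x a (t *\<^sub>R b + (t * (t - 1) * \<eta> x b) *\<^sub>R \<xi> x))"
    by (intro ext) (simp add: Gt_def bilinear_radd[OF bG[OF assms]] bilinear_rmul[OF bG[OF assms]]
        eta_eq[OF assms] symG[OF assms, of _ "\<xi> x"])
  then show ?thesis by (simp add: gram_matrix_right[OF bG[OF assms] l])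
qed

text \<open>Relative to \<open>G\<close> the deformed metric is the map
  \<open>t (I + (t - 1) P)\<close>, where \<open>P\<close> projects onto \<xi> along the kernel of
  \<eta> and has trace \<open>\<eta>(\<xi>) = 1\<close>.\<close>

lemma abs_det_gram_Gt:
  assumes x: "x \<in> S" and t: "t \<noteq> 0"
  shows "\<bar>det (gram_matrix (Gt t x))\<bar> = \<bar>t\<bar> ^ CARD('n) * \<bar>t\<bar> * \<bar>det (gram_matrix (G x))\<bar>"
proof -
  note le = linear_eta[OF x]
  let ?p = "\<lambda>v. \<eta> x v *\<^sub>R \<xi> x"
  define P where "P = matrix ?p"
  have lp: "linear ?p" by (intro linearI) (simp_all add: linear_add[OF le] linear_cmul[OF le] algebra_simps)
  have Pv: "P *v v = ?p v" for v unfolding P_def by (rule matrix_mult_linear[OF lp])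
  have l: "linear (\<lambda>v. t *\<^sub>R v + (t * (t - 1) * \<eta> x v) *\<^sub>R \<xi> x)"
    by (intro linearI) (simp_all add: linear_add[OF le] linear_cmul[OF le] algebra_simps)
  have P1: "P *v (P *v v) = P *v v" for v
    by (simp add: Pv linear_cmul[OF le] eta_xi[OF x])
  have "trace P = (\<Sum>i\<in>UNIV. \<xi> x $ i * \<eta> x (axis i 1))" by (simp add: trace_def P_def matrix_def mult.commute)
  also have "\<dots> = \<eta> x (\<Sum>i\<in>UNIV. (\<xi> x $ i) *\<^sub>R axis i 1)" by (simp add: linear_sum[OF le] linear_cmul[OF le])
  also have "\<dots> = 1" by (simp only: vec_eq_sum_axis[symmetric] eta_xi[OF x])
  finally have P2: "trace P = 1" .
  have "matrix (\<lambda>v. t *\<^sub>R v + (t * (t - 1) * \<eta> x v) *\<^sub>R \<xi> x) = mat t ** (mat 1 + (t - 1) *\<^sub>R P)"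
  proof -
    have mt: "mat t *v v = t *\<^sub>R v" for v :: "real ^ 'n"
      by (simp add: matrix_scaleR[symmetric] matrix_mult_linear linear_scaleR)
    show ?thesis
      by (simp add: matrix_eq matrix_vector_mul_assoc[symmetric] matrix_mult_linear[OF l] mt
          matrix_vector_mult_add_rdistrib scaleR_matrix_vector_assoc[symmetric] Pv scaleR_add_right)
  qed
  moreover have "det (mat t :: real ^ 'n ^ 'n) = t ^ CARD('n)"
    by (subst det_diagonal) (simp_all add: mat_def)
  ultimately show ?thesis
    unfolding gram_matrix_Gt[OF x] using abs_det_identity_plus_projection[OF P1 P2, of "t - 1"] t
    by (simp add: det_mul abs_mult power_abs)
qed

text \<open>The inverse metric becomes \<open>1 / t\<close> times the old one plus a multiple of
  \<open>\<xi> \<otimes> \<xi>\<close>, and that multiple is contracted with a form that annihilates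
  \<xi>.\<close>

lemma metric_trace_Gt:
  assumes x: "x \<in> S" and t: "t \<noteq> 0" and T: "bilinear T" "\<And>b. T (\<xi> x) b = 0"
  shows "metric_trace (Gt t x) T = metric_trace (G x) T / t"
proof -
  note le = linear_eta[OF x]
  let ?l = "\<lambda>v. t *\<^sub>R v + (t * (t - 1) * \<eta> x v) *\<^sub>R \<xi> x"
  \<comment> \<open>The inverse of \<open>t (I + (t - 1) P)\<close> is
    \<open>(1 / t) (I - ((t - 1) / t) P)\<close>, where
    \<open>P v = \<eta>(v) \<xi>\<close>.\<close>
  let ?k = "\<lambda>v. (1 / t) *\<^sub>R v + (- (t - 1) / t\<^sup>2 * \<eta> x v) *\<^sub>R \<xi> x"
  have l: "linear ?l" "linear ?k"
    by (intro linearI; simp add: linear_add[OF le] linear_cmul[OF le] algebra_simps add_divide_distrib diff_divide_distrib)+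
  have inverse: "?k (?l v) = v" for v
  proof -
    have "\<eta> x (?l v) = t\<^sup>2 * \<eta> x v"
      unfolding linear_add[OF le] linear_cmul[OF le] eta_xi[OF x] by (simp add: algebra_simps power2_eq_square)
    moreover have "(1 / t) *\<^sub>R ?l v = v + ((t - 1) * \<eta> x v) *\<^sub>R \<xi> x"
      using t by (simp add: scaleR_add_right)
    moreover have "p / t\<^sup>2 * (t\<^sup>2 * q) = p * q" for p q using t by simp
    then have "- (t - 1) / t\<^sup>2 * (t\<^sup>2 * \<eta> x v) = - ((t - 1) * \<eta> x v)" by (simp only: minus_mult_left)
    ultimately show ?thesis by (simp only: scaleR_minus_left) simp
  qed
  have kl: "matrix ?k ** matrix ?l = mat 1"
    unfolding matrix_eq matrix_vector_mul_assoc[symmetric] matrix_mult_linear[OF l(1)] matrix_mult_linear[OF l(2)] inverse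
    by simp
  note GG = matrix_inv_mult[OF invertible_gram_matrix[OF mf[OF x]]]
  let ?G = "gram_matrix (G x)" and ?T = "gram_matrix T"
  have "(matrix ?k ** matrix_inv ?G) ** (?G ** matrix ?l) = matrix ?k ** (matrix_inv ?G ** ?G) ** matrix ?l"
    by (simp add: matrix_mul_assoc)
  also have "\<dots> = mat 1" by (simp only: GG matrix_mul_rid kl)
  finally have inv: "matrix_inv (gram_matrix (Gt t x)) = matrix ?k ** matrix_inv ?G"
    unfolding gram_matrix_Gt[OF x] by (rule matrix_inv_eqI)
  have "metric_trace (Gt t x) T = trace (matrix ?k ** (matrix_inv ?G ** transpose ?T))"
    unfolding metric_trace_eq_trace inv by (simp add: matrix_mul_assoc)
  also have "\<dots> = trace (matrix_inv ?G ** (transpose ?T ** matrix ?k))"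
    by (subst trace_mul_sym) (simp add: matrix_mul_assoc)
  also have "transpose ?T ** matrix ?k = transpose (gram_matrix (\<lambda>a b. T (?k a) b))"
    unfolding gram_matrix_left[OF T(1) l(2)] matrix_transpose_mul transpose_transpose ..
  also have "(\<lambda>a b. T (?k a) b) = (\<lambda>a b. (1 / t) * T a b)"
    by (intro ext) (simp add: bilinear_ladd[OF T(1)] bilinear_lmul[OF T(1)] T(2))
  also have "trace (matrix_inv ?G ** transpose (gram_matrix (\<lambda>a b. (1 / t) * T a b))) = (1 / t) * metric_trace (G x) T"
    unfolding metric_trace_eq_trace[symmetric] by (rule metric_trace_cmult)
  finally show ?thesis by simp
qed

lemma has_derivative_eta_field:
  assumes x: "x \<in> S" and u: "(u has_derivative u') (at x)"
  shows "((\<lambda>y. \<eta> y (u y)) has_derivative (\<lambda>a. deta x a (u x) + \<eta> x (u' a))) (at x)"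
  by (rule has_derivative_linear_family[OF oS x linear_eta _ has_derivative_ident u])
    (use differentiableI[OF smooth_on_has_derivative[OF smooth_eta x]] in auto)

text \<open>In coordinates this is the Lie derivative of \<eta> along \<xi>. It vanishes because
  \<open>\<eta>(\<xi>)\<close> is constant and \<open>d\<eta>(\<xi>, \<cdot>) = 0\<close>.\<close>

lemma reeb_lie_eta:
  assumes x: "x \<in> S"
  shows "deta x (\<xi> x) a + \<eta> x (frechet_derivative \<xi> (at x) a) = 0"
proof -
  note d = has_derivative_eta_field[OF x smooth_on_has_derivative[OF smooth_xi x]]
  have "((\<lambda>y. \<eta> y (\<xi> y)) has_derivative (\<lambda>a. 0)) (at x)"
    by (rule has_derivative_transform_within_open[OF has_derivative_const[of 1] oS x]) (simp add: eta_xi)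
  from fun_cong[OF has_derivative_unique[OF d this], of a]
  have "deta x a (\<xi> x) + \<eta> x (frechet_derivative \<xi> (at x) a) = 0" .
  moreover have "deta x (\<xi> x) a = deta x a (\<xi> x)"
    using omega_eq[OF x, where v = "\<xi> x" and w = a] omega_xi[OF x, of a] by (simp add: \<omega>_def)
  ultimately show ?thesis by simp
qed

abbreviation "\<theta> x a b \<equiv> G x (covariant_deriv G \<xi> x a) b"

text \<open>The splitting of \<theta> into its symmetric part, half the Lie derivative of the metric
  along \<xi>, and its skew part \<omega>. The deformation acts on each in a simple way.\<close>

lemma theta_eq:
  assumes x: "x \<in> S"
  shows "2 * \<theta> x a b = (dform G x (\<xi> x) a b + G x (frechet_derivative \<xi> (at x) a) b +
    G x a (frechet_derivative \<xi> (at x) b)) + 2 * \<omega> x a b"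
  using covariant_deriv_decomposition[OF mG x smooth_on_has_derivative[OF smooth_xi x] eta_eq, of a b]
    omega_eq[OF x, of a b] by simp

text \<open>Both parts of \<theta> annihilate \<xi>: the Lie derivative of the metric, evaluated on
  \<xi>, is the Lie derivative of \<eta>, and \<omega> has \<xi> in its kernel.\<close>

lemma theta_xi:
  assumes x: "x \<in> S"
  shows "\<theta> x (\<xi> x) b = 0" "\<theta> x a (\<xi> x) = 0"
proof -
  let ?x = "\<xi> x" and ?D = "frechet_derivative \<xi> (at x)"
  have d: "deta x u v = dform G x u ?x v + G x (?D u) v" for u v
  proof -
    have "((\<lambda>y. G y (\<xi> y) v) has_derivative (\<lambda>u. dform G x u ?x v + G x (?D u) v + G x ?x 0)) (at x)"
      by (rule has_derivative_bilinear_on[OF metric_on_bilinear_on[OF mG] x has_derivative_ident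
          smooth_on_has_derivative[OF smooth_xi x] has_derivative_const])
    then have "((\<lambda>y. \<eta> y v) has_derivative (\<lambda>u. dform G x u ?x v + G x (?D u) v + G x ?x 0)) (at x)"
      by (rule has_derivative_transform_within_open[OF _ oS x]) (simp add: eta_eq)
    from fun_cong[OF frechet_derivative_eqI[OF this], of u] show ?thesis by (simp add: bilinear_rzero[OF bG[OF x]])
  qed
  have L: "dform G x ?x ?x b + G x (?D ?x) b + G x ?x (?D b) = 0" for b
    using reeb_lie_eta[OF x, of b] d[where u = ?x and v = b] eta_eq[OF x, of "?D b"] by simp
  have w: "\<omega> x ?x b = 0" for b using omega_xi[OF x] by (simp add: \<omega>_def)
  show "\<theta> x ?x b = 0" using theta_eq[OF x, of ?x b] L[of b] w[of b] by simp
  have "\<omega> x a ?x = 0" using omega_skew[OF x, of a ?x] w[of a] by simp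
  then show "\<theta> x a ?x = 0"
    using theta_eq[OF x, of a ?x] L[of a] symG[OF x, of a "?D ?x"] symG[OF x, of ?x "?D a"]
      dform_symmetric[OF mG x, where a = ?x and v = a and w = ?x] by simp
qed

lemma dform_Gt:
  assumes x: "x \<in> S"
  shows "dform (Gt t) x a v w = t * dform G x a v w + t * (t - 1) * (deta x a v * \<eta> x w + \<eta> x v * deta x a w)"
proof -
  have "((\<lambda>y. Gt t y v w) has_derivative (\<lambda>a. t * dform G x a v w +
      t * (t - 1) * (\<eta> x v * deta x a w + deta x a v * \<eta> x w))) (at x)"
    unfolding Gt_def
    by (intro has_derivative_add has_derivative_mult_right has_derivative_mult smooth_on_has_derivative[OF smooth_eta x]
        bilinear_on_has_derivative[OF metric_on_bilinear_on[OF mG] x])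
  from fun_cong[OF frechet_derivative_eqI[OF this], of a] show ?thesis by (simp add: add.commute)
qed

text \<open>Since \<eta> is invariant along \<xi>, the Lie derivative of the deformed metric along
  \<xi>\<open>/t\<close> is the old one: the factors \<open>t\<close> and \<open>1/t\<close> cancel.
  The skew part is multiplied by \<open>t\<close>, and the difference is
  \<open>(t - 1) * \<omega>\<close>.\<close>

lemma theta_deformed:
  assumes t: "t \<noteq> 0" and x: "x \<in> S"
  shows "Gt t x (covariant_deriv (Gt t) (\<lambda>y. inverse t *\<^sub>R \<xi> y) x a) b = \<theta> x a b + (t - 1) * \<omega> x a b"
proof -
  let ?x = "\<xi> x" and ?D = "frechet_derivative \<xi> (at x)"
  note dx = smooth_on_has_derivative[OF smooth_xi x]
  have dV: "((\<lambda>y. inverse t *\<^sub>R \<xi> y) has_derivative (\<lambda>a. inverse t *\<^sub>R ?D a)) (at x)"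
    by (rule has_derivative_scaleR_right[OF dx])
  have \<alpha>: "t * \<eta> y v = Gt t y (inverse t *\<^sub>R \<xi> y) v" if y: "y \<in> S" for y v
    unfolding Gt_def linear_cmul[OF linear_eta[OF y]] bilinear_lmul[OF bG[OF y]] eta_xi[OF y] eta_eq[OF y, symmetric]
    using t by (simp add: field_simps)
  have d\<alpha>: "frechet_derivative (\<lambda>y. t * \<eta> y v) (at x) u = t * deta x u v" for u v
    using fun_cong[OF frechet_derivative_eqI[OF has_derivative_mult_right[OF smooth_on_has_derivative[OF smooth_eta x]]]] .
  note lG = bilinear_lmul[OF bG[OF x]] bilinear_rmul[OF bG[OF x]] and le = linear_cmul[OF linear_eta[OF x]]
  have lie: "\<eta> x (?D v) = - deta x ?x v" for v using reeb_lie_eta[OF x, of v] by simp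
  note dO = linear_cmul[OF dform_linear(1)[OF metric_on_bilinear_on[OF metric_on_Gt[OF t]] x]]
  have "2 * Gt t x (covariant_deriv (Gt t) (\<lambda>y. inverse t *\<^sub>R \<xi> y) x a) b =
     (dform (Gt t) x (inverse t *\<^sub>R ?x) a b + Gt t x (inverse t *\<^sub>R ?D a) b + Gt t x a (inverse t *\<^sub>R ?D b)) +
     (t * deta x a b - t * deta x b a)"
    using covariant_deriv_decomposition[OF metric_on_Gt[OF t] x dV \<alpha>, of a b] unfolding d\<alpha> .
  also have "dform (Gt t) x (inverse t *\<^sub>R ?x) a b + Gt t x (inverse t *\<^sub>R ?D a) b + Gt t x a (inverse t *\<^sub>R ?D b) =
      (inverse t * t) * (dform G x ?x a b + G x (?D a) b + G x a (?D b))"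
    unfolding dO unfolding dform_Gt[OF x] unfolding Gt_def lG le lie real_scaleR_def by (simp add: algebra_simps)
  also have "\<dots> = dform G x ?x a b + G x (?D a) b + G x a (?D b)" using t by simp
  also have "\<dots> = 2 * \<theta> x a b - 2 * \<omega> x a b" using theta_eq[OF x, of a b] by simp
  also have "t * deta x a b - t * deta x b a = 2 * t * \<omega> x a b"
    unfolding omega_eq[OF x] by (simp add: right_diff_distrib)
  finally show ?thesis by (simp add: algebra_simps)
qed

text \<open>Koszul's formula is evaluated only against horizontal \<open>z\<close>, where most terms
  with \<eta> vanish. The component along \<xi> stays an unspecified \<open>r\<close>, because the
  forms paired with it annihilate \<xi>.\<close>

lemma covariant_deriv_deformed:
  assumes t: "t \<noteq> 0" and x: "x \<in> S" and B: "(B has_derivative B') (at x)" and hor: "\<eta> x (B x) = 0"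
  shows "\<exists>r. covariant_deriv (Gt t) B x b =
    covariant_deriv G B x b + (- (t - 1) * \<eta> x b) *\<^sub>R \<phi> x (B x) + r *\<^sub>R \<xi> x"
proof -
  let ?u = "covariant_deriv (Gt t) B x b" and ?v = "covariant_deriv G B x b + (- (t - 1) * \<eta> x b) *\<^sub>R \<phi> x (B x)"
  note bx = bG[OF x]
  have cov: "2 * H x (covariant_deriv H B x b) z = 2 * H x (B' b) z +
      (dform H x b (B x) z + dform H x (B x) b z - dform H x z b (B x))" if H: "metric_on H S" for H z
    unfolding covariant_deriv_def frechet_derivative_eqI[OF B]
      bilinear_ladd[OF metric_formD(1)[OF metric_onD(2)[OF H x]]] distrib_left christoffel_koszul[OF H x] ..
  have hz: "G x ?u z = G x ?v z" if z: "\<eta> x z = 0" for z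
  proof -
    have "2 * Gt t x ?u z = 2 * (t * G x ?u z)" by (simp add: Gt_def z)
    moreover have "2 * Gt t x ?u z = t * (2 * G x (covariant_deriv G B x b) z) +
        t * (t - 1) * (\<eta> x b * (deta x (B x) z - deta x z (B x)))"
      unfolding cov[OF metric_on_Gt[OF t]] cov[OF mG] unfolding dform_Gt[OF x] unfolding Gt_def
      by (simp add: z hor algebra_simps)
    moreover have "deta x (B x) z - deta x z (B x) = 2 * \<omega> x (B x) z"
      unfolding omega_eq[OF x] by simp
    ultimately have "t * (2 * G x ?u z) = t * (2 * G x (covariant_deriv G B x b) z + 2 * ((t - 1) * \<eta> x b * \<omega> x (B x) z))"
      by (simp add: algebra_simps)
    then have "G x ?u z = G x (covariant_deriv G B x b) z + (t - 1) * \<eta> x b * \<omega> x (B x) z"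
      using t by simp
    then show ?thesis
      unfolding bilinear_ladd[OF bx] bilinear_lmul[OF bx] phi_skew[OF x] by (simp add: \<omega>_def algebra_simps)
  qed
  let ?d = "?u - ?v"
  \<comment> \<open>A vector orthogonal to all horizontal vectors is a multiple of \<xi>; every
    \<open>z\<close> is corrected to a horizontal one by subtracting its \<xi>-component.\<close>
  have "?d = \<eta> x ?d *\<^sub>R \<xi> x"
  proof (rule metric_form_cancel[OF mf[OF x]])
    fix z
    let ?z = "z - \<eta> x z *\<^sub>R \<xi> x"
    have z0: "\<eta> x ?z = 0" by (simp add: linear_diff[OF linear_eta[OF x]] linear_cmul[OF linear_eta[OF x]] eta_xi[OF x])
    have "G x ?d z = G x ?d ?z + \<eta> x z * G x ?d (\<xi> x)"
      by (simp add: bilinear_rsub[OF bx] bilinear_rmul[OF bx])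
    also have "G x ?d ?z = 0" unfolding bilinear_lsub[OF bx] hz[OF z0] by simp
    also have "G x ?d (\<xi> x) = \<eta> x ?d" unfolding eta_eq[OF x] by (rule symG[OF x])
    finally show "G x ?d z = G x (\<eta> x ?d *\<^sub>R \<xi> x) z"
      by (simp only: bilinear_lmul[OF bx] eta_eq[OF x, of z, symmetric]) simp
  qed
  then have "?u = ?v + \<eta> x ?d *\<^sub>R \<xi> x" by (metis add_diff_cancel_left' diff_add_cancel add.commute)
  then show ?thesis by (intro exI[of _ "\<eta> x ?d"]) (simp only: add.assoc)
qed

text \<open>The form \<open>T\<close> annihilates \<xi> in both arguments. This allows the trace to
  be rescaled by \<open>1 / t\<close>, removes the unknown multiple of \<xi>, and makes the
  remaining correction, a rank one form of trace \<open>T(\<xi>, \<phi>B)\<close>, vanish.\<close>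

theorem first_variation_deformed:
  assumes t: "t \<noteq> 0" and x: "x \<in> S" and B: "(B has_derivative B') (at x)" and hor: "\<eta> x (B x) = 0"
  shows "metric_trace (Gt t x) (\<lambda>a b. Gt t x (covariant_deriv (Gt t) (\<lambda>y. inverse t *\<^sub>R \<xi> y) x a) (covariant_deriv (Gt t) B x b)) =
    (1 / t) * metric_trace (G x) (\<lambda>a b. \<theta> x a (covariant_deriv G B x b)) +
    ((t - 1) / t) * metric_trace (G x) (\<lambda>a b. \<omega> x a (covariant_deriv G B x b))"
proof -
  define T where "T a b = \<theta> x a b + (t - 1) * \<omega> x a b" for a b
  note bx = bG[OF x] and bo = bilinear_omega[OF x]
  have ln: "linear (covariant_deriv G \<xi> x)"
    by (rule linear_covariant_deriv[OF mG x differentiableI[OF smooth_on_has_derivative[OF smooth_xi x]]])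
  have lB: "linear (covariant_deriv G B x)" by (rule linear_covariant_deriv[OF mG x differentiableI[OF B]])
  have lBt: "linear (covariant_deriv (Gt t) B x)"
    by (rule linear_covariant_deriv[OF metric_on_Gt[OF t] x differentiableI[OF B]])
  have bT: "bilinear T"
    unfolding bilinear_def T_def
    by (intro conjI allI linearI)
      (simp_all add: linear_add[OF ln] linear_cmul[OF ln] bilinear_ladd[OF bx] bilinear_lmul[OF bx]
        bilinear_radd[OF bx] bilinear_rmul[OF bx] bilinear_ladd[OF bo] bilinear_lmul[OF bo]
        bilinear_radd[OF bo] bilinear_rmul[OF bo] algebra_simps)
  have T\<xi>: "T (\<xi> x) b = 0" "T a (\<xi> x) = 0" for a b
    using theta_xi[OF x] omega_xi[OF x] omega_skew[OF x, of a "\<xi> x"] by (simp_all add: T_def \<omega>_def)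
  have Tt: "T a (covariant_deriv (Gt t) B x b) =
      T a (covariant_deriv G B x b) + (- (t - 1)) * (T a (\<phi> x (B x)) * G x (\<xi> x) b)" for a b
  proof -
    obtain r where "covariant_deriv (Gt t) B x b =
        covariant_deriv G B x b + (- (t - 1) * \<eta> x b) *\<^sub>R \<phi> x (B x) + r *\<^sub>R \<xi> x"
      using covariant_deriv_deformed[OF t x B hor] by blast
    then show ?thesis
      by (simp add: bilinear_radd[OF bT] bilinear_rmul[OF bT] T\<xi> eta_eq[OF x])
  qed
  have bTt: "bilinear (\<lambda>a b. T a (covariant_deriv (Gt t) B x b))"
    unfolding bilinear_def
    by (intro conjI allI linearI)
      (simp_all add: linear_add[OF lBt] linear_cmul[OF lBt] bilinear_ladd[OF bT] bilinear_lmul[OF bT]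
        bilinear_radd[OF bT] bilinear_rmul[OF bT])
  have lT: "linear (\<lambda>a. T a (\<phi> x (B x)))" using bT by (simp add: bilinear_def)
  have "metric_trace (Gt t x) (\<lambda>a b. T a (covariant_deriv (Gt t) B x b)) =
      metric_trace (G x) (\<lambda>a b. T a (covariant_deriv (Gt t) B x b)) / t"
    by (rule metric_trace_Gt[OF x t bTt T\<xi>(1)])
  also have "metric_trace (G x) (\<lambda>a b. T a (covariant_deriv (Gt t) B x b)) =
      metric_trace (G x) (\<lambda>a b. T a (covariant_deriv G B x b))"
    unfolding Tt metric_trace_add metric_trace_cmult metric_trace_rank_one[OF mf[OF x] lT] T\<xi> by simp
  also have "\<dots> = metric_trace (G x) (\<lambda>a b. \<theta> x a (covariant_deriv G B x b)) +
      (t - 1) * metric_trace (G x) (\<lambda>a b. \<omega> x a (covariant_deriv G B x b))"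
    unfolding T_def metric_trace_add metric_trace_cmult ..
  finally show ?thesis
    unfolding theta_deformed[OF t x] T_def[symmetric] by (simp add: add_divide_distrib)
qed

end

lemma scale_measure_eq_density: "scale_measure r M = density M (\<lambda>_. r)"
  by (rule measure_eqI) (simp_all add: emeasure_density nn_integral_cmult_indicator)

lemma wedge_power2_scale:
  "wedge_power2 k (\<lambda>v w. t * \<omega> v w) = (\<lambda>v. t ^ k * wedge_power2 k \<omega> v)"
proof (induction k)
  case (Suc k)
  show ?case
    by (rule ext) (simp add: Suc.IH wedge_def sum_distrib_left mult_ac)
qed simp

lemma frechet_derivative_cmult:
  assumes "f differentiable (at x)"
  shows "frechet_derivative (\<lambda>y. t * f y :: real) (at x) a = t * frechet_derivative f (at x) a"
  using fun_cong[OF frechet_derivative_eqI[OF has_derivative_mult_right[OF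
      assms[unfolded frechet_derivative_works]]]] .

section \<open>The deformed structure on the manifold and its harmonicity\<close>

context paracontact_manifold
begin

lemma eta_smooth: "c \<in> A \<Longrightarrow> smooth_on (chart_image c) (\<lambda>x. \<eta> c x v)"
  using eta_form unfolding one_form_def by blast

lemma eta_linear: "c \<in> A \<Longrightarrow> x \<in> chart_image c \<Longrightarrow> linear (\<eta> c x)"
  using eta_form unfolding one_form_def by blast

lemma eta_transform:
  "c \<in> A \<Longrightarrow> d \<in> A \<Longrightarrow> p \<in> chart_dom c \<inter> chart_dom d \<Longrightarrow>
    \<eta> c (coord c p) v = \<eta> d (coord d p) (jacobian c d p v)"
  using eta_form unfolding one_form_def by blast

lemma xi_field: "vector_field A \<xi>"
  using reeb unfolding reeb_field_def by blast

lemma eta_xi: "c \<in> A \<Longrightarrow> x \<in> chart_image c \<Longrightarrow> \<eta> c x (\<xi> c x) = 1"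
  using reeb unfolding reeb_field_def by blast

lemma deform_g_eq_Gt:
  assumes "c \<in> A"
  shows "deform_g t \<eta> g c = local_paracontact.Gt (g c) (\<eta> c) t"
proof -
  interpret lp: local_paracontact "g c" "chart_image c" "\<phi> c" "\<xi> c" "\<eta> c" by (rule local_paracontact[OF assms])
  show ?thesis by (intro ext) (simp add: deform_g_def lp.Gt_def)
qed

lemma vector_field_scale: "vector_field A V \<Longrightarrow> vector_field A (\<lambda>c x. r *\<^sub>R V c x)"
  unfolding vector_field_def
proof (intro conjI ballI)
  assume V: "(\<forall>c\<in>A. smooth_on (chart_image c) (V c)) \<and>
     (\<forall>c\<in>A. \<forall>d\<in>A. \<forall>p\<in>chart_dom c \<inter> chart_dom d. V d (coord d p) = jacobian c d p (V c (coord c p)))"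
  show "smooth_on (chart_image c) (\<lambda>x. r *\<^sub>R V c x)" if "c \<in> A" for c
    unfolding smooth_on_def
    using V that by (intro allI Ck_on_scaleR Ck_on_const open_chart_image) (auto intro: smooth_on_imp_Ck)
  show "r *\<^sub>R V d (coord d p) = jacobian c d p (r *\<^sub>R V c (coord c p))"
    if a: "c \<in> A" "d \<in> A" "p \<in> chart_dom c \<inter> chart_dom d" for c d p
  proof -
    have "V d (coord d p) = jacobian c d p (V c (coord c p))" using V a by blast
    then show ?thesis by (simp add: linear_cmul[OF linear_jacobian[OF a]])
  qed
qed

lemma deform_xi_field: "vector_field A (deform_xi t \<xi>)"
  using vector_field_scale[OF xi_field, of "inverse t"] by (simp add: deform_xi_def[abs_def])

lemma ext_deriv_deform_eta:
  assumes "c \<in> A" "x \<in> chart_image c"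
  shows "ext_deriv (deform_eta t \<eta>) c x = (\<lambda>v w. t * ext_deriv \<eta> c x v w)"
proof (intro ext)
  fix v w
  have d: "(\<lambda>y. \<eta> c y v) differentiable (at x)" for v
    using differentiableI[OF smooth_on_has_derivative[OF eta_smooth[OF assms(1)] assms(2)]] .
  show "ext_deriv (deform_eta t \<eta>) c x v w = t * ext_deriv \<eta> c x v w"
    unfolding ext_deriv_def deform_eta_def frechet_derivative_cmult[OF d] by (simp add: right_diff_distrib)
qed

lemma deform_g_semi_riemannian:
  assumes t: "t \<noteq> 0"
  shows "semi_riemannian_metric A (deform_g t \<eta> g)"
  unfolding semi_riemannian_metric_def covariant_2_tensor_def
proof (intro conjI ballI allI impI)
  fix c assume c: "c \<in> A"
  interpret lp: local_paracontact "g c" "chart_image c" "\<phi> c" "\<xi> c" "\<eta> c" by (rule local_paracontact[OF c])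
  note m = lp.metric_on_Gt[OF t] and eq = deform_g_eq_Gt[OF c, of t]
  show "smooth_on (chart_image c) (\<lambda>x. deform_g t \<eta> g c x v w)" for v w
    unfolding eq by (rule metric_onD(3)[OF m])
  fix x assume x: "x \<in> chart_image c"
  note f = metric_onD(2)[OF m x]
  show "bilinear (deform_g t \<eta> g c x)" unfolding eq by (rule metric_formD(1)[OF f])
  show "deform_g t \<eta> g c x v w = deform_g t \<eta> g c x w v" for v w unfolding eq by (rule metric_formD(2)[OF f])
  show "v = 0" if "\<forall>w. deform_g t \<eta> g c x v w = 0" for v
    using that metric_formD(3)[OF f] unfolding eq by blast
next
  fix c d p v w assume a: "c \<in> A" "d \<in> A" "p \<in> chart_dom c \<inter> chart_dom d"
  show "deform_g t \<eta> g c (coord c p) v w =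
      deform_g t \<eta> g d (coord d p) (jacobian c d p v) (jacobian c d p w)"
    unfolding deform_g_def covariant_2_tensor_transform[OF metric_covariant a, of v w]
      eta_transform[OF a, of v] eta_transform[OF a, of w] ..
qed

lemma paracontact_deformed:
  assumes t: "t \<noteq> 0"
  shows "paracontact_metric_manifold n X A (deform_phi t \<phi>) (deform_xi t \<xi>) (deform_eta t \<eta>) (deform_g t \<eta> g)"
  unfolding paracontact_metric_manifold_def
proof (intro conjI ballI allI)
  show "connected_smooth_manifold X A" using paracontact unfolding paracontact_metric_manifold_def by blast
  have card: "CARD('n) = 2 * n + 1" and nonzero: "\<And>c x. c \<in> A \<Longrightarrow> x \<in> chart_image c \<Longrightarrow>
      \<exists>v. wedge 1 (2 * n) (\<lambda>v. \<eta> c x (v 0)) (wedge_power2 n (ext_deriv \<eta> c x)) v \<noteq> 0"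
    using paracontact unfolding paracontact_metric_manifold_def contact_form_def by blast+
  show "contact_form n A (deform_eta t \<eta>)"
    unfolding contact_form_def
  proof (intro conjI ballI)
    show "CARD('n) = 2 * n + 1" by (rule card)
    show "one_form A (deform_eta t \<eta>)"
      unfolding one_form_def
    proof (intro conjI ballI allI)
      fix c assume c: "c \<in> A"
      show "linear (deform_eta t \<eta> c x)" if "x \<in> chart_image c" for x
        using eta_linear[OF c that] by (intro linearI) (simp_all add: deform_eta_def linear_add linear_cmul algebra_simps)
      show "smooth_on (chart_image c) (\<lambda>x. deform_eta t \<eta> c x v)" for v
        unfolding smooth_on_def deform_eta_def
        by (intro allI Ck_on_mult open_chart_image[OF c] Ck_on_const smooth_on_imp_Ck[OF eta_smooth[OF c]])
    next
      show "deform_eta t \<eta> c (coord c p) v = deform_eta t \<eta> d (coord d p) (jacobian c d p v)"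
        if "c \<in> A" "d \<in> A" "p \<in> chart_dom c \<inter> chart_dom d" for c d p v
        unfolding deform_eta_def eta_transform[OF that, of v] ..
    qed
    fix c x assume c: "c \<in> A" "x \<in> chart_image c"
    obtain v where v: "wedge 1 (2 * n) (\<lambda>v. \<eta> c x (v 0)) (wedge_power2 n (ext_deriv \<eta> c x)) v \<noteq> 0"
      using nonzero[OF c] by blast
    \<comment> \<open>One factor \<open>t\<close> comes from \<eta> and one from each of the
      \<open>n\<close> factors \<open>d\<eta>\<close>.\<close>
    have "wedge 1 (2 * n) (\<lambda>v. deform_eta t \<eta> c x (v 0)) (wedge_power2 n (ext_deriv (deform_eta t \<eta>) c x)) v =
       t ^ Suc n * wedge 1 (2 * n) (\<lambda>v. \<eta> c x (v 0)) (wedge_power2 n (ext_deriv \<eta> c x)) v"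
      unfolding ext_deriv_deform_eta[OF c] wedge_power2_scale
      by (simp add: wedge_def deform_eta_def sum_distrib_left mult_ac)
    then show "\<exists>v. wedge 1 (2 * n) (\<lambda>v. deform_eta t \<eta> c x (v 0))
        (wedge_power2 n (ext_deriv (deform_eta t \<eta>) c x)) v \<noteq> 0"
      using v t by (intro exI[of _ v]) simp
  qed
  show "reeb_field A (deform_eta t \<eta>) (deform_xi t \<xi>)"
    unfolding reeb_field_def
  proof (intro conjI ballI allI)
    show "vector_field A (deform_xi t \<xi>)" by (rule deform_xi_field)
    fix c x assume c: "c \<in> A" "x \<in> chart_image c"
    interpret lp: local_paracontact "g c" "chart_image c" "\<phi> c" "\<xi> c" "\<eta> c" by (rule local_paracontact[OF c(1)])
    show "deform_eta t \<eta> c x (deform_xi t \<xi> c x) = 1"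
      using t by (simp add: deform_eta_def deform_xi_def linear_cmul[OF lp.linear_eta[OF c(2)]] lp.eta_xi[OF c(2)])
    show "ext_deriv (deform_eta t \<eta>) c x (deform_xi t \<xi> c x) v = 0" for v
      unfolding ext_deriv_deform_eta[OF c] compatible(2)[OF c]
      by (simp add: deform_xi_def bilinear_lmul[OF lp.bG[OF c(2)]] lp.omega_xi[OF c(2)])
  qed
  show "semi_riemannian_metric A (deform_g t \<eta> g)" by (rule deform_g_semi_riemannian[OF t])
  show "endomorphism_field A (deform_phi t \<phi>)" using phi_field by (simp add: deform_phi_def)
  fix c x v w assume c: "c \<in> A" "x \<in> chart_image c"
  interpret lp: local_paracontact "g c" "chart_image c" "\<phi> c" "\<xi> c" "\<eta> c" by (rule local_paracontact[OF c(1)])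
  show "deform_eta t \<eta> c x v = deform_g t \<eta> g c x (deform_xi t \<xi> c x) v"
    using t by (simp add: deform_eta_def deform_g_def deform_xi_def bilinear_lmul[OF lp.bG[OF c(2)]]
        lp.eta_eq[OF c(2), symmetric] linear_cmul[OF lp.linear_eta[OF c(2)]] lp.eta_xi[OF c(2)] field_simps)
  show "ext_deriv (deform_eta t \<eta>) c x v w = deform_g t \<eta> g c x v (deform_phi t \<phi> c x w)"
    unfolding ext_deriv_deform_eta[OF c] compatible(2)[OF c]
    by (simp add: deform_g_def deform_phi_def lp.eta_phi[OF c(2)])
  show "deform_phi t \<phi> c x (deform_phi t \<phi> c x v) = v - deform_eta t \<eta> c x v *\<^sub>R deform_xi t \<xi> c x"
    using t by (simp add: deform_phi_def deform_eta_def deform_xi_def lp.phi_phi[OF c(2)])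
qed

text \<open>With \<open>CARD('n) = 2 * n + 1\<close> the constant is the power \<open>n + 1\<close>
  of the absolute value of \<open>t\<close>. Stating it as a density lets
  \<open>integral_density\<close> pull it out of integrals.\<close>

lemma volume_measure_deformed:
  assumes t: "t \<noteq> 0"
  shows "volume_measure X A (deform_g t \<eta> g) =
    density (volume_measure X A g) (\<lambda>_. ennreal (sqrt (\<bar>t\<bar> ^ CARD('n) * \<bar>t\<bar>)))"
  unfolding scale_measure_eq_density[symmetric]
proof (rule volume_measure_scale[OF metric_covariant semi_riemannian_covariant[OF deform_g_semi_riemannian[OF t]]])
  fix c x assume c: "c \<in> A" "x \<in> chart_image c"
  interpret lp: local_paracontact "g c" "chart_image c" "\<phi> c" "\<xi> c" "\<eta> c" by (rule local_paracontact[OF c(1)])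
  show "volume_density (deform_g t \<eta> g) c x = sqrt (\<bar>t\<bar> ^ CARD('n) * \<bar>t\<bar>) * volume_density g c x"
    unfolding volume_density_def deform_g_eq_Gt[OF c(1)] lp.abs_det_gram_Gt[OF c(2) t]
    by (rule real_sqrt_mult)
qed simp

text \<open>Representatives carry meaning only on the chart image, so a variation field equals its
  prescribed direction only there.\<close>

lemma deriv_trace_cong:
  assumes h: "semi_riemannian_metric A h" and c: "c \<in> A" "x \<in> chart_image c"
    and B: "C1_field B" "\<And>y. y \<in> chart_image c \<Longrightarrow> B' c y = B c y"
  shows "deriv_trace h T B' c x = deriv_trace h T B c x"
proof -
  have "frechet_derivative (B' c) (at x) = frechet_derivative (B c) (at x)"
    by (rule frechet_derivative_cong_open(1)[OF open_chart_image[OF c(1)] c(2) _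
        differentiableI[OF C1_field_has_derivative[OF B(1) c]]]) (simp add: B(2))
  then show ?thesis by (simp add: deriv_trace_def covariant_deriv_def B(2)[OF c(2)])
qed

definition first_variation_density :: "('m, 'n) vecfield \<Rightarrow> 'm \<Rightarrow> real" where
  "first_variation_density B = at_point (deriv_trace g (energy_gradient g \<xi>) B)"

lemma first_variation_density_eq:
  "C1_field B \<Longrightarrow> c \<in> A \<Longrightarrow> p \<in> chart_dom c \<Longrightarrow>
    first_variation_density B p = deriv_trace g (energy_gradient g \<xi>) B c (coord c p)"
  unfolding first_variation_density_def
  by (rule at_point_deriv_trace[OF metric _ pointwise_covariant_energy_gradient[OF metric vector_field_C1[OF xi_field]]])

lemma set_integrable_first_variation_density:
  assumes "C1_field B" and D: "relatively_compact_domain X D"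
  shows "set_integrable (volume_measure X A g) D (first_variation_density B)"
    and "set_integrable (volume_measure X A g) D (fundamental_trace B)"
proof -
  note x = vector_field_C1[OF xi_field]
  have D': "openin X D" "compactin X (X closure_of D)" using D by (auto simp: relatively_compact_domain_def)
  show "set_integrable (volume_measure X A g) D (first_variation_density B)"
    unfolding first_variation_density_def
    by (rule continuous_imp_set_integrable[OF metric_covariant continuous_map_deriv_trace[OF metric assms(1)
        pointwise_covariant_energy_gradient[OF metric x] continuous_on_energy_gradient[OF metric x]] D'])
  show "set_integrable (volume_measure X A g) D (fundamental_trace B)"
    by (rule continuous_imp_set_integrable[OF metric_covariant continuous_map_fundamental_trace[OF assms(1)] D'])
qed

lemma set_integral_fundamental_trace:
  assumes B: "horizontal_supported B K" and K: "K \<subseteq> D"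
  shows "(LINT p:D|volume_measure X A g. fundamental_trace B p) = 0"
proof -
  have "(LINT p:D|volume_measure X A g. fundamental_trace B p) = (LINT p|volume_measure X A g. fundamental_trace B p)"
    unfolding set_lebesgue_integral_def
  proof (rule Bochner_Integration.integral_cong[OF refl])
    fix p assume "p \<in> space (volume_measure X A g)"
    then show "indicator D p *\<^sub>R fundamental_trace B p = fundamental_trace B p"
      using fundamental_trace_outside[OF B, of p] K by (cases "p \<in> D") (auto simp: space_volume_measure[OF metric_covariant])
  qed
  then show ?thesis using integral_fundamental_trace[OF B] by simp
qed

text \<open>The variation is the rational parametrization of the unit quadric in the plane spanned by
  \<open>\<xi>\<close> and \<open>B\<close>: with \<open>q = s\<^sup>2 g(B,B) / 4\<close> one has \<open>(1 - q)\<^sup>2 + s\<^sup>2 g(B,B) = (1 + q)\<^sup>2\<close>, whatever the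
  sign of \<open>g(B,B)\<close>.\<close>

definition unit_variation :: "('m, 'n) vecfield \<Rightarrow> real \<Rightarrow> ('m, 'n) vecfield" where
  "unit_variation B s c x = (let q = s\<^sup>2 / 4 * g c x (B c x) (B c x) in
    inverse (1 + q) *\<^sub>R ((1 - q) *\<^sub>R \<xi> c x + s *\<^sub>R B c x))"

lemma unit_variation_0: "unit_variation B 0 = \<xi>"
  by (intro ext) (simp add: unit_variation_def Let_def)

text \<open>Harmonicity speaks of variations, not of directions. To test it on a given
  \<open>B\<close>, the field \<open>B\<close> is made the direction of
  \<open>unit_variation B\<close>, which has to be smooth, of length 1 and equal to \<xi> outside
  \<open>K\<close>.\<close>

lemma first_variation_zero:
  assumes harm: "harmonic_vector_field X A g \<xi>" and ne: "topspace X \<noteq> {}"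
    and B: "vector_field A B" "horizontal_supported B K" and D: "relatively_compact_domain X D" "K \<subseteq> D"
  shows "(LINT p:D|volume_measure X A g. first_variation_density B p) = 0"
proof -
  note H = horizontal_supportedD[OF B(2)]
  define Q where "Q c x = g c x (B c x) (B c x)" for c x
  have QCk: "Ck_on k (Q c) (chart_image c)" if c: "c \<in> A" for c k
  proof -
    interpret lp: local_paracontact "g c" "chart_image c" "\<phi> c" "\<xi> c" "\<eta> c" by (rule local_paracontact[OF c])
    have Bc: "Ck_on k (B c) (chart_image c)" using B(1) c smooth_on_imp_Ck unfolding vector_field_def by blast
    have "Ck_on k (\<lambda>x. \<Sum>i\<in>UNIV. \<Sum>j\<in>UNIV. B c x $ i * B c x $ j * g c x (axis i 1) (axis j 1)) (chart_image c)"
      by (intro Ck_on_sum Ck_on_mult open_chart_image[OF c] Ck_on_vec_nth[OF _ Bc] smooth_on_imp_Ck[OF metric_onD(3)[OF lp.mG]])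
    then show ?thesis
      by (rule Ck_on_cong[OF open_chart_image[OF c], rotated])
        (simp add: Q_def bilinear_eq_sum[OF lp.bG, symmetric])
  qed
  have Qtr: "Q c (coord c p) = Q d (coord d p)" if "c \<in> A" "d \<in> A" "p \<in> chart_dom c \<inter> chart_dom d" for c d p
    unfolding Q_def covariant_2_tensor_transform[OF metric_covariant that] C1_field_transform[OF H(1) that] ..
  \<comment> \<open>Where \<open>g(B, B)\<close> is negative, the denominator \<open>1 + q\<close>
    could vanish. A global bound, available because \<open>B\<close> vanishes outside a compact set,
    excludes this for small times.\<close>
  obtain b where b: "b \<ge> 0" "\<And>c p. c \<in> A \<Longrightarrow> p \<in> chart_dom c \<Longrightarrow> \<bar>Q c (coord c p)\<bar> \<le> b"
  proof -
    define f where "f p = (let c = SOME c. c \<in> A \<and> p \<in> chart_dom c in Q c (coord c p))" for p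
    have f: "f p = Q c (coord c p)" if c: "c \<in> A" "p \<in> chart_dom c" for c p
    proof -
      define d where "d = (SOME c. c \<in> A \<and> p \<in> chart_dom c)"
      have "d \<in> A \<and> p \<in> chart_dom d" unfolding d_def by (rule someI[of _ c]) (use c in auto)
      then show ?thesis using Qtr[of d c p] c by (auto simp: f_def d_def[symmetric] Let_def)
    qed
    have "continuous_map X euclideanreal f"
      by (rule continuous_map_chartsI[where l = Q]) (use Ck_on_imp_continuous[OF QCk] f in auto)
    then have "compact (f ` K)" using image_compactin[OF H(2)] by fastforce
    from compact_imp_bounded[OF this] obtain b where "b > 0" "\<forall>y\<in>f ` K. norm y \<le> b"
      unfolding bounded_pos by (elim exE conjE)
    then have "\<bar>f p\<bar> \<le> b" if "p \<in> K" for p using that by auto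
    moreover have "Q c (coord c p) = 0" if "c \<in> A" "p \<in> chart_dom c - K" for c p
      using H(4)[OF that] bilinear_lzero[OF metric_formD(1)[OF metric_onD(2)[OF semi_riemannian_metric_on[OF metric that(1)]]]]
        coord_in_image[of p c] that by (simp add: Q_def)
    ultimately have "\<bar>Q c (coord c p)\<bar> \<le> b" if "c \<in> A" "p \<in> chart_dom c" for c p
      using f[OF that] that \<open>b > 0\<close> by (cases "p \<in> K") (force, simp)
    then show thesis using that[of b] \<open>b > 0\<close> by simp
  qed
  \<comment> \<open>This choice bounds \<open>s\<^sup>2 / 4\<close> times \<open>b\<close> by
    \<open>1 / 4\<close>, so \<open>1 + q\<close> stays positive, also when \<open>b\<close> is
    0.\<close>
  define \<epsilon> where "\<epsilon> = 1 / (1 + b)"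
  have \<epsilon>: "\<epsilon> > 0" using b(1) by (simp add: \<epsilon>_def)
  let ?I = "{-\<epsilon><..<\<epsilon>}"
  have pos: "1 + s\<^sup>2 / 4 * Q c x > 0" if s: "s \<in> ?I" and c: "c \<in> A" "x \<in> chart_image c" for s c x
  proof -
    have Qb: "\<bar>Q c x\<bar> \<le> b"
      using b(2)[OF c(1) chart_point_in[OF c(2)]] coord_chart_point[OF c(2)] by simp
    have "\<bar>s\<bar> \<le> \<epsilon>" using s by auto
    then have "s\<^sup>2 \<le> \<epsilon>\<^sup>2" by (metis abs_le_square_iff abs_of_pos \<epsilon>)
    then have "s\<^sup>2 / 4 * \<bar>Q c x\<bar> \<le> \<epsilon>\<^sup>2 / 4 * b" using Qb b(1) by (intro mult_mono) auto
    also have "\<dots> = (b / (1 + b)) * (1 / (1 + b)) / 4" by (simp add: \<epsilon>_def power2_eq_square)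
    also have "\<dots> \<le> 1 * 1 / 4" using b(1) by (intro divide_right_mono mult_mono) (auto simp: field_simps)
    finally have "\<bar>s\<^sup>2 / 4 * Q c x\<bar> \<le> 1 / 4" by (simp add: abs_mult)
    then show ?thesis by linarith
  qed
  let ?W = "unit_variation B"
  have W_eq: "?W s c x = inverse (1 + s\<^sup>2 / 4 * Q c x) *\<^sub>R ((1 - s\<^sup>2 / 4 * Q c x) *\<^sub>R \<xi> c x + s *\<^sub>R B c x)" for s c x
    by (simp add: unit_variation_def Q_def Let_def)
  have sm: "smooth_on (?I \<times> chart_image c) (\<lambda>(s, x). ?W s c x)" if c: "c \<in> A" for c
    unfolding smooth_on_def
  proof
    fix k
    let ?U = "?I \<times> chart_image c"
    have o: "open ?U" by (intro open_Times open_chart_image[OF c]) auto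
    have lift: "Ck_on k (\<lambda>z. f (snd z)) ?U" if "Ck_on k f (chart_image c)" for f :: "real ^ 'n \<Rightarrow> 'z::real_normed_vector"
      using Ck_on_affine_compose[OF bounded_linear_snd open_chart_image[OF c] o _ that, of 0] by auto
    have s: "Ck_on k (\<lambda>z. fst z) ?U" by (rule Ck_on_bounded_linear[OF bounded_linear_fst o])
    have q: "Ck_on k (\<lambda>z. (fst z)\<^sup>2 / 4 * Q c (snd z)) ?U"
    proof -
      have "Ck_on k (\<lambda>z. (1 / 4) * (fst z * fst z) * Q c (snd z)) ?U"
        by (intro Ck_on_mult o Ck_on_const s lift QCk[OF c])
      then show ?thesis by (simp add: power2_eq_square)
    qed
    have "Ck_on k (\<lambda>z. inverse (1 + (fst z)\<^sup>2 / 4 * Q c (snd z)) *\<^sub>R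
        ((1 - (fst z)\<^sup>2 / 4 * Q c (snd z)) *\<^sub>R \<xi> c (snd z) + fst z *\<^sub>R B c (snd z))) ?U"
    proof (intro Ck_on_scaleR Ck_on_inverse Ck_on_add Ck_on_diff o Ck_on_const q s lift)
      show "1 + (fst z)\<^sup>2 / 4 * Q c (snd z) \<noteq> 0" if "z \<in> ?U" for z
        using pos[of "fst z" c "snd z"] that c by auto
      show "Ck_on k (\<xi> c) (chart_image c)"
        using xi_field c smooth_on_imp_Ck unfolding vector_field_def by blast
      show "Ck_on k (B c) (chart_image c)"
        using B(1) c smooth_on_imp_Ck unfolding vector_field_def by blast
    qed
    then show "Ck_on k (\<lambda>(s, x). ?W s c x) ?U"
      unfolding case_prod_unfold W_eq .
  qed
  have WV: "vector_field A (?W s)" if s: "s \<in> ?I" for s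
    unfolding vector_field_def
  proof (intro conjI ballI)
    fix c assume c: "c \<in> A"
    have lin: "bounded_linear (\<lambda>x :: real ^ 'n. (0 :: real, x))"
      by (intro bounded_linear_Pair bounded_linear_zero bounded_linear_ident)
    have o: "open (?I \<times> chart_image c)" by (intro open_Times open_chart_image[OF c]) auto
    show "smooth_on (chart_image c) (?W s c)"
      unfolding smooth_on_def
    proof
      fix k
      have "Ck_on k (\<lambda>x. (\<lambda>(s, x). ?W s c x) ((s, 0) + (0, x))) (chart_image c)"
        by (rule Ck_on_affine_compose[OF lin o open_chart_image[OF c] _ smooth_on_imp_Ck[OF sm[OF c]]])
          (use s in auto)
      then show "Ck_on k (?W s c) (chart_image c)" by simp
    qed
    fix d p assume d: "d \<in> A" and p: "p \<in> chart_dom c \<inter> chart_dom d"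
    note l = linear_jacobian[OF c d p]
    show "?W s d (coord d p) = jacobian c d p (?W s c (coord c p))"
      unfolding W_eq linear_cmul[OF l] linear_add[OF l] Qtr[OF c d p]
        C1_field_transform[OF H(1) c d p] C1_field_transform[OF vector_field_C1[OF xi_field] c d p] ..
  qed
  have len: "constant_length A g (?W s) 1" if s: "s \<in> ?I" for s
    unfolding constant_length_def
  proof (intro ballI)
    fix c x assume c: "c \<in> A" "x \<in> chart_image c"
    interpret lp: local_paracontact "g c" "chart_image c" "\<phi> c" "\<xi> c" "\<eta> c" by (rule local_paracontact[OF c(1)])
    note bb = lp.bG[OF c(2)]
    let ?q = "s\<^sup>2 / 4 * Q c x"
    have "g c x (\<xi> c x) (\<xi> c x) = 1" "g c x (\<xi> c x) (B c x) = 0" "g c x (B c x) (\<xi> c x) = 0"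
      using lp.eta_eq[OF c(2)] lp.eta_xi[OF c(2)] H(3)[OF c] lp.symG[OF c(2), of "B c x"] by simp_all
    then have "g c x (i *\<^sub>R (r *\<^sub>R \<xi> c x + s *\<^sub>R B c x)) (i *\<^sub>R (r *\<^sub>R \<xi> c x + s *\<^sub>R B c x)) =
        (i * i) * (r * r + s * s * Q c x)" for i r
      by (simp add: bilinear_ladd[OF bb] bilinear_lmul[OF bb] bilinear_radd[OF bb] bilinear_rmul[OF bb]
          Q_def[symmetric] algebra_simps)
    then have "g c x (?W s c x) (?W s c x) = (inverse (1 + ?q) * inverse (1 + ?q)) * ((1 - ?q) * (1 - ?q) + s * s * Q c x)"
      unfolding W_eq .
    also have "(1 - ?q) * (1 - ?q) + s * s * Q c x = (1 + ?q) * (1 + ?q)"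
      by (simp add: algebra_simps power2_eq_square)
    also have "inverse (1 + ?q) * inverse (1 + ?q) * ((1 + ?q) * (1 + ?q)) = 1"
    proof -
      have "inverse z * inverse z * (z * z) = 1" if "z > 0" for z :: real
        using that by (simp add: field_simps)
      from this[OF pos[OF s c]] show ?thesis .
    qed
    finally show "g c x (?W s c x) (?W s c x) = 1" .
  qed
  have Wout: "?W s c (coord c p) = \<xi> c (coord c p)" if "c \<in> A" "p \<in> chart_dom c - K" for s c p
    using H(4)[OF that] bilinear_lzero[OF metric_formD(1)[OF metric_onD(2)[OF semi_riemannian_metric_on[OF metric that(1)]]]]
      coord_in_image[of p c] that by (simp add: W_eq Q_def)
  obtain r where r: "r \<noteq> 0" "constant_length A g \<xi> r" and crit: "\<And>D \<epsilon> W. relatively_compact_domain X D \<Longrightarrow>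
     length_preserving_variation X A g r D \<xi> \<epsilon> W \<Longrightarrow> ((\<lambda>s. energy X A g D (W s)) has_real_derivative 0) (at 0)"
    using harm unfolding harmonic_vector_field_def by blast
  \<comment> \<open>Harmonicity supplies some length \<open>r\<close>; a point of the manifold
    identifies it with the length 1 of the Reeb field.\<close>
  have "r = 1"
  proof -
    obtain p where "p \<in> topspace X" using ne by blast
    then obtain c where c: "c \<in> A" "p \<in> chart_dom c" using Union_chart_dom by blast
    show ?thesis
      using r(2) c coord_in_image[OF c(2)] len[of 0] \<epsilon> unit_variation_0[of B] unfolding constant_length_def by force
  qed
  have "length_preserving_variation X A g 1 D \<xi> \<epsilon> ?W"
    unfolding length_preserving_variation_def
  proof (intro conjI ballI)
    show "?W 0 c x = \<xi> c x" for c x by (simp add: unit_variation_0)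
    show "\<exists>K. compactin X K \<and> K \<subseteq> D \<and> (\<forall>s\<in>?I. \<forall>c\<in>A. \<forall>p\<in>chart_dom c - K. ?W s c (coord c p) = \<xi> c (coord c p))"
      by (intro exI[of _ K] conjI ballI H(2) D(2) Wout)
  qed (rule \<epsilon> WV len sm, assumption?)+
  from crit[OF D(1) this[folded \<open>r = 1\<close>]]
  have zero: "((\<lambda>s. energy X A g D (?W s)) has_real_derivative 0) (at 0)" .
  have "((\<lambda>s. energy X A g D (?W s)) has_real_derivative (LINT p:D|volume_measure X A g.
      at_point (deriv_trace g (energy_gradient g (?W 0)) (variation_field ?W)) p)) (at 0)"
    by (rule first_variation[OF metric D(1) \<epsilon> WV sm H(2) D(2)]) (simp_all add: Wout unit_variation_0)
  then have "(LINT p:D|volume_measure X A g. at_point (deriv_trace g (energy_gradient g \<xi>) (variation_field ?W)) p) = 0"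
    using DERIV_unique[OF _ zero] by (simp add: unit_variation_0)
  moreover have "at_point (deriv_trace g (energy_gradient g \<xi>) (variation_field ?W)) p = first_variation_density B p"
    if p: "p \<in> D" for p
  proof -
    have "p \<in> topspace X" using p D(1) openin_subset unfolding relatively_compact_domain_def by blast
    then obtain c where c: "c \<in> A" "p \<in> chart_dom c" using Union_chart_dom by blast
    have vf: "variation_field ?W c y = B c y" if y: "y \<in> chart_image c" for y
    proof -
      have 1: "((\<lambda>s. ?W s c y) has_vector_derivative variation_field ?W c y) (at 0)"
        using smooth_on_slice_time[OF sm[OF c(1)], of 0 y] \<epsilon> y by (simp add: variation_field_def)
      \<comment> \<open>Both scalar coefficients depend on \<open>s\<close> through its square, so
        at time 0 only the term with \<open>B\<close> contributes to the derivative.\<close>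
      have i: "((\<lambda>s. inverse (1 + s\<^sup>2 / 4 * Q c y)) has_real_derivative 0) (at 0)"
        by (auto intro!: derivative_eq_intros)
      have q: "((\<lambda>s. 1 - s\<^sup>2 / 4 * Q c y) has_real_derivative 0) (at 0)"
        by (auto intro!: derivative_eq_intros)
      have "((\<lambda>s. (1 - s\<^sup>2 / 4 * Q c y) *\<^sub>R \<xi> c y + s *\<^sub>R B c y) has_vector_derivative B c y) (at 0)"
        using has_vector_derivative_add[OF has_vector_derivative_scaleR[OF q has_vector_derivative_const[of "\<xi> c y"]]
            has_vector_derivative_scaleR[OF DERIV_ident has_vector_derivative_const[of "B c y"]]] by simp
      from has_vector_derivative_scaleR[OF i this]
      have "((\<lambda>s. ?W s c y) has_vector_derivative B c y) (at 0)" by (simp add: W_eq)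
      then show ?thesis by (rule vector_derivative_unique_at[OF 1])
    qed
    have C1v: "C1_field (variation_field ?W)" by (rule vector_field_C1[OF vector_field_variation_field[OF \<epsilon> WV sm]])
    have "at_point (deriv_trace g (energy_gradient g \<xi>) (variation_field ?W)) p =
        deriv_trace g (energy_gradient g \<xi>) (variation_field ?W) c (coord c p)"
      by (rule at_point_deriv_trace[OF metric C1v pointwise_covariant_energy_gradient[OF metric vector_field_C1[OF xi_field]] c])
    also have "\<dots> = deriv_trace g (energy_gradient g \<xi>) B c (coord c p)"
      by (rule deriv_trace_cong[where B = B and B' = "variation_field ?W", OF metric c(1) coord_in_image[OF c(2)] H(1) vf])
    finally show ?thesis using first_variation_density_eq[OF H(1) c] by simp
  qed
  ultimately show ?thesis
    unfolding set_lebesgue_integral_def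
    by (metis (no_types, lifting) Bochner_Integration.integral_cong indicator_simps(2) scaleR_zero_left)
qed

theorem harmonic_deformed:
  assumes harm: "harmonic_vector_field X A g \<xi>" and t: "t \<noteq> 0"
  shows "harmonic_vector_field X A (deform_g t \<eta> g) (deform_xi t \<xi>)"
proof -
  let ?g = "deform_g t \<eta> g" and ?\<xi> = "deform_xi t \<xi>" and ?\<mu> = "volume_measure X A g"
  note gt = deform_g_semi_riemannian[OF t] and xt = deform_xi_field[of t]
  have len: "constant_length A ?g ?\<xi> 1"
    unfolding constant_length_def
  proof (intro ballI)
    fix c x assume c: "c \<in> A" "x \<in> chart_image c"
    interpret lp: local_paracontact "g c" "chart_image c" "\<phi> c" "\<xi> c" "\<eta> c" by (rule local_paracontact[OF c(1)])
    have "g c x (\<xi> c x) (\<xi> c x) = 1" using lp.eta_eq[OF c(2)] lp.eta_xi[OF c(2)] by simp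
    then show "?g c x (?\<xi> c x) (?\<xi> c x) = 1"
      using t by (simp add: deform_g_def deform_xi_def bilinear_lmul[OF lp.bG[OF c(2)]] bilinear_rmul[OF lp.bG[OF c(2)]]
          linear_cmul[OF lp.linear_eta[OF c(2)]] lp.eta_xi[OF c(2)] field_simps)
  qed
  have "((\<lambda>s. energy X A ?g D (W s)) has_real_derivative 0) (at 0)"
    if D: "relatively_compact_domain X D" and var: "length_preserving_variation X A ?g 1 D ?\<xi> \<epsilon> W" for D \<epsilon> W
  proof (cases "topspace X = {}")
    case True
    \<comment> \<open>Without points the length \<open>r\<close> of the original harmonicity is
      undetermined, so this case is settled directly: all energies are 0.\<close>
    then have "D = {}" using D openin_subset unfolding relatively_compact_domain_def by blast
    then show ?thesis by (simp add: energy_def set_lebesgue_integral_def)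
  next
    case False
    have \<epsilon>: "\<epsilon> > 0" and W: "\<And>s. s \<in> {-\<epsilon><..<\<epsilon>} \<Longrightarrow> vector_field A (W s)"
      and Wl: "\<And>s. s \<in> {-\<epsilon><..<\<epsilon>} \<Longrightarrow> constant_length A ?g (W s) 1"
      and sm: "\<And>c. c \<in> A \<Longrightarrow> smooth_on ({-\<epsilon><..<\<epsilon>} \<times> chart_image c) (\<lambda>(s, x). W s c x)"
      and W0: "\<And>c x. c \<in> A \<Longrightarrow> x \<in> chart_image c \<Longrightarrow> W 0 c x = ?\<xi> c x"
      using var unfolding length_preserving_variation_def by blast+
    obtain K where K: "compactin X K" "K \<subseteq> D" and Wout: "\<And>s c p. s \<in> {-\<epsilon><..<\<epsilon>} \<Longrightarrow> c \<in> A \<Longrightarrow> p \<in> chart_dom c - K \<Longrightarrow>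
        W s c (coord c p) = ?\<xi> c (coord c p)"
      using var unfolding length_preserving_variation_def by blast
    have 0: "0 \<in> {-\<epsilon><..<\<epsilon>}" using \<epsilon> by simp
    have oI: "open {-\<epsilon><..<\<epsilon>}" by simp
    let ?B = "variation_field W"
    have B: "vector_field A ?B" by (rule vector_field_variation_field[OF \<epsilon> W sm])
    note C1B = vector_field_C1[OF B]
    have time: "((\<lambda>s. W s c x) has_vector_derivative ?B c x) (at 0)" if "c \<in> A" "x \<in> chart_image c" for c x
      using smooth_on_slice_time[OF sm[OF that(1)], of 0 x] 0 that(2) by (simp add: variation_field_def)
    \<comment> \<open>Differentiating the constant length of \<open>W s\<close> for the deformed
      metric shows that \<open>B\<close> is orthogonal to the deformed Reeb field. Its dual form is
      \<open>t\<close> times \<eta>, so \<open>B\<close> is horizontal for the original structure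
      too.\<close>
    have hor: "\<eta> c x (?B c x) = 0" if c: "c \<in> A" "x \<in> chart_image c" for c x
    proof -
      interpret lp: local_paracontact "g c" "chart_image c" "\<phi> c" "\<xi> c" "\<eta> c" by (rule local_paracontact[OF c(1)])
      note m = metric_onD(2)[OF semi_riemannian_metric_on[OF gt c(1)] c(2)]
      have bb: "bounded_bilinear (?g c x)" using metric_formD(1)[OF m] bilinear_conv_bounded_bilinear by blast
      have 1: "((\<lambda>s. ?g c x (W s c x) (W s c x)) has_vector_derivative
          ?g c x (W 0 c x) (?B c x) + ?g c x (?B c x) (W 0 c x)) (at 0)"
        by (rule bounded_bilinear.has_vector_derivative[OF bb time[OF c] time[OF c]])
      have 2: "((\<lambda>s. ?g c x (W s c x) (W s c x)) has_vector_derivative 0) (at 0)"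
        by (rule has_vector_derivative_transform_within_open[OF has_vector_derivative_const[of 1] oI 0])
          (use Wl c in \<open>auto simp: constant_length_def\<close>)
      have "?g c x (W 0 c x) (?B c x) + ?g c x (?B c x) (W 0 c x) = 0"
        by (rule vector_derivative_unique_at[OF 1 2])
      then have "?g c x (?\<xi> c x) (?B c x) = 0"
        using metric_formD(2)[OF m, of "?B c x"] by (simp add: W0[OF c])
      moreover have "?g c x (?\<xi> c x) (?B c x) = t * \<eta> c x (?B c x)"
        using t by (simp add: deform_g_def deform_xi_def bilinear_lmul[OF lp.bG[OF c(2)]]
            lp.eta_eq[OF c(2), symmetric] linear_cmul[OF lp.linear_eta[OF c(2)]] lp.eta_xi[OF c(2)] field_simps)
      ultimately show ?thesis using t by simp
    qed
    have Bout: "?B c (coord c p) = 0" if c: "c \<in> A" "p \<in> chart_dom c - K" for c p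
    proof -
      have x: "coord c p \<in> chart_image c" using c(2) coord_in_image[of p c] by blast
      have "((\<lambda>s. W s c (coord c p)) has_vector_derivative 0) (at 0)"
        by (rule has_vector_derivative_transform_within_open[OF has_vector_derivative_const[of "?\<xi> c (coord c p)"] oI 0])
          (use Wout c in auto)
      then show ?thesis by (rule vector_derivative_unique_at[OF time[OF c(1) x]])
    qed
    have BK: "horizontal_supported ?B K"
      unfolding horizontal_supported_def using C1B K(1) hor Bout by blast
    \<comment> \<open>Both energies are thus tested on the same field: the first term is controlled
      by harmonicity of the original Reeb field, the second integrates to 0.\<close>
    have main: "at_point (deriv_trace ?g (energy_gradient ?g (W 0)) ?B) p =
        (1 / t) * first_variation_density ?B p + ((t - 1) / t) * fundamental_trace ?B p" if p: "p \<in> D" for p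
    proof -
      have "p \<in> topspace X" using p D openin_subset unfolding relatively_compact_domain_def by blast
      then obtain c where c: "c \<in> A" "p \<in> chart_dom c" using Union_chart_dom by blast
      let ?x = "coord c p"
      note x = coord_in_image[OF c(2)]
      interpret lp: local_paracontact "g c" "chart_image c" "\<phi> c" "\<xi> c" "\<eta> c" by (rule local_paracontact[OF c(1)])
      have W0C: "W 0 c y = ?\<xi> c y" if "y \<in> chart_image c" for y by (rule W0[OF c(1) that])
      have cov0: "covariant_deriv (?g c) (W 0 c) ?x = covariant_deriv (?g c) (?\<xi> c) ?x"
      proof -
        have "frechet_derivative (W 0 c) (at ?x) = frechet_derivative (?\<xi> c) (at ?x)"
          by (rule frechet_derivative_cong_open(1)[OF open_chart_image[OF c(1)] x _
              differentiableI[OF C1_field_has_derivative[OF vector_field_C1[OF xt] c(1) x]]]) (simp add: W0C)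
        then show ?thesis by (intro ext) (simp add: covariant_deriv_def W0C[OF x])
      qed
      have xi_eq: "?\<xi> c = (\<lambda>y. inverse t *\<^sub>R \<xi> c y)" by (rule ext) (simp add: deform_xi_def)
      have "at_point (deriv_trace ?g (energy_gradient ?g (W 0)) ?B) p =
          deriv_trace ?g (energy_gradient ?g (W 0)) ?B c ?x"
        by (rule at_point_deriv_trace[OF gt C1B pointwise_covariant_energy_gradient[OF gt vector_field_C1[OF W[OF 0]]] c])
      also have "\<dots> = (1 / t) * deriv_trace g (energy_gradient g \<xi>) ?B c ?x +
          ((t - 1) / t) * deriv_trace g fundamental_form ?B c ?x"
        using lp.first_variation_deformed[OF t x C1_field_has_derivative[OF C1B c(1) x] hor[OF c(1) x]]
        unfolding deriv_trace_def energy_gradient_def fundamental_form_def cov0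
        unfolding xi_eq deform_g_eq_Gt[OF c(1)] lp.\<omega>_def .
      finally show ?thesis
        unfolding first_variation_density_eq[OF C1B c] fundamental_trace_eq[OF C1B c] .
    qed
    have fv: "((\<lambda>s. energy X A ?g D (W s)) has_real_derivative (LINT p:D|volume_measure X A ?g.
        at_point (deriv_trace ?g (energy_gradient ?g (W 0)) ?B) p)) (at 0)"
    proof (rule first_variation[OF gt D \<epsilon> W sm K])
      show "W s c (coord c p) = W 0 c (coord c p)"
        if "s \<in> {-\<epsilon><..<\<epsilon>}" "c \<in> A" "p \<in> chart_dom c - K" for s c p
        using Wout[OF that] Wout[OF 0 that(2,3)] by simp
    qed
    let ?F = "at_point (deriv_trace ?g (energy_gradient ?g (W 0)) ?B)"
    have Fm: "(\<lambda>p. indicator D p *\<^sub>R ?F p) \<in> borel_measurable ?\<mu>"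
    proof -
      have "continuous_map X euclideanreal ?F"
        by (rule continuous_map_deriv_trace[OF gt C1B pointwise_covariant_energy_gradient[OF gt vector_field_C1[OF W[OF 0]]]
            continuous_on_energy_gradient[OF gt vector_field_C1[OF W[OF 0]]]])
      then have "?F \<in> borel_measurable ?\<mu>" by (rule continuous_imp_measurable[OF metric_covariant])
      moreover have "D \<in> sets ?\<mu>"
        using D by (simp add: relatively_compact_domain_def sets_volume_measure[OF metric_covariant] openin_borel_of_top)
      ultimately show ?thesis by measurable
    qed
    let ?k = "sqrt (\<bar>t\<bar> ^ CARD('n) * \<bar>t\<bar>)"
    have "(LINT p:D|volume_measure X A ?g. ?F p) = (LINT p|?\<mu>. ?k *\<^sub>R (indicator D p *\<^sub>R ?F p))"
      unfolding set_lebesgue_integral_def volume_measure_deformed[OF t]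
      by (rule integral_density[OF Fm]) simp_all
    also have "\<dots> = ?k * (LINT p:D|?\<mu>. ?F p)"
      unfolding set_lebesgue_integral_def by simp
    also have "(LINT p:D|?\<mu>. ?F p) =
        (LINT p:D|?\<mu>. (1 / t) * first_variation_density ?B p + ((t - 1) / t) * fundamental_trace ?B p)"
      unfolding set_lebesgue_integral_def
      by (rule Bochner_Integration.integral_cong[OF refl]) (use main in \<open>auto simp: indicator_def\<close>)
    also have "\<dots> = (LINT p:D|?\<mu>. (1 / t) * first_variation_density ?B p) +
        (LINT p:D|?\<mu>. ((t - 1) / t) * fundamental_trace ?B p)"
      by (intro set_integral_add(2) set_integrable_mult_right set_integrable_first_variation_density[OF C1B D])
    also have "\<dots> = (1 / t) * (LINT p:D|?\<mu>. first_variation_density ?B p) +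
        ((t - 1) / t) * (LINT p:D|?\<mu>. fundamental_trace ?B p)"
      by (simp only: set_integral_mult_right)
    also have "\<dots> = 0"
      using first_variation_zero[OF harm False B BK D K(2)] set_integral_fundamental_trace[OF BK K(2)] by simp
    finally have "(LINT p:D|volume_measure X A ?g. ?F p) = 0" by simp
    then show ?thesis using fv by simp
  qed
  then show ?thesis
    unfolding harmonic_vector_field_def using xt len by (intro conjI exI[of _ 1]) auto
qed

end

theorem theorem3p5:
  fixes n :: nat and X :: "'m topology" and A :: "('m, 'n::finite) chart set"
    and \<phi> :: "('m, 'n) tensor11" and \<xi> :: "('m, 'n) vecfield"
    and \<eta> :: "('m, 'n) form1" and g :: "('m, 'n) tensor02" and t :: real
  assumes "H_paracontact n X A \<phi> \<xi> \<eta> g"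
    and "t \<noteq> 0"
  shows "H_paracontact n X A (deform_phi t \<phi>) (deform_xi t \<xi>) (deform_eta t \<eta>) (deform_g t \<eta> g)"
proof -
  have p: "paracontact_metric_manifold n X A \<phi> \<xi> \<eta> g" and h: "harmonic_vector_field X A g \<xi>"
    using assms(1) by (simp_all add: H_paracontact_def)
  interpret paracontact_manifold X A n \<phi> \<xi> \<eta> g
    by unfold_locales
      (use p in \<open>auto simp: paracontact_metric_manifold_def connected_smooth_manifold_def\<close>)
  show ?thesis
    unfolding H_paracontact_def
    using paracontact_deformed[OF assms(2)] harmonic_deformed[OF h assms(2)] by blast
qed

end
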